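(* Let $k$ be an algebraically closed field of characteristic $p>0$, and let $C\subset\mathbb{P}^2$ be an irreducible plane curve over $k$ of degree $d\ge 3$, where $d$ is divisible by $p$. Then there exist an inner Galois point $P$ and an outer Galois point $Q$ for $C$ such that $G_PG_Q=G_P\ltimes G_Q$, $G_PG_Q\ne G_P\times G_Q$ and the line $\overline{PQ}$ is not the tangent line to $C$ at $P$, if and only if $d$ is a power of $p$ and $C$ is projectively equivalent to the curve defined by $$y^{d-1}x+(x+1)^d=0.$$
   Context: For an irreducible plane curve $C\subset\mathbb{P}^2$ and a point $R\in\mathbb{P}^2$, let $\pi_R:C\dashrightarrow\mathbb{P}^1$ be the projection from $R$. The point $R$ is called a Galois point for $C$ if the extension of function fields $k(C)/\pi_R^*k(\mathbb{P}^1)$ is Galois; its Galois group is denoted $G_R$. A Galois point $R$ is inner if $R\in C\setminus\mathrm{Sing}(C)$ and outer if $R\in\mathbb{P}^2\setminus C$. Let $\varphi:X\to C$ be the normalization; $G_R$ is regarded as a subgroup of $\mathrm{Aut}(X)$, namely $G_R=\{\sigma\in\mathrm{Aut}(X):(\pi_R\circ\varphi)\circ\sigma=\pi_R\circ\varphi\}$. $G_PG_Q=\{\sigma\tau:\sigma\in G_P,\tau\in G_Q\}\subset\mathrm{Aut}(X)$. The notation $G_PG_Q=G_P\ltimes G_Q$ means that $G_PG_Q$ is a subgroup of $\mathrm{Aut}(X)$ which is the internal semidirect product of $G_P$ and $G_Q$ with $G_Q$ normal; $G_PG_Q=G_P\times G_Q$ means that $G_PG_Q$ is a subgroup which is the internal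 direct product of $G_P$ and $G_Q$. The affine equation in $x,y$ defines a plane projective curve by homogenization (taking closure in $\mathbb{P}^2$). *)

theory Defs
  imports
    "HOL-Analysis.Cartesian_Space"
    "HOL-Algebra.Coset"
    "HOL-Algebra.Bij"
    "HOL-Algebra.Finite_Extensions"
    "HOL-Algebra.Generated_Fields"
    "HOL-Computational_Algebra.Computational_Algebra"
begin

section \<open>The projective plane\<close>

text \<open>A point of the projective plane over \<open>'k\<close> is a one-dimensional subspace of \<open>'k ^ 3\<close>;
  a line is a two-dimensional subspace.\<close>

definition proj_plane :: "('k::field ^ 3) set set" where
  "proj_plane = {vec.span {v} | v. v \<noteq> 0}"

definition line_through :: "('k::field ^ 3) set \<Rightarrow> ('k ^ 3) set \<Rightarrow> ('k ^ 3) set" where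
  "line_through A B = vec.span (A \<union> B)"

definition projectively_equivalent ::
    "('k::field ^ 3) set set \<Rightarrow> ('k ^ 3) set set \<Rightarrow> bool" where
  "projectively_equivalent C C' \<longleftrightarrow>
     (\<exists>M :: 'k ^ 3 ^ 3. invertible M \<and> (\<lambda>A. ((*v) M) ` A) ` C = C')"


section \<open>Ternary forms\<close>

text \<open>Polynomials in \<open>X, Y, Z\<close> are elements of \<open>k[X][Y][Z]\<close>: the outermost variable is \<open>Z\<close>,
  the innermost one is \<open>X\<close>.\<close>

type_synonym 'k poly3 = "'k poly poly poly"

definition varX :: "'k::field poly3" where "varX = [:[:[:0, 1:]:]:]"
definition varY :: "'k::field poly3" where "varY = [:[:0, 1:]:]"
definition varZ :: "'k::field poly3" where "varZ = [:0, 1:]"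

definition const3 :: "'k::field \<Rightarrow> 'k poly3" where "const3 c = [:[:[:c:]:]:]"

definition eval3 :: "'k::field poly3 \<Rightarrow> 'k ^ 3 \<Rightarrow> 'k" where
  "eval3 G v = poly (poly (poly G [:[:v $ 3:]:]) [:v $ 2:]) (v $ 1)"

definition homogeneous :: "nat \<Rightarrow> 'k::field poly3 \<Rightarrow> bool" where
  "homogeneous n G \<longleftrightarrow>
     (\<forall>i j l. Polynomial.coeff (Polynomial.coeff (Polynomial.coeff G l) j) i \<noteq> 0 \<longrightarrow> i + j + l = n)"

definition partialX :: "'k::field poly3 \<Rightarrow> 'k poly3" where
  "partialX = map_poly (map_poly pderiv)"
definition partialY :: "'k::field poly3 \<Rightarrow> 'k poly3" where
  "partialY = map_poly pderiv"
definition partialZ :: "'k::field poly3 \<Rightarrow> 'k poly3" where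
  "partialZ = pderiv"

definition vanishes_at :: "'k::field poly3 \<Rightarrow> ('k ^ 3) set \<Rightarrow> bool" where
  "vanishes_at G A \<longleftrightarrow> (\<forall>v\<in>A. eval3 G v = 0)"


section \<open>Plane curves\<close>

text \<open>Below, \<open>F\<close> is a homogeneous irreducible polynomial, and the curve is its zero locus.\<close>

definition plane_curve :: "'k::field poly3 \<Rightarrow> ('k ^ 3) set set" where
  "plane_curve F = {A \<in> proj_plane. vanishes_at F A}"

definition singular_points :: "'k::field poly3 \<Rightarrow> ('k ^ 3) set set" where
  "singular_points F = {A \<in> plane_curve F.
     vanishes_at (partialX F) A \<and> vanishes_at (partialY F) A \<and> vanishes_at (partialZ F) A}"

definition tangent_line :: "'k::field poly3 \<Rightarrow> ('k ^ 3) set \<Rightarrow> ('k ^ 3) set" where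
  "tangent_line F A = {w. \<forall>v\<in>A. eval3 (partialX F) v * w $ 1 + eval3 (partialY F) v * w $ 2
                              + eval3 (partialZ F) v * w $ 3 = 0}"


section \<open>The function field\<close>

text \<open>The function field of the curve \<open>F = 0\<close> is the degree zero part of the localization of
  \<open>k[X,Y,Z]/(F)\<close> at its nonzero homogeneous elements.\<close>

definition frac_pairs :: "'k::field poly3 \<Rightarrow> ('k poly3 \<times> 'k poly3) set" where
  "frac_pairs F = {(G, H). (\<exists>n. homogeneous n G \<and> homogeneous n H) \<and> \<not> F dvd H}"

definition frac_rel ::
    "'k::field poly3 \<Rightarrow> (('k poly3 \<times> 'k poly3) \<times> ('k poly3 \<times> 'k poly3)) set" where
  "frac_rel F = {((G, H), (G', H')).
     (G, H) \<in> frac_pairs F \<and> (G', H') \<in> frac_pairs F \<and> F dvd (G * H' - G' * H)}"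

type_synonym 'k rat_fun = "('k poly3 \<times> 'k poly3) set"

definition form_quot :: "'k::field poly3 \<Rightarrow> 'k poly3 \<Rightarrow> 'k poly3 \<Rightarrow> 'k rat_fun" where
  "form_quot F G H = frac_rel F `` {(G, H)}"

definition function_field :: "'k::field poly3 \<Rightarrow> 'k rat_fun ring" where
  "function_field F =
     \<lparr>carrier = frac_pairs F // frac_rel F,
      monoid.mult = (\<lambda>f g. \<Union>(G, H)\<in>f. \<Union>(G', H')\<in>g. form_quot F (G * G') (H * H')),
      one = form_quot F 1 1,
      zero = form_quot F 0 1,
      add = (\<lambda>f g. \<Union>(G, H)\<in>f. \<Union>(G', H')\<in>g. form_quot F (G * H' + G' * H) (H * H'))\<rparr>"

definition const_fun :: "'k::field poly3 \<Rightarrow> 'k \<Rightarrow> 'k rat_fun" where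
  "const_fun F c = form_quot F (const3 c) 1"


section \<open>The normalization\<close>

text \<open>The normalization \<open>X\<close> is realized as the abstract nonsingular curve of the function field:
  its points are the valuation rings of the function field over \<open>k\<close> (other than the whole field),
  its nonempty open sets are the cofinite sets, and the ring of regular functions on an open set
  is the intersection of the valuation rings belonging to it.\<close>

type_synonym 'k place = "'k rat_fun set"

definition normalization :: "'k::field poly3 \<Rightarrow> 'k place set" where
  "normalization F = {V. subring V (function_field F) \<and> range (const_fun F) \<subseteq> V \<and>
     V \<noteq> carrier (function_field F) \<and>
     (\<forall>f \<in> carrier (function_field F) - {\<zero>\<^bsub>function_field F\<^esub>}.
        f \<in> V \<or> inv\<^bsub>function_field F\<^esub> f \<in> V)}"

definition max_ideal :: "'k::field poly3 \<Rightarrow> 'k place \<Rightarrow> 'k rat_fun set" where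
  "max_ideal F V = {f \<in> V. f = \<zero>\<^bsub>function_field F\<^esub> \<or> inv\<^bsub>function_field F\<^esub> f \<notin> V}"

text \<open>The value at the point \<open>V\<close> of a function regular there; the residue field of \<open>V\<close> is \<open>k\<close>
  when \<open>k\<close> is algebraically closed.\<close>

definition value_at :: "'k::field poly3 \<Rightarrow> 'k place \<Rightarrow> 'k rat_fun \<Rightarrow> 'k" where
  "value_at F V f = (THE c. f \<ominus>\<^bsub>function_field F\<^esub> const_fun F c \<in> max_ideal F V)"

definition open_subset :: "'k::field poly3 \<Rightarrow> 'k place set \<Rightarrow> bool" where
  "open_subset F U \<longleftrightarrow> U \<subseteq> normalization F \<and> (U = {} \<or> finite (normalization F - U))"

definition regular_on :: "'k::field poly3 \<Rightarrow> 'k place set \<Rightarrow> ('k place \<Rightarrow> 'k) \<Rightarrow> bool" where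
  "regular_on F U g \<longleftrightarrow>
     (\<exists>f \<in> carrier (function_field F). \<forall>V\<in>U. f \<in> V \<and> g V = value_at F V f)"

definition self_morphism :: "'k::field poly3 \<Rightarrow> ('k place \<Rightarrow> 'k place) \<Rightarrow> bool" where
  "self_morphism F \<sigma> \<longleftrightarrow> \<sigma> \<in> normalization F \<rightarrow> normalization F \<and>
     (\<forall>U. open_subset F U \<longrightarrow>
        open_subset F (\<sigma> -` U \<inter> normalization F) \<and>
        (\<forall>g. regular_on F U g \<longrightarrow> regular_on F (\<sigma> -` U \<inter> normalization F) (g \<circ> \<sigma>)))"

definition Aut_curve :: "'k::field poly3 \<Rightarrow> ('k place \<Rightarrow> 'k place) set" where
  "Aut_curve F = {\<sigma> \<in> Bij (normalization F).
     self_morphism F \<sigma> \<and> self_morphism F (inv_into (normalization F) \<sigma>)}"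

definition Aut_group :: "'k::field poly3 \<Rightarrow> ('k place \<Rightarrow> 'k place) monoid" where
  "Aut_group F = (BijGroup (normalization F))\<lparr>carrier := Aut_curve F\<rparr>"

text \<open>\<open>centre F\<close> is the normalization map: \<open>V\<close> is sent to the point \<open>A\<close> of the curve whose
  local ring is dominated by \<open>V\<close>.\<close>

definition local_ring :: "'k::field poly3 \<Rightarrow> ('k ^ 3) set \<Rightarrow> 'k rat_fun set" where
  "local_ring F A = {form_quot F G H | G H n.
     homogeneous n G \<and> homogeneous n H \<and> \<not> vanishes_at H A}"

definition local_max_ideal :: "'k::field poly3 \<Rightarrow> ('k ^ 3) set \<Rightarrow> 'k rat_fun set" where
  "local_max_ideal F A = {form_quot F G H | G H n.
     homogeneous n G \<and> homogeneous n H \<and> \<not> vanishes_at H A \<and> vanishes_at G A}"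

definition centre :: "'k::field poly3 \<Rightarrow> 'k place \<Rightarrow> ('k ^ 3) set" where
  "centre F V = (THE A. A \<in> plane_curve F \<and>
     local_ring F A \<subseteq> V \<and> local_max_ideal F A \<subseteq> max_ideal F V)"


section \<open>Galois points\<close>

definition galois_extension :: "('a, 'b) ring_scheme \<Rightarrow> 'a set \<Rightarrow> bool" where
  "galois_extension K L \<longleftrightarrow> field K \<and> subfield L K \<and>
     (\<forall>f \<in> carrier K. ring.algebraic K L f) \<and>
     (\<forall>f \<in> carrier K. (\<forall>s \<in> ring_iso K K. (\<forall>g\<in>L. s g = g) \<longrightarrow> s f = f) \<longrightarrow> f \<in> L)"

text \<open>The projection from \<open>R\<close> is given by \<open>(L : M)\<close> for independent linear forms \<open>L, M\<close>
  vanishing at \<open>R\<close>, so the pulled back function field of the projective line is \<open>k(L/M)\<close>.\<close>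

definition proj_subfield :: "'k::field poly3 \<Rightarrow> ('k ^ 3) set \<Rightarrow> 'k rat_fun set" where
  "proj_subfield F R = generate_field (function_field F)
     (range (const_fun F) \<union> {form_quot F L M | L M.
        homogeneous 1 L \<and> homogeneous 1 M \<and> vanishes_at L R \<and> vanishes_at M R \<and> \<not> F dvd M})"

definition galois_point :: "'k::field poly3 \<Rightarrow> ('k ^ 3) set \<Rightarrow> bool" where
  "galois_point F R \<longleftrightarrow> R \<in> proj_plane \<and> galois_extension (function_field F) (proj_subfield F R)"

definition inner_galois_point :: "'k::field poly3 \<Rightarrow> ('k ^ 3) set \<Rightarrow> bool" where
  "inner_galois_point F R \<longleftrightarrow> galois_point F R \<and> R \<in> plane_curve F - singular_points F"

definition outer_galois_point :: "'k::field poly3 \<Rightarrow> ('k ^ 3) set \<Rightarrow> bool" where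
  "outer_galois_point F R \<longleftrightarrow> galois_point F R \<and> R \<in> proj_plane - plane_curve F"

text \<open>The target of the projection from \<open>R\<close> is the pencil of lines through \<open>R\<close>, a point
  \<open>A \<noteq> R\<close> being sent to the line \<open>RA\<close>. Two rational maps agree iff they agree wherever both are
  defined.\<close>

definition galois_group :: "'k::field poly3 \<Rightarrow> ('k ^ 3) set \<Rightarrow> ('k place \<Rightarrow> 'k place) set" where
  "galois_group F R = {\<sigma> \<in> Aut_curve F. \<forall>V \<in> normalization F.
     centre F V \<noteq> R \<and> centre F (\<sigma> V) \<noteq> R \<longrightarrow>
     line_through R (centre F (\<sigma> V)) = line_through R (centre F V)}"


section \<open>Internal products of subgroups\<close>

text \<open>The second factor is the normal one.\<close>

definition internal_semidirect :: "('a, 'b) monoid_scheme \<Rightarrow> 'a set \<Rightarrow> 'a set \<Rightarrow> bool" where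
  "internal_semidirect G H N \<longleftrightarrow> subgroup H G \<and> subgroup N G \<and> subgroup (H <#>\<^bsub>G\<^esub> N) G \<and>
     N \<lhd> G\<lparr>carrier := H <#>\<^bsub>G\<^esub> N\<rparr> \<and> H \<inter> N = {\<one>\<^bsub>G\<^esub>}"

definition internal_direct :: "('a, 'b) monoid_scheme \<Rightarrow> 'a set \<Rightarrow> 'a set \<Rightarrow> bool" where
  "internal_direct G H N \<longleftrightarrow> internal_semidirect G H N \<and> H \<lhd> G\<lparr>carrier := H <#>\<^bsub>G\<^esub> N\<rparr>"


section \<open>The model curve\<close>

text \<open>The homogenization of \<open>y^(d-1) x + (x+1)^d\<close>, with \<open>x = X/Z\<close> and \<open>y = Y/Z\<close>.\<close>

definition model_form :: "nat \<Rightarrow> 'k::field poly3" where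
  "model_form d = varY ^ (d - 1) * varX + (varX + varZ) ^ d"

end

theory Submission
  imports Defs "HOL-Algebra.Algebraic_Closure_Type" "HOL-Algebra.Sylow" "HOL-Algebra.Multiplicative_Group"
begin

no_notation fps_nth (infixl \<open>$\<close> 75)

hide_const (open) Polynomials.degree Polynomials.lead_coeff Divisibility.irreducible Divisibility.prime up_ring.coeff up_ring.monom

text \<open>
  The function field \<open>K\<close> of the curve is realized inside an algebraically closed field by a generic
  point \<open>v\<close>, so that the coordinate functions of the projections from \<open>P\<close> and \<open>Q\<close> become elements
  \<open>x\<close> and \<open>y\<close> with \<open>G_P = Gal(K / k(x))\<close> and \<open>G_Q = Gal(K / k(y))\<close>.

  Suppose that \<open>P\<close> and \<open>Q\<close> are as required. Since \<open>G_Q\<close> is normalized by \<open>G_P\<close>, the elements \<open>s y\<close>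
  for \<open>s\<close> in \<open>G_P\<close> are rational functions of \<open>y\<close>. The norm of \<open>y\<close> to \<open>k(x)\<close> is a quotient with a
  linear denominator, because the line \<open>PQ\<close> is not tangent; comparing poles, each \<open>s y\<close> is affine in
  \<open>y\<close>, and after a change of coordinates \<open>A(x) = x y^(d-1)\<close> for a polynomial \<open>A\<close> of degree \<open>d\<close>, while
  \<open>G_P\<close> acts on \<open>y\<close> by roots of unity. At a place over \<open>y = \<infinity>\<close> the values of \<open>g x / y\<close> for \<open>g\<close> in
  \<open>G_Q\<close> are distinct and show that \<open>G_P\<close> permutes the nontrivial elements of \<open>G_Q\<close> transitively.
  Hence all of them have order \<open>p\<close>, and \<open>d\<close> is a power of \<open>p\<close>. Some root of \<open>A\<close> has multiplicity
  divisible by \<open>p\<close>, so a place over \<open>y = 0\<close> has a nontrivial stabiliser in \<open>G_Q\<close>. The conjugates of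
  this stabiliser cover \<open>G_Q\<close>, so it is all of \<open>G_Q\<close>, and \<open>A = a (x - z)^d\<close>.

  Conversely, the model is parametrized by \<open>w = (X + Z) / Y\<close>, and the two Galois groups consist of
  the maps \<open>w \<mapsto> \<zeta> w\<close> with \<open>\<zeta>^(d-1) = 1\<close> and \<open>w \<mapsto> w + a\<close> with \<open>a^d + a = 0\<close>.
\<close>

section \<open>Evaluation of polynomials along ring homomorphisms\<close>

text \<open>Since p divides d, ramification is wild, and tame counts of ramification points do not
  determine the groups. The argument therefore compares values of functions at places. As k is
  algebraically closed, every place has residue field k, and conjugacy of the places with a common
  value of x or of y takes the part of decomposition and inertia theory: it turns equalities of
  values into elements of \<open>GP\<close> or \<open>GQ\<close>. Only finitely many functions, the
  conjugates of x and of y, are compared at a time.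

  The fibre over y = 0 is controlled through the critical points of A / x. Because d = 0 in k, the
  polynomial x A' - A keeps the full degree d, while none of its zeros can lie over a nonzero value
  of y; so all of them are roots of A, which is too much for multiplicities prime to p.

  The group G_R is defined by automorphisms of the curve. The forward implication turns field
  automorphisms into curve automorphisms, which works for every curve. The opposite passage is made
  on the model, where the pullback of the parameter w is computed and is affine in w.\<close>

locale rhom =
  fixes h :: "'a::comm_ring_1 \<Rightarrow> 'b::comm_ring_1"
  assumes h_one [simp]: "h 1 = 1"
    and h_add [simp]: "h (a + b) = h a + h b"
    and h_mult [simp]: "h (a * b) = h a * h b"
begin

lemma h_zero [simp]: "h 0 = 0"
  using h_add[of 0 0] by simp

lemma h_minus [simp]: "h (- a) = - h a"
  using h_add[of a "-a"] by (simp add: eq_neg_iff_add_eq_0 add.commute)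

lemma h_diff [simp]: "h (a - b) = h a - h b"
  using h_add[of a "-b"] by simp

lemma h_power [simp]: "h (a ^ n) = h a ^ n"
  by (induction n) auto

lemma h_sum: "h (sum f A) = (\<Sum>x\<in>A. h (f x))"
  by (induction A rule: infinite_finite_induct) auto

lemma h_prod: "h (prod f A) = (\<Prod>x\<in>A. h (f x))"
  by (induction A rule: infinite_finite_induct) auto

lemma h_of_nat [simp]: "h (of_nat n) = of_nat n"
  by (induction n) auto

end

lemma rhom_id: "rhom (\<lambda>x. x)"
  by unfold_locales auto

lemma rhom_comp: "rhom f \<Longrightarrow> rhom g \<Longrightarrow> rhom (\<lambda>x. g (f x))"
  by (simp add: rhom_def)

lemma rhom_inj:
  fixes h :: "'a::field \<Rightarrow> 'b::field"
  assumes "rhom h"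
  shows "inj h"
proof (rule injI)
  interpret rhom h by fact
  fix a b assume "h a = h b"
  hence 0: "h (a - b) = 0" by simp
  show "a = b"
  proof (rule ccontr)
    assume "a \<noteq> b"
    hence "h ((a - b) * inverse (a - b)) = 1" by simp
    thus False using 0 by (simp only: h_mult) simp
  qed
qed

text \<open>Nesting handles several variables: \<open>pev (pev emb a) b P\<close> is the value at
  (a, b) of a polynomial in two variables whose inner variable goes to a.\<close>

definition pev :: "('a::comm_ring_1 \<Rightarrow> 'b::comm_ring_1) \<Rightarrow> 'b \<Rightarrow> 'a poly \<Rightarrow> 'b" where
  "pev h x p = poly (map_poly h p) x"

context rhom begin

lemma pev_0 [simp]: "pev h x 0 = 0"
  by (simp add: pev_def)

lemma pev_pCons [simp]: "pev h x (pCons a p) = h a + x * pev h x p"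
  by (simp add: pev_def map_poly_pCons)

lemma pev_1 [simp]: "pev h x 1 = 1"
  by (simp add: one_pCons)

lemma pev_add: "pev h x (p + q) = pev h x p + pev h x q"
  by (induction p q rule: poly_induct2) (auto simp: algebra_simps)

lemma pev_smult: "pev h x (smult a p) = h a * pev h x p"
  by (induction p) (auto simp: algebra_simps)

lemma pev_mult: "pev h x (p * q) = pev h x p * pev h x q"
  by (induction p) (auto simp: algebra_simps pev_add pev_smult)

lemma rhom_pev: "rhom (pev h x)"
  by unfold_locales (auto simp: pev_add pev_mult)

lemma pev_minus [simp]: "pev h x (- p) = - pev h x p"
  by (rule rhom.h_minus[OF rhom_pev])

lemma pev_diff: "pev h x (p - q) = pev h x p - pev h x q"
  by (rule rhom.h_diff[OF rhom_pev])

lemma pev_power: "pev h x (p ^ n) = pev h x p ^ n"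
  by (rule rhom.h_power[OF rhom_pev])

lemma pev_sum: "pev h x (sum f A) = (\<Sum>i\<in>A. pev h x (f i))"
  by (rule rhom.h_sum[OF rhom_pev])

lemma pev_prod: "pev h x (prod f A) = (\<Prod>i\<in>A. pev h x (f i))"
  by (rule rhom.h_prod[OF rhom_pev])

lemma pev_monom: "pev h x (monom c n) = h c * x ^ n"
  by (induction n) (auto simp: monom_0 monom_Suc)

lemma pev_pcompose: "pev h x (pcompose p q) = pev h (pev h x q) p"
  by (induction p) (auto simp: pcompose_pCons pev_add pev_mult)

lemma pev_altdef:
  assumes "degree p \<le> n"
  shows "pev h x p = (\<Sum>i\<le>n. h (coeff p i) * x ^ i)"
proof -
  have "pev h x p = pev h x (\<Sum>i\<le>n. monom (coeff p i) i)"
    using poly_as_sum_of_monoms'[OF assms] by simp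
  thus ?thesis by (simp add: pev_sum pev_monom)
qed

lemma map_poly_rhom: "rhom (map_poly h)"
proof -
  have add: "map_poly h (p + q) = map_poly h p + map_poly h q" for p q
    by (rule poly_eqI) (simp add: coeff_map_poly)
  have mult: "map_poly h (p * q) = map_poly h p * map_poly h q" for p q
    by (rule poly_eqI) (simp add: coeff_map_poly coeff_mult h_sum)
  show ?thesis by unfold_locales (auto simp: add mult)
qed

lemma poly_map_poly: "poly (map_poly h p) (h a) = h (poly p a)"
  by (induction p) (auto simp: map_poly_pCons)

end

text \<open>The coefficients \<open>h a\<close> are themselves polynomials, so the product rule
  leaves a second sum in which only they are differentiated. In \<open>ev3_pderiv\<close> this sum
  supplies the partial derivatives in the inner variables.\<close>

lemma pev_pderiv:
  assumes h: "rhom (h :: 'a::idom \<Rightarrow> 'b::idom poly)"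
  shows "pderiv (pev h x p) = pev h x (pderiv p) * pderiv x + poly (map_poly (\<lambda>a. pderiv (h a)) p) x"
proof -
  interpret rhom h by fact
  show ?thesis
  proof (induction p)
    case (pCons a p)
    have e: "poly (map_poly (\<lambda>a. pderiv (h a)) (pCons a p)) x
        = pderiv (h a) + x * poly (map_poly (\<lambda>a. pderiv (h a)) p) x"
      by (cases "a = 0 \<and> p = 0") (auto simp: map_poly_pCons)
    show ?case
      by (simp add: pCons e pderiv_mult pderiv_pCons pderiv_add pev_add algebra_simps)
  qed auto
qed

section \<open>Evaluation of polynomials in three variables\<close>

definition ev3 :: "('a::comm_ring_1 \<Rightarrow> 'b::comm_ring_1) \<Rightarrow> 'b ^ 3 \<Rightarrow> 'a poly poly poly \<Rightarrow> 'b" where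
  "ev3 h v = pev (pev (pev h (v $ 1)) (v $ 2)) (v $ 3)"

lemma rhom_ev3: "rhom h \<Longrightarrow> rhom (ev3 h v)"
  unfolding ev3_def by (intro rhom.rhom_pev)

lemma rhom_const3: "rhom (const3 :: 'k::field \<Rightarrow> _)"
  unfolding const3_def by unfold_locales (auto simp: one_pCons)

lemma
  assumes "rhom h"
  shows ev3_const3 [simp]: "ev3 h v (const3 c) = h c"
    and ev3_varX [simp]: "ev3 h v varX = v $ 1"
    and ev3_varY [simp]: "ev3 h v varY = v $ 2"
    and ev3_varZ [simp]: "ev3 h v varZ = v $ 3"
proof -
  interpret a: rhom h by fact
  interpret b: rhom "pev h (v $ 1)" by (rule a.rhom_pev)
  interpret c: rhom "pev (pev h (v $ 1)) (v $ 2)" by (rule b.rhom_pev)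
  show "ev3 h v (const3 c) = h c" "ev3 h v varX = v $ 1" "ev3 h v varY = v $ 2" "ev3 h v varZ = v $ 3"
    by (simp_all add: ev3_def const3_def varX_def varY_def varZ_def)
qed

lemma poly3_induct [case_names const varX varY varZ add mult]:
  fixes G :: "'k::field poly3"
  assumes const: "\<And>c. P (const3 c)" and x: "P varX" and y: "P varY" and z: "P varZ"
    and add: "\<And>G H. P G \<Longrightarrow> P H \<Longrightarrow> P (G + H)" and mult: "\<And>G H. P G \<Longrightarrow> P H \<Longrightarrow> P (G * H)"
  shows "P G"
proof -
  have 0: "P 0" using const[of 0] by (simp add: const3_def)
  have 1: "P [:[:p:]:]" for p
  proof (induction p)
    case (pCons a p)
    have "[:[:pCons a p:]:] = const3 a + varX * [:[:p:]:]"
      by (simp add: const3_def varX_def)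
    thus ?case using pCons const x add mult by metis
  qed (use 0 in simp)
  have 2: "P [:q:]" for q
  proof (induction q)
    case (pCons a q)
    have "[:pCons a q:] = [:[:a:]:] + varY * [:q:]" by (simp add: varY_def)
    thus ?case using pCons 1 y add mult by metis
  qed (use 0 in simp)
  show ?thesis
  proof (induction G)
    case (pCons a G)
    have "pCons a G = [:a:] + varZ * G" by (simp add: varZ_def)
    thus ?case using pCons 2 z add mult by metis
  qed (use 0 in simp)
qed

text \<open>Constants and variables generate the polynomial ring, so identities between differently
  nested evaluations or substitutions need to be checked on these generators only.\<close>

lemma poly3_hom_unique:
  fixes f g :: "'k::field poly3 \<Rightarrow> 'b::comm_ring_1"
  assumes f: "rhom f" and g: "rhom g"
    and "\<And>c. f (const3 c) = g (const3 c)" "f varX = g varX" "f varY = g varY" "f varZ = g varZ"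
  shows "f G = g G"
proof -
  interpret f: rhom f by fact
  interpret g: rhom g by fact
  show ?thesis by (induction G rule: poly3_induct) (use assms in simp_all)
qed

lemma rhom_poly: "rhom (\<lambda>p. poly p (a::'a::comm_ring_1))"
  by unfold_locales auto

lemma eval3_conv_ev3: "eval3 G v = ev3 (\<lambda>x. x) v G"
proof (rule poly3_hom_unique)
  have "rhom (\<lambda>G. poly (poly (poly G [:[:v $ 3:]:]) [:v $ 2:]) (v $ 1))"
    by unfold_locales auto
  thus "rhom (\<lambda>G. eval3 G v)" unfolding eval3_def .
  show "rhom (ev3 (\<lambda>x. x) v)" by (rule rhom_ev3[OF rhom_id])
qed (simp_all only: ev3_const3[OF rhom_id] ev3_varX[OF rhom_id] ev3_varY[OF rhom_id] ev3_varZ[OF rhom_id],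
  simp_all add: eval3_def const3_def varX_def varY_def varZ_def)

lemma rhom_eval3: "rhom (\<lambda>G. eval3 G v)"
  unfolding eval3_conv_ev3 by (rule rhom_ev3[OF rhom_id])

lemma ev3_hom:
  fixes h :: "'a::field \<Rightarrow> 'b::comm_ring_1"
  assumes "rhom h" and "rhom g"
  shows "g (ev3 h v G) = ev3 (\<lambda>x. g (h x)) (\<chi> i. g (v $ i)) G"
proof (rule poly3_hom_unique[where f = "\<lambda>G. g (ev3 h v G)"])
  have r: "rhom (\<lambda>x. g (h x))" using assms by (rule rhom_comp)
  show "rhom (\<lambda>G. g (ev3 h v G))" by (rule rhom_comp[OF rhom_ev3[OF assms(1)] assms(2)])
  show "rhom (ev3 (\<lambda>x. g (h x)) (\<chi> i. g (v $ i)))" by (rule rhom_ev3[OF r])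
qed (simp_all add: assms rhom_comp[OF assms])

lemma ev3_altdef:
  fixes G :: "'k::field poly3"
  assumes "rhom h"
  shows "\<exists>N. \<forall>M\<ge>N. \<forall>v. ev3 h v G = (\<Sum>l\<le>M. \<Sum>j\<le>M. \<Sum>i\<le>M. h (coeff (coeff (coeff G l) j) i) * v$1^i * v$2^j * v$3^l)"
proof -
  define N1 where "N1 = Max (insert 0 ((\<lambda>(l,j). degree (coeff (coeff G l) j)) ` ({..degree G} \<times> {..Max (insert 0 ((\<lambda>l. degree (coeff G l)) ` {..degree G}))})))"
  define N2 where "N2 = Max (insert 0 ((\<lambda>l. degree (coeff G l)) ` {..degree G}))"
  define N where "N = max (degree G) (max N1 N2)"
  interpret a: rhom h by fact
  have d3: "degree G \<le> N" by (simp add: N_def)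
  have d2: "degree (coeff G l) \<le> N" for l
  proof (cases "l \<le> degree G")
    case True
    hence "degree (coeff G l) \<le> N2" unfolding N2_def by (intro Max_ge) auto
    thus ?thesis by (simp add: N_def)
  qed (auto simp: coeff_eq_0)
  have d1: "degree (coeff (coeff G l) j) \<le> N" for l j
  proof (cases "l \<le> degree G \<and> j \<le> N2")
    case True
    hence "degree (coeff (coeff G l) j) \<le> N1" unfolding N1_def N2_def by (intro Max_ge) auto
    thus ?thesis by (simp add: N_def)
  next
    case False
    have "coeff (coeff G l) j = 0"
    proof (cases "l \<le> degree G")
      case True
      hence "degree (coeff G l) \<le> N2" unfolding N2_def by (intro Max_ge) auto
      thus ?thesis using False True by (intro coeff_eq_0) auto
    qed (auto simp: coeff_eq_0)
    thus ?thesis by simp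
  qed
  have "ev3 h v G = (\<Sum>l\<le>M. \<Sum>j\<le>M. \<Sum>i\<le>M. h (coeff (coeff (coeff G l) j) i) * v$1^i * v$2^j * v$3^l)" if "N \<le> M" for v M
  proof -
    interpret b: rhom "pev h (v $ 1)" by (rule a.rhom_pev)
    interpret c: rhom "pev (pev h (v $ 1)) (v $ 2)" by (rule b.rhom_pev)
    show ?thesis unfolding ev3_def
      by (subst c.pev_altdef[OF order.trans[OF d3 that]], subst b.pev_altdef[OF order.trans[OF d2 that]],
          subst a.pev_altdef[OF order.trans[OF d1 that]])
        (simp add: sum_distrib_right)
  qed
  thus ?thesis by blast
qed

lemma ev3_pderiv:
  assumes h: "h = (\<lambda>c. [:c:] :: 'k::field poly)"
  shows "pderiv (ev3 h w G) = ev3 h w (partialX G) * pderiv (w$1) + ev3 h w (partialY G) * pderiv (w$2)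
     + ev3 h w (partialZ G) * pderiv (w$3)"
proof -
  interpret a: rhom h unfolding h by unfold_locales (auto simp: one_pCons)
  let ?f1 = "pev h (w $ 1)" let ?f2 = "pev ?f1 (w $ 2)" let ?f3 = "pev ?f2 (w $ 3)"
  interpret b: rhom ?f1 by (rule a.rhom_pev)
  interpret c: rhom ?f2 by (rule b.rhom_pev)
  interpret d: rhom ?f3 by (rule c.rhom_pev)
  have 1: "pderiv (?f1 p) = ?f1 (pderiv p) * pderiv (w$1)" for p
  proof -
    have "map_poly (\<lambda>a. pderiv (h a)) p = 0" by (rule poly_eqI) (simp add: coeff_map_poly h)
    thus ?thesis by (simp add: pev_pderiv[OF a.rhom_axioms])
  qed
  have 2: "pderiv (?f2 p) = ?f2 (pderiv p) * pderiv (w$2) + ?f2 (map_poly pderiv p) * pderiv (w$1)" for p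
  proof -
    have "poly (map_poly (\<lambda>a. pderiv (?f1 a)) p) (w$2) = ?f2 (map_poly pderiv p) * pderiv (w$1)"
      unfolding 1
    proof (induction p)
      case (pCons x p)
      thus ?case
        by (cases "x = 0 \<and> p = 0") (auto simp: map_poly_pCons algebra_simps)
    qed auto
    thus ?thesis by (simp add: pev_pderiv[OF b.rhom_axioms])
  qed
  have 3: "poly (map_poly (\<lambda>a. pderiv (?f2 a)) p) (w$3)
       = ?f3 (map_poly pderiv p) * pderiv (w$2) + ?f3 (map_poly (map_poly pderiv) p) * pderiv (w$1)" for p
    unfolding 2
  proof (induction p)
    case (pCons x p)
    thus ?case
      by (cases "x = 0 \<and> p = 0") (auto simp: map_poly_pCons algebra_simps)
  qed auto
  show ?thesis
    by (simp add: ev3_def partialX_def partialY_def partialZ_def pev_pderiv[OF c.rhom_axioms] 3 algebra_simps)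
qed

section \<open>Homogeneous forms\<close>

lemma homogeneousD: "homogeneous n G \<Longrightarrow> i + j + l \<noteq> n \<Longrightarrow> coeff (coeff (coeff G l) j) i = 0"
  unfolding homogeneous_def by blast

lemma homogeneous_0 [simp]: "homogeneous n 0"
  by (simp add: homogeneous_def)

lemma homogeneous_const3 [simp]: "homogeneous 0 (const3 c)"
  unfolding homogeneous_def const3_def
  by (auto simp: coeff_pCons split: nat.splits if_splits)

lemma homogeneous_1 [simp]: "homogeneous 0 1"
  using homogeneous_const3[of 1] by (simp add: rhom.h_one[OF rhom_const3])

lemma homogeneous_var [simp]:
  "homogeneous 1 varX" "homogeneous 1 varY" "homogeneous 1 varZ"
  unfolding homogeneous_def varX_def varY_def varZ_def
  by (auto simp: coeff_pCons split: nat.splits if_splits)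

lemma homogeneous_add: "homogeneous n G \<Longrightarrow> homogeneous n H \<Longrightarrow> homogeneous n (G + H)"
  unfolding homogeneous_def by (metis add.right_neutral coeff_add)

lemma homogeneous_minus: "homogeneous n G \<Longrightarrow> homogeneous n (- G)"
  unfolding homogeneous_def by simp

lemma homogeneous_diff: "homogeneous n G \<Longrightarrow> homogeneous n H \<Longrightarrow> homogeneous n (G - H)"
  using homogeneous_add[of n G "-H"] homogeneous_minus[of n H] by simp

lemma homogeneous_mult:
  fixes G H :: "'k::field poly3"
  assumes "homogeneous n G" "homogeneous m H"
  shows "homogeneous (n + m) (G * H)"
  unfolding homogeneous_def
proof (intro allI impI, rule ccontr)
  fix i j l assume nz: "coeff (coeff (coeff (G * H) l) j) i \<noteq> 0" and ne: "i + j + l \<noteq> n + m"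
  have "coeff (coeff (coeff (G * H) l) j) i =
     (\<Sum>l'\<le>l. \<Sum>j'\<le>j. \<Sum>i'\<le>i. coeff (coeff (coeff G l') j') i' * coeff (coeff (coeff H (l - l')) (j - j')) (i - i'))"
    by (simp add: coeff_mult coeff_sum)
  also have "\<dots> = 0"
  proof (intro sum.neutral ballI)
    fix l' j' i' assume *: "l' \<in> {..l}" "j' \<in> {..j}" "i' \<in> {..i}"
    show "coeff (coeff (coeff G l') j') i' * coeff (coeff (coeff H (l - l')) (j - j')) (i - i') = 0"
    proof (cases "i' + j' + l' = n")
      case True
      hence "(i - i') + (j - j') + (l - l') \<noteq> m" using * ne by auto
      thus ?thesis using homogeneousD[OF assms(2)] by simp
    next
      case False
      thus ?thesis using homogeneousD[OF assms(1)] by simp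
    qed
  qed
  finally show False using nz by simp
qed

lemma homogeneous_power: "homogeneous n (G :: 'k::field poly3) \<Longrightarrow> homogeneous (n * m) (G ^ m)"
  by (induction m) (auto intro: homogeneous_mult)

lemma homogeneous_sum: "(\<And>x. x \<in> A \<Longrightarrow> homogeneous n (f x)) \<Longrightarrow> homogeneous n (sum f A)"
  by (induction A rule: infinite_finite_induct) (auto intro: homogeneous_add)

lemma homogeneous_const_mult: "homogeneous n (G :: 'k::field poly3) \<Longrightarrow> homogeneous n (const3 c * G)"
  using homogeneous_mult[OF homogeneous_const3[of c], of n G] by simp

lemma ev3_scale:
  assumes h: "rhom h" and "homogeneous n G"
  shows "ev3 h (\<chi> i. t * v $ i) G = t ^ n * ev3 h v G"
proof -
  obtain N where N: "\<And>v. ev3 h v G = (\<Sum>l\<le>N. \<Sum>j\<le>N. \<Sum>i\<le>N. h (coeff (coeff (coeff G l) j) i) * v$1^i * v$2^j * v$3^l)"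
    using ev3_altdef[OF h, of G] order_refl by blast
  interpret rhom h by fact
  show ?thesis unfolding N sum_distrib_left
  proof (intro sum.cong refl)
    fix i j l
    show "h (coeff (coeff (coeff G l) j) i) * (\<chi> i. t * v $ i) $ 1 ^ i * (\<chi> i. t * v $ i) $ 2 ^ j * (\<chi> i. t * v $ i) $ 3 ^ l
      = t ^ n * (h (coeff (coeff (coeff G l) j) i) * v $ 1 ^ i * v $ 2 ^ j * v $ 3 ^ l)"
    proof (cases "i + j + l = n")
      case True
      show ?thesis unfolding True[symmetric] vec_lambda_beta power_mult_distrib power_add by (simp only: mult_ac)
    qed (auto simp: homogeneousD[OF assms(2)])
  qed
qed

lemma eval3_scale: "homogeneous n G \<Longrightarrow> eval3 G (t *s v) = t ^ n * eval3 G v"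
  using ev3_scale[OF rhom_id, of n G t v] by (simp add: eval3_conv_ev3 vector_scalar_mult_def)

definition lin3 :: "'k::field ^ 3 \<Rightarrow> 'k poly3" where
  "lin3 a = const3 (a $ 1) * varX + const3 (a $ 2) * varY + const3 (a $ 3) * varZ"

lemma homogeneous_lin3 [simp]: "homogeneous 1 (lin3 a)"
  unfolding lin3_def by (intro homogeneous_add homogeneous_const_mult homogeneous_var)

lemma ev3_lin3: 
  assumes "rhom h"
  shows "ev3 h v (lin3 a) = h (a$1) * v$1 + h (a$2) * v$2 + h (a$3) * v$3"
proof -
  interpret e: rhom "ev3 h v" by (rule rhom_ev3) fact
  show ?thesis unfolding lin3_def using assms by simp
qed

lemma homogeneous_1_imp_lin3:
  fixes L :: "'k::field poly3"
  assumes "homogeneous 1 L"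
  shows "\<exists>a. L = lin3 a"
proof
  let ?c = "\<lambda>i j l. coeff (coeff (coeff L l) j) i"
  let ?a = "(\<chi> m. if m = 1 then ?c 1 0 0 else if m = 2 then ?c 0 1 0 else ?c 0 0 1) :: 'k ^ 3"
  show "L = lin3 ?a"
  proof (intro poly_eqI)
    fix l j i
    have e: "lin3 ?a = [:[:[:0, ?c 1 0 0:], [:?c 0 1 0:]:], [:[:?c 0 0 1:]:]:]"
      by (simp add: lin3_def const3_def varX_def varY_def varZ_def)
    have z: "?c i j l = 0" if "i + j + l \<noteq> 1" using homogeneousD[OF assms that] .
    have "i + j + l \<noteq> 1 \<or> (i = 1 \<and> j = 0 \<and> l = 0) \<or> (i = 0 \<and> j = 1 \<and> l = 0) \<or> (i = 0 \<and> j = 0 \<and> l = 1)"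
      by (auto simp: add_is_1)
    then consider "i + j + l \<noteq> 1" | "i = 1" "j = 0" "l = 0" | "i = 0" "j = 1" "l = 0" | "i = 0" "j = 0" "l = 1"
      by blast
    thus "?c i j l = coeff (coeff (coeff (lin3 ?a) l) j) i"
    proof cases
      case 1
      thus ?thesis unfolding e using z[OF 1]
        by (auto simp: coeff_pCons split: nat.splits)
    qed (auto simp: e coeff_pCons split: nat.splits)
  qed
qed

section \<open>Places of a function field\<close>

text \<open>If k were finite, the product of all X - a, increased by 1, would be a nonconstant
  polynomial taking only the value 1.\<close>

lemma infinite_UNIV_alg_closed: "infinite (UNIV :: 'k::alg_closed_field set)"
proof
  assume fin: "finite (UNIV :: 'k set)"
  define p :: "'k poly" where "p = (\<Prod>a\<in>UNIV. [:-a, 1:]) + 1"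
  have "degree (\<Prod>a\<in>(UNIV::'k set). [:-a, 1:]) = card (UNIV :: 'k set)"
    by (subst degree_prod_eq_sum_degree) auto
  moreover have "card (UNIV :: 'k set) > 0" using fin by (simp add: card_gt_0_iff)
  ultimately have "degree p > 0" unfolding p_def by (subst degree_add_eq_left) auto
  then obtain x where "poly p x = 0" using alg_closed_imp_poly_has_root by blast
  moreover have "poly p x = 1" using fin by (auto simp: p_def poly_prod)
  ultimately show False by simp
qed

lemma alg_closed_poly_induct [consumes 1, case_names const linear]:
  fixes p :: "'k::alg_closed_field poly"
  assumes "p \<noteq> 0" and const: "\<And>c. c \<noteq> 0 \<Longrightarrow> P [:c:]"
    and lin: "\<And>r q. q \<noteq> 0 \<Longrightarrow> P q \<Longrightarrow> P ([:-r, 1:] * q)"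
  shows "P p"
  using assms(1)
proof (induction "degree p" arbitrary: p)
  case 0
  then obtain c where "p = [:c:]" by (metis degree_eq_zeroE)
  thus ?case using const 0 by auto
next
  case (Suc n)
  then obtain r where "poly p r = 0" using alg_closed_imp_poly_has_root[of p] by auto
  then obtain q where q: "p = [:-r, 1:] * q" by (auto simp: poly_eq_0_iff_dvd)
  have "q \<noteq> 0" using q Suc.prems by auto
  moreover have "degree p = Suc (degree q)" unfolding q using \<open>q \<noteq> 0\<close> by (subst degree_mult_eq) auto
  ultimately have "P q" using Suc.hyps by auto
  thus ?case unfolding q using lin[OF \<open>q \<noteq> 0\<close>] by simp
qed

lemma exists_nonroot:
  fixes p :: "'k::alg_closed_field poly"
  assumes "p \<noteq> 0" "finite S"
  shows "\<exists>a. a \<notin> S \<and> poly p a \<noteq> 0"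
proof -
  have "finite (S \<union> {a. poly p a = 0})" using assms(2) poly_roots_finite[OF assms(1)] by blast
  hence "S \<union> {a. poly p a = 0} \<noteq> UNIV" using infinite_UNIV_alg_closed by metis
  thus ?thesis by blast
qed

text \<open>A homomorphism defined on a subring of a type. It covers automorphisms on K, the residue
  map \<open>val V\<close> on a place V and, with the identity map, mere closure properties. With it
  \<open>map_poly \<phi>\<close> reduces polynomials whose coefficients lie in B.\<close>

locale phom =
  fixes B :: "'a::comm_ring_1 set" and \<phi> :: "'a \<Rightarrow> 'b::comm_ring_1"
  assumes B_one [simp]: "1 \<in> B" and B_add [simp]: "a \<in> B \<Longrightarrow> b \<in> B \<Longrightarrow> a + b \<in> B"
    and B_uminus [simp]: "a \<in> B \<Longrightarrow> - a \<in> B" and B_mult [simp]: "a \<in> B \<Longrightarrow> b \<in> B \<Longrightarrow> a * b \<in> B"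
    and p_one: "\<phi> 1 = 1" and p_add: "a \<in> B \<Longrightarrow> b \<in> B \<Longrightarrow> \<phi> (a + b) = \<phi> a + \<phi> b"
    and p_mult: "a \<in> B \<Longrightarrow> b \<in> B \<Longrightarrow> \<phi> (a * b) = \<phi> a * \<phi> b"
begin

lemma B_zero [simp]: "0 \<in> B" using B_add[of 1 "-1"] by simp
lemma B_diff [simp]: "a \<in> B \<Longrightarrow> b \<in> B \<Longrightarrow> a - b \<in> B" using B_add[of a "-b"] by simp
lemma B_power [simp]: "a \<in> B \<Longrightarrow> a ^ n \<in> B" by (induction n) auto
lemma B_sum: "(\<And>x. x \<in> A \<Longrightarrow> f x \<in> B) \<Longrightarrow> sum f A \<in> B"
  by (induction A rule: infinite_finite_induct) auto
lemma B_prod: "(\<And>x. x \<in> A \<Longrightarrow> f x \<in> B) \<Longrightarrow> prod f A \<in> B"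
  by (induction A rule: infinite_finite_induct) auto

lemma p_zero: "\<phi> 0 = 0" using p_add[of 0 0] by simp
lemma p_uminus: "a \<in> B \<Longrightarrow> \<phi> (- a) = - \<phi> a"
  using p_add[of a "-a"] by (simp add: eq_neg_iff_add_eq_0 add.commute p_zero)
lemma p_diff: "a \<in> B \<Longrightarrow> b \<in> B \<Longrightarrow> \<phi> (a - b) = \<phi> a - \<phi> b"
  using p_add[of a "-b"] by (simp add: p_uminus)
lemma p_power: "a \<in> B \<Longrightarrow> \<phi> (a ^ n) = \<phi> a ^ n"
  by (induction n) (auto simp: p_one p_mult)
lemma p_sum: "(\<And>x. x \<in> A \<Longrightarrow> f x \<in> B) \<Longrightarrow> \<phi> (sum f A) = (\<Sum>x\<in>A. \<phi> (f x))"
  by (induction A rule: infinite_finite_induct) (auto simp: p_add B_sum p_zero)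
lemma p_prod: "(\<And>x. x \<in> A \<Longrightarrow> f x \<in> B) \<Longrightarrow> \<phi> (prod f A) = (\<Prod>x\<in>A. \<phi> (f x))"
  by (induction A rule: infinite_finite_induct) (auto simp: p_mult B_prod p_one)

definition Bpoly :: "'a poly \<Rightarrow> bool" where "Bpoly p \<longleftrightarrow> (\<forall>i. coeff p i \<in> B)"

lemma Bpoly_0 [simp]: "Bpoly 0" by (simp add: Bpoly_def)
lemma Bpoly_pCons [simp]: "Bpoly (pCons a p) \<longleftrightarrow> a \<in> B \<and> Bpoly p"
  unfolding Bpoly_def by (metis coeff_pCons_0 coeff_pCons_Suc not0_implies_Suc)
lemma Bpoly_1 [simp]: "Bpoly 1" by (simp add: one_pCons)
lemma Bpoly_add: "Bpoly p \<Longrightarrow> Bpoly q \<Longrightarrow> Bpoly (p + q)" by (simp add: Bpoly_def)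
lemma Bpoly_uminus: "Bpoly p \<Longrightarrow> Bpoly (- p)" by (simp add: Bpoly_def)
lemma Bpoly_mult: "Bpoly p \<Longrightarrow> Bpoly q \<Longrightarrow> Bpoly (p * q)"
  unfolding Bpoly_def coeff_mult by (auto intro!: B_sum)
lemma Bpoly_smult: "a \<in> B \<Longrightarrow> Bpoly q \<Longrightarrow> Bpoly (smult a q)" by (simp add: Bpoly_def)
lemma poly_in_B: "Bpoly p \<Longrightarrow> x \<in> B \<Longrightarrow> poly p x \<in> B"
  by (induction p) auto

lemma map_p_mult: "Bpoly p \<Longrightarrow> Bpoly q \<Longrightarrow> map_poly \<phi> (p * q) = map_poly \<phi> p * map_poly \<phi> q"
  by (rule poly_eqI) (simp add: coeff_map_poly coeff_mult Bpoly_def p_sum p_mult p_zero)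
lemma map_p_smult: "a \<in> B \<Longrightarrow> Bpoly q \<Longrightarrow> map_poly \<phi> (smult a q) = smult (\<phi> a) (map_poly \<phi> q)"
  by (rule poly_eqI) (simp add: coeff_map_poly Bpoly_def p_mult p_zero)

lemma map_p_linear: "a \<in> B \<Longrightarrow> map_poly \<phi> [:-a, 1:] = [:- \<phi> a, 1:]"
  by (cases "(1::'b) = 0") (auto simp: map_poly_pCons p_one p_uminus p_zero)

lemma map_p_prod_linear:
  assumes "\<And>x. x \<in> A \<Longrightarrow> r x \<in> B"
  shows "Bpoly (\<Prod>x\<in>A. [:- r x, 1:])"
    and "map_poly \<phi> (\<Prod>x\<in>A. [:- r x, 1:]) = (\<Prod>x\<in>A. [:- \<phi> (r x), 1:])"
proof -
  have "Bpoly (\<Prod>x\<in>A. [:- r x, 1:]) \<and> map_poly \<phi> (\<Prod>x\<in>A. [:- r x, 1:]) = (\<Prod>x\<in>A. [:- \<phi> (r x), 1:])"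
    using assms
  proof (induction A rule: infinite_finite_induct)
    case (insert x A)
    hence b: "Bpoly [:- r x, 1:]" "Bpoly (\<Prod>x\<in>A. [:- r x, 1:])" by auto
    show ?case using insert map_p_mult[OF b] Bpoly_mult[OF b] map_p_linear[of "r x"]
      by (simp only: prod.insert if_False insert_iff simp_thms)
  qed (auto simp: p_one)
  thus "Bpoly (\<Prod>x\<in>A. [:- r x, 1:])"
    and "map_poly \<phi> (\<Prod>x\<in>A. [:- r x, 1:]) = (\<Prod>x\<in>A. [:- \<phi> (r x), 1:])" by auto
qed

lemma p_poly: "Bpoly p \<Longrightarrow> x \<in> B \<Longrightarrow> \<phi> (poly p x) = poly (map_poly \<phi> p) (\<phi> x)"
proof (induction p)
  case (pCons a p)
  show ?case
  proof (cases "a = 0 \<and> p = 0")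
    case False
    thus ?thesis using pCons by (simp add: map_poly_pCons p_add p_mult poly_in_B p_zero)
  qed (auto simp: p_zero)
qed (auto simp: p_zero)

end

lemma eval3_simps [simp]:
  "eval3 (const3 c) v = c" "eval3 varX v = v $ 1" "eval3 varY v = v $ 2" "eval3 varZ v = v $ 3"
  unfolding eval3_conv_ev3
  by (rule ev3_const3[OF rhom_id] ev3_varX[OF rhom_id] ev3_varY[OF rhom_id] ev3_varZ[OF rhom_id])+

text \<open>Transcendence degree one over k, in elementary terms: \<open>K_dep\<close> bounds it by
  one, and \<open>K_nonconst\<close> excludes zero.\<close>

locale func_field = rhom emb for emb :: "'k::alg_closed_field \<Rightarrow> 'e::field" +
  fixes K :: "'e set"
  assumes K_emb [simp]: "emb c \<in> K"
    and K_add [simp]: "a \<in> K \<Longrightarrow> b \<in> K \<Longrightarrow> a + b \<in> K"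
    and K_uminus [simp]: "a \<in> K \<Longrightarrow> - a \<in> K"
    and K_mult [simp]: "a \<in> K \<Longrightarrow> b \<in> K \<Longrightarrow> a * b \<in> K"
    and K_inverse [simp]: "a \<in> K \<Longrightarrow> inverse a \<in> K"
    and K_dep: "a \<in> K \<Longrightarrow> b \<in> K \<Longrightarrow> \<exists>P. P \<noteq> 0 \<and> pev (pev emb a) b P = 0"
    and K_nonconst: "\<exists>a\<in>K. a \<notin> range emb"
begin

sublocale K: phom K "\<lambda>x. x"
proof
  show "1 \<in> K" using K_emb[of 1] by simp
qed auto

lemma K_divide [simp]: "a \<in> K \<Longrightarrow> b \<in> K \<Longrightarrow> a / b \<in> K"
  by (simp add: divide_inverse)

lemma emb_inj [simp]: "emb a = emb b \<longleftrightarrow> a = b"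
  using rhom_inj[OF rhom_axioms] by (auto dest: injD)

lemma emb_eq_0 [simp]: "emb a = 0 \<longleftrightarrow> a = 0"
  using emb_inj[of a 0] by simp

lemma emb_eq_1 [simp]: "emb a = 1 \<longleftrightarrow> a = 1"
  using emb_inj[of a 1] by simp

lemma emb_inverse: "emb (inverse a) = inverse (emb a)"
proof (cases "a = 0")
  case False
  hence "emb a * emb (inverse a) = 1" by (simp flip: h_mult)
  thus ?thesis using inverse_unique by metis
qed auto

lemma emb_divide: "emb (a / b) = emb a / emb b"
  by (simp add: divide_inverse emb_inverse)

text \<open>As k is algebraically closed, a nonzero polynomial splits into linear factors, and no
  \<open>f - emb r\<close> is zero.\<close>

lemma transcendental:
  assumes "f \<notin> range emb" and "p \<noteq> 0"
  shows "pev emb f p \<noteq> 0"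
  using assms(2)
proof (induction p rule: alg_closed_poly_induct)
  case (linear r q)
  have "f - emb r \<noteq> 0" using assms(1) by auto
  thus ?case using linear by (simp add: pev_mult del: mult_pCons_left)
qed auto

lemma transcendental_inj:
  assumes "f \<notin> range emb" and "pev emb f p = pev emb f q"
  shows "p = q"
  using transcendental[OF assms(1), of "p - q"] assms(2) by (auto simp: pev_diff)

section \<open>Valuation rings and residue values\<close>

definition subr :: "'e set \<Rightarrow> bool" where
  "subr B \<longleftrightarrow> B \<subseteq> K \<and> range emb \<subseteq> B \<and> (\<forall>a\<in>B. \<forall>b\<in>B. a + b \<in> B \<and> a * b \<in> B) \<and> (\<forall>a\<in>B. - a \<in> B)"

text \<open>The copy inside the ambient field of the valuation rings that form
  \<open>normalization\<close>; \<open>cls\<close> carries one to the other.\<close>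

definition place :: "'e set \<Rightarrow> bool" where
  "place V \<longleftrightarrow> subr V \<and> V \<noteq> K \<and> (\<forall>f\<in>K. f \<in> V \<or> inverse f \<in> V)"

definition mid :: "'e set \<Rightarrow> 'e set" where
  "mid V = {f \<in> V. f = 0 \<or> inverse f \<notin> V}"

definition val :: "'e set \<Rightarrow> 'e \<Rightarrow> 'k" where
  "val V f = (THE c. f - emb c \<in> mid V)"

lemma subr_phom: "subr B \<Longrightarrow> phom B (\<lambda>x. x)"
proof -
  assume s: "subr B"
  have "emb 1 \<in> B" using s unfolding subr_def by blast
  hence "1 \<in> B" by simp
  thus ?thesis using s unfolding subr_def by unfold_locales auto
qed

lemma subr_emb: "subr B \<Longrightarrow> emb c \<in> B"
  unfolding subr_def by blast

lemma subr_subset: "subr B \<Longrightarrow> B \<subseteq> K"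
  unfolding subr_def by blast

lemma subr_pev: "subr B \<Longrightarrow> a \<in> B \<Longrightarrow> pev emb a p \<in> B"
proof (induction p)
  case 0
  interpret phom B "\<lambda>x. x" by (rule subr_phom) fact
  show ?case by simp
next
  case (pCons c p)
  interpret B: phom B "\<lambda>x. x" by (rule subr_phom) fact
  show ?case using pCons subr_emb[of B c] by simp
qed

lemma subr_adjoin:
  assumes "subr B" "f \<in> K"
  shows "subr {poly p f | p. phom.Bpoly B p}" "f \<in> {poly p f | p. phom.Bpoly B p}"
    "B \<subseteq> {poly p f | p. phom.Bpoly B p}"
proof -
  interpret B: phom B "\<lambda>x. x" by (rule subr_phom) fact
  have sub: "K.Bpoly p" if "B.Bpoly p" for p
    using that subr_subset[OF assms(1)] unfolding B.Bpoly_def K.Bpoly_def by blast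
  have "poly [:b:] f = b" "B.Bpoly [:b:] = (b \<in> B)" for b by auto
  thus 1: "B \<subseteq> {poly p f | p. B.Bpoly p}" by (smt (verit) mem_Collect_eq subsetI)
  have "poly [:0, 1:] f = f" "B.Bpoly [:0, 1:]" by auto
  thus "f \<in> {poly p f | p. B.Bpoly p}" by (smt (verit) mem_Collect_eq)
  show "subr {poly p f | p. B.Bpoly p}"
    unfolding subr_def
  proof (intro conjI ballI)
    show "{poly p f | p. B.Bpoly p} \<subseteq> K" using sub K.poly_in_B[OF _ assms(2)] by auto
    show "range emb \<subseteq> {poly p f | p. B.Bpoly p}" using 1 assms(1) unfolding subr_def by blast
    fix a assume "a \<in> {poly p f | p. B.Bpoly p}"
    then obtain p where p: "a = poly p f" "B.Bpoly p" by blast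
    show "- a \<in> {poly p f | p. B.Bpoly p}"
      using p B.Bpoly_uminus[OF p(2)] poly_minus[of p f] by (metis (mono_tags, lifting) mem_Collect_eq)
    fix b assume "b \<in> {poly p f | p. B.Bpoly p}"
    then obtain q where q: "b = poly q f" "B.Bpoly q" by blast
    show "a + b \<in> {poly p f | p. B.Bpoly p}"
      using p q B.Bpoly_add[OF p(2) q(2)] poly_add[of p q f] by (metis (mono_tags, lifting) mem_Collect_eq)
    show "a * b \<in> {poly p f | p. B.Bpoly p}"
      using p q B.Bpoly_mult[OF p(2) q(2)] poly_mult[of p q f] by (metis (mono_tags, lifting) mem_Collect_eq)
  qed
qed

text \<open>The reduction step in the proof that a subring maximal subject to \<open>inverse a \<notin> B\<close> is a
  valuation ring: the relation of higher degree can be shortened.\<close>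

lemma relation_reduce:
  fixes z :: 'e
  assumes "subr B" "a \<in> B" "z \<noteq> 0"
    and b: "\<And>i. b i \<in> B" "1 = (\<Sum>i\<le>n. a * b i * z ^ i)"
    and c: "\<And>i. c i \<in> B" "1 = (\<Sum>i\<le>m. a * c i * inverse z ^ i)"
    and "m \<le> n" "n > 0"
  shows "\<exists>b'. (\<forall>i. b' i \<in> B) \<and> 1 = (\<Sum>i\<le>n-1. a * b' i * z ^ i)"
proof -
  interpret B: phom B "\<lambda>x. x" by (rule subr_phom) fact
  \<comment> \<open>Padding with zeros lets both relations be summed up to the same n.\<close>
  define c' where "c' i = (if i \<le> m then c i else 0)" for i
  have c'B: "c' i \<in> B" for i using c(1) by (simp add: c'_def)
  have c'1: "1 = (\<Sum>i\<le>n. a * c' i * inverse z ^ i)"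
    unfolding c(2) by (rule sum.mono_neutral_cong_left) (use \<open>m \<le> n\<close> in \<open>auto simp: c'_def\<close>)
  obtain k where n: "n = Suc k" using \<open>n > 0\<close> by (cases n) auto
  have eq1: "1 - a * c' 0 = (\<Sum>j\<le>k. a * c' (Suc j) * inverse z ^ Suc j)"
    by (subst c'1) (simp add: n sum.atMost_Suc_shift del: sum.atMost_Suc)
  have "(\<Sum>j\<le>k. a * c' (Suc j) * inverse z ^ Suc j) * z ^ Suc k = (\<Sum>j\<le>k. a * c' (Suc j) * z ^ (k - j))"
  proof (subst sum_distrib_right, intro sum.cong refl)
    fix j assume "j \<in> {..k}"
    hence "z ^ Suc k = z ^ Suc j * z ^ (k - j)" by (simp flip: power_add)
    moreover have "inverse z ^ Suc j * z ^ Suc j = 1"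
      using \<open>z \<noteq> 0\<close> by (simp flip: power_mult_distrib del: power_Suc)
    ultimately show "a * c' (Suc j) * inverse z ^ Suc j * z ^ Suc k = a * c' (Suc j) * z ^ (k - j)"
      by (metis mult.assoc mult.right_neutral)
  qed
  also have "\<dots> = (\<Sum>i\<le>k. a * c' (Suc (k - i)) * z ^ i)"
    by (rule sum.reindex_bij_witness[of _ "\<lambda>i. k - i" "\<lambda>i. k - i"]) auto
  \<comment> \<open>The relation for \<open>inverse z\<close>, multiplied by the n-th power of z,
    expresses (1 - a c_0) z^n by lower powers of z. The relation for z, multiplied by 1 - a c_0, can
    then dispense with its top term.\<close>
  finally have eq2: "(1 - a * c' 0) * z ^ Suc k = (\<Sum>i\<le>k. a * c' (Suc (k - i)) * z ^ i)"
    by (simp only: eq1)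
  let ?S1 = "\<Sum>i\<le>k. a * ((1 - a * c' 0) * b i) * z ^ i"
  let ?S2 = "\<Sum>i\<le>k. a * (b (Suc k) * a * c' (Suc (k - i))) * z ^ i"
  let ?S3 = "\<Sum>i\<le>k. a * (if i = 0 then c' 0 else 0) * z ^ i"
  have "1 - a * c' 0 = (1 - a * c' 0) * (\<Sum>i\<le>Suc k. a * b i * z ^ i)"
    using b(2) n by simp
  also have "\<dots> = ?S1 + a * b (Suc k) * ((1 - a * c' 0) * z ^ Suc k)"
    by (simp add: sum_distrib_left algebra_simps)
  also have "a * b (Suc k) * ((1 - a * c' 0) * z ^ Suc k) = ?S2"
    unfolding eq2 sum_distrib_left by (intro sum.cong refl) (simp add: mult_ac)
  finally have 1: "1 - a * c' 0 = ?S1 + ?S2" .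
  have "?S3 = (\<Sum>i\<le>k. if i = 0 then a * c' 0 else 0)" by (intro sum.cong refl) auto
  hence 2: "?S3 = a * c' 0" by simp
  have "1 = ?S3 + (?S1 + ?S2)" unfolding 2 1[symmetric] by simp
  hence "1 = (\<Sum>i\<le>n-1. a * ((if i = 0 then c' 0 else 0) + (1 - a * c' 0) * b i + b (Suc k) * a * c' (Suc (k - i))) * z ^ i)"
    unfolding n diff_Suc_1 sum.distrib[symmetric] by (simp only: distrib_left distrib_right add.assoc)
  moreover have "(if i = 0 then c' 0 else 0) + (1 - a * c' 0) * b i + b (Suc k) * a * c' (Suc (k - i)) \<in> B" for i
    using c'B b(1) assms(2) by simp
  ultimately show ?thesis by (intro exI[of _ "\<lambda>i. (if i = 0 then c' 0 else 0) + (1 - a * c' 0) * b i + b (Suc k) * a * c' (Suc (k - i))"]) blast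
qed

text \<open>Descent on n + m: the longer relation is shortened by \<open>relation_reduce\<close>,
  where z and \<open>inverse z\<close> may exchange roles. A relation of length zero would exhibit
  \<open>inverse a\<close> in B.\<close>

lemma relations_absurd:
  fixes z :: 'e
  assumes "subr B" "a \<in> B" "inverse a \<notin> B" "z \<noteq> 0"
  shows "\<lbrakk>\<And>i. b i \<in> B; 1 = (\<Sum>i\<le>n. a * b i * z ^ i); \<And>i. c i \<in> B; 1 = (\<Sum>i\<le>m. a * c i * inverse z ^ i)\<rbrakk> \<Longrightarrow> False"
proof (induction "n + m" arbitrary: n m b c rule: less_induct)
  case less
  have a: "b0 \<in> B \<Longrightarrow> 1 = a * b0 \<Longrightarrow> False" for b0
    using assms(3) by (metis inverse_unique)
  have n: "n > 0" and m: "m > 0"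
    using a[of "b 0"] a[of "c 0"] less.prems by (cases n; cases m; auto)+
  show False
  proof (cases "m \<le> n")
    case True
    from relation_reduce[OF assms(1,2,4) less.prems this n]
    obtain b' where "\<forall>i. b' i \<in> B" "1 = (\<Sum>i\<le>n-1. a * b' i * z ^ i)" by blast
    thus False using less.hyps[of "n - 1" m b' c] less.prems n by auto
  next
    case False
    have nm: "n \<le> m" using False by simp
    have z': "inverse z \<noteq> 0" using assms(4) by simp
    have b': "1 = (\<Sum>i\<le>n. a * b i * inverse (inverse z) ^ i)" using less.prems by simp
    from relation_reduce[OF assms(1,2) z' less.prems(3,4,1) b' nm m]
    obtain c' where "\<forall>i. c' i \<in> B" "1 = (\<Sum>i\<le>m-1. a * c' i * inverse z ^ i)" by blast
    thus False using less.hyps[of n "m - 1" b c'] less.prems m by auto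
  qed
qed

text \<open>Chevalley's extension argument. Zorn's lemma gives a ring M maximal among those that
  contain A but not \<open>inverse a\<close>. Adjoining an element f outside M brings in
  \<open>inverse a\<close>, which is a relation for f; if f and \<open>inverse f\<close> were both
  outside, \<open>relations_absurd\<close> would apply.\<close>

lemma place_exists:
  assumes A: "subr A" and a: "a \<in> A" "a \<noteq> 0" "inverse a \<notin> A"
  shows "\<exists>V. place V \<and> A \<subseteq> V \<and> a \<in> mid V"
proof -
  define AA where "AA = {B. subr B \<and> A \<subseteq> B \<and> inverse a \<notin> B}"
  have "\<exists>M\<in>AA. \<forall>N\<in>AA. M \<subseteq> N \<longrightarrow> N = M"
  proof (rule subset_Zorn_nonempty)
    show "AA \<noteq> {}" using A a unfolding AA_def by blast
  next
    fix C assume ne: "C \<noteq> {}" and ch: "subset.chain AA C"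
    have sub: "\<And>B. B \<in> C \<Longrightarrow> subr B \<and> A \<subseteq> B \<and> inverse a \<notin> B"
      using ch unfolding subset_chain_def AA_def by blast
    have two: "\<exists>B\<in>C. x \<in> B \<and> y \<in> B" if "x \<in> \<Union>C" "y \<in> \<Union>C" for x y
      using that ch unfolding subset_chain_def by blast
    have "subr (\<Union>C)"
      unfolding subr_def
    proof (intro conjI ballI)
      show "\<Union>C \<subseteq> K" using sub unfolding subr_def by blast
      show "range emb \<subseteq> \<Union>C" using ne sub unfolding subr_def by blast
      fix x assume x: "x \<in> \<Union>C"
      show "- x \<in> \<Union>C" using x sub unfolding subr_def by blast
      fix y assume y: "y \<in> \<Union>C"
      obtain B where B: "B \<in> C" "x \<in> B" "y \<in> B" using two[OF x y] by blast
      show "x + y \<in> \<Union>C" "x * y \<in> \<Union>C" using B sub unfolding subr_def by blast+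
    qed
    moreover have "A \<subseteq> \<Union>C" using ne sub by blast
    moreover have "inverse a \<notin> \<Union>C" using sub by blast
    ultimately show "\<Union>C \<in> AA" unfolding AA_def by blast
  qed
  then obtain M where M: "M \<in> AA" and max: "\<And>N. N \<in> AA \<Longrightarrow> M \<subseteq> N \<Longrightarrow> N = M" by blast
  have Ms: "subr M" "A \<subseteq> M" "inverse a \<notin> M" using M unfolding AA_def by auto
  interpret M: phom M "\<lambda>x. x" by (rule subr_phom) fact
  have ia: "inverse a \<in> K" using A a unfolding subr_def by auto
  have rel: "\<exists>n b. (\<forall>i. b i \<in> M) \<and> 1 = (\<Sum>i\<le>n. a * b i * f ^ i)" if f: "f \<in> K" "f \<notin> M" for f
  proof -
    let ?X = "{poly p f | p. M.Bpoly p}"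
    have "?X \<noteq> M" using subr_adjoin(2)[OF Ms(1) f(1)] f by blast
    hence "?X \<notin> AA" using max subr_adjoin(3)[OF Ms(1) f(1)] by blast
    hence "inverse a \<in> ?X" using subr_adjoin[OF Ms(1) f(1)] Ms unfolding AA_def by blast
    then obtain p where p: "inverse a = poly p f" "M.Bpoly p" by blast
    have "1 = a * poly p f" using a p(1)[symmetric] by simp
    also have "\<dots> = (\<Sum>i\<le>degree p. a * coeff p i * f ^ i)"
      by (simp add: poly_altdef sum_distrib_left mult_ac)
    finally show ?thesis using p(2) unfolding M.Bpoly_def by blast
  qed
  have "place M"
    unfolding place_def
  proof (intro conjI ballI)
    show "subr M" by fact
    show "M \<noteq> K" using ia Ms by blast
    fix f assume f: "f \<in> K"
    show "f \<in> M \<or> inverse f \<in> M"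
    proof (rule ccontr)
      assume "\<not> (f \<in> M \<or> inverse f \<in> M)"
      hence nf: "f \<notin> M" "inverse f \<notin> M" by auto
      have "f \<noteq> 0" using nf by auto
      obtain n b where b: "\<And>i. b i \<in> M" "1 = (\<Sum>i\<le>n. a * b i * f ^ i)" using rel[OF f nf(1)] by blast
      obtain m c where c: "\<And>i. c i \<in> M" "1 = (\<Sum>i\<le>m. a * c i * inverse f ^ i)"
        using rel[OF K_inverse[OF f] nf(2)] by blast
      have "a \<in> M" using Ms a by blast
      show False by (rule relations_absurd[OF Ms(1) \<open>a \<in> M\<close> Ms(3) \<open>f \<noteq> 0\<close> b c])
    qed
  qed
  moreover have "a \<in> mid M" using a Ms unfolding mid_def by blast
  ultimately show ?thesis using Ms by blast
qed

context
  fixes V assumes V: "place V"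
begin

interpretation V: phom V "\<lambda>x. x"
  using V unfolding place_def by (intro subr_phom) auto

lemma place_subset: "f \<in> V \<Longrightarrow> f \<in> K"
  using V unfolding place_def subr_def by blast

lemma place_emb [simp]: "emb c \<in> V"
  using V unfolding place_def subr_def by blast

lemma place_total: "f \<in> K \<Longrightarrow> f \<notin> V \<Longrightarrow> inverse f \<in> V"
  using V unfolding place_def by blast

lemma place_notin: "f \<in> K \<Longrightarrow> f \<notin> V \<Longrightarrow> inverse f \<in> mid V"
  using V unfolding place_def mid_def by auto

lemma mid_subset: "f \<in> mid V \<Longrightarrow> f \<in> V"
  by (simp add: mid_def)

lemma mid_zero: "0 \<in> mid V"
  by (simp add: mid_def)

lemma one_notin_mid: "1 \<notin> mid V"
  by (simp add: mid_def)

lemma unitI: "f \<in> V \<Longrightarrow> f \<notin> mid V \<Longrightarrow> f \<noteq> 0 \<and> inverse f \<in> V"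
  by (auto simp: mid_def)

lemma mid_mult: "f \<in> mid V \<Longrightarrow> g \<in> V \<Longrightarrow> f * g \<in> mid V"
proof -
  assume f: "f \<in> mid V" and g: "g \<in> V"
  show ?thesis
  proof (rule ccontr)
    assume "f * g \<notin> mid V"
    hence *: "f * g \<noteq> 0" "inverse (f * g) \<in> V" using unitI[of "f * g"] f g mid_subset by auto
    have "g * inverse (f * g) = inverse f" using * by (simp add: field_simps)
    hence "inverse f \<in> V" using V.B_mult[OF g *(2)] by metis
    thus False using f * by (auto simp: mid_def)
  qed
qed

lemma mid_add: "f \<in> mid V \<Longrightarrow> g \<in> mid V \<Longrightarrow> f + g \<in> mid V"
proof -
  have *: "f + g \<in> mid V" if f: "f \<in> mid V" and g: "g \<in> mid V" and gn: "g \<noteq> 0" and q: "f * inverse g \<in> V" for f g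
  proof -
    have "g * (f * inverse g + 1) \<in> mid V" using g q by (intro mid_mult) auto
    moreover have "g * (f * inverse g + 1) = f + g" using gn by (simp add: field_simps)
    ultimately show ?thesis by simp
  qed
  assume f: "f \<in> mid V" and g: "g \<in> mid V"
  show ?thesis
  proof (cases "f = 0 \<or> g = 0")
    case False
    have "f * inverse g \<in> V \<or> g * inverse f \<in> V"
      using place_total[of "f * inverse g"] f g mid_subset place_subset by (auto simp: mult.commute)
    thus ?thesis using *[OF f g] *[OF g f] False by (auto simp: add.commute)
  qed (use f g in auto)
qed

lemma mid_uminus: "f \<in> mid V \<Longrightarrow> - f \<in> mid V"
  using mid_mult[of f "-1"] by simp

lemma mid_diff: "f \<in> mid V \<Longrightarrow> g \<in> mid V \<Longrightarrow> f - g \<in> mid V"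
  using mid_add[of f "-g"] mid_uminus[of g] by simp

lemma emb_mid: "emb c \<in> mid V \<longleftrightarrow> c = 0"
proof
  assume "emb c \<in> mid V"
  thus "c = 0" unfolding mid_def by (auto simp flip: emb_inverse)
qed (auto simp: mid_zero)

text \<open>Valuation rings are integrally closed. If g were not in V, then \<open>inverse g\<close>
  would be, and dividing the equation by the power of g with exponent \<open>degree p - 1\<close>
  would express g by elements of V.\<close>

lemma place_integral:
  assumes p: "\<And>i. coeff p i \<in> V" "p \<noteq> 0" "inverse (lead_coeff p) \<in> V" and g: "g \<in> K" "poly p g = 0"
  shows "g \<in> V"
proof (rule ccontr)
  assume ng: "g \<notin> V"
  let ?u = "inverse g" and ?n = "degree p"
  have g0: "g \<noteq> 0" using ng by auto
  have u: "?u \<in> V" using place_total[OF g(1) ng] .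
  have n: "?n > 0"
  proof (rule ccontr)
    assume "\<not> ?n > 0"
    then obtain c where "p = [:c:]" by (metis degree_eq_zeroE neq0_conv)
    thus False using g p by auto
  qed
  have "lead_coeff p * g ^ ?n + (\<Sum>i<?n. coeff p i * g ^ i) = 0"
    using g(2) by (simp add: poly_altdef add.commute flip: lessThan_Suc_atMost)
  hence "lead_coeff p * g ^ ?n * ?u ^ (?n - 1) = - (\<Sum>i<?n. coeff p i * g ^ i * ?u ^ (?n - 1))"
    by (simp only: eq_neg_iff_add_eq_0[symmetric] sum_distrib_right mult_minus_left)
  also have "\<dots> = - (\<Sum>i<?n. coeff p i * ?u ^ (?n - 1 - i))"
  proof -
    have "g ^ i * ?u ^ (?n - 1) = ?u ^ (?n - 1 - i)" if "i < ?n" for i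
    proof -
      have "?u ^ (?n - 1) = ?u ^ i * ?u ^ (?n - 1 - i)" using that by (simp flip: power_add)
      thus ?thesis using g0 by (simp add: power_inverse)
    qed
    thus ?thesis by (simp add: mult.assoc)
  qed
  also have "\<dots> \<in> V" using p u by (intro V.B_uminus V.B_sum V.B_mult V.B_power) auto
  also have "lead_coeff p * g ^ ?n * ?u ^ (?n - 1) = lead_coeff p * g"
  proof -
    have "g ^ ?n = g * g ^ (?n - 1)" using n by (simp flip: power_Suc)
    thus ?thesis using g0 by (simp add: power_inverse)
  qed
  finally have "inverse (lead_coeff p) * (lead_coeff p * g) \<in> V" by (rule V.B_mult[OF p(3)])
  moreover have "inverse (lead_coeff p) * (lead_coeff p * g) = g" using p(2) by (simp flip: mult.assoc)
  ultimately show False using ng by simp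
qed

text \<open>Otherwise all \<open>f - emb c\<close> are units of V, hence so are all nonzero
  polynomials in f. By \<open>K_dep\<close> every element of K is then integral over V, and V would
  be K.\<close>

lemma residue_exists:
  assumes f: "f \<in> V"
  shows "\<exists>c. f - emb c \<in> mid V"
proof (rule ccontr)
  assume "\<not> ?thesis"
  hence n: "f - emb c \<notin> mid V" for c by blast
  have fr: "f \<notin> range emb" using n mid_zero by (metis cancel_comm_monoid_add_class.diff_cancel imageE)
  have unit: "inverse (pev emb f p) \<in> V" if "p \<noteq> 0" for p
    using that
  proof (induction p rule: alg_closed_poly_induct)
    case (const c)
    thus ?case by (simp flip: emb_inverse)
  next
    case (linear r q)
    have "inverse (f - emb r) \<in> V" using unitI[of "f - emb r"] n f by auto
    thus ?case using linear by (simp add: pev_mult del: mult_pCons_left)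
  qed
  have pin: "pev emb f p \<in> V" for p
    using f V subr_pev unfolding place_def by blast
  have "g \<in> V" if g: "g \<in> K" for g
  proof -
    obtain P where P: "P \<noteq> 0" "pev (pev emb f) g P = 0"
      using K_dep[OF place_subset[OF f] g] by blast
    have nz: "pev emb f (lead_coeff P) \<noteq> 0" using transcendental[OF fr] P by simp
    let ?p = "map_poly (pev emb f) P"
    have co: "coeff ?p i = pev emb f (coeff P i)" for i by (simp add: coeff_map_poly)
    have dg: "degree ?p = degree P" by (rule degree_map_poly) (use transcendental[OF fr] in blast)
    show ?thesis
    proof (rule place_integral[of ?p])
      show "coeff ?p i \<in> V" for i using pin by (simp add: co)
      show "?p \<noteq> 0" using nz co[of "degree P"] by auto
      show "inverse (lead_coeff ?p) \<in> V" using unit[of "lead_coeff P"] P by (simp add: dg co)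
      show "poly ?p g = 0" using P by (simp add: pev_def)
    qed fact
  qed
  hence "V = K" using place_subset by blast
  thus False using V unfolding place_def by blast
qed

lemma residue_unique: "f - emb c \<in> mid V \<Longrightarrow> f - emb c' \<in> mid V \<Longrightarrow> c = c'"
  using mid_diff[of "f - emb c" "f - emb c'"] emb_mid[of "c' - c"] by simp

lemma valI: "f - emb c \<in> mid V \<Longrightarrow> val V f = c"
  unfolding val_def using residue_unique by blast

lemma val_spec: "f \<in> V \<Longrightarrow> f - emb (val V f) \<in> mid V"
  using residue_exists valI by metis

lemma val_emb [simp]: "val V (emb c) = c"
  by (rule valI) (simp add: mid_zero)

lemma val_mid: "f \<in> V \<Longrightarrow> f \<in> mid V \<longleftrightarrow> val V f = 0"
  using valI[of f 0] val_spec[of f] by auto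

lemma val_phom: "phom V (val V)"
proof
  fix a b assume ab: "a \<in> V" "b \<in> V"
  note s = val_spec[OF ab(1)] val_spec[OF ab(2)]
  have "a + b - emb (val V a + val V b) = (a - emb (val V a)) + (b - emb (val V b))" by simp
  also have "\<dots> \<in> mid V" using s by (rule mid_add)
  finally show "val V (a + b) = val V a + val V b" by (rule valI)
  have "a * b - emb (val V a * val V b) = (a - emb (val V a)) * b + (b - emb (val V b)) * emb (val V a)"
    by (simp add: algebra_simps)
  also have "\<dots> \<in> mid V" using s ab by (intro mid_add mid_mult) auto
  finally show "val V (a * b) = val V a * val V b" by (rule valI)
next
  show "val V 1 = 1" using val_emb[of 1] by simp
qed auto

lemma val_pev: "f \<in> V \<Longrightarrow> pev emb f p \<in> V \<and> val V (pev emb f p) = poly p (val V f)"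
proof (induction p)
  case (pCons c p)
  interpret v: phom V "val V" by (rule val_phom)
  show ?case using pCons by (simp add: v.p_add v.p_mult)
qed (auto simp: phom.p_zero[OF val_phom])

lemma val_nonzeroD: "f \<in> V \<Longrightarrow> val V f \<noteq> 0 \<Longrightarrow> f \<noteq> 0 \<and> inverse f \<in> V \<and> val V (inverse f) = inverse (val V f)"
proof -
  assume f: "f \<in> V" "val V f \<noteq> 0"
  interpret v: phom V "val V" by (rule val_phom)
  have *: "f \<noteq> 0" "inverse f \<in> V" using unitI[OF f(1)] val_mid[OF f(1)] f by auto
  have "val V f * val V (inverse f) = 1" using * f v.p_one by (simp flip: v.p_mult)
  thus ?thesis using * inverse_unique by metis
qed

lemma val_ev3:
  assumes "\<And>i. w $ i \<in> V"
  shows "ev3 emb w G \<in> V \<and> val V (ev3 emb w G) = eval3 G (\<chi> i. val V (w $ i))"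
proof -
  interpret v: phom V "val V" by (rule val_phom)
  interpret e: rhom "ev3 emb w" by (rule rhom_ev3) (rule rhom_axioms)
  interpret g: rhom "\<lambda>G. eval3 G (\<chi> i. val V (w $ i))" by (rule rhom_eval3)
  note [simp] = ev3_const3[OF rhom_axioms] ev3_varX[OF rhom_axioms] ev3_varY[OF rhom_axioms] ev3_varZ[OF rhom_axioms]
  show ?thesis
    by (induction G rule: poly3_induct) (use assms in \<open>simp_all add: v.p_add v.p_mult\<close>)
qed

end

text \<open>The ring k[f] is a polynomial ring because f is transcendental, so
  \<open>f - emb c\<close> is not invertible in it and \<open>place_exists\<close> applies.\<close>

lemma place_at:
  assumes f: "f \<in> K" "f \<notin> range emb"
  shows "\<exists>V. place V \<and> f \<in> V \<and> val V f = c"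
proof -
  let ?A = "range (pev emb f)"
  have A: "subr ?A"
    unfolding subr_def
  proof (intro conjI ballI)
    show "?A \<subseteq> K"
    proof (rule image_subsetI)
      fix p show "pev emb f p \<in> K" by (induction p) (use f in auto)
    qed
    have "emb c = pev emb f [:c:]" for c by simp
    thus "range emb \<subseteq> ?A" by blast
  qed (auto simp flip: pev_add pev_mult pev_minus)
  have a: "f - emb c = pev emb f [:-c, 1:]" by simp
  have n: "inverse (f - emb c) \<notin> ?A"
  proof
    assume "inverse (f - emb c) \<in> ?A"
    then obtain p where p: "inverse (f - emb c) = pev emb f p" by blast
    have "f - emb c \<noteq> 0" using f by auto
    hence "pev emb f ([:-c, 1:] * p) = pev emb f 1" unfolding pev_mult a[symmetric] p[symmetric] by simp
    hence eq: "[:-c, 1:] * p = 1" using transcendental_inj f by blast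
    have 0: "degree ([:-c, 1:] * p) = 0" unfolding eq by simp
    have "p \<noteq> 0" using eq by (metis mult_zero_right zero_neq_one)
    note 0 = 0 this
    have "degree ([:-c, 1:] * p) = 1 + degree p" using 0(2) by (subst degree_mult_eq) auto
    thus False using 0(1) by linarith
  qed
  have nz: "f - emb c \<noteq> 0" using f by auto
  have aA: "f - emb c \<in> ?A" unfolding a by blast
  obtain V where V: "place V" "?A \<subseteq> V" "f - emb c \<in> mid V" using place_exists[OF A aA nz n] by blast
  have "f = pev emb f [:0, 1:]" by simp
  hence "f \<in> V" using V by blast
  thus ?thesis using V valI by blast
qed

text \<open>Each g in S satisfies an equation over k[f]. At a place where f has a value at which no
  leading coefficient vanishes, all these equations are integral.\<close>

lemma place_containing:
  assumes "finite S" "S \<subseteq> K"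
  shows "\<exists>V. place V \<and> S \<subseteq> V"
proof -
  obtain f where f: "f \<in> K" "f \<notin> range emb" using K_nonconst by blast
  have "\<forall>g\<in>S. \<exists>P. P \<noteq> 0 \<and> pev (pev emb f) g P = 0" using K_dep f assms by blast
  then obtain P where P: "\<And>g. g \<in> S \<Longrightarrow> P g \<noteq> 0 \<and> pev (pev emb f) g (P g) = 0" by metis
  define L where "L = (\<Prod>g\<in>S. lead_coeff (P g))"
  have "L \<noteq> 0" using P assms unfolding L_def by auto
  then obtain c where c: "poly L c \<noteq> 0" using exists_nonroot[of L "{}"] by auto
  obtain V where V: "place V" "f \<in> V" "val V f = c" using place_at[OF f] by blast
  have "g \<in> V" if g: "g \<in> S" for g
  proof -
    have nz: "pev emb f (lead_coeff (P g)) \<noteq> 0" using transcendental[OF f(2)] P g by simp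
    let ?p = "map_poly (pev emb f) (P g)"
    have co: "coeff ?p i = pev emb f (coeff (P g) i)" for i by (simp add: coeff_map_poly)
    have dg: "degree ?p = degree (P g)" by (rule degree_map_poly) (use transcendental[OF f(2)] in blast)
    have cg: "poly (lead_coeff (P g)) c \<noteq> 0"
      using c g assms(1) unfolding L_def poly_prod by (auto simp: prod_zero_iff)
    show ?thesis
    proof (rule place_integral[OF V(1), of ?p])
      show "coeff ?p i \<in> V" for i using val_pev[OF V(1,2)] by (simp add: co)
      show "?p \<noteq> 0" using nz co[of "degree (P g)"] by auto
      show "inverse (lead_coeff ?p) \<in> V"
        using val_nonzeroD[OF V(1), of "pev emb f (lead_coeff (P g))"] val_pev[OF V(1,2)] cg V(3) by (simp add: dg co)
      show "poly ?p g = 0" using P g by (simp add: pev_def)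
      show "g \<in> K" using g assms by blast
    qed
  qed
  thus ?thesis using V by blast
qed


section \<open>The subfield k(x), and automorphisms of K over k\<close>

definition rat :: "'e \<Rightarrow> 'e set" where
  "rat x = {pev emb x p / pev emb x q | p q. pev emb x q \<noteq> 0}"

lemma pev_in_K [simp]: "x \<in> K \<Longrightarrow> pev emb x p \<in> K"
  by (induction p) auto

lemma rat_subset: "x \<in> K \<Longrightarrow> rat x \<subseteq> K"
  unfolding rat_def by auto

lemma ratI: "pev emb x q \<noteq> 0 \<Longrightarrow> pev emb x p / pev emb x q \<in> rat x"
  unfolding rat_def by blast

lemma rat_pev: "pev emb x p \<in> rat x"
  using ratI[of x 1 p] by simp

lemma rat_emb: "emb c \<in> rat x"
  using rat_pev[of x "[:c:]"] by simp

lemma rat_self: "x \<in> rat x"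
  using rat_pev[of x "[:0, 1:]"] by simp

lemma rat_add: "a \<in> rat x \<Longrightarrow> b \<in> rat x \<Longrightarrow> a + b \<in> rat x"
proof -
  assume "a \<in> rat x" "b \<in> rat x"
  then obtain p q p' q' where *: "a = pev emb x p / pev emb x q" "pev emb x q \<noteq> 0"
    "b = pev emb x p' / pev emb x q'" "pev emb x q' \<noteq> 0" unfolding rat_def by blast
  have "a + b = pev emb x (p * q' + p' * q) / pev emb x (q * q')"
    unfolding *(1,3) using *(2,4) by (simp add: pev_add pev_mult field_simps)
  thus ?thesis using ratI[of x "q * q'" "p * q' + p' * q"] * by (simp only: pev_mult mult_eq_0_iff simp_thms)
qed

lemma rat_mult: "a \<in> rat x \<Longrightarrow> b \<in> rat x \<Longrightarrow> a * b \<in> rat x"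
proof -
  assume "a \<in> rat x" "b \<in> rat x"
  then obtain p q p' q' where *: "a = pev emb x p / pev emb x q" "pev emb x q \<noteq> 0"
    "b = pev emb x p' / pev emb x q'" "pev emb x q' \<noteq> 0" unfolding rat_def by blast
  have "a * b = pev emb x (p * p') / pev emb x (q * q')"
    unfolding *(1,3) by (simp add: pev_mult)
  thus ?thesis using ratI[of x "q * q'" "p * p'"] * by (simp only: pev_mult mult_eq_0_iff simp_thms)
qed

lemma rat_uminus: "a \<in> rat x \<Longrightarrow> - a \<in> rat x"
  using rat_mult[of "emb (-1)" x a] rat_emb[of "-1" x] by simp

lemma rat_inverse: "a \<in> rat x \<Longrightarrow> inverse a \<in> rat x"
proof -
  assume "a \<in> rat x"
  then obtain p q where *: "a = pev emb x p / pev emb x q" "pev emb x q \<noteq> 0" unfolding rat_def by blast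
  show ?thesis
  proof (cases "pev emb x p = 0")
    case True
    thus ?thesis using * rat_emb[of 0 x] by simp
  next
    case False
    thus ?thesis using * ratI[of x p q] by simp
  qed
qed

lemma rat_phom: "phom (rat x) (\<lambda>x. x)"
  by unfold_locales (use rat_add rat_uminus rat_mult rat_emb[of 1 x] in auto)

lemma rat_divide: "a \<in> rat x \<Longrightarrow> b \<in> rat x \<Longrightarrow> a / b \<in> rat x"
  unfolding divide_inverse by (intro rat_mult rat_inverse)

lemma rat_mono:
  assumes x: "x \<in> rat z"
  shows "rat x \<subseteq> rat z"
proof -
  have p: "pev emb x a \<in> rat z" for a
    by (induction a) (use x rat_emb[of 0] in \<open>auto intro!: rat_add rat_mult rat_emb\<close>)
  show ?thesis unfolding rat_def[of x] by (auto intro: rat_divide p)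
qed

text \<open>Common roots are cancelled one linear factor at a time. Over an algebraically closed
  field, absence of common roots is coprimality.\<close>

lemma rat_lowest:
  assumes "c \<in> rat x"
  shows "\<exists>p q. c = pev emb x p / pev emb x q \<and> pev emb x q \<noteq> 0 \<and> (\<forall>r. \<not> (poly p r = 0 \<and> poly q r = 0))"
proof -
  obtain p q where "c = pev emb x p / pev emb x q" "pev emb x q \<noteq> 0" using assms unfolding rat_def by blast
  thus ?thesis
  proof (induction "degree q" arbitrary: p q rule: less_induct)
    case less
    show ?case
    proof (cases "\<exists>r. poly p r = 0 \<and> poly q r = 0")
      case True
      then obtain r where "poly p r = 0" "poly q r = 0" by blast
      then obtain p' q' where pq: "p = [:-r, 1:] * p'" "q = [:-r, 1:] * q'"
        unfolding poly_eq_0_iff_dvd dvd_def by blast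
      have e: "pev emb x p = (x - emb r) * pev emb x p'" "pev emb x q = (x - emb r) * pev emb x q'"
        unfolding pq pev_mult by simp_all
      hence n: "x - emb r \<noteq> 0" "pev emb x q' \<noteq> 0" using less.prems by auto
      have "q' \<noteq> 0" using n by auto
      hence "degree q = Suc (degree q')" unfolding pq by (subst degree_mult_eq) auto
      thus ?thesis using less.hyps[of q' p'] n less.prems e by simp
    qed (use less.prems in blast)
  qed
qed

text \<open>In lowest terms the denominator of c cannot vanish at the value of x, since c is regular
  at V and the numerator would vanish too. So the value of c is a rational expression in the value
  of x and agrees at both places.\<close>

lemma rat_val:
  assumes V: "place V" and V': "place V'" and x: "x \<in> V" "x \<in> V'" "val V x = val V' x"
    and c: "c \<in> rat x" "c \<in> V"
  shows "c \<in> V' \<and> val V' c = val V c"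
proof -
  interpret v: phom V "val V" by (rule val_phom[OF V])
  obtain p q where pq: "c = pev emb x p / pev emb x q" "pev emb x q \<noteq> 0" "\<And>r. \<not> (poly p r = 0 \<and> poly q r = 0)"
    using rat_lowest[OF c(1)] by blast
  have nq: "poly q (val V x) \<noteq> 0"
  proof
    assume q0: "poly q (val V x) = 0"
    have "c * pev emb x q = pev emb x p" using pq by simp
    moreover have "val V (c * pev emb x q) = 0"
      using c val_pev[OF V x(1)] q0 by (simp add: v.p_mult)
    ultimately have "poly p (val V x) = 0" using val_pev[OF V x(1)] by simp
    thus False using pq(3) q0 by blast
  qed
  have *: "c \<in> W \<and> val W c = poly p (val V x) * inverse (poly q (val V x))"
    if W: "place W" "x \<in> W" "val W x = val V x" for W
  proof -
    interpret w: phom W "val W" by (rule val_phom[OF W(1)])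
    have i: "inverse (pev emb x q) \<in> W \<and> val W (inverse (pev emb x q)) = inverse (poly q (val V x))"
      using val_nonzeroD[OF W(1), of "pev emb x q"] val_pev[OF W(1,2), of q] W nq by simp
    have j: "pev emb x p \<in> W \<and> val W (pev emb x p) = poly p (val V x)"
      using val_pev[OF W(1,2), of p] W by simp
    thus ?thesis using i unfolding pq(1) divide_inverse by (simp add: w.p_mult)
  qed
  show ?thesis using *[OF V x(1)] *[OF V' x(2)] x(3) by simp
qed

text \<open>Automorphisms of \<open>K\<close> are extended by the identity outside of \<open>K\<close>, so that they form a group
  under composition of total functions.\<close>

abbreviation ainv :: "('e \<Rightarrow> 'e) \<Rightarrow> 'e \<Rightarrow> 'e" where
  "ainv \<equiv> inv_into UNIV"

definition aut :: "('e \<Rightarrow> 'e) \<Rightarrow> bool" where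
  "aut s \<longleftrightarrow> bij s \<and> (\<forall>a. a \<notin> K \<longrightarrow> s a = a) \<and> s ` K = K \<and>
     (\<forall>a\<in>K. \<forall>b\<in>K. s (a + b) = s a + s b \<and> s (a * b) = s a * s b) \<and> (\<forall>c. s (emb c) = emb c)"

abbreviation Gal :: "'e \<Rightarrow> ('e \<Rightarrow> 'e) set" where
  "Gal x \<equiv> {s. aut s \<and> s x = x}"

lemma aut_id: "aut id"
  unfolding aut_def by auto

lemma aut_in_K: "aut s \<Longrightarrow> s a \<in> K \<longleftrightarrow> a \<in> K"
  unfolding aut_def by (metis imageI image_iff)

lemma aut_emb: "aut s \<Longrightarrow> s (emb c) = emb c"
  unfolding aut_def by blast

lemma aut_inj: "aut s \<Longrightarrow> s a = s b \<longleftrightarrow> a = b"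
  unfolding aut_def bij_def by (metis injD)

lemma aut_bij: "aut s \<Longrightarrow> bij s"
  unfolding aut_def by blast

lemma aut_inv_apply: "aut s \<Longrightarrow> s (ainv s a) = a" "aut s \<Longrightarrow> ainv s (s a) = a"
  unfolding aut_def bij_def by (auto simp: surj_f_inv_f inv_f_f)

lemma aut_comp: "aut s \<Longrightarrow> aut t \<Longrightarrow> aut (s \<circ> t)"
proof -
  assume s: "aut s" and t: "aut t"
  have "(s \<circ> t) ` K = K" using s t unfolding aut_def by (metis image_comp)
  moreover have "t a \<in> K" if "a \<in> K" for a using aut_in_K[OF t] that by blast
  ultimately show ?thesis using s t unfolding aut_def comp_def by (simp add: bij_comp[unfolded comp_def])
qed

lemma aut_inv:
  assumes s: "aut s"
  shows "aut (ainv s)"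
proof -
  have b: "bij s" using s by (rule aut_bij)
  have k: "ainv s a \<in> K \<longleftrightarrow> a \<in> K" for a
    using aut_in_K[OF s, of "ainv s a"] aut_inv_apply[OF s] by simp
  have "ainv s a = a" if "a \<notin> K" for a
    using s that aut_inv_apply(2)[OF s, of a] unfolding aut_def by metis
  moreover have "ainv s ` K = K"
  proof
    show "ainv s ` K \<subseteq> K" using k by auto
    show "K \<subseteq> ainv s ` K"
    proof
      fix a assume "a \<in> K"
      hence "s a \<in> K" "a = ainv s (s a)" using aut_in_K[OF s] aut_inv_apply[OF s] by auto
      thus "a \<in> ainv s ` K" by blast
    qed
  qed
  moreover have "ainv s (a + b) = ainv s a + ainv s b \<and> ainv s (a * b) = ainv s a * ainv s b" if ab: "a \<in> K" "b \<in> K" for a b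
  proof -
    have "s (ainv s a + ainv s b) = s (ainv s (a + b))" "s (ainv s a * ainv s b) = s (ainv s (a * b))"
      using s ab k aut_inv_apply(1)[OF s] unfolding aut_def by auto
    thus ?thesis using aut_inj[OF s] by metis
  qed
  moreover have "ainv s (emb c) = emb c" for c
    using aut_inv_apply(2)[OF s] aut_emb[OF s] by metis
  ultimately show ?thesis unfolding aut_def using bij_imp_bij_inv[OF b] by blast
qed

lemma aut_phom: "aut s \<Longrightarrow> phom K s"
  using aut_emb[of s 1] unfolding aut_def by unfold_locales auto

lemma aut_inverse: "aut s \<Longrightarrow> a \<in> K \<Longrightarrow> s (inverse a) = inverse (s a)"
proof (cases "a = 0")
  case True
  assume "aut s"
  thus ?thesis using True aut_emb[of s 0] by simp
next
  case False
  assume s: "aut s" and a: "a \<in> K"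
  interpret s: phom K s by (rule aut_phom) fact
  have "s a * s (inverse a) = 1" using False a s.p_one by (simp flip: s.p_mult)
  thus ?thesis using inverse_unique by metis
qed

lemma aut_divide: "aut s \<Longrightarrow> a \<in> K \<Longrightarrow> b \<in> K \<Longrightarrow> s (a / b) = s a / s b"
  unfolding divide_inverse by (simp add: phom.p_mult[OF aut_phom] aut_inverse)

lemma aut_zero: "aut s \<Longrightarrow> s a = 0 \<longleftrightarrow> a = 0"
  using aut_inj[of s a 0] aut_emb[of s 0] by simp

lemma aut_pev: "aut s \<Longrightarrow> x \<in> K \<Longrightarrow> s (pev emb x p) = pev emb (s x) p"
proof (induction p)
  case 0
  thus ?case using aut_emb[of s 0] by simp
next
  case (pCons a p)
  interpret s: phom K s by (rule aut_phom) fact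
  show ?case using pCons by (simp add: s.p_add s.p_mult aut_emb)
qed

lemma aut_rat: "aut s \<Longrightarrow> x \<in> K \<Longrightarrow> s x = x \<Longrightarrow> a \<in> rat x \<Longrightarrow> s a = a"
  unfolding rat_def by (auto simp: aut_divide aut_pev)

lemma place_aut:
  assumes s: "aut s" and V: "place V"
  shows "place (s ` V)" "mid (s ` V) = s ` mid V" "f \<in> V \<Longrightarrow> val (s ` V) (s f) = val V f"
proof -
  interpret s: phom K s by (rule aut_phom) fact
  interpret V: phom V "\<lambda>x. x" using V unfolding place_def by (intro subr_phom) auto
  have VK: "a \<in> K" if "a \<in> V" for a using place_subset[OF V that] .
  have sV: "s a \<in> s ` V \<longleftrightarrow> a \<in> V" for a using aut_inj[OF s] by auto
  show p: "place (s ` V)"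
    unfolding place_def subr_def
  proof (intro conjI ballI)
    show "s ` V \<subseteq> K" using aut_in_K[OF s] VK by auto
    have "emb c = s (emb c)" for c using aut_emb[OF s] by simp
    thus "range emb \<subseteq> s ` V" using place_emb[OF V] by (metis image_subsetI sV)
    show "s ` V \<noteq> K"
    proof
      assume "s ` V = K"
      hence "V = K" using s sV VK unfolding aut_def by blast
      thus False using V unfolding place_def by blast
    qed
    fix a assume "a \<in> s ` V"
    then obtain a' where a: "a = s a'" "a' \<in> V" by blast
    show "- a \<in> s ` V" using a VK sV[of "-a'"] by (simp add: s.p_uminus)
    fix b assume "b \<in> s ` V"
    then obtain b' where b: "b = s b'" "b' \<in> V" by blast
    show "a + b \<in> s ` V" "a * b \<in> s ` V"
      using a b VK sV[of "a' + b'"] sV[of "a' * b'"] by (simp_all add: s.p_add s.p_mult)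
  next
    fix f assume f: "f \<in> K"
    obtain g where g: "f = s g" "g \<in> K" using f s unfolding aut_def by blast
    thus "f \<in> s ` V \<or> inverse f \<in> s ` V"
      using place_total[OF V, of g] sV aut_inverse[OF s, of g] by metis
  qed
  have m: "s f \<in> mid (s ` V) \<longleftrightarrow> f \<in> mid V" for f
  proof (cases "f \<in> V")
    case True
    have "inverse (s f) = s (inverse f)" using aut_inverse[OF s VK[OF True]] by simp
    thus ?thesis unfolding mid_def mem_Collect_eq by (simp only: sV aut_zero[OF s])
  next
    case False
    thus ?thesis using sV[of f] mid_subset[OF p] mid_subset[OF V] by blast
  qed
  show "mid (s ` V) = s ` mid V"
  proof
    show "mid (s ` V) \<subseteq> s ` mid V"
    proof
      fix a assume a: "a \<in> mid (s ` V)"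
      then obtain b where "a = s b" using mid_subset[OF p a] by blast
      thus "a \<in> s ` mid V" using m a by blast
    qed
  qed (use m in auto)
  show "val (s ` V) (s f) = val V f" if f: "f \<in> V"
  proof (rule valI[OF p])
    have "s f - emb (val V f) = s (f - emb (val V f))"
      using VK[OF f] by (simp add: s.p_diff aut_emb[OF s])
    thus "s f - emb (val V f) \<in> mid (s ` V)" using m val_spec[OF V f] by simp
  qed
qed

section \<open>Finite groups of automorphisms and conjugate places\<close>

definition agroup :: "('e \<Rightarrow> 'e) set \<Rightarrow> bool" where
  "agroup G \<longleftrightarrow> finite G \<and> id \<in> G \<and> (\<forall>s\<in>G. aut s) \<and> (\<forall>s\<in>G. \<forall>t\<in>G. s \<circ> t \<in> G)"

lemma agroup_left:
  assumes G: "agroup G" and s: "s \<in> G"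
  shows "bij_betw (\<lambda>t. s \<circ> t) G G"
proof -
  have a: "aut s" using G s unfolding agroup_def by blast
  have "inj_on (\<lambda>t. s \<circ> t) G"
    by (rule inj_onI) (metis a aut_inv_apply(2) comp_apply ext)
  moreover have "(\<lambda>t. s \<circ> t) ` G \<subseteq> G" using G s unfolding agroup_def by blast
  ultimately show ?thesis using G unfolding agroup_def bij_betw_def by (metis endo_inj_surj)
qed

text \<open>Composition with s permutes the linear factors, so the coefficients belong to the fixed
  field.\<close>

lemma agroup_prod_invariant:
  assumes G: "agroup G" and x: "x \<in> K" and s: "s \<in> G"
  shows "s (coeff (\<Prod>t\<in>G. [:- t x, 1:]) i) = coeff (\<Prod>t\<in>G. [:- t x, 1:]) i"
proof -
  have a: "aut t" if "t \<in> G" for t using G that unfolding agroup_def by blast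
  interpret s: phom K s by (rule aut_phom[OF a[OF s]])
  have "map_poly s (\<Prod>t\<in>G. [:- t x, 1:]) = (\<Prod>t\<in>G. [:- s (t x), 1:])"
    by (rule s.map_p_prod_linear) (use a aut_in_K x in blast)
  also have "\<dots> = (\<Prod>t\<in>G. [:- t x, 1:])"
    using prod.reindex_bij_betw[OF agroup_left[OF G s], of "\<lambda>t. [:- t x, 1:]"] by simp
  finally show ?thesis by (metis coeff_map_poly s.p_zero)
qed

text \<open>Places with the same restriction to the fixed field are conjugate. To obtain a single
  conjugating element for all of \<open>T\<close>, one compares the values of a generic linear combination.\<close>

lemma places_conjugate:
  assumes G: "agroup G" and V: "place V" and V': "place V'"
    and T: "finite T" "T \<subseteq> V" "T \<subseteq> V'" "\<And>s e. s \<in> G \<Longrightarrow> e \<in> T \<Longrightarrow> s e \<in> T"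
    and agree: "\<And>c. c \<in> K \<Longrightarrow> (\<And>s. s \<in> G \<Longrightarrow> s c = c) \<Longrightarrow> c \<in> V \<Longrightarrow> c \<in> V' \<Longrightarrow> val V' c = val V c"
  shows "\<exists>h\<in>G. \<forall>e\<in>T. val V' e = val V (h e)"
proof (rule ccontr)
  assume "\<not> ?thesis"
  hence ne: "\<exists>e\<in>T. val V' e \<noteq> val V (h e)" if "h \<in> G" for h using that by blast
  have a: "aut t" if "t \<in> G" for t using G that unfolding agroup_def by blast
  have fin: "finite G" and idG: "id \<in> G" using G unfolding agroup_def by auto
  interpret v: phom V "val V" by (rule val_phom[OF V])
  interpret v': phom V' "val V'" by (rule val_phom[OF V'])
  \<comment> \<open>Distinct exponents for the elements of T turn a linear combination into a
    polynomial in one parameter \<open>l\<close>. For each h, \<open>D h\<close> is a nonzero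
    polynomial, so one value of \<open>l\<close> separates the values for all h at once.\<close>
  obtain n :: "'e \<Rightarrow> nat" where n: "inj_on n T" using T(1) finite_imp_inj_to_nat_seg by blast
  define D where "D h = (\<Sum>e\<in>T. monom (val V' e - val V (h e)) (n e))" for h
  have "D h \<noteq> 0" if h: "h \<in> G" for h
  proof -
    obtain e where e: "e \<in> T" "val V' e \<noteq> val V (h e)" using ne[OF h] by blast
    have "coeff (D h) (n e) = (\<Sum>e'\<in>T. if e' = e then val V' e' - val V (h e') else 0)"
      unfolding D_def coeff_sum by (intro sum.cong refl) (use n e in \<open>auto simp: inj_on_def\<close>)
    also have "\<dots> \<noteq> 0" using e T(1) by simp
    finally show ?thesis by auto
  qed
  hence "(\<Prod>h\<in>G. D h) \<noteq> 0" using fin by auto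
  then obtain l where l: "poly (\<Prod>h\<in>G. D h) l \<noteq> 0" using exists_nonroot[of _ "{}"] by blast
  define f where "f = (\<Sum>e\<in>T. emb (l ^ n e) * e)"
  have TK: "T \<subseteq> K" using T place_subset[OF V] by blast
  have fK: "f \<in> K" unfolding f_def using TK by (intro K.B_sum K_mult K_emb) blast
  have hf: "h f = (\<Sum>e\<in>T. emb (l ^ n e) * h e)" if h: "h \<in> G" for h
  proof -
    interpret h: phom K h by (rule aut_phom[OF a[OF h]])
    have "h f = (\<Sum>e\<in>T. h (emb (l ^ n e) * e))" unfolding f_def
      by (rule h.p_sum) (use TK in auto)
    also have "\<dots> = (\<Sum>e\<in>T. emb (l ^ n e) * h e)"
      by (intro sum.cong refl, subst h.p_mult) (use TK in \<open>auto simp: aut_emb[OF a[OF h]] simp del: h_power\<close>)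
    finally show ?thesis .
  qed
  have hV: "h f \<in> V" "h f \<in> V'" if h: "h \<in> G" for h
    unfolding hf[OF h] by (intro v.B_sum v.B_mult v'.B_sum v'.B_mult place_emb V V'; use T h in blast)+
  have vh: "val V (h f) = (\<Sum>e\<in>T. l ^ n e * val V (h e))" if h: "h \<in> G" for h
    unfolding hf[OF h] by (subst v.p_sum) (use T h V in \<open>auto simp: v.p_mult subset_iff simp del: h_power\<close>)
  have v'f: "val V' f = (\<Sum>e\<in>T. l ^ n e * val V' e)"
    unfolding f_def by (subst v'.p_sum) (use T V' in \<open>auto simp: v'.p_mult subset_iff simp del: h_power\<close>)
  have neq: "val V' f \<noteq> val V (h f)" if h: "h \<in> G" for h
  proof
    assume "val V' f = val V (h f)"
    hence "poly (D h) l = 0"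
      unfolding D_def poly_sum poly_monom vh[OF h] v'f by (simp add: sum_subtractf algebra_simps)
    thus False using l h fin by (auto simp: poly_prod prod_zero_iff)
  qed
  \<comment> \<open>The coefficients of this polynomial are invariant, so by \<open>agree\<close>
    its reductions at V and V' coincide. Since the identity is in G, \<open>val V' f\<close> is a
    root of the second, hence of the first, contrary to \<open>neq\<close>.\<close>
  let ?q = "\<Prod>h\<in>G. [:- h f, 1:]"
  have q: "v.Bpoly ?q" "map_poly (val V) ?q = (\<Prod>h\<in>G. [:- val V (h f), 1:])"
    by (rule v.map_p_prod_linear; use hV in blast)+
  have q': "v'.Bpoly ?q" "map_poly (val V') ?q = (\<Prod>h\<in>G. [:- val V' (h f), 1:])"
    by (rule v'.map_p_prod_linear; use hV in blast)+
  have "map_poly (val V) ?q = map_poly (val V') ?q"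
  proof (rule poly_eqI)
    fix i
    have "val V' (coeff ?q i) = val V (coeff ?q i)"
    proof (rule agree)
      show "coeff ?q i \<in> V" using q(1) unfolding v.Bpoly_def by blast
      thus "coeff ?q i \<in> K" by (rule place_subset[OF V])
      show "coeff ?q i \<in> V'" using q'(1) unfolding v'.Bpoly_def by blast
      show "s (coeff ?q i) = coeff ?q i" if "s \<in> G" for s
        by (rule agroup_prod_invariant[OF G fK that])
    qed
    thus "coeff (map_poly (val V) ?q) i = coeff (map_poly (val V') ?q) i"
      by (simp add: coeff_map_poly v.p_zero v'.p_zero)
  qed
  hence "poly (\<Prod>h\<in>G. [:- val V (h f), 1:]) (val V' f) = poly (\<Prod>h\<in>G. [:- val V' (h f), 1:]) (val V' f)"
    unfolding q(2) q'(2) by simp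
  also have "\<dots> = 0" unfolding poly_prod by (rule prod_zero[OF fin], rule bexI[OF _ idG]) simp
  finally obtain h where "h \<in> G" "val V' f - val V (h f) = 0"
    using fin by (auto simp: poly_prod prod_zero_iff)
  thus False using neq by auto
qed

end

section \<open>Generic points of plane curves\<close>

lemma range_to_ac: "range (to_ac :: 'k::alg_closed_field \<Rightarrow> 'k alg_closure) = UNIV"
proof -
  have r: "rhom (to_ac :: 'k \<Rightarrow> 'k alg_closure)" by unfold_locales auto
  have "x \<in> range to_ac" if "p \<noteq> 0" "pev to_ac x p = 0" for p :: "'k poly" and x
    using that
  proof (induction p rule: alg_closed_poly_induct)
    case (const c)
    thus ?case using rhom.pev_pCons[OF r] rhom.pev_0[OF r] by simp
  next
    case (linear a q)
    have "(x - to_ac a) * pev to_ac x q = 0"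
      using linear.prems rhom.pev_mult[OF r, of x "[:-a, 1:]" q] rhom.pev_pCons[OF r] rhom.pev_0[OF r]
      by (simp del: mult_pCons_left)
    thus ?case using linear by auto
  qed
  moreover have "\<exists>p. p \<noteq> 0 \<and> pev to_ac x p = 0" for x :: "'k alg_closure"
    using alg_closure_algebraic[of x] unfolding pev_def by metis
  ultimately show ?thesis by blast
qed

lemma bij_map_poly:
  assumes "rhom h" "bij h"
  shows "bij (map_poly h)"
proof -
  interpret rhom h by fact
  have "inj (map_poly h)"
  proof (rule injI)
    fix p q assume "map_poly h p = map_poly h q"
    hence "h (coeff p i) = h (coeff q i)" for i by (metis coeff_map_poly h_zero)
    thus "p = q" using assms(2) by (intro poly_eqI) (auto dest: injD simp: bij_def)
  qed
  moreover have "map_poly h (map_poly (inv_into UNIV h) q) = q" for q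
  proof (rule poly_eqI)
    fix i
    have "inv_into UNIV h 0 = 0" using assms(2) by (metis bij_def h_zero inv_f_f)
    thus "coeff (map_poly h (map_poly (inv_into UNIV h) q)) i = coeff q i"
      using assms(2) by (simp add: coeff_map_poly bij_def surj_f_inv_f)
  qed
  hence "surj (map_poly h)" by (metis surj_def)
  ultimately show ?thesis by (simp add: bij_def)
qed

lemma rhom_bij_dvd:
  assumes "rhom h" "bij h"
  shows "h a dvd h b \<longleftrightarrow> a dvd b"
proof -
  interpret rhom h by fact
  show ?thesis unfolding dvd_def using assms(2) by (metis bij_pointE h_mult)
qed

lemma rhom_bij_prime_elem:
  fixes h :: "'a::idom \<Rightarrow> 'b::idom"
  assumes "rhom h" "bij h" "prime_elem (h a)"
  shows "prime_elem a"
proof (rule prime_elemI)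
  interpret rhom h by fact
  show "a \<noteq> 0" using assms(3) by auto
  show "\<not> a dvd 1" using assms(3) rhom_bij_dvd[OF assms(1,2), of a 1] by (simp add: prime_elem_def)
  fix x y assume "a dvd x * y"
  hence "h a dvd h x * h y" using rhom_bij_dvd[OF assms(1,2), of a "x * y"] by simp
  hence "h a dvd h x \<or> h a dvd h y" using assms(3) prime_elem_dvd_multD by blast
  thus "a dvd x \<or> a dvd y" using rhom_bij_dvd[OF assms(1,2)] by blast
qed

lemma rhom_bij_irreducible:
  fixes h :: "'a::idom \<Rightarrow> 'b::idom"
  assumes "rhom h" "bij h" "irreducible a"
  shows "irreducible (h a)"
proof (rule irreducibleI)
  interpret rhom h by fact
  have inj: "h x = h y \<longleftrightarrow> x = y" for x y using assms(2) by (auto simp: bij_def dest: injD)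
  show "h a \<noteq> 0" using inj[of a 0] assms(3) by auto
  have 1: "h x dvd 1 \<longleftrightarrow> x dvd 1" for x using rhom_bij_dvd[OF assms(1,2), of x 1] by simp
  show "\<not> h a dvd 1" using 1 assms(3) by (auto simp: irreducible_def)
  fix x y assume xy: "h a = x * y"
  obtain x' y' where "x = h x'" "y = h y'" using assms(2) by (metis bij_pointE)
  hence *: "a = x' * y'" "x = h x'" "y = h y'" using xy inj[of a "x' * y'"] by auto
  thus "x dvd 1 \<or> y dvd 1" using irreducibleD[OF assms(3) *(1)] 1 by auto
qed

text \<open>Irreducibility is carried along the isomorphism \<open>to_ac\<close> to polynomials over
  \<open>'k alg_closure\<close>, where unique factorization makes F prime, and primality is carried
  back.\<close>

lemma poly3_irreducible_imp_prime:
  fixes F :: "'k::alg_closed_field poly3"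
  assumes "irreducible F"
  shows "prime_elem F"
proof -
  let ?h = "to_ac :: 'k \<Rightarrow> 'k alg_closure"
  have 0: "rhom ?h" "bij ?h" using range_to_ac inj_to_ac by (auto simp: bij_def rhom_def)
  have 1: "rhom (map_poly ?h)" "bij (map_poly ?h)" using 0 rhom.map_poly_rhom bij_map_poly by auto
  have 2: "rhom (map_poly (map_poly ?h))" "bij (map_poly (map_poly ?h))"
    using 1 rhom.map_poly_rhom bij_map_poly by auto
  have 3: "rhom (map_poly (map_poly (map_poly ?h)))" "bij (map_poly (map_poly (map_poly ?h)))"
    using 2 rhom.map_poly_rhom bij_map_poly by auto
  have "irreducible (map_poly (map_poly (map_poly ?h)) F)"
    by (rule rhom_bij_irreducible[OF 3 assms])
  hence "prime_elem (map_poly (map_poly (map_poly ?h)) F)"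
    by (rule irreducible_imp_prime_elem_gcd)
  thus ?thesis by (rule rhom_bij_prime_elem[OF 3])
qed

text \<open>Values of X, Y and Z are chosen in turn so that the leading coefficient in the remaining
  variables does not vanish.\<close>

lemma eval3_nonzero:
  fixes G :: "'k::alg_closed_field poly3"
  assumes "G \<noteq> 0"
  shows "\<exists>u. eval3 G u \<noteq> 0"
proof -
  have step: "\<exists>x. pev h x p \<noteq> 0" if "rhom h" "h (lead_coeff p) \<noteq> 0"
    for h :: "'a::comm_ring_1 \<Rightarrow> 'k" and p
  proof -
    interpret rhom h by fact
    have "coeff (map_poly h p) (degree p) \<noteq> 0" using that by (simp add: coeff_map_poly)
    hence "map_poly h p \<noteq> 0" by auto
    thus ?thesis unfolding pev_def using exists_nonroot[of _ "{}"] by blast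
  qed
  obtain a where a: "pev (\<lambda>x. x) a (lead_coeff (lead_coeff G)) \<noteq> 0"
    using step[of "\<lambda>x. x", OF rhom_id, of "lead_coeff (lead_coeff G)"] assms by auto
  have r1: "rhom (pev (\<lambda>x::'k. x) a)" by (rule rhom.rhom_pev[OF rhom_id])
  obtain b where b: "pev (pev (\<lambda>x. x) a) b (lead_coeff G) \<noteq> 0" using step[OF r1 a] by blast
  obtain c where c: "pev (pev (pev (\<lambda>x. x) a) b) c G \<noteq> 0"
    using step[OF rhom.rhom_pev[OF r1] b] by blast
  have "eval3 G (vector [a, b, c]) \<noteq> 0" using c by (simp add: eval3_conv_ev3 ev3_def vector_3)
  thus ?thesis by blast
qed

section \<open>Linear substitutions in forms\<close>

lemma homogeneous_ev3:
  fixes G :: "'k::field poly3"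
  assumes "homogeneous n G" and w: "\<And>i. homogeneous 1 (w $ i)"
  shows "homogeneous n (ev3 const3 w G)"
proof -
  obtain N where N: "ev3 const3 w G = (\<Sum>l\<le>N. \<Sum>j\<le>N. \<Sum>i\<le>N. const3 (coeff (coeff (coeff G l) j) i) * w$1^i * w$2^j * w$3^l)"
    using ev3_altdef[OF rhom_const3, of G] order_refl by blast
  show ?thesis unfolding N
  proof (intro homogeneous_sum)
    fix i j l
    show "homogeneous n (const3 (coeff (coeff (coeff G l) j) i) * w $ 1 ^ i * w $ 2 ^ j * w $ 3 ^ l)"
    proof (cases "i + j + l = n")
      case True
      have "homogeneous (0 + 1 * i + 1 * j + 1 * l) (const3 (coeff (coeff (coeff G l) j) i) * w $ 1 ^ i * w $ 2 ^ j * w $ 3 ^ l)"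
        by (intro homogeneous_mult homogeneous_power w homogeneous_const3)
      thus ?thesis using True by simp
    next
      case False
      hence "coeff (coeff (coeff G l) j) i = 0" using homogeneousD[OF assms(1)] by blast
      thus ?thesis by (simp add: rhom.h_zero[OF rhom_const3])
    qed
  qed
qed

text \<open>Pullback of forms along the linear map M; \<open>eval3_subst3\<close> states this for
  values.\<close>

definition subst3 :: "'k::field ^ 3 ^ 3 \<Rightarrow> 'k poly3 \<Rightarrow> 'k poly3" where
  "subst3 M = ev3 const3 (\<chi> i. lin3 (M $ i))"

lemma rhom_subst3: "rhom (subst3 M)"
  unfolding subst3_def by (rule rhom_ev3[OF rhom_const3])

lemma homogeneous_subst3: "homogeneous n G \<Longrightarrow> homogeneous n (subst3 M G)"
  unfolding subst3_def by (rule homogeneous_ev3) (use homogeneous_lin3 in simp_all)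

lemma subst3_simps [simp]:
  "subst3 M (const3 c) = const3 c" "subst3 M varX = lin3 (M $ 1)"
  "subst3 M varY = lin3 (M $ 2)" "subst3 M varZ = lin3 (M $ 3)"
  unfolding subst3_def by (simp_all add: rhom_const3)

lemma ev3_subst3:
  assumes "rhom h"
  shows "ev3 h w (subst3 M G) = ev3 h (\<chi> i. ev3 h w (lin3 (M $ i))) G"
proof (rule poly3_hom_unique[where f = "\<lambda>G. ev3 h w (subst3 M G)"])
  show "rhom (\<lambda>G. ev3 h w (subst3 M G))"
    by (rule rhom_comp[OF rhom_subst3 rhom_ev3[OF assms]])
qed (simp_all add: assms rhom_ev3)

lemma eval3_subst3: "eval3 (subst3 M G) w = eval3 G (M *v w)"
proof -
  have "(\<chi> i. ev3 (\<lambda>x. x) w (lin3 (M $ i))) = M *v w"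
    by (simp add: vec_eq_iff matrix_vector_mult_def sum_3 ev3_lin3 rhom_id)
  thus ?thesis unfolding eval3_conv_ev3 ev3_subst3[OF rhom_id] by simp
qed

lemma subst3_subst3:
  assumes "M ** M' = mat 1"
  shows "subst3 M' (subst3 M G) = G"
proof (rule poly3_hom_unique[where f = "\<lambda>G. subst3 M' (subst3 M G)" and g = "\<lambda>G. G"])
  show "rhom (\<lambda>G. subst3 M' (subst3 M G))" by (rule rhom_comp[OF rhom_subst3 rhom_subst3])
  interpret s: rhom "subst3 M'" by (rule rhom_subst3)
  interpret c: rhom const3 by (rule rhom_const3)
  have l: "subst3 M' (lin3 a) = const3 (\<Sum>j\<in>UNIV. a $ j * M' $ j $ 1) * varX
     + const3 (\<Sum>j\<in>UNIV. a $ j * M' $ j $ 2) * varY + const3 (\<Sum>j\<in>UNIV. a $ j * M' $ j $ 3) * varZ" for a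
    unfolding lin3_def[of a] by (simp add: lin3_def sum_3 algebra_simps)
  have m: "(\<Sum>j\<in>UNIV. M $ i $ j * M' $ j $ k) = (if i = k then 1 else 0)" for i k
    using assms by (simp add: vec_eq_iff matrix_matrix_mult_def mat_def)
  show "subst3 M' (subst3 M varX) = varX" "subst3 M' (subst3 M varY) = varY" "subst3 M' (subst3 M varZ) = varZ"
    by (simp_all add: l m)
qed (simp_all add: rhom_id)

lemma bij_subst3:
  assumes "M ** M' = mat 1" "M' ** M = mat 1"
  shows "bij (subst3 M)"
  by (rule o_bij[of "subst3 M'"]) (use subst3_subst3[OF assms(1)] subst3_subst3[OF assms(2)] in \<open>auto simp: fun_eq_iff\<close>)

text \<open>The vector v consists of homogeneous coordinates. Quotients of forms of equal degree are
  unchanged when v is scaled, so they are functions on the curve.\<close>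

definition frac_field :: "('k::field \<Rightarrow> 'e::field) \<Rightarrow> 'e ^ 3 \<Rightarrow> 'e set" where
  "frac_field emb v = {ev3 emb v G / ev3 emb v H | n G H. homogeneous n G \<and> homogeneous n H \<and> ev3 emb v H \<noteq> 0}"

section \<open>Algebraic dependence of any two functions on the curve\<close>

lemma (in vector_space) family_dependent:
  assumes fin: "finite I" "finite T" and card: "card T < card I" and sp: "\<And>i. i \<in> I \<Longrightarrow> u i \<in> span T"
  shows "\<exists>c. (\<exists>i\<in>I. c i \<noteq> 0) \<and> (\<Sum>i\<in>I. scale (c i) (u i)) = 0"
proof (cases "inj_on u I")
  case False
  then obtain i j where ij: "i \<in> I" "j \<in> I" "i \<noteq> j" "u i = u j" unfolding inj_on_def by blast
  let ?c = "\<lambda>x. if x = i then 1 else if x = j then -1 else 0"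
  have "(\<Sum>x\<in>I. scale (?c x) (u x)) = (\<Sum>x\<in>{i, j}. scale (?c x) (u x))"
    by (rule sum.mono_neutral_right) (use fin ij in auto)
  also have "\<dots> = 0" using ij by simp
  finally show ?thesis using ij by (intro exI[of _ ?c]) auto
next
  case True
  have "dependent (u ` I)"
  proof (rule ccontr)
    assume "\<not> ?thesis"
    hence "card (u ` I) \<le> card T" using independent_span_bound[OF fin(2), of "u ` I"] sp by auto
    thus False using card card_image[OF True] by simp
  qed
  then obtain f where f: "\<exists>x\<in>u ` I. f x \<noteq> 0" "(\<Sum>x\<in>u ` I. scale (f x) x) = 0"
    using dependent_finite[of "u ` I"] fin by auto
  thus ?thesis using True by (intro exI[of _ "f \<circ> u"]) (auto simp: sum.reindex)
qed

text \<open>The condition \<open>lead\<close> says that (0 : 0 : 1) is off the curve. Then F1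
  expresses \<open>v0 $ 3 ^ d\<close> by monomials with smaller exponents of
  \<open>v0 $ 3\<close>.\<close>

locale cone_point = rhom emb for emb :: "'k::alg_closed_field \<Rightarrow> 'e::field" +
  fixes v0 :: "'e ^ 3" and F1 :: "'k poly3" and d :: nat
  assumes hF: "homogeneous d F1" and d_pos: "d > 0"
    and F1_zero: "ev3 emb v0 F1 = 0" and lead: "coeff (coeff (coeff F1 d) 0) 0 \<noteq> 0"
begin

lemma vs: "vector_space (\<lambda>c e. emb c * e)"
  by unfold_locales (auto simp: algebra_simps)

interpretation vs: vector_space "\<lambda>c e. emb c * e" by (rule vs)

text \<open>The monomials of degree n whose third exponent is below d. Truncated subtraction may add
  a few other products; what matters is that the set is spanning and that its size is linear in
  n.\<close>

definition Tn :: "nat \<Rightarrow> 'e set" where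
  "Tn n = (\<lambda>(i, l). v0$1^i * v0$2^(n - l - i) * v0$3^l) ` ({..n} \<times> {..<d})"

lemma card_Tn: "finite (Tn n)" "card (Tn n) \<le> (n + 1) * d"
proof -
  have "card ({..n} \<times> {..<d}) = (n + 1) * d" by simp
  moreover have "card (Tn n) \<le> card ({..n} \<times> {..<d})" unfolding Tn_def by (rule card_image_le) simp
  ultimately show "card (Tn n) \<le> (n + 1) * d" by simp
qed (simp add: Tn_def)

text \<open>While the third exponent is at least d, the factor \<open>v0 $ 3 ^ d\<close> is
  rewritten by F1. Homogeneity keeps the total degree, and the third exponent drops.\<close>

lemma monomial_span: "v0$1^i * v0$2^j * v0$3^l \<in> vs.span (Tn (i + j + l))"
proof (induction l arbitrary: i j rule: less_induct)
  case (less l)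
  show ?case
  proof (cases "l < d")
    case True
    have "v0$1^i * v0$2^j * v0$3^l \<in> Tn (i + j + l)"
      unfolding Tn_def using True by (intro image_eqI[of _ _ "(i, l)"]) auto
    thus ?thesis by (rule vs.span_base)
  next
    case False
    let ?c = "\<lambda>i j l. coeff (coeff (coeff F1 l) j) i"
    obtain N where N: "\<And>M. M \<ge> N \<Longrightarrow> ev3 emb v0 F1 = (\<Sum>l\<le>M. \<Sum>j\<le>M. \<Sum>i\<le>M. emb (?c i j l) * v0$1^i * v0$2^j * v0$3^l)"
      using ev3_altdef[OF rhom_axioms, of F1] by blast
    define M where "M = max N d"
    define A where "A = {..M} \<times> {..M} \<times> {..M}"
    let ?m = "\<lambda>x. emb (?c (snd (snd x)) (fst (snd x)) (fst x)) * (v0$1^snd (snd x) * v0$2^fst (snd x) * v0$3^fst x)"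
    let ?z = "(d, 0, 0) :: nat \<times> nat \<times> nat"
    have fA: "finite A" and zA: "?z \<in> A" unfolding A_def M_def by auto
    have "(\<Sum>x\<in>A. ?m x) = 0"
      using N[of M] unfolding F1_zero A_def M_def by (simp add: sum.cartesian_product case_prod_beta mult.assoc)
    hence e: "emb (?c 0 0 d) * v0$3^d = - (\<Sum>x\<in>A-{?z}. ?m x)"
      using fA zA by (simp add: sum.remove eq_neg_iff_add_eq_0)
    have ne: "emb (?c 0 0 d) \<noteq> 0" using lead rhom_inj[OF rhom_axioms] by (metis h_zero injD)
    have "emb (inverse (?c 0 0 d)) * emb (?c 0 0 d) = 1" using lead by (simp flip: h_mult)
    hence "v0$3^d = emb (inverse (?c 0 0 d)) * (emb (?c 0 0 d) * v0$3^d)" by (simp flip: mult.assoc)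
    also have "\<dots> = - (\<Sum>x\<in>A-{?z}. emb (inverse (?c 0 0 d)) * ?m x)"
      unfolding e by (simp add: sum_distrib_left)
    finally have e2: "v0$3^d = - (\<Sum>x\<in>A-{?z}. emb (inverse (?c 0 0 d)) * ?m x)" .
    have "v0$1^i * v0$2^j * v0$3^l = v0$1^i * v0$2^j * v0$3^(l-d) * v0$3^d"
      using False by (simp flip: power_add)
    also have "\<dots> = - (\<Sum>x\<in>A-{?z}. v0$1^i * v0$2^j * v0$3^(l-d) * (emb (inverse (?c 0 0 d)) * ?m x))"
      unfolding e2 by (simp add: sum_distrib_left)
    also have "\<dots> \<in> vs.span (Tn (i + j + l))"
    proof (intro vs.span_neg vs.span_sum)
      fix x assume x: "x \<in> A - {?z}"
      obtain l' j' i' where x': "x = (l', j', i')" by (cases x) auto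
      show "v0$1^i * v0$2^j * v0$3^(l-d) * (emb (inverse (?c 0 0 d)) * ?m x) \<in> vs.span (Tn (i + j + l))"
      proof (cases "?c i' j' l' = 0")
        case True
        thus ?thesis by (simp add: x' vs.span_zero)
      next
        case False
        hence s: "i' + j' + l' = d" using homogeneousD[OF hF] by blast
        hence "l' < d" using x x' by (cases "l' = d") auto
        hence lt: "l - d + l' < l" using \<open>\<not> l < d\<close> by linarith
        have eq: "(i + i') + (j + j') + (l - d + l') = i + j + l" using s \<open>\<not> l < d\<close> by linarith
        have "v0$1^(i+i') * v0$2^(j+j') * v0$3^(l-d+l') \<in> vs.span (Tn (i + j + l))"
          using less.IH[OF lt, of "i + i'" "j + j'"] unfolding eq .
        from vs.span_scale[OF this, of "inverse (?c 0 0 d) * ?c i' j' l'"]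
        show ?thesis by (simp add: x' power_add mult_ac)
      qed
    qed
    finally show ?thesis .
  qed
qed

lemma form_span:
  assumes "homogeneous n G"
  shows "ev3 emb v0 G \<in> vs.span (Tn n)"
proof -
  obtain N where N: "ev3 emb v0 G = (\<Sum>l\<le>N. \<Sum>j\<le>N. \<Sum>i\<le>N. emb (coeff (coeff (coeff G l) j) i) * v0$1^i * v0$2^j * v0$3^l)"
    using ev3_altdef[OF rhom_axioms, of G] order_refl by blast
  show ?thesis unfolding N
  proof (intro vs.span_sum)
    fix i j l
    show "emb (coeff (coeff (coeff G l) j) i) * v0$1^i * v0$2^j * v0$3^l \<in> vs.span (Tn n)"
    proof (cases "i + j + l = n")
      case True
      from vs.span_scale[OF monomial_span[of i j l], of "coeff (coeff (coeff G l) j) i"] True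
      show ?thesis by (simp add: mult.assoc)
    next
      case False
      thus ?thesis using homogeneousD[OF assms False] by (simp add: vs.span_zero)
    qed
  qed
qed

text \<open>Forms of degree \<open>n\<close> span a space of dimension linear in \<open>n\<close>, while the number of monomials
  in two functions grows quadratically.\<close>

lemma forms_dependent:
  assumes A: "homogeneous m A" and B: "homogeneous m B" and H: "homogeneous m H" "ev3 emb v0 H \<noteq> 0"
  shows "\<exists>P. P \<noteq> 0 \<and> pev (pev emb (ev3 emb v0 A / ev3 emb v0 H)) (ev3 emb v0 B / ev3 emb v0 H) P = 0"
proof -
  \<comment> \<open>There are (N + 1)^2 products of powers of the two functions with exponents at
    most N, and over the common denominator all have degree 2 N m. This N makes the bound (2 N m +
    1) d smaller than their number.\<close>
  define N where "N = 2 * d * m + d"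
  define I where "I = {..N} \<times> {..N}"
  let ?u = "\<lambda>x. ev3 emb v0 (A ^ fst x * B ^ snd x * H ^ (2 * N - fst x - snd x))"
  let ?n = "2 * N * m"
  interpret e: rhom "ev3 emb v0" by (rule rhom_ev3[OF rhom_axioms])
  have cI: "card I = (N + 1) * (N + 1)" "finite I" unfolding I_def by auto
  have "(?n + 1) * d = N * (2 * d * m) + d" by (simp add: algebra_simps)
  also have "\<dots> < (N + 1) * (N + 1)"
  proof -
    have 1: "2 * d * m \<le> N" and "d \<le> N" by (auto simp: N_def)
    have "N * (2 * d * m) \<le> N * N" by (rule mult_le_mono2[OF 1])
    moreover have "(N + 1) * (N + 1) = N * N + 2 * N + 1" by (simp add: algebra_simps)
    ultimately show ?thesis using \<open>d \<le> N\<close> by linarith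
  qed
  finally have card: "card (Tn ?n) < card I" using card_Tn(2)[of ?n] cI by simp
  have sp: "?u x \<in> vs.span (Tn ?n)" if "x \<in> I" for x
  proof (rule form_span)
    have "fst x + snd x + (2 * N - fst x - snd x) = 2 * N" using that by (auto simp: I_def)
    hence "m * (fst x + snd x + (2 * N - fst x - snd x)) = m * (2 * N)" by (rule arg_cong)
    hence "m * fst x + m * snd x + m * (2 * N - fst x - snd x) = ?n"
      unfolding distrib_left by (simp only: mult.commute)
    moreover have "homogeneous (m * fst x + m * snd x + m * (2 * N - fst x - snd x))
        (A ^ fst x * B ^ snd x * H ^ (2 * N - fst x - snd x))"
      by (intro homogeneous_mult homogeneous_power A B H)
    ultimately show "homogeneous ?n (A ^ fst x * B ^ snd x * H ^ (2 * N - fst x - snd x))"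
      by metis
  qed
  have "\<exists>c. (\<exists>x\<in>I. c x \<noteq> 0) \<and> (\<Sum>x\<in>I. emb (c x) * ?u x) = 0"
    by (rule vs.family_dependent[OF cI(2) card_Tn(1) card]) (rule sp)
  then obtain c where c: "\<exists>x\<in>I. c x \<noteq> 0" "(\<Sum>x\<in>I. emb (c x) * ?u x) = 0" by blast
  let ?f = "ev3 emb v0 A / ev3 emb v0 H" and ?g = "ev3 emb v0 B / ev3 emb v0 H" and ?h = "ev3 emb v0 H"
  have "?h ^ (2 * N) * (\<Sum>x\<in>I. emb (c x) * (?f ^ fst x * ?g ^ snd x)) = (\<Sum>x\<in>I. emb (c x) * ?u x)"
    unfolding sum_distrib_left
  proof (intro sum.cong refl)
    fix x assume x: "x \<in> I"
    have "?h ^ (2 * N) = ?h ^ fst x * ?h ^ snd x * ?h ^ (2 * N - fst x - snd x)"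
      using x by (auto simp: I_def simp flip: power_add)
    thus "?h ^ (2 * N) * (emb (c x) * (?f ^ fst x * ?g ^ snd x)) = emb (c x) * ?u x"
      using H(2) by (simp add: power_divide)
  qed
  hence z: "(\<Sum>x\<in>I. emb (c x) * (?f ^ fst x * ?g ^ snd x)) = 0" using c(2) H(2) by simp
  define P where "P = (\<Sum>j\<le>N. monom (\<Sum>i\<le>N. monom (c (i, j)) i) j)"
  interpret p: rhom "pev emb ?f" by (rule rhom_pev)
  have "pev (pev emb ?f) ?g P = (\<Sum>j\<le>N. \<Sum>i\<le>N. emb (c (i, j)) * ?f ^ i * ?g ^ j)"
    unfolding P_def by (simp add: p.pev_sum p.pev_monom pev_sum pev_monom sum_distrib_right)
  also have "\<dots> = (\<Sum>i\<le>N. \<Sum>j\<le>N. emb (c (i, j)) * ?f ^ i * ?g ^ j)" by (rule sum.swap)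
  also have "\<dots> = (\<Sum>x\<in>I. emb (c x) * (?f ^ fst x * ?g ^ snd x))"
    unfolding I_def by (simp add: sum.cartesian_product case_prod_beta mult.assoc)
  also have "\<dots> = 0" by (rule z)
  finally have "pev (pev emb ?f) ?g P = 0" .
  moreover have "P \<noteq> 0"
  proof
    assume P0: "P = 0"
    obtain i j where ij: "i \<le> N" "j \<le> N" "c (i, j) \<noteq> 0" using c(1) unfolding I_def by auto
    have "coeff (coeff P j) i = c (i, j)"
      unfolding P_def using ij by (simp add: coeff_sum if_distrib[of "\<lambda>p. coeff p i"] cong: if_cong)
    thus False using P0 ij by simp
  qed
  ultimately show ?thesis by blast
qed

end

lemma eval3_001:
  assumes "homogeneous n G"
  shows "eval3 G (vector [0, 0, 1]) = coeff (coeff (coeff G n) 0) 0"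
proof -
  obtain N where N: "\<And>M v. M \<ge> N \<Longrightarrow> eval3 G v = (\<Sum>l\<le>M. \<Sum>j\<le>M. \<Sum>i\<le>M. coeff (coeff (coeff G l) j) i * v$1^i * v$2^j * v$3^l)"
    using ev3_altdef[OF rhom_id, of G] unfolding eval3_conv_ev3 by blast
  define M where "M = max N n"
  have "eval3 G (vector [0, 0, 1]) = (\<Sum>l\<le>M. \<Sum>j\<le>M. \<Sum>i\<le>M. if i = 0 then if j = 0 then if l = n then coeff (coeff (coeff G l) 0) 0 else 0 else 0 else 0)"
    unfolding N[of M, OF max.cobounded1[of N n, folded M_def]]
    by (intro sum.cong refl) (auto simp: vector_3 power_0_left homogeneousD[OF assms])
  also have "\<dots> = coeff (coeff (coeff G n) 0) 0"
    by (simp add: M_def sum.delta)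
  finally show ?thesis .
qed

text \<open>The condition \<open>kernel\<close> is genericity: exactly the multiples of F vanish at
  v. As d exceeds 1, no nonzero linear form does, and every linear form may serve as a
  denominator.\<close>

locale generic_point = rhom emb for emb :: "'k::alg_closed_field \<Rightarrow> 'e::field" +
  fixes F :: "'k poly3" and d :: nat and v :: "'e ^ 3"
  assumes F_hom: "homogeneous d F" and d_gt_1: "d > 1" and F_nonzero: "F \<noteq> 0"
    and kernel: "ev3 emb v G = 0 \<longleftrightarrow> F dvd G"
    and dep: "a \<in> frac_field emb v \<Longrightarrow> b \<in> frac_field emb v \<Longrightarrow> \<exists>P. P \<noteq> 0 \<and> pev (pev emb a) b P = 0"
    and nonconst: "\<exists>a\<in>frac_field emb v. a \<notin> range emb"

context generic_point begin

text \<open>The form is pulled back by M while the generic point moves by the inverse matrix, so the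
  subfield K of the ambient field stays the same. Places and automorphisms are thus shared by all
  coordinate systems.\<close>

theorem change_coordinates:
  assumes M: "M ** M' = mat 1" "M' ** M = mat 1"
  defines "w \<equiv> \<chi> i. ev3 emb v (lin3 (M' $ i))"
  shows "generic_point emb (subst3 M F) d w" "frac_field emb w = frac_field emb v"
proof -
  have e: "ev3 emb w G = ev3 emb v (subst3 M' G)" for G
    unfolding w_def by (rule ev3_subst3[OF rhom_axioms, symmetric])
  have ss: "subst3 M' (subst3 M G) = G" "subst3 M (subst3 M' G) = G" for G
    using subst3_subst3 M by blast+
  show fr: "frac_field emb w = frac_field emb v"
  proof
    show "frac_field emb w \<subseteq> frac_field emb v" unfolding frac_field_def e
      using homogeneous_subst3 by blast
    show "frac_field emb v \<subseteq> frac_field emb w"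
    proof
      fix c assume "c \<in> frac_field emb v"
      then obtain n G H where c: "c = ev3 emb v G / ev3 emb v H" "homogeneous n G" "homogeneous n H" "ev3 emb v H \<noteq> 0"
        unfolding frac_field_def by blast
      hence "c = ev3 emb w (subst3 M G) / ev3 emb w (subst3 M H)" "ev3 emb w (subst3 M H) \<noteq> 0"
        unfolding e ss by simp_all
      thus "c \<in> frac_field emb w" unfolding frac_field_def[of emb w]
        using homogeneous_subst3 c(2,3) by blast
    qed
  qed
  interpret s: rhom "subst3 M" by (rule rhom_subst3)
  interpret s': rhom "subst3 M'" by (rule rhom_subst3)
  show "generic_point emb (subst3 M F) d w"
  proof
    show "homogeneous d (subst3 M F)" by (rule homogeneous_subst3[OF F_hom])
    show "1 < d" by (rule d_gt_1)
    show "subst3 M F \<noteq> 0" using F_nonzero ss(1)[of F] s'.h_zero by metis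
    show "ev3 emb w G = 0 \<longleftrightarrow> subst3 M F dvd G" for G
    proof -
      have "F dvd subst3 M' G \<longleftrightarrow> subst3 M F dvd G"
        unfolding dvd_def by (metis s.h_mult s'.h_mult ss)
      thus ?thesis unfolding e kernel .
    qed
    show "\<exists>P. P \<noteq> 0 \<and> pev (pev emb a) b P = 0" if "a \<in> frac_field emb w" "b \<in> frac_field emb w" for a b
      using dep that unfolding fr by blast
    show "\<exists>a\<in>frac_field emb w. a \<notin> range emb" using nonconst unfolding fr .
  qed
qed

end

text \<open>X and Y become the variables of the rational function field, and Z becomes a root in its
  algebraic closure. The field of all quotients has transcendence degree two; passing to degree zero
  quotients leaves one, which is \<open>forms_dependent\<close>.\<close>

theorem generic_point_exists:
  fixes F :: "'k::alg_closed_field poly3"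
  assumes hF: "homogeneous d F" and d: "d > 1" and irr: "irreducible F"
  shows "\<exists>(emb :: 'k \<Rightarrow> 'k poly poly fract alg_closure) v. generic_point emb F d v"
proof -
  have prime: "prime_elem F" by (rule poly3_irreducible_imp_prime[OF irr])
  \<comment> \<open>The factor Z yields a point off the curve with nonzero last coordinate,
    normalized to (a : b : 1). The shear \<open>M a b\<close> moves (0 : 0 : 1) there, so the pulled
    back form F1 has a constant leading coefficient in Z.\<close>
  have "F * varZ \<noteq> 0" using irr by (auto simp: irreducible_def varZ_def)
  then obtain u where u: "eval3 (F * varZ) u \<noteq> 0" using eval3_nonzero by blast
  hence u': "eval3 F u \<noteq> 0" "u $ 3 \<noteq> 0" by (auto simp: rhom.h_mult[OF rhom_eval3])
  define a b where "a = u $ 1 / u $ 3" and "b = u $ 2 / u $ 3"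
  have ab: "eval3 F (vector [a, b, 1]) \<noteq> 0"
  proof -
    have "u = u $ 3 *s vector [a, b, 1]"
      using u'(2) by (simp add: vec_eq_iff forall_3 vector_3 a_def b_def)
    thus ?thesis using u'(1) eval3_scale[OF hF, of "u $ 3" "vector [a, b, 1]"] by auto
  qed
  define M where "M = (\<lambda>a b. vector [vector [1, 0, a], vector [0, 1, b], vector [0, 0, 1]] :: 'k ^ 3 ^ 3)"
  have MM: "M a' b' ** M (- a') (- b') = mat 1" for a' b'
    by (simp add: M_def vec_eq_iff forall_3 matrix_matrix_mult_def sum_3 mat_def)
  have M: "M a b ** M (- a) (- b) = mat 1" "M (- a) (- b) ** M a b = mat 1"
    using MM[of a b] MM[of "- a" "- b"] by simp_all
  define F1 where "F1 = subst3 (M a b) F"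
  have hF1: "homogeneous d F1" unfolding F1_def by (rule homogeneous_subst3[OF hF])
  have lead: "coeff (coeff (coeff F1 d) 0) 0 \<noteq> 0"
  proof -
    have "M a b *v vector [0, 0, 1] = vector [a, b, 1]"
      by (simp add: M_def vec_eq_iff forall_3 matrix_vector_mult_def sum_3)
    hence "eval3 F1 (vector [0, 0, 1]) = eval3 F (vector [a, b, 1])"
      unfolding F1_def eval3_subst3 by simp
    thus ?thesis using ab eval3_001[OF hF1] by simp
  qed
  define c where "c = coeff (coeff (coeff F1 d) 0) 0"
  have c0: "c \<noteq> 0" using lead by (simp add: c_def)
  have lF: "coeff F1 d = [:[:c:]:]"
  proof (intro poly_eqI)
    fix j i
    show "coeff (coeff (coeff F1 d) j) i = coeff (coeff [:[:c:]:] j) i"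
      using homogeneousD[OF hF1, of i j d] by (cases "i = 0 \<and> j = 0") (auto simp: c_def coeff_pCons split: nat.splits)
  qed
  have dF: "degree F1 = d"
  proof (rule antisym)
    show "degree F1 \<le> d"
    proof (rule degree_le, intro allI impI)
      fix l assume "d < l"
      thus "coeff F1 l = 0" by (intro poly_eqI) (simp add: homogeneousD[OF hF1])
    qed
    show "d \<le> degree F1" by (rule le_degree) (simp add: lF c0)
  qed
  have F: "subst3 (M (- a) (- b)) F1 = F" unfolding F1_def by (rule subst3_subst3[OF M(1)])
  have prime1: "prime_elem F1"
    by (rule rhom_bij_prime_elem[OF rhom_subst3 bij_subst3[OF M(2,1)]]) (simp only: F prime)
  let ?em = "\<lambda>p. to_ac (to_fract p) :: 'k poly poly fract alg_closure"
  interpret em: rhom ?em by unfold_locales auto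
  have em0: "?em p = 0 \<longleftrightarrow> p = 0" for p by simp
  define emb where "emb = (\<lambda>c. ?em [:[:c:]:])"
  interpret i: rhom emb unfolding emb_def
  proof
    show "?em [:[:1:]:] = 1" by (metis em.h_one one_pCons)
  qed (simp_all flip: em.h_add em.h_mult)
  have "degree (map_poly ?em F1) = degree F1" by (rule degree_map_poly) (simp only: em0 not_False_eq_True)
  then obtain \<zeta> where \<zeta>: "pev ?em \<zeta> F1 = 0"
    using alg_closed_imp_poly_has_root[of "map_poly ?em F1"] d dF unfolding pev_def by auto
  interpret ez: rhom "pev ?em \<zeta>" by (rule em.rhom_pev)
  have ker1: "pev ?em \<zeta> G = 0 \<longleftrightarrow> F1 dvd G" for G
  proof
    assume "F1 dvd G"
    thus "pev ?em \<zeta> G = 0" using \<zeta> by (auto simp: dvd_def em.pev_mult)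
  next
    assume G: "pev ?em \<zeta> G = 0"
    \<comment> \<open>A relation of least degree divides every relation up to a nonzero factor free
      of Z, by pseudo-division. Applied to the prime F1 this shows that F1 divides the least
      relation, and hence, being of positive degree in Z, every relation.\<close>
    define N where "N = {p. p \<noteq> 0 \<and> pev ?em \<zeta> p = 0}"
    have "F1 \<noteq> 0" using prime1 by auto
    hence "F1 \<in> N" using \<zeta> by (simp add: N_def)
    then obtain \<mu> where \<mu>: "\<mu> \<in> N" "\<And>p. p \<in> N \<Longrightarrow> degree \<mu> \<le> degree p"
      using ex_has_least_nat[of "\<lambda>p. p \<in> N" F1 degree] by blast
    have \<mu>0: "\<mu> \<noteq> 0" "pev ?em \<zeta> \<mu> = 0" using \<mu>(1) by (auto simp: N_def)
    have d\<mu>: "degree \<mu> > 0"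
    proof (rule ccontr)
      assume "\<not> degree \<mu> > 0"
      then obtain m where "\<mu> = [:m:]" by (metis degree_eq_zeroE neq0_conv)
      thus False using \<mu>0 by auto
    qed
    have div: "\<exists>r. r \<noteq> 0 \<and> \<mu> dvd smult r H" if H: "pev ?em \<zeta> H = 0" for H
    proof -
      obtain r q where rq: "r \<noteq> 0" "smult r H = \<mu> * q + pseudo_mod H \<mu>" using pseudo_mod(1)[OF \<mu>0(1), of H] by blast
      have "pev ?em \<zeta> (pseudo_mod H \<mu>) = 0"
        using arg_cong[OF rq(2), of "pev ?em \<zeta>"] H \<mu>0 by (simp add: em.pev_add em.pev_mult em.pev_smult)
      hence "pseudo_mod H \<mu> = 0"
        using pseudo_mod(2)[OF \<mu>0(1), of H] \<mu>(2)[of "pseudo_mod H \<mu>"] unfolding N_def by fastforce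
      thus ?thesis using rq by auto
    qed
    obtain r q where rq: "r \<noteq> 0" "smult r F1 = \<mu> * q" using div[OF \<zeta>] by (auto simp: dvd_def)
    have "F1 dvd \<mu> * q" unfolding rq(2)[symmetric] by (rule dvd_smult) simp
    hence "F1 dvd \<mu> \<or> F1 dvd q" using prime1 prime_elem_dvd_multD by blast
    hence "F1 dvd \<mu>"
    proof
      assume "F1 dvd q"
      then obtain q' where "q = F1 * q'" by (auto simp: dvd_def)
      hence "F1 * [:r:] = F1 * (\<mu> * q')" using rq(2) by (simp add: mult_ac)
      hence e: "[:r:] = \<mu> * q'" using \<open>F1 \<noteq> 0\<close> mult_left_cancel by blast
      hence "q' \<noteq> 0" using rq by auto
      hence "degree (\<mu> * q') = degree \<mu> + degree q'" using \<mu>0 by (intro degree_mult_eq) auto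
      thus ?thesis using d\<mu> unfolding e[symmetric] by simp
    qed
    moreover obtain s where s: "s \<noteq> 0" "\<mu> dvd smult s G" using div[OF G] by blast
    ultimately have "F1 dvd [:s:] * G" by (simp add: dvd_trans)
    moreover have "\<not> F1 dvd [:s:]" using s d dvd_imp_degree_le[of F1 "[:s:]"] by (auto simp: dF)
    ultimately show "F1 dvd G" using prime1 prime_elem_dvd_multD by blast
  qed
  define x y where "x = ?em [:[:0, 1:]:]" and "y = ?em [:0, 1:]"
  define v0 where "v0 = (vector [x, y, \<zeta>] :: ('k poly poly fract alg_closure) ^ 3)"
  have ev0: "ev3 emb v0 G = pev ?em \<zeta> G" for G
  proof (rule poly3_hom_unique)
    show "rhom (ev3 emb v0)" by (rule rhom_ev3) (rule i.rhom_axioms)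
    show "rhom (pev ?em \<zeta>)" by (rule ez.rhom_axioms)
  qed (simp_all only: ev3_const3[OF i.rhom_axioms] ev3_varX[OF i.rhom_axioms] ev3_varY[OF i.rhom_axioms] ev3_varZ[OF i.rhom_axioms],
      simp_all add: v0_def vector_3 x_def y_def emb_def const3_def varX_def varY_def varZ_def
        rhom.pev_pCons[OF em.rhom_axioms] rhom.pev_0[OF em.rhom_axioms])
  interpret cp: cone_point emb v0 F1 d
    by unfold_locales (use hF1 d lead \<zeta> in \<open>auto simp: ev0\<close>)
  have "generic_point emb F1 d v0"
  proof
    show "homogeneous d F1" "d > 1" by fact+
    show "F1 \<noteq> 0" using prime1 by auto
    show "ev3 emb v0 G = 0 \<longleftrightarrow> F1 dvd G" for G
      unfolding ev0 ker1 ..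
    fix f g assume "f \<in> frac_field emb v0" "g \<in> frac_field emb v0"
    then obtain A H n B H' n' where
      f: "f = ev3 emb v0 A / ev3 emb v0 H" "homogeneous n A" "homogeneous n H" "ev3 emb v0 H \<noteq> 0" and
      g: "g = ev3 emb v0 B / ev3 emb v0 H'" "homogeneous n' B" "homogeneous n' H'" "ev3 emb v0 H' \<noteq> 0"
      unfolding frac_field_def by blast
    interpret e: rhom "ev3 emb v0" by (rule rhom_ev3[OF i.rhom_axioms])
    have "f = ev3 emb v0 (A * H') / ev3 emb v0 (H * H')" "g = ev3 emb v0 (H * B) / ev3 emb v0 (H * H')"
      using f(1,4) g(1,4) by simp_all
    moreover have "homogeneous (n + n') (A * H')" "homogeneous (n + n') (H * B)" "homogeneous (n + n') (H * H')"
      using f g by (auto intro: homogeneous_mult)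
    moreover have "ev3 emb v0 (H * H') \<noteq> 0" using f g by simp
    ultimately show "\<exists>P. P \<noteq> 0 \<and> pev (pev emb f) g P = 0"
      using cp.forms_dependent[of "n + n'"] by metis
  next
    have y0: "y \<noteq> 0" by (simp add: y_def)
    have "x / y \<notin> range emb"
    proof
      assume "x / y \<in> range emb"
      then obtain t where "x / y = emb t" by blast
      hence "x - emb t * y = 0" using y0 by (simp add: field_simps)
      hence "?em ([:[:0, 1:]:] - [:[:t:]:] * [:0, 1:]) = 0"
        unfolding x_def y_def emb_def by (simp only: em.h_diff em.h_mult)
      hence "[:[:0, 1:]:] - [:[:t:]:] * [:0, 1:] = (0 :: 'k poly poly)" by (simp only: em0)
      thus False by simp
    qed
    moreover have "x / y \<in> frac_field emb v0"
    proof -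
      have "x / y = ev3 emb v0 varX / ev3 emb v0 varY" "ev3 emb v0 varY \<noteq> 0"
        using y0 by (simp_all only: ev3_varX[OF i.rhom_axioms] ev3_varY[OF i.rhom_axioms]) (simp_all add: v0_def)
      thus ?thesis unfolding frac_field_def using homogeneous_var by blast
    qed
    ultimately show "\<exists>a\<in>frac_field emb v0. a \<notin> range emb" by blast
  qed
  from generic_point.change_coordinates(1)[OF this M(2,1)] show ?thesis unfolding F by blast
qed

section \<open>Linear forms, and divisibility of forms along rays\<close>

definition dot :: "'k::field ^ 3 \<Rightarrow> 'k ^ 3 \<Rightarrow> 'k" where
  "dot a z = a $ 1 * z $ 1 + a $ 2 * z $ 2 + a $ 3 * z $ 3"

lemma dot_add: "dot a (y + z) = dot a y + dot a z"
  and dot_scale: "dot a (c *s z) = c * dot a z"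
  and dot_diff: "dot a (y - z) = dot a y - dot a z"
  by (simp_all add: dot_def algebra_simps)

lemma span_singleton_eq:
  fixes u r :: "'k::field ^ 3"
  assumes "u \<noteq> 0"
  shows "vec.span {u} = vec.span {r} \<longleftrightarrow> u \<in> vec.span {r}"
proof
  assume "u \<in> vec.span {r}"
  then obtain k where k: "u = k *s r" by (auto simp: vec.span_singleton)
  hence k0: "k \<noteq> 0" using assms by auto
  show "vec.span {u} = vec.span {r}"
  proof
    show "vec.span {u} \<subseteq> vec.span {r}" unfolding k by (simp add: vec.span_minimal vec.span_scale vec.span_base)
    have r: "r = inverse k *s u" unfolding k using k0 by (simp add: vector_smult_assoc)
    have "inverse k *s u \<in> vec.span {u}" by (intro vec.span_scale vec.span_base) simp
    thus "vec.span {r} \<subseteq> vec.span {u}" unfolding r[symmetric] by (simp add: vec.span_minimal)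
  qed
qed (metis singletonI vec.span_base)

lemma eval3_lin3: "eval3 (lin3 a) z = dot a z"
  unfolding eval3_conv_ev3 ev3_lin3[OF rhom_id] dot_def ..

lemma rhom_const_poly: "rhom (\<lambda>c::'a::comm_ring_1. [:c:])"
  by unfold_locales (auto simp: one_pCons)

text \<open>Both sides of \<open>G = F H\<close> are restricted to the line through \<open>u\<close> and the origin.\<close>

lemma form_dvd_ray:
  fixes F G :: "'k::field poly3"
  assumes "homogeneous d F" "homogeneous n G" "F dvd G"
  shows "\<exists>q c. \<forall>u. [:0, 1:] ^ n * [:eval3 G u:] = [:0, 1:] ^ d * [:eval3 F u:] * q u \<and> poly (q u) 0 = c"
proof -
  obtain H where H: "G = F * H" using assms(3) by (auto simp: dvd_def)
  let ?h = "\<lambda>c::'k. [:c:]"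
  define q where "q u = ev3 ?h (\<chi> i. [:0, 1:] * [:u $ i:]) H" for u :: "'k ^ 3"
  have c: "ev3 ?h (\<chi> i. [:u $ i:]) G' = [:eval3 G' u:]" for G' u
    unfolding eval3_conv_ev3 using ev3_hom[OF rhom_id rhom_const_poly, of u G'] by simp
  have "[:0, 1:] ^ n * [:eval3 G u:] = [:0, 1:] ^ d * [:eval3 F u:] * q u" for u
  proof -
    interpret e: rhom "ev3 ?h (\<chi> i. [:0, 1:] * [:u $ i:])" by (rule rhom_ev3[OF rhom_const_poly])
    have "[:0, 1:] ^ n * [:eval3 G u:] = ev3 ?h (\<chi> i. [:0, 1:] * [:u $ i:]) G"
      using ev3_scale[OF rhom_const_poly assms(2), of "[:0, 1:]" "\<chi> i. [:u $ i:]"] unfolding c by simp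
    also have "\<dots> = ev3 ?h (\<chi> i. [:0, 1:] * [:u $ i:]) F * q u" by (simp only: H q_def e.h_mult)
    also have "ev3 ?h (\<chi> i. [:0, 1:] * [:u $ i:]) F = [:0, 1:] ^ d * [:eval3 F u:]"
      using ev3_scale[OF rhom_const_poly assms(1), of "[:0, 1:]" "\<chi> i. [:u $ i:]"] unfolding c by simp
    finally show ?thesis .
  qed
  moreover have "poly (q u) 0 = eval3 H 0" for u
  proof -
    have z: "(\<chi> i. poly ((\<chi> i. [:0, 1:] * [:u $ i:]) $ i) 0) = 0" by (simp add: vec_eq_iff)
    show ?thesis
      unfolding q_def ev3_hom[OF rhom_const_poly rhom_poly] z eval3_conv_ev3 by simp
  qed
  ultimately show ?thesis by blast
qed

text \<open>Along a ray G has order n at the origin unless its value at u is zero, whereas a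
  multiple of F has order at least d.\<close>

lemma form_dvd_small:
  fixes F G :: "'k::field poly3"
  assumes "homogeneous d F" "homogeneous n G" "F dvd G" "n < d"
  shows "eval3 G u = 0"
proof -
  obtain q where q: "[:0, 1:] ^ n * [:eval3 G u:] = [:0, 1:] ^ d * [:eval3 F u:] * q u"
    using form_dvd_ray[OF assms(1-3)] by blast
  have "[:0, 1::'k:] ^ d = [:0, 1:] ^ n * [:0, 1:] ^ (d - n)" using assms(4) by (simp flip: power_add)
  hence "[:0, 1:] ^ n * [:eval3 G u:] = [:0, 1:] ^ n * ([:0, 1:] ^ (d - n) * [:eval3 F u:] * q u)"
    unfolding q by (simp only: mult.assoc)
  hence "[:eval3 G u:] = [:0, 1:] ^ (d - n) * [:eval3 F u:] * q u"
    by (simp only: mult_cancel_left) simp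
  hence "poly [:eval3 G u:] 0 = poly ([:0, 1:] ^ (d - n) * [:eval3 F u:] * q u) 0" by (rule arg_cong)
  thus ?thesis using assms(4) by (simp add: power_0_left)
qed

text \<open>The equal powers of the ray parameter cancel, and at parameter 0 only the constant term
  of the quotient is left.\<close>

lemma form_dvd_same:
  fixes F G :: "'k::field poly3"
  assumes "homogeneous d F" "homogeneous d G" "F dvd G"
  shows "\<exists>c. \<forall>u. eval3 G u = c * eval3 F u"
proof -
  obtain q c where q: "\<And>u. [:0, 1:] ^ d * [:eval3 G u:] = [:0, 1:] ^ d * [:eval3 F u:] * q u" "\<And>u. poly (q u) 0 = c"
    using form_dvd_ray[OF assms(1-3)] by blast
  have "eval3 G u = c * eval3 F u" for u
  proof -
    have "[:eval3 G u:] = [:eval3 F u:] * q u" using q(1)[of u] unfolding mult.assoc by (simp only: mult_cancel_left) simp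
    hence "poly [:eval3 G u:] 0 = poly ([:eval3 F u:] * q u) 0" by (rule arg_cong)
    thus ?thesis using q(2)[of u] by simp
  qed
  thus ?thesis by blast
qed

section \<open>The function field and the normalization\<close>

lemma vanishes_at_span:
  assumes "homogeneous n (G :: 'k::field poly3)"
  shows "vanishes_at G (vec.span {u}) \<longleftrightarrow> eval3 G u = 0"
proof
  assume "vanishes_at G (vec.span {u})"
  thus "eval3 G u = 0" unfolding vanishes_at_def by (simp add: vec.span_base)
qed (auto simp: vanishes_at_def vec.span_singleton eval3_scale[OF assms])

text \<open>If every form vanishing at u vanished at u', the forms built from two coordinates of u
  would show that all 2 x 2 minors of u and u' are zero.\<close>

lemma independent_form:
  fixes u u' :: "'k::field ^ 3"
  assumes "u' \<notin> vec.span {u}"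
  shows "\<exists>a. dot a u = 0 \<and> dot a u' \<noteq> 0"
proof (rule ccontr)
  assume "\<not> ?thesis"
  hence *: "dot a u = 0 \<Longrightarrow> dot a u' = 0" for a by blast
  have 1: "u $ 1 * u' $ 2 = u $ 2 * u' $ 1"
    using *[of "vector [u $ 2, - u $ 1, 0]"] by (simp add: dot_def vector_3 algebra_simps)
  have 2: "u $ 1 * u' $ 3 = u $ 3 * u' $ 1"
    using *[of "vector [u $ 3, 0, - u $ 1]"] by (simp add: dot_def vector_3 algebra_simps)
  have 3: "u $ 2 * u' $ 3 = u $ 3 * u' $ 2"
    using *[of "vector [0, u $ 3, - u $ 2]"] by (simp add: dot_def vector_3 algebra_simps)
  have "\<exists>k. u' = k *s u"
  proof -
    consider "u $ 1 \<noteq> 0" | "u $ 2 \<noteq> 0" | "u $ 3 \<noteq> 0" | "u = 0" by (auto simp: vec_eq_iff forall_3)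
    thus ?thesis
    proof cases
      case 1
      show ?thesis by (rule exI[of _ "u' $ 1 / u $ 1"])
        (use 1 \<open>u $ 1 * u' $ 2 = _\<close> 2 in \<open>simp add: vec_eq_iff forall_3 field_simps\<close>)
    next
      case 2
      show ?thesis by (rule exI[of _ "u' $ 2 / u $ 2"])
        (use 2 \<open>u $ 1 * u' $ 2 = _\<close> 3 in \<open>simp add: vec_eq_iff forall_3 field_simps\<close>)
    next
      case 3
      show ?thesis by (rule exI[of _ "u' $ 3 / u $ 3"])
        (use 3 \<open>u $ 1 * u' $ 3 = _\<close> \<open>u $ 2 * u' $ 3 = _\<close> in \<open>simp add: vec_eq_iff forall_3 field_simps\<close>)
    next
      case 4
      have "dot (vector [1, 0, 0]) u' = 0" "dot (vector [0, 1, 0]) u' = 0" "dot (vector [0, 0, 1]) u' = 0"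
        by (rule *; simp add: 4 dot_def)+
      hence "u' = 0" by (simp add: dot_def vector_3 vec_eq_iff forall_3)
      thus ?thesis by (intro exI[of _ 0]) simp
    qed
  qed
  thus False using assms by (auto simp: vec.span_singleton)
qed

context generic_point begin

abbreviation ev :: "'k poly3 \<Rightarrow> 'e" where "ev \<equiv> ev3 emb v"
abbreviation K :: "'e set" where "K \<equiv> frac_field emb v"
abbreviation FF :: "'k rat_fun ring" where "FF \<equiv> function_field F"

sublocale ev: rhom ev
  by (rule rhom_ev3) (rule rhom_axioms)

lemma K_I: "homogeneous n G \<Longrightarrow> homogeneous n H \<Longrightarrow> ev H \<noteq> 0 \<Longrightarrow> ev G / ev H \<in> K"
  unfolding frac_field_def by blast

lemma ev_small_nonzero:
  assumes "homogeneous n G" "n < d" "G \<noteq> 0"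
  shows "ev G \<noteq> 0"
proof
  assume "ev G = 0"
  hence "F dvd G" using kernel by blast
  hence "eval3 G u = 0" for u using form_dvd_small[OF F_hom assms(1)] assms(2) by blast
  thus False using eval3_nonzero[OF assms(3)] by blast
qed

lemma lin3_nonzero: "a \<noteq> 0 \<Longrightarrow> lin3 a \<noteq> (0 :: 'k poly3)"
proof
  assume a: "a \<noteq> 0" and 0: "lin3 a = 0"
  have "dot a z = 0" for z using eval3_lin3[of a z] unfolding 0 by (simp add: rhom.h_zero[OF rhom_eval3])
  from this[of "vector [1, 0, 0]"] this[of "vector [0, 1, 0]"] this[of "vector [0, 0, 1]"]
  have "a = 0" by (simp add: dot_def vector_3 vec_eq_iff forall_3)
  thus False using a by simp
qed

lemma ev_lin3_nonzero: "a \<noteq> 0 \<Longrightarrow> ev (lin3 a) \<noteq> 0"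
  using ev_small_nonzero[OF homogeneous_lin3] lin3_nonzero d_gt_1 by simp

sublocale func_field emb K
proof
  have one: "ev 1 = 1" by simp
  show "emb c \<in> K" for c
    using K_I[of 0 "const3 c" 1] by (simp add: rhom_axioms)
  fix a assume a: "a \<in> K"
  then obtain G H n where g: "a = ev G / ev H" "homogeneous n G" "homogeneous n H" "ev H \<noteq> 0"
    unfolding frac_field_def by blast
  show "- a \<in> K" using K_I[of n "- G" H] g homogeneous_minus[of n G] by simp
  show "inverse a \<in> K"
  proof (cases "ev G = 0")
    case True
    thus ?thesis using K_I[of 0 0 1] g by simp
  next
    case False
    thus ?thesis using K_I[of n H G] g by simp
  qed
  fix b assume b: "b \<in> K"
  then obtain G' H' n' where g': "b = ev G' / ev H'" "homogeneous n' G'" "homogeneous n' H'" "ev H' \<noteq> 0"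
    unfolding frac_field_def by blast
  have h: "homogeneous (n + n') (H * H')" "homogeneous (n + n') (G * G')" "homogeneous (n + n') (G * H')"
    "homogeneous (n + n') (H * G')" using g g' by (auto intro: homogeneous_mult)
  have "a + b = ev (G * H' + H * G') / ev (H * H')" unfolding g(1) g'(1) using g(4) g'(4) by (simp add: field_simps)
  thus "a + b \<in> K" using K_I[OF homogeneous_add[OF h(3,4)] h(1)] g g' by simp
  have "a * b = ev (G * G') / ev (H * H')" using g g' by simp
  thus "a * b \<in> K" using K_I[OF h(2,1)] g g' by simp
  show "\<exists>P. P \<noteq> 0 \<and> pev (pev emb a) b P = 0" by (rule dep[OF a b])
qed (rule nonconst)

text \<open>The class of fractions with value r. This is the isomorphism from K onto
  \<open>function_field F\<close>, and every notion of the definitions is transported along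
  it.\<close>

definition cls :: "'e \<Rightarrow> 'k rat_fun" where
  "cls r = {(G, H). (G, H) \<in> frac_pairs F \<and> ev G / ev H = r}"

lemma frac_pairs_iff: "(G, H) \<in> frac_pairs F \<longleftrightarrow> (\<exists>n. homogeneous n G \<and> homogeneous n H) \<and> ev H \<noteq> 0"
  unfolding frac_pairs_def using kernel by auto

lemma form_quot_cls: "(G, H) \<in> frac_pairs F \<Longrightarrow> form_quot F G H = cls (ev G / ev H)"
proof -
  assume a: "(G, H) \<in> frac_pairs F"
  hence H: "ev H \<noteq> 0" by (simp add: frac_pairs_iff)
  have "F dvd (G * H' - G' * H) \<longleftrightarrow> ev G' / ev H' = ev G / ev H" if "ev H' \<noteq> 0" for G' H'
    using kernel[of "G * H' - G' * H"] that H by (auto simp: field_simps)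
  thus ?thesis using a unfolding form_quot_def frac_rel_def cls_def by (auto simp: frac_pairs_iff)
qed

lemma cls_nonempty: "r \<in> K \<Longrightarrow> \<exists>G H. (G, H) \<in> frac_pairs F \<and> ev G / ev H = r"
  unfolding frac_field_def frac_pairs_iff by blast

lemma cls_inj: "r \<in> K \<Longrightarrow> cls r = cls s \<longleftrightarrow> r = s"
proof -
  assume "r \<in> K"
  then obtain G H where "(G, H) \<in> cls r" using cls_nonempty[of r] unfolding cls_def by blast
  moreover have "r = s" if "(G, H) \<in> cls s" using that \<open>(G, H) \<in> cls r\<close> by (simp add: cls_def)
  ultimately show ?thesis by blast
qed

lemma inj_on_cls: "inj_on cls K"
  using cls_inj by (auto intro: inj_onI)

lemma carrier_FF: "carrier FF = cls ` K"
proof -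
  have "frac_pairs F // frac_rel F = {form_quot F G H | G H. (G, H) \<in> frac_pairs F}"
    unfolding quotient_def form_quot_def by auto
  also have "\<dots> = cls ` K"
  proof
    show "{form_quot F G H | G H. (G, H) \<in> frac_pairs F} \<subseteq> cls ` K"
    proof clarify
      fix G H assume a: "(G, H) \<in> frac_pairs F"
      thus "form_quot F G H \<in> cls ` K" using form_quot_cls[OF a] K_I[of _ G H] by (auto simp: frac_pairs_iff)
    qed
    show "cls ` K \<subseteq> {form_quot F G H | G H. (G, H) \<in> frac_pairs F}"
    proof clarify
      fix r assume "r \<in> K"
      then obtain G H where "(G, H) \<in> frac_pairs F" "ev G / ev H = r" using cls_nonempty by blast
      thus "\<exists>G H. cls r = form_quot F G H \<and> (G, H) \<in> frac_pairs F" using form_quot_cls by metis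
    qed
  qed
  finally show ?thesis by (simp add: function_field_def)
qed

lemma frac_pairs_1: "(const3 c, 1) \<in> frac_pairs F"
  unfolding frac_pairs_iff by (auto intro!: exI[of _ 0])

lemma cls_const: "const_fun F c = cls (emb c)"
  unfolding const_fun_def using form_quot_cls[OF frac_pairs_1] by (simp add: rhom_axioms)

lemma cls_one: "\<one>\<^bsub>FF\<^esub> = cls 1"
  using form_quot_cls[OF frac_pairs_1[of 1]] by (simp add: function_field_def rhom.h_one[OF rhom_const3])

lemma cls_zero: "\<zero>\<^bsub>FF\<^esub> = cls 0"
  using form_quot_cls[OF frac_pairs_1[of 0]] by (simp add: function_field_def rhom.h_zero[OF rhom_const3])

lemma cls_mult: "r \<in> K \<Longrightarrow> s \<in> K \<Longrightarrow> cls r \<otimes>\<^bsub>FF\<^esub> cls s = cls (r * s)"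
proof -
  assume r: "r \<in> K" and s: "s \<in> K"
  have *: "form_quot F (G * G') (H * H') = cls (r * s)" if "(G, H) \<in> cls r" "(G', H') \<in> cls s" for G H G' H'
  proof -
    from that have a: "(G, H) \<in> frac_pairs F" "ev G / ev H = r" "(G', H') \<in> frac_pairs F" "ev G' / ev H' = s"
      by (auto simp: cls_def)
    have "(G * G', H * H') \<in> frac_pairs F"
      using a unfolding frac_pairs_iff by (auto intro: homogeneous_mult)
    thus ?thesis using form_quot_cls a by auto
  qed
  obtain a b where ab: "a \<in> cls r" "b \<in> cls s" using cls_nonempty[OF r] cls_nonempty[OF s] unfolding cls_def by blast
  have "(\<Union>(G, H)\<in>cls r. \<Union>(G', H')\<in>cls s. form_quot F (G * G') (H * H')) = (\<Union>x\<in>cls r. \<Union>y\<in>cls s. cls (r * s))"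
    by (intro SUP_cong refl) (auto simp: *)
  also have "\<dots> = cls (r * s)" using ab by auto
  finally show ?thesis by (simp add: function_field_def)
qed

lemma cls_add: "r \<in> K \<Longrightarrow> s \<in> K \<Longrightarrow> cls r \<oplus>\<^bsub>FF\<^esub> cls s = cls (r + s)"
proof -
  assume r: "r \<in> K" and s: "s \<in> K"
  have *: "form_quot F (G * H' + G' * H) (H * H') = cls (r + s)" if "(G, H) \<in> cls r" "(G', H') \<in> cls s" for G H G' H'
  proof -
    from that have a: "(G, H) \<in> frac_pairs F" "ev G / ev H = r" "(G', H') \<in> frac_pairs F" "ev G' / ev H' = s"
      by (auto simp: cls_def)
    then obtain n n' where n: "homogeneous n G" "homogeneous n H" "homogeneous n' G'" "homogeneous n' H'"
      and nz: "ev H \<noteq> 0" "ev H' \<noteq> 0" by (auto simp: frac_pairs_iff)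
    have "homogeneous (n + n') (G * H')" "homogeneous (n + n') (G' * H)"
      using homogeneous_mult[OF n(1,4)] homogeneous_mult[OF n(3,2)] by (simp_all add: add.commute)
    hence "(G * H' + G' * H, H * H') \<in> frac_pairs F"
      unfolding frac_pairs_iff using nz homogeneous_add homogeneous_mult[OF n(2,4)] by auto
    moreover have "ev (G * H' + G' * H) / ev (H * H') = r + s"
      unfolding a(2,4)[symmetric] using nz by (simp add: field_simps)
    ultimately show ?thesis using form_quot_cls by metis
  qed
  obtain a b where ab: "a \<in> cls r" "b \<in> cls s" using cls_nonempty[OF r] cls_nonempty[OF s] unfolding cls_def by blast
  have "(\<Union>(G, H)\<in>cls r. \<Union>(G', H')\<in>cls s. form_quot F (G * H' + G' * H) (H * H')) = (\<Union>x\<in>cls r. \<Union>y\<in>cls s. cls (r + s))"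
    by (intro SUP_cong refl) (auto simp: *)
  also have "\<dots> = cls (r + s)" using ab by auto
  finally show ?thesis by (simp add: function_field_def)
qed

definition KR :: "'e ring" where
  "KR = \<lparr>carrier = K, monoid.mult = (*), one = 1, zero = 0, add = (+)\<rparr>"

lemma field_KR: "field KR"
proof -
  let ?E = "ring_of_type_algebra :: 'e ring"
  interpret E: field ?E by (rule field_from_type_algebra)
  have KR: "KR = ?E\<lparr>carrier := K\<rparr>" by (simp add: KR_def ring_of_type_algebra_def)
  have e: "\<one>\<^bsub>?E\<^esub> = 1" "\<zero>\<^bsub>?E\<^esub> = 0" "x \<oplus>\<^bsub>?E\<^esub> y = x + y" "x \<otimes>\<^bsub>?E\<^esub> y = x * y" "carrier ?E = UNIV" for x y
    by (simp_all add: ring_of_type_algebra_def)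
  have neg: "\<ominus>\<^bsub>?E\<^esub> x = - x" for x
    by (rule E.minus_equality) (simp_all add: e)
  have inv: "inv\<^bsub>?E\<^esub> x = inverse x" if "x \<noteq> 0" for x
    by (rule E.comm_inv_char) (use that in \<open>simp_all add: e\<close>)
  have "subfield K ?E"
  proof (rule E.subfieldI'[OF E.subringI])
    show "inv\<^bsub>?E\<^esub> k \<in> K" if "k \<in> K - {\<zero>\<^bsub>?E\<^esub>}" for k using that inv by (auto simp: e)
  qed (auto simp: e neg)
  thus ?thesis unfolding KR by (rule E.subfield_iff(2))
qed

lemma cls_iso: "cls \<in> ring_iso KR FF"
  unfolding ring_iso_def ring_hom_def
  by (auto simp: KR_def carrier_FF cls_one cls_mult cls_add bij_betw_def inj_on_cls)

lemma field_FF: "field FF"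
proof -
  have "field (FF\<lparr>zero := cls \<zero>\<^bsub>KR\<^esub>\<rparr>)" by (rule field.ring_iso_imp_img_field[OF field_KR cls_iso])
  moreover have "FF\<lparr>zero := cls \<zero>\<^bsub>KR\<^esub>\<rparr> = FF" using cls_zero by (simp add: KR_def)
  ultimately show ?thesis by simp
qed

sublocale FF: field FF by (rule field_FF)

lemma cls_in_carrier [simp]: "r \<in> K \<Longrightarrow> cls r \<in> carrier FF"
  by (simp add: carrier_FF)

lemma cls_uminus: "r \<in> K \<Longrightarrow> \<ominus>\<^bsub>FF\<^esub> cls r = cls (- r)"
  by (rule FF.minus_equality) (simp_all add: cls_add cls_zero)

lemma cls_minus: "r \<in> K \<Longrightarrow> s \<in> K \<Longrightarrow> cls r \<ominus>\<^bsub>FF\<^esub> cls s = cls (r - s)"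
  by (simp add: a_minus_def cls_uminus cls_add)

lemma cls_inverse: "r \<in> K \<Longrightarrow> r \<noteq> 0 \<Longrightarrow> inv\<^bsub>FF\<^esub> (cls r) = cls (inverse r)"
  by (rule FF.comm_inv_char) (simp_all add: cls_mult cls_one)

lemma cls_image_iff: "r \<in> K \<Longrightarrow> T \<subseteq> K \<Longrightarrow> cls r \<in> cls ` T \<longleftrightarrow> r \<in> T"
  by (metis cls_inj image_iff)

section \<open>Places as points of the normalization, and their centres\<close>

lemma place_normalization:
  assumes V: "place V"
  shows "cls ` V \<in> normalization F"
proof -
  have VK: "V \<subseteq> K" using place_subset[OF V] by blast
  have s: "subr V" using V unfolding place_def by blast
  interpret V: phom V "\<lambda>x. x" by (rule subr_phom[OF s])
  have "subring (cls ` V) FF"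
  proof (rule FF.subringI)
    show "cls ` V \<subseteq> carrier FF" using VK carrier_FF by blast
    show "\<one>\<^bsub>FF\<^esub> \<in> cls ` V" unfolding cls_one by simp
    fix a assume "a \<in> cls ` V"
    then obtain x where x: "a = cls x" "x \<in> V" by blast
    show "\<ominus>\<^bsub>FF\<^esub> a \<in> cls ` V" using x VK by (auto simp: cls_uminus subset_iff)
    fix b assume "b \<in> cls ` V"
    then obtain y where y: "b = cls y" "y \<in> V" by blast
    show "a \<otimes>\<^bsub>FF\<^esub> b \<in> cls ` V" "a \<oplus>\<^bsub>FF\<^esub> b \<in> cls ` V"
      using x y VK by (auto simp: cls_mult cls_add subset_iff)
  qed
  moreover have "range (const_fun F) \<subseteq> cls ` V" using place_emb[OF V] by (auto simp: cls_const)
  moreover have "cls ` V \<noteq> carrier FF"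
  proof
    assume "cls ` V = carrier FF"
    hence "V = K" unfolding carrier_FF using inj_on_cls VK by (meson inj_on_image_eq_iff subset_refl)
    thus False using V unfolding place_def by blast
  qed
  moreover have "f \<in> cls ` V \<or> inv\<^bsub>FF\<^esub> f \<in> cls ` V" if f: "f \<in> carrier FF - {\<zero>\<^bsub>FF\<^esub>}" for f
  proof -
    obtain x where x: "f = cls x" "x \<in> K" using f unfolding carrier_FF by blast
    moreover have "x \<noteq> 0" using f x cls_zero by auto
    ultimately show ?thesis using place_total[OF V x(2)] by (auto simp: cls_inverse)
  qed
  ultimately show ?thesis unfolding normalization_def by blast
qed

lemma normalization_place:
  assumes W: "W \<in> normalization F"
  shows "\<exists>V. place V \<and> W = cls ` V"
proof -
  define V where "V = {r \<in> K. cls r \<in> W}"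
  have sr: "subring W FF" and c: "range (const_fun F) \<subseteq> W" and ne: "W \<noteq> carrier FF"
    and tot: "\<And>f. f \<in> carrier FF - {\<zero>\<^bsub>FF\<^esub>} \<Longrightarrow> f \<in> W \<or> inv\<^bsub>FF\<^esub> f \<in> W"
    using W unfolding normalization_def by auto
  have WV: "W = cls ` V" using subringE(1)[OF sr] unfolding carrier_FF V_def by auto
  have "subr V"
    unfolding subr_def
  proof (intro conjI ballI)
    show "V \<subseteq> K" by (auto simp: V_def)
    show "range emb \<subseteq> V" using c by (auto simp: V_def cls_const)
    fix a assume a: "a \<in> V"
    show "- a \<in> V" using a subringE(5)[OF sr, of "cls a"] by (auto simp: V_def cls_uminus)
    fix b assume b: "b \<in> V"
    show "a + b \<in> V" "a * b \<in> V"
      using a b subringE(6,7)[OF sr, of "cls a" "cls b"] by (auto simp: V_def cls_mult cls_add)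
  qed
  moreover have "V \<noteq> K" using ne WV carrier_FF by auto
  moreover have "f \<in> V \<or> inverse f \<in> V" if f: "f \<in> K" for f
  proof (cases "f = 0")
    case True
    thus ?thesis using subringE(2)[OF sr] f by (simp add: V_def cls_zero)
  next
    case False
    have "cls f \<in> carrier FF - {\<zero>\<^bsub>FF\<^esub>}" using f False cls_inj[of f 0] by (simp add: cls_zero)
    from tot[OF this] show ?thesis using f False by (auto simp: V_def cls_inverse)
  qed
  ultimately show ?thesis using WV unfolding place_def by blast
qed

lemma max_ideal_cls:
  assumes V: "place V"
  shows "max_ideal F (cls ` V) = cls ` mid V"
proof -
  have VK: "V \<subseteq> K" using place_subset[OF V] by blast
  have "cls x \<in> max_ideal F (cls ` V) \<longleftrightarrow> x \<in> mid V" if x: "x \<in> V" for x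
  proof (cases "x = 0")
    case False
    have "inv\<^bsub>FF\<^esub> (cls x) = cls (inverse x)" using False x VK by (auto simp: cls_inverse)
    thus ?thesis using False x VK cls_inj[of x 0] cls_image_iff[of "inverse x" V]
      unfolding max_ideal_def mid_def cls_zero by auto
  qed (use x VK in \<open>auto simp: max_ideal_def mid_def cls_zero\<close>)
  moreover have "max_ideal F (cls ` V) \<subseteq> cls ` V" "mid V \<subseteq> V" unfolding max_ideal_def mid_def by auto
  ultimately show ?thesis by blast
qed

lemma mid_in_K: "place V \<Longrightarrow> mid V \<subseteq> K"
  using place_subset mid_subset by blast

lemma value_at_cls:
  assumes V: "place V" and f: "f \<in> K"
  shows "value_at F (cls ` V) (cls f) = val V f"
proof -
  have "cls f \<ominus>\<^bsub>FF\<^esub> const_fun F c \<in> max_ideal F (cls ` V) \<longleftrightarrow> f - emb c \<in> mid V" for c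
    unfolding max_ideal_cls[OF V] cls_const using f mid_in_K[OF V] by (simp add: cls_minus cls_image_iff)
  thus ?thesis unfolding value_at_def val_def by simp
qed

lemma coord_ratio_in_K: "v $ i / v $ j \<in> K" if "v $ j \<noteq> 0"
proof -
  have *: "\<exists>L. homogeneous 1 L \<and> ev L = v $ i" for i
    using exhaust_3[of i] homogeneous_var by (metis ev3_varX ev3_varY ev3_varZ rhom_axioms)
  obtain L M where "homogeneous 1 L" "ev L = v $ i" "homogeneous 1 M" "ev M = v $ j" using * by metis
  thus ?thesis using K_I[of 1 L M] that by simp
qed

lemma v_nonzero: "\<exists>i. v $ i \<noteq> 0"
proof (rule ccontr)
  assume "\<not> ?thesis"
  hence "ev (lin3 (vector [1, 0, 0])) = 0" unfolding ev3_lin3[OF rhom_axioms] by simp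
  moreover have "(vector [1, 0, 0] :: 'k ^ 3) \<noteq> 0" by (simp add: vec_eq_iff forall_3 vector_3)
  ultimately show False using ev_lin3_nonzero by blast
qed

text \<open>The factor l makes the homogeneous coordinates primitive at V; then u gives homogeneous
  coordinates of the centre of V.\<close>

definition centred :: "'e set \<Rightarrow> 'e \<Rightarrow> 'k ^ 3 \<Rightarrow> bool" where
  "centred V l u \<longleftrightarrow> place V \<and> (\<forall>i. l * v $ i \<in> V \<and> val V (l * v $ i) = u $ i) \<and> u \<noteq> 0"

text \<open>Any two coordinates are comparable for divisibility in V, and divisibility is
  transitive. So some nonzero coordinate divides all others, and its inverse serves as l.\<close>

lemma centred_exists:
  assumes V: "place V"
  shows "\<exists>l u. centred V l u"
proof -
  interpret V: phom V "\<lambda>x. x" using V unfolding place_def by (intro subr_phom) auto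
  interpret w: phom V "val V" by (rule val_phom[OF V])
  have tot: "v $ i \<noteq> 0 \<Longrightarrow> v $ j \<noteq> 0 \<Longrightarrow> v $ i / v $ j \<in> V \<or> v $ j / v $ i \<in> V" for i j
    using place_total[OF V coord_ratio_in_K[of j i]] by (auto simp: field_simps)
  have tr: "v $ j \<noteq> 0 \<Longrightarrow> v $ i / v $ j \<in> V \<Longrightarrow> v $ j / v $ k \<in> V \<Longrightarrow> v $ i / v $ k \<in> V" for i j k
    using V.B_mult[of "v $ i / v $ j" "v $ j / v $ k"] by simp
  have z: "v $ i = 0 \<Longrightarrow> v $ i / v $ j \<in> V" for i j by simp
  have "\<exists>m. v $ m \<noteq> 0 \<and> (\<forall>i. v $ i / v $ m \<in> V)"
  proof -
    have fin: "finite (S :: 3 set) \<Longrightarrow> (\<exists>m. v $ m \<noteq> 0 \<and> (\<forall>i\<in>S. v $ i / v $ m \<in> V))" for S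
    proof (induction S rule: finite_induct)
      case empty
      thus ?case using v_nonzero by blast
    next
      case (insert j S)
      then obtain m where m: "v $ m \<noteq> 0" "\<forall>i\<in>S. v $ i / v $ m \<in> V" by blast
      show ?case
      proof (cases "v $ j / v $ m \<in> V")
        case False
        hence j: "v $ j \<noteq> 0" "v $ m / v $ j \<in> V" using z tot m by blast+
        have "v $ i / v $ j \<in> V" if "i \<in> S" for i using tr[OF m(1) _ j(2)] m that by blast
        moreover have "v $ j / v $ j \<in> V" using j by simp
        ultimately show ?thesis using j by blast
      qed (use m in blast)
    qed
    show ?thesis using fin[of UNIV] by auto
  qed
  then obtain m where m: "v $ m \<noteq> 0" "\<And>i. v $ i / v $ m \<in> V" by blast
  let ?l = "inverse (v $ m)" and ?u = "\<chi> i. val V (inverse (v $ m) * v $ i)"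
  have "?u $ m = 1" using m w.p_one by simp
  hence "?u \<noteq> 0" by (metis zero_index zero_neq_one)
  hence "centred V ?l ?u" unfolding centred_def using m V by (simp add: field_simps)
  thus ?thesis by blast
qed

lemma centred_eval:
  assumes "centred V l u" and "homogeneous n G"
  shows "l ^ n * ev G \<in> V" "val V (l ^ n * ev G) = eval3 G u"
proof -
  have V: "place V" using assms unfolding centred_def by blast
  have e: "l ^ n * ev G = ev3 emb (\<chi> i. l * v $ i) G"
    using ev3_scale[OF rhom_axioms assms(2), of l v] by simp
  have u: "(\<chi> i. val V ((\<chi> i. l * v $ i) $ i)) = u" using assms(1) unfolding centred_def by (simp add: vec_eq_iff)
  show "l ^ n * ev G \<in> V" "val V (l ^ n * ev G) = eval3 G u"
    unfolding e using val_ev3[OF V, of "\<chi> i. l * v $ i" G] assms(1) u unfolding centred_def by auto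
qed

lemma centred_nonzero: "centred V l u \<Longrightarrow> l \<noteq> 0"
proof
  assume c: "centred V l u" and l: "l = 0"
  have V: "place V" "u \<noteq> 0" using c unfolding centred_def by auto
  have "u $ i = val V 0" for i using c l unfolding centred_def by auto
  also have "val V 0 = 0" using val_emb[OF V(1), of 0] by simp
  finally show False using V(2) by (simp add: vec_eq_iff)
qed

lemma centred_on_curve:
  assumes "centred V l u"
  shows "vec.span {u} \<in> plane_curve F" "eval3 F u = 0"
proof -
  have V: "place V" "u \<noteq> 0" using assms unfolding centred_def by auto
  have "eval3 F u = val V (l ^ d * ev F)" using centred_eval[OF assms F_hom] by simp
  also have "ev F = 0" using kernel[of F] by simp
  finally show 0: "eval3 F u = 0" using val_emb[OF V(1), of 0] by simp
  have "vanishes_at F (vec.span {u})"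
    unfolding vanishes_at_def vec.span_singleton using eval3_scale[OF F_hom] 0 by auto
  thus "vec.span {u} \<in> plane_curve F" using V(2) unfolding plane_curve_def proj_plane_def by blast
qed

lemma form_quot_form: "homogeneous n G \<Longrightarrow> homogeneous n H \<Longrightarrow> ev H \<noteq> 0 \<Longrightarrow> form_quot F G H = cls (ev G / ev H)"
  by (rule form_quot_cls) (auto simp: frac_pairs_iff)

text \<open>For uniqueness, suppose that V also dominated the local ring of another point u'. A
  linear form a vanishing at u' but not at u, divided by a form b nonzero at u', would lie in the
  maximal ideal of V while its inverse is regular at V.\<close>

lemma centre_eq:
  assumes c: "centred V l u"
  shows "centre F (cls ` V) = vec.span {u}"
proof -
  have V: "place V" and u0: "u \<noteq> 0" using c unfolding centred_def by auto
  interpret V: phom V "\<lambda>x. x" using V unfolding place_def by (intro subr_phom) auto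
  interpret w: phom V "val V" by (rule val_phom[OF V])
  have l0: "l \<noteq> 0" by (rule centred_nonzero[OF c])
  have quot: "ev H \<noteq> 0 \<and> ev G / ev H \<in> V \<and> val V (ev G / ev H) = eval3 G u / eval3 H u"
    if "homogeneous n G" "homogeneous n H" "eval3 H u \<noteq> 0" for G H n
  proof -
    have h: "l ^ n * ev H \<noteq> 0" "inverse (l ^ n * ev H) \<in> V" "val V (inverse (l ^ n * ev H)) = inverse (eval3 H u)"
      using val_nonzeroD[OF V, of "l ^ n * ev H"] centred_eval[OF c that(2)] that(3) by auto
    have "ev G / ev H = (l ^ n * ev G) * inverse (l ^ n * ev H)" using l0 by (simp add: field_simps)
    thus ?thesis using h centred_eval[OF c that(1)]
      by (simp add: w.p_mult divide_inverse[of "eval3 G u"] del: inverse_mult_distrib)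
  qed
  have dom: "local_ring F (vec.span {u}) \<subseteq> cls ` V \<and> local_max_ideal F (vec.span {u}) \<subseteq> max_ideal F (cls ` V)"
  proof (intro conjI subsetI)
    fix f assume "f \<in> local_ring F (vec.span {u})"
    then obtain G H n where f: "f = form_quot F G H" "homogeneous n G" "homogeneous n H" "eval3 H u \<noteq> 0"
      unfolding local_ring_def by (auto simp: vanishes_at_span)
    thus "f \<in> cls ` V" using quot[OF f(2,3,4)] form_quot_form[OF f(2,3)] by simp
  next
    fix f assume "f \<in> local_max_ideal F (vec.span {u})"
    then obtain G H n where f: "f = form_quot F G H" "homogeneous n G" "homogeneous n H" "eval3 H u \<noteq> 0" "eval3 G u = 0"
      unfolding local_max_ideal_def by (auto simp: vanishes_at_span)
    have "ev G / ev H \<in> mid V" using quot[OF f(2,3,4)] f(5) val_mid[OF V] by simp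
    thus "f \<in> max_ideal F (cls ` V)" unfolding max_ideal_cls[OF V]
      using quot[OF f(2,3,4)] form_quot_form[OF f(2,3)] f(1) by simp
  qed
  show ?thesis unfolding centre_def
  proof (rule the_equality)
    show "vec.span {u} \<in> plane_curve F \<and> local_ring F (vec.span {u}) \<subseteq> cls ` V \<and>
        local_max_ideal F (vec.span {u}) \<subseteq> max_ideal F (cls ` V)"
      using centred_on_curve[OF c] dom by blast
    fix A assume A: "A \<in> plane_curve F \<and> local_ring F A \<subseteq> cls ` V \<and> local_max_ideal F A \<subseteq> max_ideal F (cls ` V)"
    then obtain u' where u': "A = vec.span {u'}" "u' \<noteq> 0" unfolding plane_curve_def proj_plane_def by blast
    have "u \<in> vec.span {u'}"
    proof (rule ccontr)
      assume "u \<notin> vec.span {u'}"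
      then obtain a where a: "dot a u' = 0" "dot a u \<noteq> 0" using independent_form by blast
      have "u' \<notin> vec.span {0}" using u' by simp
      then obtain b where b: "dot b u' \<noteq> 0" using independent_form[of u' 0] by blast
      have hb: "ev (lin3 b) \<noteq> 0" using b by (intro ev_lin3_nonzero) (auto simp: dot_def)
      have "form_quot F (lin3 a) (lin3 b) \<in> local_max_ideal F A"
        unfolding local_max_ideal_def u' using a b homogeneous_lin3 vanishes_at_span[OF homogeneous_lin3, of _ u']
        by (smt (verit) eval3_lin3 mem_Collect_eq)
      hence "cls (ev (lin3 a) / ev (lin3 b)) \<in> cls ` mid V"
        using A form_quot_form[OF homogeneous_lin3 homogeneous_lin3 hb] unfolding max_ideal_cls[OF V] by auto
      hence m: "ev (lin3 a) / ev (lin3 b) \<in> mid V"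
        using cls_image_iff[OF K_I[OF homogeneous_lin3 homogeneous_lin3 hb] mid_in_K[OF V]] by blast
      have "ev (lin3 b) / ev (lin3 a) \<in> V" "ev (lin3 a) \<noteq> 0"
        using quot[OF homogeneous_lin3 homogeneous_lin3, of a b] a by (auto simp: eval3_lin3)
      hence "1 \<in> mid V" using mid_mult[OF V m, of "ev (lin3 b) / ev (lin3 a)"] hb by simp
      thus False using one_notin_mid[OF V] by blast
    qed
    hence "vec.span {u} = vec.span {u'}" using span_singleton_eq[OF u0] by blast
    thus "A = vec.span {u}" using u' by simp
  qed
qed

end

section \<open>Pencils of lines\<close>

text \<open>\<open>a\<close> and \<open>b\<close> are coordinates on the pencil of lines through \<open>r\<close>.\<close>

definition pencil :: "'k::field ^ 3 \<Rightarrow> 'k ^ 3 \<Rightarrow> 'k ^ 3 \<Rightarrow> bool" where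
  "pencil r a b \<longleftrightarrow> r \<noteq> 0 \<and> dot a r = 0 \<and> dot b r = 0 \<and>
     (\<exists>y z. dot a y = 1 \<and> dot b y = 0 \<and> dot a z = 0 \<and> dot b z = 1 \<and>
        (\<forall>w. \<exists>t. w = dot a w *s y + dot b w *s z + t *s r))"

lemma pencil_nonzero: "pencil r a b \<Longrightarrow> a \<noteq> 0" "pencil r a b \<Longrightarrow> b \<noteq> 0"
  unfolding pencil_def dot_def by auto

lemma pencil_in_span: "pencil r a b \<Longrightarrow> w \<in> vec.span {r} \<longleftrightarrow> dot a w = 0 \<and> dot b w = 0"
proof -
  assume p: "pencil r a b"
  have "\<exists>t. w = t *s r" if "dot a w = 0" "dot b w = 0"
    using p that unfolding pencil_def by (metis add_0 vector_smult_lzero)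
  thus ?thesis using p unfolding pencil_def vec.span_singleton by (auto simp: dot_scale)
qed

lemma line_through_pencil:
  assumes p: "pencil r a b" and u: "u \<notin> vec.span {r}"
  shows "line_through (vec.span {r}) (vec.span {u}) = {w. dot a w * dot b u = dot b w * dot a u}"
proof
  let ?S = "{w. dot a w * dot b u = dot b w * dot a u}"
  have r: "dot a r = 0" "dot b r = 0" using p unfolding pencil_def by auto
  have "vec.subspace ?S"
    unfolding vec.subspace_def by (auto simp: dot_add dot_scale algebra_simps) (simp_all add: dot_def)
  moreover have "vec.span {r} \<union> vec.span {u} \<subseteq> ?S"
    using r by (auto simp: vec.span_singleton dot_scale)
  ultimately show "line_through (vec.span {r}) (vec.span {u}) \<subseteq> ?S"
    unfolding line_through_def by (rule vec.span_minimal[rotated])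
  show "?S \<subseteq> line_through (vec.span {r}) (vec.span {u})"
  proof
    fix w assume w: "w \<in> ?S"
    have "\<exists>t. w - t *s u \<in> vec.span {r}"
    proof (cases "dot b u = 0")
      case False
      have "w - (dot b w / dot b u) *s u \<in> vec.span {r}"
        unfolding pencil_in_span[OF p] dot_diff dot_scale using False w by (simp add: field_simps)
      thus ?thesis by blast
    next
      case True
      hence "dot a u \<noteq> 0" using u pencil_in_span[OF p] by blast
      hence "w - (dot a w / dot a u) *s u \<in> vec.span {r}"
        unfolding pencil_in_span[OF p] dot_diff dot_scale using True w by (simp add: field_simps)
      thus ?thesis by blast
    qed
    then obtain t where t: "w - t *s u \<in> vec.span {r}" by blast
    have "w - t *s u \<in> vec.span (vec.span {r} \<union> vec.span {u})" "t *s u \<in> vec.span (vec.span {r} \<union> vec.span {u})"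
      using t by (auto intro!: vec.span_base vec.span_scale)
    hence "(w - t *s u) + t *s u \<in> vec.span (vec.span {r} \<union> vec.span {u})" by (rule vec.span_add)
    thus "w \<in> line_through (vec.span {r}) (vec.span {u})" unfolding line_through_def by simp
  qed
qed

lemma line_through_eq_iff:
  assumes p: "pencil r a b" and u: "u \<notin> vec.span {r}" and u': "u' \<notin> vec.span {r}"
  shows "line_through (vec.span {r}) (vec.span {u'}) = line_through (vec.span {r}) (vec.span {u})
    \<longleftrightarrow> dot a u' * dot b u = dot b u' * dot a u"
  unfolding line_through_pencil[OF p u] line_through_pencil[OF p u']
proof
  assume "{w. dot a w * dot b u' = dot b w * dot a u'} = {w. dot a w * dot b u = dot b w * dot a u}"
  moreover have "u' \<in> {w. dot a w * dot b u' = dot b w * dot a u'}" by (simp add: mult.commute)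
  ultimately show "dot a u' * dot b u = dot b u' * dot a u" by blast
next
  assume e: "dot a u' * dot b u = dot b u' * dot a u"
  have n: "dot a u \<noteq> 0 \<or> dot b u \<noteq> 0" "dot a u' \<noteq> 0 \<or> dot b u' \<noteq> 0" using u u' pencil_in_span[OF p] by auto
  have "dot a w * dot b u' = dot b w * dot a u' \<longleftrightarrow> dot a w * dot b u = dot b w * dot a u" for w
  proof (cases "dot b u = 0")
    case True
    hence "dot b u' = 0" using e n by auto
    thus ?thesis using True n by simp
  next
    case False
    hence b': "dot b u' \<noteq> 0" using e n by auto
    have "(dot a w * dot b u' - dot b w * dot a u') * dot b u = (dot a w * dot b u - dot b w * dot a u) * dot b u'"
    proof -
      have "(dot a w * dot b u' - dot b w * dot a u') * dot b u - (dot a w * dot b u - dot b w * dot a u) * dot b u'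
          = dot b w * (dot b u' * dot a u - dot a u' * dot b u)"
        by (simp add: algebra_simps)
      thus ?thesis using e by simp
    qed
    thus ?thesis using False b' by (metis eq_iff_diff_eq_0 mult_eq_0_iff)
  qed
  thus "{w. dot a w * dot b u' = dot b w * dot a u'} = {w. dot a w * dot b u = dot b w * dot a u}" by blast
qed

section \<open>Automorphisms of the function field and of the curve\<close>

context generic_point begin

text \<open>The affine coordinates with respect to b are adjoined to S before
  \<open>place_containing\<close> is applied, which puts the centre off the line b = 0.\<close>

lemma place_affine:
  assumes S: "finite S" "S \<subseteq> K" and b: "b \<noteq> 0"
  shows "\<exists>V u. S \<subseteq> V \<and> centred V (inverse (ev (lin3 b))) u \<and> dot b u = 1"
proof -
  let ?b = "ev (lin3 b)"
  have b0: "?b \<noteq> 0" by (rule ev_lin3_nonzero[OF b])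
  have *: "\<exists>L. homogeneous 1 L \<and> ev L = v $ i" for i
    using exhaust_3[of i] homogeneous_var by (metis ev3_varX ev3_varY ev3_varZ rhom_axioms)
  have vi: "inverse ?b * v $ i \<in> K" for i
  proof -
    obtain L where L: "homogeneous 1 L" "ev L = v $ i" using * by metis
    from K_I[OF L(1) homogeneous_lin3 b0] show ?thesis unfolding L(2) by (simp add: divide_inverse mult.commute)
  qed
  have "finite (S \<union> range (\<lambda>i. inverse ?b * v $ i))" "S \<union> range (\<lambda>i. inverse ?b * v $ i) \<subseteq> K"
    using S vi by auto
  from place_containing[OF this] obtain V where V: "place V" "S \<subseteq> V" "\<And>i. inverse ?b * v $ i \<in> V" by blast
  let ?u = "\<chi> i. val V (inverse ?b * v $ i)"
  interpret w: phom V "val V" by (rule val_phom[OF V(1)])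
  have "dot b ?u = val V (emb (b$1) * (inverse ?b * v$1) + emb (b$2) * (inverse ?b * v$2) + emb (b$3) * (inverse ?b * v$3))"
    unfolding dot_def using V by (simp add: w.p_add w.p_mult)
  also have "emb (b$1) * (inverse ?b * v$1) + emb (b$2) * (inverse ?b * v$2) + emb (b$3) * (inverse ?b * v$3) = inverse ?b * ?b"
    by (simp only: ev3_lin3[OF rhom_axioms] distrib_left mult.left_commute)
  also have "\<dots> = 1" using b0 by simp
  finally have d: "dot b ?u = 1" using w.p_one by simp
  moreover have "dot b 0 = 0" by (simp add: dot_def)
  ultimately have "?u \<noteq> 0" by (metis zero_neq_one)
  hence "centred V (inverse ?b) ?u" unfolding centred_def using V by simp
  thus ?thesis using V d by blast
qed

text \<open>A form of this kind has zero value at the centre of every place. If \<open>ev G\<close>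
  were nonzero, there would be a place at which the inverse of \<open>ev G\<close> divided by a
  power of a linear form is regular, which excludes a zero there.\<close>

lemma vanishing_form:
  assumes "homogeneous n G" and z: "\<And>u. u \<noteq> 0 \<Longrightarrow> eval3 F u = 0 \<Longrightarrow> eval3 G u = 0"
  shows "ev G = 0"
proof (rule ccontr)
  assume G: "ev G \<noteq> 0"
  define b :: "'k ^ 3" where "b = vector [1, 0, 0]"
  have b: "b \<noteq> 0" by (simp add: b_def vec_eq_iff forall_3 vector_3)
  let ?f = "ev G / ev (lin3 b) ^ n"
  have b0: "ev (lin3 b) \<noteq> 0" by (rule ev_lin3_nonzero[OF b])
  have h: "homogeneous n (lin3 b ^ n)" using homogeneous_power[OF homogeneous_lin3[of b], of n] by simp
  have f: "?f \<in> K" "?f \<noteq> 0" using K_I[OF assms(1) h] G b0 by auto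
  have "finite {inverse ?f}" by simp
  moreover have "{inverse ?f} \<subseteq> K" using K_inverse[OF f(1)] by blast
  ultimately obtain V u where V: "inverse ?f \<in> V" "centred V (inverse (ev (lin3 b))) u"
    using place_affine[OF _ _ b] by blast
  have pl: "place V" and "u \<noteq> 0" using V(2) unfolding centred_def by auto
  hence G0: "eval3 G u = 0" using z centred_on_curve(2)[OF V(2)] by blast
  have e: "inverse (ev (lin3 b)) ^ n * ev G = ?f" by (simp add: divide_inverse mult.commute power_inverse)
  have "?f \<in> V" "val V ?f = 0" using centred_eval[OF V(2) assms(1)] G0 unfolding e by auto
  hence "?f \<in> mid V" using val_mid[OF pl] by blast
  thus False using V(1) f(2) unfolding mid_def by blast
qed

section \<open>Automorphisms of the curve induced by automorphisms of K\<close>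

abbreviation N :: "'k place set" where "N \<equiv> normalization F"

definition pl :: "'k place \<Rightarrow> 'e set" where "pl W = {r \<in> K. cls r \<in> W}"

lemma pl_cls: "T \<subseteq> K \<Longrightarrow> pl (cls ` T) = T"
  unfolding pl_def using cls_image_iff by blast

definition sig :: "('e \<Rightarrow> 'e) \<Rightarrow> 'k place \<Rightarrow> 'k place" where
  "sig s = (\<lambda>W\<in>N. cls ` s ` pl W)"

lemma sig_cls: "place V \<Longrightarrow> sig s (cls ` V) = cls ` (s ` V)"
  unfolding sig_def using place_normalization[of V] pl_cls[of V] place_subset by auto

lemma sig_in_N: "aut s \<Longrightarrow> W \<in> N \<Longrightarrow> sig s W \<in> N"
proof -
  assume s: "aut s" and "W \<in> N"
  then obtain V where V: "place V" "W = cls ` V" using normalization_place by blast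
  thus ?thesis using sig_cls[OF V(1)] place_normalization[OF place_aut(1)[OF s V(1)]] by simp
qed

lemma sig_comp: "aut s \<Longrightarrow> aut t \<Longrightarrow> W \<in> N \<Longrightarrow> sig s (sig t W) = sig (s \<circ> t) W"
proof -
  assume s: "aut s" "aut t" and "W \<in> N"
  then obtain V where V: "place V" "W = cls ` V" using normalization_place by blast
  show ?thesis unfolding V(2) sig_cls[OF V(1)] sig_cls[OF place_aut(1)[OF s(2) V(1)]] by (simp add: image_comp)
qed

lemma sig_id: "W \<in> N \<Longrightarrow> sig id W = W"
  using normalization_place[of W] sig_cls[of _ id] by auto

lemma sig_ainv: "aut s \<Longrightarrow> W \<in> N \<Longrightarrow> sig (ainv s) (sig s W) = W" "aut s \<Longrightarrow> W \<in> N \<Longrightarrow> sig s (sig (ainv s) W) = W"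
proof -
  assume s: "aut s" and W: "W \<in> N"
  have "ainv s \<circ> s = id" "s \<circ> ainv s = id" using aut_inv_apply[OF s] by auto
  thus "sig (ainv s) (sig s W) = W" "sig s (sig (ainv s) W) = W"
    using sig_comp[OF aut_inv[OF s] s W] sig_comp[OF s aut_inv[OF s] W] sig_id[OF W] by auto
qed

lemma sig_bij: "aut s \<Longrightarrow> bij_betw (sig s) N N"
  by (rule bij_betw_byWitness[of _ "sig (ainv s)"]) (auto simp: sig_ainv sig_in_N aut_inv)

lemma sig_self_morphism:
  assumes s: "aut s" and f: "\<And>W. W \<in> N \<Longrightarrow> f W = sig s W"
  shows "self_morphism F f"
  unfolding self_morphism_def
proof (intro conjI allI impI)
  show fN: "f \<in> N \<rightarrow> N" using f sig_in_N[OF s] by auto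
  have inj: "inj_on f N" using sig_bij[OF s] f by (metis bij_betw_def inj_on_cong)
  fix U assume U: "open_subset F U"
  have UN: "U \<subseteq> N" using U unfolding open_subset_def by blast
  have "N - (f -` U \<inter> N) = f -` (N - U) \<inter> N" using fN by auto
  hence "finite (N - U) \<Longrightarrow> finite (N - (f -` U \<inter> N))" using finite_vimage_IntI[OF _ inj] by metis
  thus "open_subset F (f -` U \<inter> N)" using U unfolding open_subset_def by auto
  fix g assume "regular_on F U g"
  then obtain r where r: "r \<in> K" "\<And>W. W \<in> U \<Longrightarrow> cls r \<in> W \<and> g W = value_at F W (cls r)"
    unfolding regular_on_def carrier_FF by blast
  \<comment> \<open>The place V goes to its image under s, so functions are pulled back by the
    inverse of s.\<close>
  define r' where "r' = ainv s r"
  have r': "r' \<in> K" "s r' = r" using r(1) aut_in_K[OF aut_inv[OF s]] aut_inv_apply[OF s] by (auto simp: r'_def)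
  have "cls r' \<in> W \<and> (g \<circ> f) W = value_at F W (cls r')" if W: "W \<in> f -` U \<inter> N" for W
  proof -
    obtain V where V: "place V" "W = cls ` V" using W normalization_place by blast
    have fW: "f W = cls ` (s ` V)" using f[of W] W V sig_cls by auto
    note pV = place_aut(1)[OF s V(1)]
    have "cls r \<in> cls ` (s ` V)" "g (f W) = value_at F (cls ` (s ` V)) (cls r)" using r(2)[of "f W"] W fW by auto
    hence "r \<in> s ` V" "g (f W) = val (s ` V) r"
      using cls_image_iff[OF r(1), of "s ` V"] place_subset[OF pV] value_at_cls[OF pV r(1)] by auto
    moreover from this have rV: "r' \<in> V" using r'(2) aut_inj[OF s] by auto
    ultimately have "g (f W) = val V r'" using place_aut(3)[OF s V(1) rV] r' by simp
    thus ?thesis using rV value_at_cls[OF V(1) r'(1)] V(2) by auto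
  qed
  thus "regular_on F (f -` U \<inter> N) (g \<circ> f)" unfolding regular_on_def carrier_FF using r'(1) by blast
qed

lemma sig_Aut_curve:
  assumes s: "aut s"
  shows "sig s \<in> Aut_curve F"
proof -
  have b: "bij_betw (sig s) N N" by (rule sig_bij[OF s])
  have "inv_into N (sig s) W = sig (ainv s) W" if "W \<in> N" for W
    by (rule inv_into_f_eq) (use b that s in \<open>auto simp: bij_betw_def sig_in_N aut_inv sig_ainv\<close>)
  hence "self_morphism F (inv_into N (sig s))" by (rule sig_self_morphism[OF aut_inv[OF s]])
  moreover have "self_morphism F (sig s)" by (rule sig_self_morphism[OF s]) simp
  moreover have "sig s \<in> Bij N" using b unfolding Bij_def sig_def by auto
  ultimately show ?thesis unfolding Aut_curve_def by blast
qed

lemma centre_line: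
  assumes p: "pencil r a b" and c: "centred V l u"
  shows "centre F (cls ` V) \<noteq> vec.span {r} \<longleftrightarrow> \<not> (dot a u = 0 \<and> dot b u = 0)"
  using centre_eq[OF c] span_singleton_eq[of u r] pencil_in_span[OF p] c unfolding centred_def by auto

text \<open>Regularity of the affine coordinates places both centres off the line b = 0. With b
  normalized to 1 there, the line joining r to a centre is determined by the value of a, so equal
  lines give equal values of a / b.\<close>

lemma galois_group_values:
  assumes \<sigma>: "\<sigma> \<in> galois_group F (vec.span {r})" and p: "pencil r a b"
    and V: "place V" "place V'" "\<sigma> (cls ` V) = cls ` V'"
    and i: "\<And>i. v $ i / ev (lin3 b) \<in> V" "\<And>i. v $ i / ev (lin3 b) \<in> V'"
  shows "val V' (ev (lin3 a) / ev (lin3 b)) = val V (ev (lin3 a) / ev (lin3 b))"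
proof -
  let ?l = "inverse (ev (lin3 b))"
  have b0: "ev (lin3 b) \<noteq> 0" using ev_lin3_nonzero pencil_nonzero[OF p] by blast
  have x: "ev (lin3 a) / ev (lin3 b) = ?l * ev (lin3 a)" by (simp add: divide_inverse mult.commute)
  have *: "\<exists>u. centred U ?l u \<and> dot b u = 1 \<and> val U (ev (lin3 a) / ev (lin3 b)) = dot a u"
    if U: "place U" "\<And>i. v $ i / ev (lin3 b) \<in> U" for U
  proof -
    interpret U: phom U "val U" by (rule val_phom[OF U(1)])
    define u where "u = (\<chi> i. val U (?l * v $ i))"
    have ui: "?l * v $ i \<in> U" for i using U(2)[of i] by (simp add: divide_inverse mult.commute)
    have lin: "val U (?l * ev (lin3 c)) = dot c u" for c
    proof -
      have "?l * ev (lin3 c) = emb (c$1) * (?l * v$1) + emb (c$2) * (?l * v$2) + emb (c$3) * (?l * v$3)"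
        by (simp only: ev3_lin3[OF rhom_axioms] distrib_left mult.left_commute)
      thus ?thesis using ui U(1) unfolding u_def dot_def by (simp add: U.p_add U.p_mult)
    qed
    have b1: "dot b u = 1" using lin[of b] b0 U.p_one by simp
    hence "u \<noteq> 0" by (auto simp: dot_def)
    hence "centred U ?l u" unfolding centred_def using U(1) ui by (simp add: u_def)
    thus ?thesis using b1 lin[of a] x by auto
  qed
  obtain u where u: "centred V ?l u" "dot b u = 1" "val V (ev (lin3 a) / ev (lin3 b)) = dot a u"
    using *[OF V(1) i(1)] by blast
  obtain u' where u': "centred V' ?l u'" "dot b u' = 1" "val V' (ev (lin3 a) / ev (lin3 b)) = dot a u'"
    using *[OF V(2) i(2)] by blast
  have n: "u \<notin> vec.span {r}" "u' \<notin> vec.span {r}" using pencil_in_span[OF p] u(2) u'(2) by auto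
  have "line_through (vec.span {r}) (centre F (cls ` V')) = line_through (vec.span {r}) (centre F (cls ` V))"
    using \<sigma> place_normalization[OF V(1)] centre_line[OF p u(1)] centre_line[OF p u'(1)] u(2) u'(2) V(3)
    unfolding galois_group_def by auto
  hence "dot a u' * dot b u = dot b u' * dot a u"
    unfolding centre_eq[OF u(1)] centre_eq[OF u'(1)] using line_through_eq_iff[OF p n] by simp
  thus ?thesis using u(2,3) u'(2,3) by simp
qed

text \<open>If s fixes a / b, the coordinates of the two centres on the pencil are proportional.
  Conversely, if s moves a / b, some place has its centre and the centre of its image off the line b
  = 0 but different values of a / b at the two.\<close>

lemma galois_group_iff:
  assumes s: "aut s" and p: "pencil r a b"
  shows "sig s \<in> galois_group F (vec.span {r}) \<longleftrightarrow> s (ev (lin3 a) / ev (lin3 b)) = ev (lin3 a) / ev (lin3 b)"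
    (is "_ \<longleftrightarrow> s ?x = ?x")
proof -
  interpret s: phom K s by (rule aut_phom[OF s])
  have b0: "ev (lin3 b) \<noteq> 0" using ev_lin3_nonzero pencil_nonzero[OF p] by blast
  have xK: "?x \<in> K" by (rule K_I[OF homogeneous_lin3 homogeneous_lin3 b0])
  show ?thesis
  proof
    assume sx: "s ?x = ?x"
    have "line_through (vec.span {r}) (centre F (sig s W)) = line_through (vec.span {r}) (centre F W)"
      if W: "W \<in> N" "centre F W \<noteq> vec.span {r}" "centre F (sig s W) \<noteq> vec.span {r}" for W
    proof -
      obtain V where V: "place V" "W = cls ` V" using normalization_place W by blast
      note V' = place_aut(1)[OF s V(1)]
      have sW: "sig s W = cls ` (s ` V)" using sig_cls V by simp
      obtain l u where c: "centred V l u" using centred_exists[OF V(1)] by blast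
      obtain l' u' where c': "centred (s ` V) l' u'" using centred_exists[OF V'] by blast
      interpret w': phom "s ` V" "val (s ` V)" by (rule val_phom[OF V'])
      let ?A = "l * ev (lin3 a)" and ?B = "l * ev (lin3 b)" and ?A' = "l' * ev (lin3 a)" and ?B' = "l' * ev (lin3 b)"
      have v: "?A \<in> V" "val V ?A = dot a u" "?B \<in> V" "val V ?B = dot b u"
        using centred_eval[OF c homogeneous_lin3] by (auto simp: eval3_lin3)
      have v': "?A' \<in> s ` V" "val (s ` V) ?A' = dot a u'" "?B' \<in> s ` V" "val (s ` V) ?B' = dot b u'"
        using centred_eval[OF c' homogeneous_lin3] by (auto simp: eval3_lin3)
      have AB: "?A \<in> K" "?B \<in> K" using v place_subset[OF V(1)] by auto
      have "s ?A = ?x * s ?B"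
      proof -
        have "?A = ?x * ?B" using b0 by simp
        hence "s ?A = s ?x * s ?B" using s.p_mult[OF xK AB(2)] by simp
        thus ?thesis using sx by simp
      qed
      moreover have "?A' * s ?B = ?B' * (?x * s ?B)" using b0 by simp
      ultimately have "?A' * s ?B = ?B' * s ?A" by (simp only:)
      hence "val (s ` V) (?A' * s ?B) = val (s ` V) (?B' * s ?A)" by (rule arg_cong)
      hence "dot a u' * dot b u = dot b u' * dot a u"
        using v v' place_aut(3)[OF s V(1)] by (simp add: w'.p_mult)
      moreover have "u \<notin> vec.span {r}" "u' \<notin> vec.span {r}"
        using W centre_line[OF p c] centre_line[OF p c'] pencil_in_span[OF p] V(2) sW by auto
      ultimately show ?thesis
        unfolding V(2) sig_cls[OF V(1)] centre_eq[OF c] centre_eq[OF c'] using line_through_eq_iff[OF p, of u u'] by simp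
    qed
    thus "sig s \<in> galois_group F (vec.span {r})" unfolding galois_group_def using sig_Aut_curve[OF s] by blast
  next
    assume g: "sig s \<in> galois_group F (vec.span {r})"
    show "s ?x = ?x"
    proof (rule ccontr)
      assume ne: "s ?x \<noteq> ?x"
      define t where "t = ainv s"
      have t: "aut t" unfolding t_def by (rule aut_inv[OF s])
      have st: "s (t e) = e" "t (s e) = e" for e unfolding t_def using aut_inv_apply[OF s] by auto
      have "t ?x \<noteq> ?x" using ne st by metis
      let ?l = "inverse (ev (lin3 b))"
      have *: "\<exists>L. homogeneous 1 L \<and> ev L = v $ i" for i
        using exhaust_3[of i] homogeneous_var by (metis ev3_varX ev3_varY ev3_varZ rhom_axioms)
      have vi: "?l * v $ i \<in> K" for i
      proof -
        obtain L where L: "homogeneous 1 L" "ev L = v $ i" using * by metis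
        from K_I[OF L(1) homogeneous_lin3 b0] show ?thesis unfolding L(2) by (simp add: divide_inverse mult.commute)
      qed
      have tx: "t ?x \<in> K" using aut_in_K[OF t] xK by simp
      \<comment> \<open>Regularity of \<open>inverse (t ?x - ?x)\<close> keeps the values of x and t
        x apart. The remaining entries make x, t x and the moved affine coordinates regular at
        V.\<close>
      define S where "S = {inverse (t ?x - ?x), ?x, t ?x} \<union> range (\<lambda>i. t (?l * v $ i))"
      have "finite S" "S \<subseteq> K" unfolding S_def using xK tx vi aut_in_K[OF t] by auto
      from place_affine[OF this pencil_nonzero(2)[OF p]]
      obtain V u where V: "S \<subseteq> V" "centred V ?l u" "dot b u = 1" by blast
      have pV: "place V" using V(2) unfolding centred_def by blast
      note V' = place_aut(1)[OF s pV]
      interpret w: phom V "val V" by (rule val_phom[OF pV])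
      interpret w': phom "s ` V" "val (s ` V)" by (rule val_phom[OF V'])
      have in': "e \<in> s ` V \<and> val (s ` V) e = val V (t e)" if "t e \<in> V" for e
        using place_aut(3)[OF s pV that] that st(1)[of e] by force
      have vi': "?l * v $ i \<in> s ` V" for i using in'[of "?l * v $ i"] V(1) unfolding S_def by blast
      have d: "?l * f = f / ev (lin3 b)" for f by (simp add: divide_inverse mult.commute)
      have "val (s ` V) ?x = val V ?x"
        by (rule galois_group_values[OF g p pV V' sig_cls[OF pV]])
           (use vi' V(2) in \<open>simp_all add: d centred_def\<close>)
      hence "val V (t ?x) = val V ?x" using in'[of ?x] V(1) unfolding S_def by auto
      hence "val V (t ?x - ?x) = 0" using V(1) unfolding S_def by (simp add: w.p_diff)
      moreover have "t ?x - ?x \<in> V" using V(1) unfolding S_def by simp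
      ultimately have "t ?x - ?x \<in> mid V" using val_mid[OF pV] by blast
      thus False using V(1) \<open>t ?x \<noteq> ?x\<close> unfolding S_def mid_def by auto
    qed
  qed
qed

section \<open>Subfields k(x) of the function field and Galois extensions\<close>

lemma subfield_rat:
  assumes x: "x \<in> K"
  shows "subfield (cls ` rat x) FF"
proof -
  interpret R: phom "rat x" "\<lambda>x. x" by (rule rat_phom)
  have rK: "r \<in> K" if "r \<in> rat x" for r using rat_subset[OF x] that by blast
  show ?thesis
  proof (rule FF.subfieldI'[OF FF.subringI])
    show "cls ` rat x \<subseteq> carrier FF" using rK by auto
    show "\<one>\<^bsub>FF\<^esub> \<in> cls ` rat x" unfolding cls_one by simp
    fix k assume "k \<in> cls ` rat x - {\<zero>\<^bsub>FF\<^esub>}"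
    then obtain r where r: "k = cls r" "r \<in> rat x" "r \<noteq> 0" unfolding cls_zero by auto
    thus "inv\<^bsub>FF\<^esub> k \<in> cls ` rat x" using rat_inverse[OF r(2)] rK by (auto simp: cls_inverse)
  next
    fix a assume "a \<in> cls ` rat x"
    then obtain r where r: "a = cls r" "r \<in> rat x" by blast
    thus "\<ominus>\<^bsub>FF\<^esub> a \<in> cls ` rat x" using rK by (auto simp: cls_uminus)
    fix b assume "b \<in> cls ` rat x"
    then obtain r' where r': "b = cls r'" "r' \<in> rat x" by blast
    show "a \<otimes>\<^bsub>FF\<^esub> b \<in> cls ` rat x" "a \<oplus>\<^bsub>FF\<^esub> b \<in> cls ` rat x" using r r' rK by (auto simp: cls_mult cls_add)
  qed
qed

lemma rat_subset_subfield:
  assumes x: "x \<in> K" and S: "subfield S FF" and c: "\<And>c. cls (emb c) \<in> S" and xS: "cls x \<in> S"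
  shows "cls ` rat x \<subseteq> S"
proof -
  have sr: "subring S FF" by (rule subfieldE(1)[OF S])
  have p: "cls (pev emb x p) \<in> S" for p
  proof (induction p)
    case 0
    show ?case using c[of 0] by simp
  next
    case (pCons a p)
    have "cls (emb a + x * pev emb x p) = cls (emb a) \<oplus>\<^bsub>FF\<^esub> cls x \<otimes>\<^bsub>FF\<^esub> cls (pev emb x p)"
      using x by (simp add: cls_add cls_mult)
    thus ?case using pCons c xS subringE(6,7)[OF sr] by simp
  qed
  show ?thesis
  proof
    fix f assume "f \<in> cls ` rat x"
    then obtain a q where f: "f = cls (pev emb x a / pev emb x q)" "pev emb x q \<noteq> 0" unfolding rat_def by blast
    have "cls (pev emb x q) \<in> S - {\<zero>\<^bsub>FF\<^esub>}" using p f(2) x cls_inj[of "pev emb x q" 0] by (simp add: cls_zero)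
    hence "inv\<^bsub>FF\<^esub> (cls (pev emb x q)) \<in> S" using FF.subfield_m_inv(1)[OF S] by blast
    hence "cls (inverse (pev emb x q)) \<in> S" using f(2) x by (simp add: cls_inverse)
    hence "cls (pev emb x a) \<otimes>\<^bsub>FF\<^esub> cls (inverse (pev emb x q)) \<in> S" using p subringE(6)[OF sr] by blast
    thus "f \<in> S" using f x by (simp add: cls_mult divide_inverse)
  qed
qed

text \<open>A linear form vanishing at r is a combination of a and b, so a quotient of two such
  forms is a fractional linear function of a / b.\<close>

lemma proj_subfield_eq:
  assumes p: "pencil r a b"
  shows "proj_subfield F (vec.span {r}) = cls ` rat (ev (lin3 a) / ev (lin3 b))" (is "_ = cls ` rat ?x")
proof -
  have b0: "ev (lin3 b) \<noteq> 0" using ev_lin3_nonzero pencil_nonzero[OF p] by blast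
  have xK: "?x \<in> K" by (rule K_I[OF homogeneous_lin3 homogeneous_lin3 b0])
  obtain y z where yz: "dot a y = 1" "dot b y = 0" "dot a z = 0" "dot b z = 1"
    "\<And>w. \<exists>t. w = dot a w *s y + dot b w *s z + t *s r" using p unfolding pencil_def by blast
  have r: "dot a r = 0" "dot b r = 0" using p unfolding pencil_def by auto
  have lin: "\<exists>\<alpha> \<beta>. ev L = emb \<alpha> * ev (lin3 a) + emb \<beta> * ev (lin3 b)"
    if L: "homogeneous 1 L" "vanishes_at L (vec.span {r})" for L
  proof -
    obtain c where c: "L = lin3 c" using homogeneous_1_imp_lin3[OF L(1)] by blast
    have cr: "dot c r = 0" using L(2) unfolding c vanishes_at_span[OF homogeneous_lin3] eval3_lin3 .
    have cw: "dot c w = dot a w * dot c y + dot b w * dot c z" for w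
    proof -
      obtain t where t: "w = dot a w *s y + dot b w *s z + t *s r" using yz(5) by blast
      have "dot c w = dot c (dot a w *s y + dot b w *s z + t *s r)" using t by simp
      thus ?thesis by (simp add: dot_add dot_scale cr)
    qed
    have "c = dot c y *s a + dot c z *s b"
      using cw[of "vector [1, 0, 0]"] cw[of "vector [0, 1, 0]"] cw[of "vector [0, 0, 1]"]
      unfolding dot_def[of _ "vector _"] by (simp add: vec_eq_iff forall_3 vector_3 mult.commute)
    then obtain \<alpha> \<beta> where "c = \<alpha> *s a + \<beta> *s b" by blast
    hence "ev L = emb \<alpha> * ev (lin3 a) + emb \<beta> * ev (lin3 b)"
      unfolding c by (simp add: ev3_lin3[OF rhom_axioms] algebra_simps)
    thus ?thesis by blast
  qed
  let ?H = "range (const_fun F) \<union> {form_quot F L M | L M. homogeneous 1 L \<and> homogeneous 1 M \<and>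
     vanishes_at L (vec.span {r}) \<and> vanishes_at M (vec.span {r}) \<and> \<not> F dvd M}"
  have H: "?H \<subseteq> cls ` rat ?x"
  proof
    fix f assume "f \<in> ?H"
    then consider c where "f = cls (emb c)" | L M where "f = form_quot F L M" "homogeneous 1 L" "homogeneous 1 M"
       "vanishes_at L (vec.span {r})" "vanishes_at M (vec.span {r})" "ev M \<noteq> 0"
      using kernel cls_const by auto
    thus "f \<in> cls ` rat ?x"
    proof cases
      case 1
      thus ?thesis using rat_emb by blast
    next
      case 2
      obtain \<alpha> \<beta> where L: "ev L = emb \<alpha> * ev (lin3 a) + emb \<beta> * ev (lin3 b)" using lin 2 by blast
      obtain \<gamma> \<delta> where M: "ev M = emb \<gamma> * ev (lin3 a) + emb \<delta> * ev (lin3 b)" using lin 2 by blast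
      have L': "ev L = ev (lin3 b) * pev emb ?x [:\<beta>, \<alpha>:]" and M': "ev M = ev (lin3 b) * pev emb ?x [:\<delta>, \<gamma>:]"
        unfolding L M using b0 by (simp_all add: field_simps)
      have "pev emb ?x [:\<delta>, \<gamma>:] \<noteq> 0" using 2(6) unfolding M' by auto
      moreover have "ev L / ev M = pev emb ?x [:\<beta>, \<alpha>:] / pev emb ?x [:\<delta>, \<gamma>:]" unfolding L' M' using b0 by simp
      ultimately have "ev L / ev M \<in> rat ?x" using ratI by metis
      thus ?thesis using form_quot_form[OF 2(2,3,6)] 2(1) by blast
    qed
  qed
  have Hc: "?H \<subseteq> carrier FF" using H rat_subset[OF xK] carrier_FF by blast
  have "generate_field FF ?H \<subseteq> cls ` rat ?x"
    by (rule FF.generate_field_min_subfield1[OF Hc subfield_rat[OF xK] H])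
  moreover have "cls ` rat ?x \<subseteq> generate_field FF ?H"
  proof (rule rat_subset_subfield[OF xK])
    show "subfield (generate_field FF ?H) FF" by (rule FF.generate_field_is_subfield[OF Hc])
    have i: "?H \<subseteq> generate_field FF ?H" by (auto intro: generate_field.incl)
    show "cls (emb c) \<in> generate_field FF ?H" for c using i cls_const[of c] by blast
    have "form_quot F (lin3 a) (lin3 b) = cls ?x" by (rule form_quot_form[OF homogeneous_lin3 homogeneous_lin3 b0])
    moreover have "vanishes_at (lin3 a) (vec.span {r})" "vanishes_at (lin3 b) (vec.span {r})"
      unfolding vanishes_at_span[OF homogeneous_lin3] eval3_lin3 by (rule r)+
    moreover have "\<not> F dvd lin3 b" using b0 kernel by blast
    ultimately have "cls ?x \<in> ?H" using homogeneous_lin3 by blast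
    thus "cls ?x \<in> generate_field FF ?H" using i by blast
  qed
  ultimately show ?thesis unfolding proj_subfield_def by blast
qed

text \<open>A ring automorphism of the function field is pulled back along \<open>cls\<close> and
  extended by the identity outside K, which gives an \<open>aut\<close>.\<close>

lemma galois_extension_fixed:
  assumes g: "galois_extension FF (cls ` L)" and L: "L \<subseteq> K" "range emb \<subseteq> L"
    and f: "f \<in> K" "\<And>s. aut s \<Longrightarrow> (\<And>a. a \<in> L \<Longrightarrow> s a = a) \<Longrightarrow> s f = f"
  shows "f \<in> L"
proof -
  have "S (cls f) = cls f" if S: "S \<in> ring_iso FF FF" "\<forall>g\<in>cls ` L. S g = g" for S
  proof -
    define s where "s r = (if r \<in> K then the_inv_into K cls (S (cls r)) else r)" for r
    have Sb: "bij_betw S (cls ` K) (cls ` K)" using S(1) unfolding ring_iso_def carrier_FF by blast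
    have cs: "cls (s r) = S (cls r)" "s r \<in> K" if r: "r \<in> K" for r
    proof -
      have "S (cls r) \<in> cls ` K" using Sb r by (auto simp: bij_betw_def)
      thus "cls (s r) = S (cls r)" "s r \<in> K"
        using r by (auto simp: s_def f_the_inv_into_f[OF inj_on_cls] the_inv_into_into[OF inj_on_cls])
    qed
    have hom: "S (x \<otimes>\<^bsub>FF\<^esub> y) = S x \<otimes>\<^bsub>FF\<^esub> S y" "S (x \<oplus>\<^bsub>FF\<^esub> y) = S x \<oplus>\<^bsub>FF\<^esub> S y"
      if "x \<in> carrier FF" "y \<in> carrier FF" for x y
      using S(1) that unfolding ring_iso_def ring_hom_def by auto
    have sL: "s a = a" if a: "a \<in> L" for a
      using cs[of a] S(2) L a cls_inj[of "s a" a] by auto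
    have sK: "s ` K = K"
    proof
      show "s ` K \<subseteq> K" using cs(2) by blast
      show "K \<subseteq> s ` K"
      proof
        fix a assume a: "a \<in> K"
        hence "cls a \<in> S ` (cls ` K)" using Sb by (simp add: bij_betw_def)
        then obtain b where b: "b \<in> K" "S (cls b) = cls a" by (metis (no_types, lifting) imageE)
        hence "s b = a" using cs[OF b(1)] cls_inj[of "s b" a] by simp
        thus "a \<in> s ` K" using b by blast
      qed
    qed
    have inj: "inj s"
    proof (rule injI)
      fix a b assume e: "s a = s b"
      have "s c \<in> K \<longleftrightarrow> c \<in> K" for c using cs(2)[of c] by (auto simp: s_def)
      hence ab: "a \<in> K \<longleftrightarrow> b \<in> K" using e by metis
      show "a = b"
      proof (cases "a \<in> K")
        case True
        hence "S (cls a) = S (cls b)" using cs(1) ab e by metis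
        hence "cls a = cls b" using Sb True ab unfolding bij_betw_def inj_on_def by blast
        thus ?thesis using cls_inj True by blast
      qed (use ab e in \<open>auto simp: s_def\<close>)
    qed
    have "surj s"
      unfolding surj_def
    proof
      fix y show "\<exists>x. y = s x"
      proof (cases "y \<in> K")
        case True
        hence "y \<in> s ` K" using sK by simp
        thus ?thesis by blast
      qed (auto simp: s_def intro: exI[of _ y])
    qed
    have "s (a + b) = s a + s b \<and> s (a * b) = s a * s b" if ab: "a \<in> K" "b \<in> K" for a b
    proof -
      have "cls (s (a + b)) = cls (s a + s b)" "cls (s (a * b)) = cls (s a * s b)"
        using ab cs hom[of "cls a" "cls b"] by (simp_all flip: cls_add cls_mult)
      thus ?thesis using cls_inj cs ab by (metis K_add K_mult)
    qed
    moreover have "s (emb c) = emb c" for c using sL L(2) by blast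
    moreover have "s a = a" if "a \<notin> K" for a using that by (simp add: s_def)
    ultimately have "aut s" unfolding aut_def bij_def using inj \<open>surj s\<close> sK by blast
    hence "s f = f" using f(2) sL by blast
    thus ?thesis using cs(1)[OF f(1)] by simp
  qed
  hence "cls f \<in> cls ` L" using g f(1) unfolding galois_extension_def by auto
  thus ?thesis using cls_image_iff[OF f(1) L(1)] by blast
qed

lemma galois_extension_rat_fixed:
  assumes g: "galois_extension FF (cls ` rat x)" and x: "x \<in> K"
    and c: "c \<in> K" "\<And>s. s \<in> Gal x \<Longrightarrow> s c = c"
  shows "c \<in> rat x"
proof (rule galois_extension_fixed[OF g rat_subset[OF x] _ c(1)])
  show "range emb \<subseteq> rat x" using rat_emb by blast
  fix s assume s: "aut s" "\<And>a. a \<in> rat x \<Longrightarrow> s a = a"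
  have "s x = x" by (rule s(2)) (rule rat_self)
  thus "s c = c" by (intro c(2) CollectI conjI s(1))
qed

lemma galois_extensionI:
  assumes L: "L \<subseteq> K" "subfield (cls ` L) FF" "range emb \<subseteq> L"
    and alg: "\<And>f. f \<in> K \<Longrightarrow> ring.algebraic FF (cls ` L) (cls f)"
    and fixed: "\<And>f. f \<in> K \<Longrightarrow> (\<And>s. aut s \<Longrightarrow> (\<And>a. a \<in> L \<Longrightarrow> s a = a) \<Longrightarrow> s f = f) \<Longrightarrow> f \<in> L"
  shows "galois_extension FF (cls ` L)"
proof -
  have 1: "\<forall>f\<in>carrier FF. ring.algebraic FF (cls ` L) f" unfolding carrier_FF using alg by blast
  have 2: "\<forall>f\<in>carrier FF. (\<forall>s\<in>ring_iso FF FF. (\<forall>g\<in>cls ` L. s g = g) \<longrightarrow> s f = f) \<longrightarrow> f \<in> cls ` L"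
  proof (intro ballI impI)
  fix f assume f: "f \<in> carrier FF"
  then obtain r where r: "f = cls r" "r \<in> K" unfolding carrier_FF by blast
  assume inv: "\<forall>s\<in>ring_iso FF FF. (\<forall>g\<in>cls ` L. s g = g) \<longrightarrow> s f = f"
  have "r \<in> L"
  proof (rule fixed[OF r(2)])
    fix s assume s: "aut s" "\<And>a. a \<in> L \<Longrightarrow> s a = a"
    define S where "S g = cls (s (the_inv_into K cls g))" for g
    have Sc: "S (cls a) = cls (s a)" if "a \<in> K" for a
      unfolding S_def using the_inv_into_f_f[OF inj_on_cls that] by simp
    interpret s: phom K s by (rule aut_phom[OF s(1)])
    have 1: "S \<in> carrier FF \<rightarrow> carrier FF" using Sc aut_in_K[OF s(1)] by (auto simp: carrier_FF)
    have 2: "S \<one>\<^bsub>FF\<^esub> = \<one>\<^bsub>FF\<^esub>" unfolding cls_one using Sc[of 1] s.p_one by simp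
    have 3: "bij_betw S (carrier FF) (carrier FF)"
        unfolding bij_betw_def carrier_FF
      proof
        show "inj_on S (cls ` K)"
        proof (rule inj_onI)
          fix x y assume "x \<in> cls ` K" "y \<in> cls ` K" "S x = S y"
          then obtain a b where ab: "x = cls a" "y = cls b" "a \<in> K" "b \<in> K" "cls (s a) = cls (s b)" using Sc by auto
          hence "s a = s b" using cls_inj[of "s a" "s b"] aut_in_K[OF s(1)] by simp
          thus "x = y" using ab aut_inj[OF s(1)] by simp
        qed
        have "S ` cls ` K = cls ` s ` K" using Sc by (auto simp: image_image)
        thus "S ` cls ` K = cls ` K" using s(1) unfolding aut_def by simp
      qed
    have 4: "S (x \<otimes>\<^bsub>FF\<^esub> y) = S x \<otimes>\<^bsub>FF\<^esub> S y \<and> S (x \<oplus>\<^bsub>FF\<^esub> y) = S x \<oplus>\<^bsub>FF\<^esub> S y"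
      if xy: "x \<in> carrier FF" "y \<in> carrier FF" for x y
    proof -
      obtain a b where ab: "x = cls a" "y = cls b" "a \<in> K" "b \<in> K" using xy unfolding carrier_FF by blast
      thus ?thesis using ab Sc aut_in_K[OF s(1)] by (simp_all add: cls_mult cls_add s.p_mult s.p_add)
    qed
    have "S \<in> ring_iso FF FF" unfolding ring_iso_def ring_hom_def using 1 2 3 4 by blast
    moreover have "\<forall>g\<in>cls ` L. S g = g" using Sc s(2) L(1) by auto
    ultimately have "S f = f" using inv by blast
    hence "cls (s r) = cls r" using Sc r by simp
    thus "s r = r" using cls_inj[of "s r" r] aut_in_K[OF s(1)] r(2) by simp
  qed
  thus "f \<in> cls ` L" using r by blast
  qed
  show ?thesis unfolding galois_extension_def using field_FF L(2) 1 2 by blast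
qed

lemma cls_power: "r \<in> K \<Longrightarrow> cls r [^]\<^bsub>FF\<^esub> (n::nat) = cls (r ^ n)"
  by (induction n) (simp_all add: cls_one cls_mult mult.commute)

lemma algebraicI_poly:
  assumes L: "L \<subseteq> K" and f: "f \<in> K" and p: "p \<noteq> 0" "\<And>i. coeff p i \<in> L" "poly p f = 0"
  shows "ring.algebraic FF (cls ` L) (cls f)"
proof -
  \<comment> \<open>Polynomials over a ring structure are coefficient lists with the leading
    coefficient first, hence the reversal.\<close>
  have ev: "FF.eval (map cls (rev cs)) (cls f) = cls (poly (Poly cs) f)" if "set cs \<subseteq> K" for cs
    using that
  proof (induction cs rule: rev_induct)
    case (snoc c cs)
    have k: "poly (Poly cs) f \<in> K" using snoc.prems
    proof (induction cs)
      case (Cons a cs)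
      thus ?case using f by auto
    qed auto
    have "poly (Poly (cs @ [c])) f = c * f ^ length cs + poly (Poly cs) f"
      by (simp add: Poly_append poly_monom monom_0 mult.commute)
    thus ?case using snoc k f by (simp add: cls_power cls_mult cls_add)
  qed (simp add: cls_zero)
  let ?p = "map cls (rev (coeffs p))"
  have sc: "set (coeffs p) \<subseteq> L" using p(2) by (auto simp: coeffs_def)
  have "polynomial\<^bsub>FF\<^esub> (cls ` L) ?p"
    unfolding polynomial_def
  proof (intro disjI2 conjI)
    show "set ?p \<subseteq> cls ` L" using sc by auto
    have "hd ?p = cls (lead_coeff p)" using p(1) by (simp add: hd_map hd_rev last_coeffs_eq_coeff_degree)
    moreover have "lead_coeff p \<in> K" using p(2) L by blast
    ultimately show "hd ?p \<noteq> \<zero>\<^bsub>FF\<^esub>" using p(1) cls_inj[of "lead_coeff p" 0] by (simp add: cls_zero)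
  qed
  hence "?p \<in> carrier ((cls ` L)[X]\<^bsub>FF\<^esub>)" unfolding univ_poly_carrier .
  moreover have "?p \<noteq> []" using p(1) by simp
  moreover have "FF.eval ?p (cls f) = \<zero>\<^bsub>FF\<^esub>" using ev[of "coeffs p"] sc L p(3) by (simp add: cls_zero)
  ultimately show ?thesis using FF.algebraicI by (simp add: over_def)
qed

end

section \<open>Generalities on finite groups and products of linear factors\<close>

text \<open>A Sylow subgroup for r contains some h other than the identity, of order a power of r.
  The last nontrivial element among the iterated r-th powers of h has order r.\<close>

lemma cauchy_theorem:
  assumes G: "group G" "finite (carrier G)" and r: "prime r" "r dvd Coset.order G"
  shows "\<exists>t\<in>carrier G. t \<noteq> \<one>\<^bsub>G\<^esub> \<and> t [^]\<^bsub>G\<^esub> (r::nat) = \<one>\<^bsub>G\<^esub>"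
proof -
  interpret group G by fact
  have o: "Coset.order G > 0" using G(2) by (simp add: order_gt_0_iff_finite)
  obtain a m where am: "Coset.order G = r ^ a * m" "\<not> r dvd m"
    using multiplicity_decompose'[of "Coset.order G" r] o r(1) by (metis not_prime_unit neq0_conv)
  have a: "a > 0" using am r by (cases a) auto
  obtain H where H: "subgroup H G" "card H = r ^ a" using sylow_thm[OF r(1) G(1) am(1) G(2)] by blast
  have cH: "card H > 1" unfolding H(2) by (rule one_less_power[OF prime_gt_1_nat[OF r(1)] a])
  have "\<not> H \<subseteq> {\<one>\<^bsub>G\<^esub>}"
  proof
    assume "H \<subseteq> {\<one>\<^bsub>G\<^esub>}"
    hence "card H \<le> card {\<one>\<^bsub>G\<^esub>}" by (intro card_mono) auto
    thus False using cH by simp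
  qed
  then obtain h where h: "h \<in> H" "h \<noteq> \<one>\<^bsub>G\<^esub>" by blast
  have hG: "h \<in> carrier G" by (rule subgroup.mem_carrier[OF H(1) h(1)])
  interpret H: group "G\<lparr>carrier := H\<rparr>" by (rule subgroup.subgroup_is_group[OF H(1) G(1)])
  have "h \<in> carrier (G\<lparr>carrier := H\<rparr>)" using h(1) by simp
  hence "h [^]\<^bsub>G\<lparr>carrier := H\<rparr>\<^esub> Coset.order (G\<lparr>carrier := H\<rparr>) = \<one>\<^bsub>G\<lparr>carrier := H\<rparr>\<^esub>"
    by (rule H.pow_order_eq_1)
  moreover have "Coset.order (G\<lparr>carrier := H\<rparr>) = card H" "\<one>\<^bsub>G\<lparr>carrier := H\<rparr>\<^esub> = \<one>\<^bsub>G\<^esub>"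
    by (simp_all add: Coset.order_def)
  ultimately have "h [^]\<^bsub>G\<lparr>carrier := H\<rparr>\<^esub> card H = \<one>\<^bsub>G\<^esub>" by simp
  moreover have "h [^]\<^bsub>G\<^esub> card H = h [^]\<^bsub>G\<lparr>carrier := H\<rparr>\<^esub> card H" by (rule nat_pow_consistent)
  ultimately have "h [^]\<^bsub>G\<^esub> (r ^ a) = \<one>\<^bsub>G\<^esub>" using H(2) by metis
  define j where "j = (LEAST j. h [^]\<^bsub>G\<^esub> (r ^ j) = \<one>\<^bsub>G\<^esub>)"
  have j: "h [^]\<^bsub>G\<^esub> (r ^ j) = \<one>\<^bsub>G\<^esub>" unfolding j_def by (rule LeastI) fact
  have "j \<noteq> 0" using j h(2) hG by (metis nat_pow_eone power_0)
  then obtain i where i: "j = Suc i" by (cases j) auto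
  have "h [^]\<^bsub>G\<^esub> (r ^ i) \<noteq> \<one>\<^bsub>G\<^esub>" using not_less_Least[of i "\<lambda>j. h [^]\<^bsub>G\<^esub> (r ^ j) = \<one>\<^bsub>G\<^esub>"] i unfolding j_def by simp
  moreover have "(h [^]\<^bsub>G\<^esub> (r ^ i)) [^]\<^bsub>G\<^esub> r = \<one>\<^bsub>G\<^esub>" using j hG unfolding i by (simp add: nat_pow_pow mult.commute)
  ultimately show ?thesis using hG by (intro bexI[of _ "h [^]\<^bsub>G\<^esub> (r ^ i)"]) auto
qed

lemma prod_linear_double:
  fixes r :: "'a \<Rightarrow> 'b::idom"
  assumes "finite A" "x \<in> A" "y \<in> A" "x \<noteq> y" "r x = r y"
  shows "poly (pderiv (\<Prod>x\<in>A. [:- r x, 1:])) (r x) = 0"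
proof -
  have "(\<Prod>x\<in>A. [:- r x, 1:]) = [:- r x, 1:] * ([:- r y, 1:] * (\<Prod>x\<in>A - {x} - {y}. [:- r x, 1:]))"
    using assms by (simp add: prod.remove[of A x] prod.remove[of "A - {x}" y])
  thus ?thesis using assms(5) by (simp add: pderiv_mult del: mult_pCons_left)
qed

lemma prod_linear_simple:
  fixes r :: "'a \<Rightarrow> 'b::idom"
  assumes "finite A" "x \<in> A" "inj_on r A"
  shows "poly (pderiv (\<Prod>x\<in>A. [:- r x, 1:])) (r x) \<noteq> 0"
proof -
  have "(\<Prod>x\<in>A. [:- r x, 1:]) = [:- r x, 1:] * (\<Prod>x\<in>A - {x}. [:- r x, 1:])"
    using assms by (simp add: prod.remove[of A x])
  hence "poly (pderiv (\<Prod>x\<in>A. [:- r x, 1:])) (r x) = poly (\<Prod>x\<in>A - {x}. [:- r x, 1:]) (r x)"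
    by (simp add: pderiv_mult pderiv_pCons del: mult_pCons_left)
  also have "\<dots> = (\<Prod>y\<in>A - {x}. r x - r y)" by (simp add: poly_prod)
  also have "\<dots> \<noteq> 0" using assms by (auto simp: prod_zero_iff inj_on_def)
  finally show ?thesis .
qed

lemma poly_prod_linear_eq_0:
  fixes r :: "'a \<Rightarrow> 'b::idom"
  assumes "finite A"
  shows "poly (\<Prod>x\<in>A. [:- r x, 1:]) c = 0 \<longleftrightarrow> c \<in> r ` A"
  using assms by (auto simp: poly_prod prod_zero_iff)

lemma degree_prod_linear:
  fixes r :: "'a \<Rightarrow> 'b::idom"
  shows "degree (\<Prod>x\<in>A. [:- r x, 1:]) = card A" "lead_coeff (\<Prod>x\<in>A. [:- r x, 1:]) = 1"
  by (subst degree_prod_eq_sum_degree) (auto simp: lead_coeff_prod)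

lemma order_prod_linear:
  fixes r :: "'a \<Rightarrow> 'b::idom"
  assumes "finite A"
  shows "order c (\<Prod>x\<in>A. [:- r x, 1:]) = card {x \<in> A. r x = c}"
  using assms
proof (induction A rule: finite_induct)
  case (insert x A)
  have "order c (\<Prod>x\<in>insert x A. [:- r x, 1:]) = order c [:- r x, 1:] + order c (\<Prod>x\<in>A. [:- r x, 1:])"
    using insert by (subst order_mult[symmetric]) (auto simp: prod_zero_iff simp del: mult_pCons_left)
  also have "order c [:- r x, 1:] = (if r x = c then 1 else 0)"
    using order_power_n_n[of "r x" 1] order_0I[of "[:- r x, 1:]" c] by auto
  also have "(if r x = c then 1 else 0) + order c (\<Prod>x\<in>A. [:- r x, 1:]) = card {y \<in> insert x A. r y = c}"
  proof -
    have "{y \<in> insert x A. r y = c} = (if r x = c then insert x {y \<in> A. r y = c} else {y \<in> A. r y = c})" by auto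
    thus ?thesis using insert by simp
  qed
  finally show ?case .
qed auto

lemma size_proots_alg_closed:
  fixes p :: "'k::alg_closed_field poly"
  assumes "p \<noteq> 0"
  shows "size (proots p) = degree p"
  using assms
proof (induction p rule: alg_closed_poly_induct)
  case (linear r q)
  thus ?case by (subst proots_mult, simp, simp, subst degree_mult_eq) auto
qed auto

section \<open>The Galois closure of a pair of projections\<close>

text \<open>Here \<open>K = k(x, y)\<close> with \<open>A(x) = x y^(d-1)\<close>, and both \<open>K / k(x)\<close> and \<open>K / k(y)\<close> are Galois.\<close>

locale norm_pair = func_field emb K for emb :: "'k::alg_closed_field \<Rightarrow> 'e::field" and K +
  fixes x y :: 'e and A :: "'k poly" and d p :: nat and GP GQ :: "('e \<Rightarrow> 'e) set"
  assumes xK: "x \<in> K" and yK: "y \<in> K" and y_trans: "y \<notin> range emb"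
    and GP: "GP = Gal x" and GQ: "GQ = Gal y"
    and GPg: "agroup GP" and GQg: "agroup GQ" and cardP: "card GP = d - 1" and cardQ: "card GQ = d"
    and gen: "aut s \<Longrightarrow> s x = x \<Longrightarrow> s y = y \<Longrightarrow> s = id"
    and fixP: "f \<in> K \<Longrightarrow> (\<And>s. s \<in> GP \<Longrightarrow> s f = f) \<Longrightarrow> f \<in> rat x"
    and fixQ: "f \<in> K \<Longrightarrow> (\<And>s. s \<in> GQ \<Longrightarrow> s f = f) \<Longrightarrow> f \<in> rat y"
    and normal: "s \<in> GP \<Longrightarrow> t \<in> GQ \<Longrightarrow> s (t (ainv s y)) = y"
    and zeta_ex: "s \<in> GP \<Longrightarrow> \<exists>z. s y = emb z * y"
    and degA: "degree A = d" and A0: "poly A 0 \<noteq> 0"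
    and split: "map_poly emb A - [:0, y ^ (d - 1):] = smult (emb (lead_coeff A)) (\<Prod>g\<in>GQ. [:- g x, 1:])"
    and prime_p: "prime p" and char_p: "of_nat p = (0 :: 'k)" and p_dvd: "p dvd d" and d_ge: "d \<ge> 3"
begin

lemma autP: "s \<in> GP \<Longrightarrow> aut s" and P_x: "s \<in> GP \<Longrightarrow> s x = x"
  and autQ: "t \<in> GQ \<Longrightarrow> aut t" and Q_y: "t \<in> GQ \<Longrightarrow> t y = y"
  unfolding GP GQ by auto

lemma finP: "finite GP" and finQ: "finite GQ" and idP: "id \<in> GP" and idQ: "id \<in> GQ"
  and compP: "s \<in> GP \<Longrightarrow> s' \<in> GP \<Longrightarrow> s \<circ> s' \<in> GP" and compQ: "t \<in> GQ \<Longrightarrow> t' \<in> GQ \<Longrightarrow> t \<circ> t' \<in> GQ"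
  using GPg GQg unfolding agroup_def by auto

lemma invP: "s \<in> GP \<Longrightarrow> ainv s \<in> GP"
  unfolding GP using aut_inv aut_inv_apply(2)[of s x] by auto

lemma invQ: "s \<in> GQ \<Longrightarrow> ainv s \<in> GQ"
  unfolding GQ using aut_inv aut_inv_apply(2)[of s y] by auto

lemma d_zero: "of_nat d = (0 :: 'k)"
  using p_dvd char_p by (auto elim!: dvdE)

definition a where "a = lead_coeff A"

lemma a_nonzero: "a \<noteq> 0"
  using degA d_ge unfolding a_def by auto

definition cj :: "('e \<Rightarrow> 'e) \<Rightarrow> ('e \<Rightarrow> 'e) \<Rightarrow> 'e \<Rightarrow> 'e" where "cj s t = s \<circ> t \<circ> ainv s"

lemma cj_in: "s \<in> GP \<Longrightarrow> t \<in> GQ \<Longrightarrow> cj s t \<in> GQ"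
  unfolding cj_def using normal[of s t] by (auto simp: GP GQ intro!: aut_comp aut_inv)

lemma P_x': "s \<in> GP \<Longrightarrow> ainv s x = x"
  using P_x[OF invP] .

lemma cj_x: "s \<in> GP \<Longrightarrow> s (t x) = cj s t x"
  unfolding cj_def using P_x' by simp

lemma cj_id: "cj s id = id \<longleftrightarrow> True" if "s \<in> GP"
  unfolding cj_def using aut_inv_apply(1)[OF autP[OF that]] by auto

definition zeta :: "('e \<Rightarrow> 'e) \<Rightarrow> 'k" where "zeta s = (SOME z. s y = emb z * y)"

lemma zeta: "s \<in> GP \<Longrightarrow> s y = emb (zeta s) * y"
  unfolding zeta_def by (rule someI_ex) (rule zeta_ex)

lemma y0: "y \<noteq> 0"
  using y_trans h_zero by (metis rangeI)

lemma zeta_nonzero: "s \<in> GP \<Longrightarrow> zeta s \<noteq> 0"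
  using zeta[of s] aut_zero[OF autP, of s y] y0 by auto

lemma zeta_1: "s \<in> GP \<Longrightarrow> zeta s = 1 \<Longrightarrow> s = id"
  using zeta[of s] gen[of s] autP[of s] P_x[of s] by simp

text \<open>A value of \<open>g e\<close> at V is the value of e at a translate of V. This moves
  group elements from functions to places, where conjugacy applies.\<close>

lemma place_shift:
  assumes g: "aut g" and V: "place V"
  shows "place (ainv g ` V)" "g e \<in> V \<Longrightarrow> e \<in> ainv g ` V \<and> val (ainv g ` V) e = val V (g e)"
proof -
  show "place (ainv g ` V)" by (rule place_aut(1)[OF aut_inv[OF g] V])
  assume e: "g e \<in> V"
  show "e \<in> ainv g ` V \<and> val (ainv g ` V) e = val V (g e)"
    using place_aut(3)[OF aut_inv[OF g] V e] aut_inv_apply(2)[OF g, of e] e by (metis imageI)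
qed

lemma lead_1: "coeff A d = a" using degA by (simp add: a_def)

text \<open>By \<open>split\<close> the conjugates of x are the roots of A(X) - X y^(d-1), whose
  leading coefficient is a constant; so they are integral over k[y]. Reducing the factorization at V
  gives the second claim.\<close>

lemma gx_in_place:
  assumes V: "place V" and y: "y \<in> V"
  shows "t \<in> GQ \<Longrightarrow> t x \<in> V"
    and "smult a (\<Prod>g\<in>GQ. [:- val V (g x), 1:]) = A - [:0, val V y ^ (d - 1):]"
proof -
  interpret v: phom V "val V" by (rule val_phom[OF V])
  let ?R = "map_poly emb A - [:0, y ^ (d - 1):]"
  have "coeff ?R i \<in> V" for i
    using V y by (cases i) (auto simp: coeff_map_poly coeff_pCons intro!: v.B_diff split: nat.splits)
  hence R: "v.Bpoly ?R" by (simp add: v.Bpoly_def)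
  have inV: "t x \<in> V" if "t \<in> GQ" for t
  proof (rule place_integral[OF V, of ?R])
    show "coeff ?R i \<in> V" for i by fact
    have lc: "lead_coeff ?R = emb a"
      unfolding split using degree_prod_linear(2)[of "\<lambda>g. g x" GQ] by (simp add: a_def)
    show "?R \<noteq> 0" using lc a_nonzero by auto
    show "inverse (lead_coeff ?R) \<in> V" unfolding lc using V by (simp flip: emb_inverse)
    show "t x \<in> K" using aut_in_K[OF autQ[OF that]] xK by simp
    show "poly ?R (t x) = 0" unfolding split using that poly_prod_linear_eq_0[OF finQ, of "\<lambda>g. g x" "t x"] by auto
  qed
  show "t \<in> GQ \<Longrightarrow> t x \<in> V" by (rule inV)
  have "map_poly (val V) ?R = A - [:0, val V y ^ (d - 1):]"
  proof (rule poly_eqI)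
    fix i
    show "coeff (map_poly (val V) ?R) i = coeff (A - [:0, val V y ^ (d - 1):]) i"
      using V y by (auto simp: coeff_map_poly v.p_zero coeff_pCons v.p_diff v.p_power split: nat.splits)
  qed
  moreover have "map_poly (val V) ?R = smult a (\<Prod>g\<in>GQ. [:- val V (g x), 1:])"
  proof -
    have l: "v.Bpoly (\<Prod>g\<in>GQ. [:- g x, 1:])" "map_poly (val V) (\<Prod>g\<in>GQ. [:- g x, 1:]) = (\<Prod>g\<in>GQ. [:- val V (g x), 1:])"
      by (rule v.map_p_prod_linear; use inV in blast)+
    show ?thesis unfolding split using v.map_p_smult[OF place_emb[OF V] l(1), of a] l(2) V by (simp add: a_def)
  qed
  ultimately show "smult a (\<Prod>g\<in>GQ. [:- val V (g x), 1:]) = A - [:0, val V y ^ (d - 1):]" by simp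
qed

lemma conjugateQ:
  assumes V: "place V" "y \<in> V" and V': "place V'" "y \<in> V'" "val V' y = val V y"
  shows "\<exists>h\<in>GQ. \<forall>g\<in>GQ. val V' (g x) = val V (h (g x))"
proof -
  have "\<exists>h\<in>GQ. \<forall>e\<in>(\<lambda>g. g x) ` GQ. val V' e = val V (h e)"
  proof (rule places_conjugate[OF GQg V(1) V'(1)])
    show "finite ((\<lambda>g. g x) ` GQ)" using finQ by simp
    show "(\<lambda>g. g x) ` GQ \<subseteq> V" "(\<lambda>g. g x) ` GQ \<subseteq> V'" using gx_in_place(1)[OF V] gx_in_place(1)[OF V'(1,2)] by auto
    show "s e \<in> (\<lambda>g. g x) ` GQ" if se: "s \<in> GQ" "e \<in> (\<lambda>g. g x) ` GQ" for s e
    proof -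
      obtain g where g: "g \<in> GQ" "e = g x" using se(2) by blast
      have "s e = (s \<circ> g) x" using g by simp
      thus ?thesis using compQ[OF se(1) g(1)] by blast
    qed
    show "val V' c = val V c" if "c \<in> K" "\<And>s. s \<in> GQ \<Longrightarrow> s c = c" "c \<in> V" "c \<in> V'" for c
    proof -
      have "c \<in> rat y" by (rule fixQ[OF that(1)]) (rule that(2))
      thus ?thesis using rat_val[OF V(1) V'(1) V(2) V'(2) V'(3)[symmetric] _ that(3)] by simp
    qed
  qed
  thus ?thesis by blast
qed

text \<open>Here the orbit of y must be included in T, so that one element of \<open>GP\<close>
  accounts for the values of the conjugates of x and for that of y together.\<close>

lemma conjugateP:
  assumes V: "place V" "y \<in> V" and V': "place V'" "y \<in> V'" and x: "val V' x = val V x"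
  shows "\<exists>s\<in>GP. (\<forall>g\<in>GQ. val V' (g x) = val V (s (g x))) \<and> val V' y = val V (s y)"
proof -
  let ?T = "(\<lambda>g. g x) ` GQ \<union> (\<lambda>s. s y) ` GP"
  have "\<exists>s\<in>GP. \<forall>e\<in>?T. val V' e = val V (s e)"
  proof (rule places_conjugate[OF GPg V(1) V'(1)])
    show "finite ?T" using finQ finP by simp
    have *: "s y \<in> W" if "place W" "y \<in> W" "s \<in> GP" for W s
      using phom.B_mult[OF val_phom[OF that(1)] place_emb[OF that(1)] that(2)] zeta[OF that(3)] by simp
    show "?T \<subseteq> V" "?T \<subseteq> V'" using gx_in_place(1)[OF V] gx_in_place(1)[OF V'(1,2)] * V V' by auto
    show "s e \<in> ?T" if se: "s \<in> GP" "e \<in> ?T" for s e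
      using se(2)
    proof
      assume "e \<in> (\<lambda>g. g x) ` GQ"
      then obtain g where g: "g \<in> GQ" "e = g x" by blast
      thus ?thesis using cj_x[OF se(1), of g] cj_in[OF se(1) g(1)] by auto
    next
      assume "e \<in> (\<lambda>s. s y) ` GP"
      then obtain s' where s': "s' \<in> GP" "e = s' y" by blast
      have "s e = (s \<circ> s') y" using s' by simp
      thus ?thesis using compP[OF se(1) s'(1)] by blast
    qed
    have xV: "x \<in> V" "x \<in> V'" using gx_in_place(1)[OF V idQ] gx_in_place(1)[OF V' idQ] by auto
    show "val V' c = val V c" if "c \<in> K" "\<And>s. s \<in> GP \<Longrightarrow> s c = c" "c \<in> V" "c \<in> V'" for c
    proof -
      have "c \<in> rat x" by (rule fixP[OF that(1)]) (rule that(2))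
      thus ?thesis using rat_val[OF V(1) V'(1) xV x[symmetric] _ that(3)] by simp
    qed
  qed
  then obtain s where s: "s \<in> GP" "\<forall>e\<in>?T. val V' e = val V (s e)" by blast
  have "y \<in> ?T" by (rule UnI2, rule image_eqI[of _ _ id]) (simp_all add: idP)
  thus ?thesis using s by blast
qed

text \<open>Where y has a pole, the conjugates of x may have one too. Dividing A(x) = x y^(d-1) by
  y^d gives an equation for x / y whose coefficients are regular there.\<close>

definition xi :: "('e \<Rightarrow> 'e) \<Rightarrow> 'e" where "xi g = g x / y"

lemma xi_shift: "h \<in> GQ \<Longrightarrow> g \<in> GQ \<Longrightarrow> h (xi g) = xi (h \<circ> g)"
  unfolding xi_def using aut_divide[OF autQ, of h "g x" y] aut_in_K[OF autQ, of g x] xK yK Q_y[of h] by simp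

lemma xi_K: "g \<in> GQ \<Longrightarrow> xi g \<in> K"
  unfolding xi_def using aut_in_K[OF autQ, of g x] xK yK by simp

text \<open>The substitution of y T for the variable, followed by division by y^d, turns the
  equation for the conjugates of x into the one for the \<open>xi g\<close>. The outer
  \<open>map_poly\<close> is the identity.\<close>

lemma xi_poly:
  "smult (emb a) (\<Prod>g\<in>GQ. [:- xi g, 1:]) = map_poly (\<lambda>c. c) (\<Sum>i\<le>d. monom ((emb (coeff A i) - (if i = 1 then y ^ (d - 1) else 0)) * inverse y ^ (d - i)) i)"
proof -
  let ?R = "map_poly emb A - [:0, y ^ (d - 1):]"
  have cR: "coeff ?R i = emb (coeff A i) - (if i = 1 then y ^ (d - 1) else 0)" for i
    by (auto simp: coeff_map_poly coeff_pCons split: nat.splits)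
  have e: "pcompose [:- g x, 1:] [:0, y:] = smult y [:- xi g, 1:]" for g
    using y0 by (simp add: pcompose_pCons xi_def)
  have "pcompose ?R [:0, y:] = smult (emb a) (\<Prod>g\<in>GQ. smult y [:- xi g, 1:])"
    unfolding split pcompose_smult pcompose_prod e a_def ..
  also have "\<dots> = smult (y ^ d) (smult (emb a) (\<Prod>g\<in>GQ. [:- xi g, 1:]))"
    unfolding prod_smult by (simp add: cardQ mult.commute)
  finally have 1: "pcompose ?R [:0, y:] = smult (y ^ d) (smult (emb a) (\<Prod>g\<in>GQ. [:- xi g, 1:]))" .
  show ?thesis
  proof (rule poly_eqI)
    fix i
    have "coeff (pcompose ?R [:0, y:]) i = coeff ?R i * y ^ i"
      using coeff_pcompose_linear[of ?R y i] by (simp add: mult.commute)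
    hence c1: "y ^ d * coeff (smult (emb a) (\<Prod>g\<in>GQ. [:- xi g, 1:])) i = coeff ?R i * y ^ i"
      using arg_cong[OF 1, of "\<lambda>p. coeff p i"] by simp
    show "coeff (smult (emb a) (\<Prod>g\<in>GQ. [:- xi g, 1:])) i =
      coeff (map_poly (\<lambda>c. c) (\<Sum>i\<le>d. monom ((emb (coeff A i) - (if i = 1 then y ^ (d - 1) else 0)) * inverse y ^ (d - i)) i)) i"
    proof (cases "i \<le> d")
      case True
      hence e: "y ^ d = y ^ i * y ^ (d - i)" by (simp flip: power_add)
      define S where "S = coeff (smult (emb a) (\<Prod>g\<in>GQ. [:- xi g, 1:])) i"
      have "y ^ i * (y ^ (d - i) * S) = y ^ i * coeff ?R i"
        using c1 unfolding S_def[symmetric] e by (simp only: mult_ac)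
      hence r: "coeff ?R i = y ^ (d - i) * S" using y0 by (metis mult_left_cancel power_not_zero)
      have "S = coeff ?R i * inverse y ^ (d - i)"
        unfolding r using y0 by (simp add: power_inverse)
      hence "coeff (smult (emb a) (\<Prod>g\<in>GQ. [:- xi g, 1:])) i = coeff ?R i * inverse y ^ (d - i)"
        unfolding S_def .
      thus ?thesis unfolding cR using True by (simp add: coeff_sum map_poly_idI')
    next
      case False
      hence "coeff (\<Prod>g\<in>GQ. [:- xi g, 1:]) i = 0"
        using degree_prod_linear(1)[of xi GQ] cardQ by (intro coeff_eq_0) simp
      thus ?thesis using False by (simp add: coeff_sum map_poly_idI')
    qed
  qed
qed

text \<open>Written in 1 / y the coefficients are regular, and at 1 / y = 0 only the terms of
  degrees d and 1 survive.\<close>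

lemma infinite_place:
  assumes V: "place V" and t: "inverse y \<in> V" "val V (inverse y) = 0"
  shows "g \<in> GQ \<Longrightarrow> xi g \<in> V"
    and "smult a (\<Prod>g\<in>GQ. [:- val V (xi g), 1:]) = monom a d - [:0, 1:]"
proof -
  interpret v: phom V "val V" by (rule val_phom[OF V])
  let ?R = "smult (emb a) (\<Prod>g\<in>GQ. [:- xi g, 1:])"
  have cR: "coeff ?R i = (if i \<le> d then (emb (coeff A i) - (if i = 1 then y ^ (d - 1) else 0)) * inverse y ^ (d - i) else 0)" for i
    unfolding xi_poly by (simp add: coeff_sum map_poly_idI')
  have c1: "coeff ?R i = (if i = 1 then emb (coeff A 1) * inverse y ^ (d - 1) - 1 else if i \<le> d then emb (coeff A i) * inverse y ^ (d - i) else 0)" for i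
    unfolding cR using d_ge y0 by (auto simp: left_diff_distrib simp flip: power_mult_distrib)
  have cV: "coeff ?R i \<in> V" for i
    unfolding c1 using t V by auto
  have cv: "val V (coeff ?R i) = coeff (monom a d - [:0, 1:]) i" for i
  proof -
    have z: "d - 1 \<noteq> 0" "d \<noteq> 1" "d \<noteq> 0" using d_ge by auto
    consider "i = 1" | "i = d" | "i \<noteq> 1" "i < d" | "i > d" using d_ge by linarith
    thus ?thesis
    proof cases
      case 1
      thus ?thesis unfolding c1 using t V z by (simp add: v.p_diff v.p_mult v.p_power v.p_one)
    next
      case 2
      have "coeff [:0, 1 :: 'k:] d = 0" using d_ge by (cases d) (auto simp: coeff_pCons split: nat.splits)
      thus ?thesis unfolding c1 using 2 t V z lead_1 by (simp add: v.p_one)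
    next
      case 3
      have "coeff [:0, 1 :: 'k:] i = 0" using 3 by (cases i) (auto simp: coeff_pCons split: nat.splits)
      thus ?thesis unfolding c1 using 3 t V by (simp add: v.p_mult v.p_power power_0_left)
    next
      case 4
      have "coeff [:0, 1 :: 'k:] i = 0" using 4 d_ge by (cases i) (auto simp: coeff_pCons split: nat.splits)
      thus ?thesis unfolding c1 using 4 d_ge v.p_zero by simp
    qed
  qed
  have lc: "lead_coeff ?R = emb a" using degree_prod_linear(2)[of xi GQ] by simp
  have inV: "xi g \<in> V" if "g \<in> GQ" for g
  proof (rule place_integral[OF V, of ?R])
    show "?R \<noteq> 0" using lc a_nonzero by auto
    show "inverse (lead_coeff ?R) \<in> V" unfolding lc using V by (simp flip: emb_inverse)
    show "poly ?R (xi g) = 0" using that poly_prod_linear_eq_0[OF finQ, of xi "xi g"] by auto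
  qed (use cV xi_K that in auto)
  show "g \<in> GQ \<Longrightarrow> xi g \<in> V" by (rule inV)
  have l: "v.Bpoly (\<Prod>g\<in>GQ. [:- xi g, 1:])" "map_poly (val V) (\<Prod>g\<in>GQ. [:- xi g, 1:]) = (\<Prod>g\<in>GQ. [:- val V (xi g), 1:])"
    by (rule v.map_p_prod_linear; use inV in blast)+
  have "smult a (\<Prod>g\<in>GQ. [:- val V (xi g), 1:]) = map_poly (val V) ?R"
    using v.map_p_smult[OF place_emb[OF V] l(1), of a] l(2) V by simp
  also have "\<dots> = monom a d - [:0, 1:]"
    by (rule poly_eqI) (simp only: coeff_map_poly[where f = "val V", OF v.p_zero] cv)
  finally show "smult a (\<Prod>g\<in>GQ. [:- val V (xi g), 1:]) = monom a d - [:0, 1:]" .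
qed

text \<open>The values of \<open>g x / y\<close> at a place over infinity are distinct, and \<open>GP\<close> acts on them by
  multiplication with roots of unity.\<close>

lemma chi_exists:
  "\<exists>c. inj_on c GQ \<and> c id = 0 \<and> (\<forall>s\<in>GP. \<forall>g\<in>GQ. c (cj s g) = zeta s * c g)"
proof -
  have iy: "inverse y \<in> K" using yK by simp
  have "inverse y \<notin> range emb"
  proof
    assume "inverse y \<in> range emb"
    then obtain c where "inverse y = emb c" by blast
    hence "y = emb (inverse c)" unfolding emb_inverse by (metis inverse_inverse_eq)
    thus False using y_trans by blast
  qed
  then obtain V where V: "place V" "inverse y \<in> V" "val V (inverse y) = 0" using place_at[OF iy] by blast
  have inj: "inj_on (\<lambda>g. val W (xi g)) GQ" if W: "place W" "inverse y \<in> W" "val W (inverse y) = 0" for W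
  proof (rule inj_onI, rule ccontr)
    fix g h assume gh: "g \<in> GQ" "h \<in> GQ" "val W (xi g) = val W (xi h)" "g \<noteq> h"
    have "poly (pderiv (smult a (\<Prod>g\<in>GQ. [:- val W (xi g), 1:]))) (val W (xi g)) = 0"
      using prod_linear_double[OF finQ gh(1,2,4), of "\<lambda>g. val W (xi g)"] gh(3) by (simp add: pderiv_smult)
    hence "poly (pderiv (monom a d - [:0, 1:])) (val W (xi g)) = 0" unfolding infinite_place(2)[OF W] .
    thus False using d_zero by (simp add: pderiv_diff pderiv_monom pderiv_pCons)
  qed
  have "poly (smult a (\<Prod>g\<in>GQ. [:- val V (xi g), 1:])) 0 = 0"
    unfolding infinite_place(2)[OF V] using d_ge by (simp add: poly_monom)
  hence "0 \<in> (\<lambda>g. val V (xi g)) ` GQ" using a_nonzero poly_prod_linear_eq_0[OF finQ, of "\<lambda>g. val V (xi g)" 0] by simp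
  \<comment> \<open>Zero is a root of the reduced equation. Translating V by g0 gives the identity
    the value 0, and this normalization determines the conjugating element h below.\<close>
  then obtain g0 where g0: "g0 \<in> GQ" "val V (xi g0) = 0" by auto
  define V1 where "V1 = ainv g0 ` V"
  have ty: "t (inverse y) = inverse y" if "t \<in> GQ" for t
    using aut_inverse[OF autQ[OF that] yK] Q_y[OF that] by simp
  have V1: "place V1" "inverse y \<in> V1" "val V1 (inverse y) = 0"
    unfolding V1_def using place_shift[OF autQ[OF g0(1)] V(1)] ty[OF g0(1)] V(2,3) by auto
  have c: "val V1 (xi g) = val V (xi (g0 \<circ> g))" if "g \<in> GQ" for g
    unfolding V1_def using place_shift(2)[OF autQ[OF g0(1)] V(1), of "xi g"] xi_shift[OF g0(1) that]
      infinite_place(1)[OF V compQ[OF g0(1) that]] by simp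
  have c0: "val V1 (xi id) = 0" using c[OF idQ] g0 by simp
  have "val V1 (xi (cj s g)) = zeta s * val V1 (xi g)" if s: "s \<in> GP" and g: "g \<in> GQ" for s g
  proof -
    interpret v: phom V1 "val V1" by (rule val_phom[OF V1(1)])
    have sy: "s (inverse y) = emb (inverse (zeta s)) * inverse y"
      using aut_inverse[OF autP[OF s] yK] zeta[OF s] by (simp add: emb_inverse)
    have sxi: "s (xi h) = emb (inverse (zeta s)) * xi (cj s h)" if "h \<in> GQ" for h
    proof -
      have "s (xi h) = s (h x) / s y"
        unfolding xi_def using aut_divide[OF autP[OF s], of "h x" y] aut_in_K[OF autQ[OF that]] xK yK by simp
      thus ?thesis using cj_x[OF s, of h] zeta[OF s] unfolding xi_def by (simp add: emb_inverse divide_inverse mult_ac)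
    qed
    \<comment> \<open>The translate V2 again lies over infinity, so its values are those of V1 moved
      by some h in \<open>GQ\<close>. Comparison at the identity gives h = id, and what remains is
      the factor by which s multiplies y.\<close>
    define V2 where "V2 = ainv s ` V1"
    note sh = place_shift[OF autP[OF s] V1(1), folded V2_def]
    have "s (inverse y) \<in> V1" "val V1 (s (inverse y)) = 0" unfolding sy using V1 by (auto simp: v.p_mult)
    hence V2: "place V2" "inverse y \<in> V2" "val V2 (inverse y) = 0" using sh by auto
    have "\<exists>h\<in>GQ. \<forall>e\<in>xi ` GQ. val V2 e = val V1 (h e)"
    proof (rule places_conjugate[OF GQg V1(1) V2(1)])
      show "finite (xi ` GQ)" using finQ by simp
      show "xi ` GQ \<subseteq> V1" "xi ` GQ \<subseteq> V2" using infinite_place(1)[OF V1] infinite_place(1)[OF V2] by auto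
      show "t e \<in> xi ` GQ" if te: "t \<in> GQ" "e \<in> xi ` GQ" for t e
      proof -
        obtain g where g: "g \<in> GQ" "e = xi g" using te(2) by blast
        have "t e = xi (t \<circ> g)" using xi_shift[OF te(1) g(1)] g(2) by simp
        thus ?thesis using compQ[OF te(1) g(1)] by blast
      qed
      show "val V2 c = val V1 c" if c: "c \<in> K" "\<And>s. s \<in> GQ \<Longrightarrow> s c = c" "c \<in> V1" "c \<in> V2" for c
      proof -
        have "c \<in> rat y" by (rule fixQ[OF c(1)]) (rule c(2))
        moreover have "rat y \<subseteq> rat (inverse y)"
          using rat_mono[OF rat_inverse[OF rat_self[of "inverse y"]]] by simp
        ultimately have "c \<in> rat (inverse y)" by blast
        thus ?thesis using rat_val[OF V1(1) V2(1) V1(2) V2(2) _ _ c(3)] V1(3) V2(3) by simp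
      qed
    qed
    then obtain h where h: "h \<in> GQ" "\<And>g. g \<in> GQ \<Longrightarrow> val V2 (xi g) = val V1 (xi (h \<circ> g))" using xi_shift by auto
    have v2: "val V2 (xi g) = inverse (zeta s) * val V1 (xi (cj s g))" if "g \<in> GQ" for g
    proof -
      have "s (xi g) \<in> V1" unfolding sxi[OF that] using infinite_place(1)[OF V1 cj_in[OF s that]] V1 by simp
      hence "val V2 (xi g) = val V1 (s (xi g))" using sh(2) by blast
      thus ?thesis unfolding sxi[OF that] using infinite_place(1)[OF V1 cj_in[OF s that]] V1 by (simp add: v.p_mult)
    qed
    have "val V1 (xi (h \<circ> id)) = 0" using h(2)[OF idQ] v2[OF idQ] c0 cj_id[OF s] by simp
    hence "h = id" using inj[OF V1] c0 h(1) idQ unfolding inj_on_def by simp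
    hence "val V1 (xi g) = inverse (zeta s) * val V1 (xi (cj s g))" using h(2)[OF g] v2[OF g] by simp
    thus ?thesis using zeta_nonzero[OF s] by (simp add: field_simps)
  qed
  thus ?thesis using inj[OF V1] c0 by (intro exI[of _ "\<lambda>g. val V1 (xi g)"]) blast
qed

text \<open>By \<open>chi_exists\<close> the conjugate \<open>cj s g\<close> determines
  \<open>zeta s\<close>, hence s. So \<open>GP\<close> yields d - 1 distinct nontrivial elements of
  \<open>GQ\<close>, which has no more of them.\<close>

lemma cj_transitive:
  assumes g: "g \<in> GQ" "g \<noteq> id" and h: "h \<in> GQ" "h \<noteq> id"
  shows "\<exists>s\<in>GP. h = cj s g"
proof -
  obtain c where c: "inj_on c GQ" "c id = 0" "\<And>s g. s \<in> GP \<Longrightarrow> g \<in> GQ \<Longrightarrow> c (cj s g) = zeta s * c g"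
    using chi_exists by blast
  have nz: "c u \<noteq> 0" if "u \<in> GQ" "u \<noteq> id" for u using c(1,2) that idQ unfolding inj_on_def by metis
  have sub: "(\<lambda>s. cj s g) ` GP \<subseteq> GQ - {id}"
  proof
    fix u assume "u \<in> (\<lambda>s. cj s g) ` GP"
    then obtain s where s: "s \<in> GP" "u = cj s g" by blast
    have "c u \<noteq> 0" using c(3)[OF s(1) g(1)] s zeta_nonzero[OF s(1)] nz[OF g] by simp
    thus "u \<in> GQ - {id}" using cj_in[OF s(1) g(1)] s(2) c(2) by auto
  qed
  have "inj_on (\<lambda>s. cj s g) GP"
  proof (rule inj_onI)
    fix s t assume st: "s \<in> GP" "t \<in> GP" "cj s g = cj t g"
    have "zeta s * c g = zeta t * c g"
      unfolding c(3)[OF st(1) g(1), symmetric] c(3)[OF st(2) g(1), symmetric] st(3) ..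
    hence z: "zeta s = zeta t" using nz[OF g] mult_right_cancel by blast
    have u: "ainv t \<circ> s \<in> GP" using st compP invP by blast
    interpret t: phom K "ainv t" by (rule aut_phom[OF aut_inv[OF autP[OF st(2)]]])
    have "(ainv t \<circ> s) y = ainv t (emb (zeta t) * y)" using zeta[OF st(1)] z by simp
    also have "\<dots> = ainv t (t y)" using zeta[OF st(2)] by simp
    finally have "(ainv t \<circ> s) y = y" using aut_inv_apply(2)[OF autP[OF st(2)]] by simp
    hence "ainv t \<circ> s = id" using gen[OF autP[OF u] P_x[OF u]] by blast
    hence "t (ainv t (s e)) = t e" for e by (metis comp_apply id_apply)
    thus "s = t" using aut_inv_apply(1)[OF autP[OF st(2)]] by auto
  qed
  hence "card ((\<lambda>s. cj s g) ` GP) = d - 1" using cardP by (simp add: card_image)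
  moreover have "card (GQ - {id}) = d - 1" using cardQ idQ finQ by simp
  ultimately have "(\<lambda>s. cj s g) ` GP = GQ - {id}" using sub finQ by (intro card_subset_eq) auto
  thus ?thesis using h by blast
qed

end

lemma card_image_fibres:
  assumes "finite A" "\<And>a. a \<in> A \<Longrightarrow> card {b \<in> A. f b = f a} = k"
  shows "card A = card (f ` A) * k"
proof -
  have "card A = (\<Sum>y\<in>f ` A. card {b \<in> A. f b = y})"
    using sum.image_gen[OF assms(1), of "\<lambda>_. 1::nat" f] by simp
  also have "\<dots> = (\<Sum>y\<in>f ` A. k)" using assms(2) by (intro sum.cong) auto
  finally show ?thesis by simp
qed

context norm_pair begin

section \<open>The exponent and the order of GQ\<close>

definition GR :: "('e \<Rightarrow> 'e) monoid" where
  "GR = \<lparr>carrier = GQ, monoid.mult = (\<circ>), one = id\<rparr>"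

lemma ainv_comp: "t \<in> GQ \<Longrightarrow> ainv t \<circ> t = id" "t \<in> GQ \<Longrightarrow> t \<circ> ainv t = id"
  using aut_inv_apply[OF autQ] by auto

lemma ainv_compP: "t \<in> GP \<Longrightarrow> ainv t \<circ> t = id" "t \<in> GP \<Longrightarrow> t \<circ> ainv t = id"
  using aut_inv_apply[OF autP] by auto

lemma group_GR: "group GR"
proof (rule groupI)
  fix t assume "t \<in> carrier GR"
  thus "\<exists>u\<in>carrier GR. u \<otimes>\<^bsub>GR\<^esub> t = \<one>\<^bsub>GR\<^esub>" using ainv_comp invQ by (auto simp: GR_def)
qed (auto simp: GR_def compQ idQ comp_assoc)

lemma cj_comp: "s \<in> GP \<Longrightarrow> cj s (t \<circ> u) = cj s t \<circ> cj s u"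
  using aut_inv_apply(2)[OF autP] by (auto simp: cj_def fun_eq_iff)

lemma cj_cj: "s \<in> GP \<Longrightarrow> s' \<in> GP \<Longrightarrow> cj s (cj s' t) = cj (s \<circ> s') t"
proof -
  assume s: "s \<in> GP" "s' \<in> GP"
  have "ainv (s \<circ> s') = ainv s' \<circ> ainv s"
    by (rule o_inv_distrib) (use s autP aut_bij in auto)
  thus ?thesis by (simp add: cj_def comp_assoc)
qed

lemma cj_id_left: "cj id t = t"
  by (simp add: cj_def)

lemma cj_pow: "s \<in> GP \<Longrightarrow> cj s t [^]\<^bsub>GR\<^esub> (n::nat) = cj s (t [^]\<^bsub>GR\<^esub> n)"
proof (induction n)
  case 0
  interpret G: group GR by (rule group_GR)
  have "\<one>\<^bsub>GR\<^esub> = id" by (simp add: GR_def)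
  thus ?case using cj_id[OF 0] G.nat_pow_0 by metis
next
  case (Suc n)
  interpret G: group GR by (rule group_GR)
  have m: "t \<otimes>\<^bsub>GR\<^esub> u = t \<circ> u" for t u by (simp add: GR_def)
  show ?case unfolding G.nat_pow_Suc m cj_comp[OF Suc.prems] Suc.IH[OF Suc.prems] ..
qed

text \<open>Cauchy's theorem gives one nontrivial element with trivial p-th power, and by
  \<open>cj_transitive\<close> all other nontrivial elements are conjugate to it.\<close>

lemma exponent_p: "t \<in> GQ \<Longrightarrow> t [^]\<^bsub>GR\<^esub> p = id"
proof -
  interpret G: group GR by (rule group_GR)
  assume t: "t \<in> GQ"
  have o: "Coset.order GR = d" by (simp add: Coset.order_def GR_def cardQ)
  obtain t0 where t0: "t0 \<in> GQ" "t0 \<noteq> id" "t0 [^]\<^bsub>GR\<^esub> p = id"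
    using cauchy_theorem[OF group_GR _ prime_p] finQ p_dvd unfolding o by (auto simp: GR_def)
  show ?thesis
  proof (cases "t = id")
    case True
    thus ?thesis using G.nat_pow_one[of p] by (simp add: GR_def)
  next
    case False
    then obtain s where s: "s \<in> GP" "t = cj s t0" using cj_transitive[OF t0(1,2) t] by blast
    thus ?thesis using cj_pow[OF s(1), of t0 p] t0(3) cj_id[OF s(1)] by simp
  qed
qed

text \<open>A prime divisor r of d other than p would give a nontrivial element whose order divides
  both r and p.\<close>

lemma degree_prime_power: "\<exists>e. d = p ^ e"
proof -
  interpret G: group GR by (rule group_GR)
  have o: "Coset.order GR = d" by (simp add: Coset.order_def GR_def cardQ)
  obtain e m where em: "d = p ^ e * m" "\<not> p dvd m"
    using multiplicity_decompose'[of d p] d_ge prime_p by (metis not_numeral_le_zero not_prime_unit)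
  have "m = 1"
  proof (rule ccontr)
    assume "m \<noteq> 1"
    then obtain r where r: "prime r" "r dvd m" using prime_factor_nat by blast
    hence "r \<noteq> p" "r dvd d" using em by auto
    then obtain t where t: "t \<in> GQ" "t \<noteq> id" "t [^]\<^bsub>GR\<^esub> r = id"
      using cauchy_theorem[OF group_GR _ r(1)] finQ unfolding o by (auto simp: GR_def)
    have tc: "t \<in> carrier GR" using t by (simp add: GR_def)
    have "G.ord t dvd r" "G.ord t dvd p"
      using t(3) exponent_p[OF t(1)] G.pow_eq_id[OF tc] by (auto simp: GR_def)
    moreover have "coprime r p" using primes_coprime[OF r(1) prime_p \<open>r \<noteq> p\<close>] .
    ultimately have "G.ord t = 1" by (metis coprime_common_divisor_nat)
    thus False using t(2) G.ord_eq_1[OF tc] by (simp add: GR_def)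
  qed
  thus ?thesis using em by auto
qed

lemma p_dvd_card_subgroup:
  assumes J: "J \<subseteq> GQ" "\<And>t u. t \<in> J \<Longrightarrow> u \<in> J \<Longrightarrow> t \<circ> u \<in> J" "\<And>t. t \<in> J \<Longrightarrow> ainv t \<in> J"
    and t: "t \<in> J" "t \<noteq> id"
  shows "p dvd card J"
proof -
  interpret G: group GR by (rule group_GR)
  have inv: "inv\<^bsub>GR\<^esub> u = ainv u" if "u \<in> GQ" for u
    by (rule G.inv_equality) (use that invQ ainv_comp in \<open>auto simp: GR_def\<close>)
  have "subgroup J GR"
    by (rule G.subgroupI) (use J t inv in \<open>auto simp: GR_def subset_iff\<close>)
  then interpret H: group "GR\<lparr>carrier := J\<rparr>" by (rule subgroup.subgroup_is_group[OF _ group_GR])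
  have tc: "t \<in> carrier (GR\<lparr>carrier := J\<rparr>)" using t by simp
  have "t [^]\<^bsub>GR\<^esub> p = t [^]\<^bsub>GR\<lparr>carrier := J\<rparr>\<^esub> p" by (rule G.nat_pow_consistent)
  hence "t [^]\<^bsub>GR\<lparr>carrier := J\<rparr>\<^esub> p = \<one>\<^bsub>GR\<lparr>carrier := J\<rparr>\<^esub>" using exponent_p[of t] J(1) t(1) by (auto simp: GR_def)
  hence "H.ord t dvd p" using H.pow_eq_id[OF tc] by blast
  moreover have "H.ord t \<noteq> 1" using H.ord_eq_1[OF tc] t(2) by (simp add: GR_def)
  ultimately have "H.ord t = p" using prime_p prime_nat_iff by blast
  moreover have "H.ord t dvd Coset.order (GR\<lparr>carrier := J\<rparr>)" by (rule H.ord_dvd_group_order[OF tc])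
  ultimately show ?thesis by (simp add: Coset.order_def)
qed

text \<open>Stands for the inertia group of V in \<open>GQ\<close>, read off from the values of the
  conjugates of x alone.\<close>

definition stab :: "'e set \<Rightarrow> ('e \<Rightarrow> 'e) set" where
  "stab V = {t \<in> GQ. \<forall>h\<in>GQ. val V (t (h x)) = val V (h x)}"

lemma stab_props: "id \<in> stab V" "t \<in> stab V \<Longrightarrow> u \<in> stab V \<Longrightarrow> t \<circ> u \<in> stab V" "t \<in> stab V \<Longrightarrow> ainv t \<in> stab V"
proof -
  show "id \<in> stab V" using idQ by (simp add: stab_def)
  show "t \<circ> u \<in> stab V" if "t \<in> stab V" "u \<in> stab V"
  proof -
    have "val V (t (u (h x))) = val V (h x)" if "h \<in> GQ" for h
    proof -
      have "val V (t ((u \<circ> h) x)) = val V ((u \<circ> h) x)"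
        using \<open>t \<in> stab V\<close> \<open>u \<in> stab V\<close> compQ[of u h] that unfolding stab_def by blast
      thus ?thesis using \<open>u \<in> stab V\<close> that by (simp add: stab_def)
    qed
    thus ?thesis using that compQ by (auto simp: stab_def)
  qed
  show "ainv t \<in> stab V" if t: "t \<in> stab V"
  proof -
    have tQ: "t \<in> GQ" using t by (simp add: stab_def)
    have "val V (ainv t (h x)) = val V (h x)" if "h \<in> GQ" for h
    proof -
      have "val V (t ((ainv t \<circ> h) x)) = val V ((ainv t \<circ> h) x)"
        using t compQ[OF invQ[OF tQ] that] unfolding stab_def by blast
      thus ?thesis using aut_inv_apply(1)[OF autQ[OF tQ]] by simp
    qed
    thus ?thesis using tQ invQ by (auto simp: stab_def)
  qed
qed

lemma stab_subset: "stab V \<subseteq> GQ"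
  by (auto simp: stab_def)

section \<open>Stabilisers of places over finite values of y\<close>

lemma place_over: "\<exists>V. place V \<and> y \<in> V \<and> val V y = c"
  by (rule place_at[OF yK y_trans])

lemma shift_place:
  assumes V: "place V" "y \<in> V" and g: "g \<in> GQ"
  shows "place (ainv g ` V)" "y \<in> ainv g ` V" "val (ainv g ` V) y = val V y"
    "h \<in> GQ \<Longrightarrow> val (ainv g ` V) (h x) = val V (g (h x))"
proof -
  note sh = place_shift[OF autQ[OF g] V(1)]
  show "place (ainv g ` V)" by (rule sh(1))
  show "y \<in> ainv g ` V" "val (ainv g ` V) y = val V y" using sh(2)[of y] Q_y[OF g] V(2) by auto
  assume h: "h \<in> GQ"
  have "(g \<circ> h) x \<in> V" by (rule gx_in_place(1)[OF V compQ[OF g h]])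
  thus "val (ainv g ` V) (h x) = val V (g (h x))" using sh(2)[of "h x"] by simp
qed

lemma shift_placeP:
  assumes V: "place V" "y \<in> V" and s: "s \<in> GP"
  shows "place (ainv s ` V)" "y \<in> ainv s ` V" "val (ainv s ` V) y = zeta s * val V y"
    "h \<in> GQ \<Longrightarrow> val (ainv s ` V) (h x) = val V (s (h x))"
proof -
  interpret v: phom V "val V" by (rule val_phom[OF V(1)])
  note sh = place_shift[OF autP[OF s] V(1)]
  show "place (ainv s ` V)" by (rule sh(1))
  show "y \<in> ainv s ` V" "val (ainv s ` V) y = zeta s * val V y"
    using sh(2)[of y] zeta[OF s] V by (auto simp: v.p_mult)
  assume h: "h \<in> GQ"
  have "s (h x) \<in> V" using gx_in_place(1)[OF V cj_in[OF s h]] cj_x[OF s, of h] by simp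
  thus "val (ainv s ` V) (h x) = val V (s (h x))" using sh(2)[of "h x"] by simp
qed

text \<open>Over a point \<open>y = c \<noteq> 0\<close> a nontrivial stabiliser would be a \<open>p\<close>-group, so that \<open>A - c^(d-1) x\<close>
  would be a \<open>p\<close>-th power, and \<open>A'\<close> a nonzero constant. Then \<open>A\<close> is separable, and \<open>GP\<close> would fix all
  places over \<open>y = 0\<close>.\<close>

lemma unramified_outside_zero:
  assumes V: "place V" "y \<in> V" and c: "val V y \<noteq> 0"
  shows "inj_on (\<lambda>g. val V (g x)) GQ"
proof (rule inj_onI, rule ccontr)
  fix g1 g2 assume g: "g1 \<in> GQ" "g2 \<in> GQ" "val V (g1 x) = val V (g2 x)" "g1 \<noteq> g2"
  \<comment> \<open>Two conjugates of x with equal values give two translates of V with the same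
    value of x. An element s of \<open>GP\<close> relates them, and since y has the same nonzero
    value at both, \<open>zeta s = 1\<close>. Thus the values of all conjugates agree.\<close>
  have st: "g2 \<circ> ainv g1 \<in> stab V" if g: "g1 \<in> GQ" "g2 \<in> GQ" "val V (g1 x) = val V (g2 x)" for g1 g2
  proof -
    note sh1 = shift_place[OF V g(1)] and sh2 = shift_place[OF V g(2)]
    have e: "val (ainv g2 ` V) x = val (ainv g1 ` V) x" using sh1(4)[OF idQ] sh2(4)[OF idQ] g(3) by simp
    obtain s where s: "s \<in> GP" "\<And>h. h \<in> GQ \<Longrightarrow> val (ainv g2 ` V) (h x) = val (ainv g1 ` V) (s (h x))"
      "val (ainv g2 ` V) y = val (ainv g1 ` V) (s y)" using conjugateP[OF sh1(1,2) sh2(1,2) e] by blast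
    interpret v: phom "ainv g1 ` V" "val (ainv g1 ` V)" by (rule val_phom[OF sh1(1)])
    have "val V y = zeta s * val V y" using s(3) sh1 sh2 zeta[OF s(1)] by (simp add: v.p_mult)
    hence "s = id" using c zeta_1[OF s(1)] by simp
    hence eq: "val V (g2 (h x)) = val V (g1 (h x))" if "h \<in> GQ" for h
      using s(2)[OF that] sh1(4)[OF that] sh2(4)[OF that] by simp
    have "val V (g2 (ainv g1 (h x))) = val V (h x)" if "h \<in> GQ" for h
      using eq[OF compQ[OF invQ[OF g(1)] that]] aut_inv_apply(1)[OF autQ[OF g(1)]] by simp
    thus ?thesis using g compQ invQ by (auto simp: stab_def)
  qed
  have "g2 \<circ> ainv g1 \<noteq> id"
  proof
    assume "g2 \<circ> ainv g1 = id"
    hence "(g2 \<circ> ainv g1) \<circ> g1 = g1" by simp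
    thus False using g(4) ainv_comp(1)[OF g(1)] by (simp add: comp_assoc)
  qed
  hence pJ: "p dvd card (stab V)"
    using p_dvd_card_subgroup[OF stab_subset stab_props(2,3) st[OF g(1-3)]] by blast
  let ?c = "\<lambda>g. val V (g x)"
  \<comment> \<open>The conjugates sharing a value form a coset of the stabiliser, so every root of
    the reduced polynomial has multiplicity \<open>card (stab V)\<close>, a multiple of p.\<close>
  have fib: "{h \<in> GQ. ?c h = ?c g} = (\<lambda>t. t \<circ> g) ` stab V" if "g \<in> GQ" for g
  proof
    show "{h \<in> GQ. ?c h = ?c g} \<subseteq> (\<lambda>t. t \<circ> g) ` stab V"
    proof
      fix h assume h: "h \<in> {h \<in> GQ. ?c h = ?c g}"
      have "h = (h \<circ> ainv g) \<circ> g" using ainv_comp(1)[OF that] by (simp add: comp_assoc)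
      moreover have "h \<circ> ainv g \<in> stab V" using st[OF that, of h] h by auto
      ultimately show "h \<in> (\<lambda>t. t \<circ> g) ` stab V" by blast
    qed
    show "(\<lambda>t. t \<circ> g) ` stab V \<subseteq> {h \<in> GQ. ?c h = ?c g}" using that compQ by (auto simp: stab_def)
  qed
  have cfib: "card {h \<in> GQ. ?c h = ?c g} = card (stab V)" if "g \<in> GQ" for g
    unfolding fib[OF that]
  proof (rule card_image, rule inj_onI)
    fix t u assume "t \<circ> g = u \<circ> g"
    hence "t \<circ> (g \<circ> ainv g) = u \<circ> (g \<circ> ainv g)" by (metis comp_assoc)
    thus "t = u" using ainv_comp(2)[OF that] by simp
  qed
  obtain k where k: "card (stab V) = p * k" using pJ by auto
  have "(\<Prod>g\<in>GQ. [:- ?c g, 1:]) = (\<Prod>z\<in>?c ` GQ. \<Prod>g\<in>{g \<in> GQ. ?c g = z}. [:- ?c g, 1:])"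
    by (rule prod.image_gen[OF finQ])
  also have "\<dots> = (\<Prod>z\<in>?c ` GQ. [:- z, 1:] ^ (p * k))"
  proof (rule prod.cong[OF refl])
    fix z assume "z \<in> ?c ` GQ"
    then obtain g where gz: "g \<in> GQ" "z = ?c g" by blast
    have "(\<Prod>g\<in>{g \<in> GQ. ?c g = z}. [:- ?c g, 1:]) = (\<Prod>g\<in>{g \<in> GQ. ?c g = z}. [:- z, 1:])"
      by (rule prod.cong) auto
    also have "\<dots> = [:- z, 1:] ^ card {g \<in> GQ. ?c g = z}" by simp
    finally show "(\<Prod>g\<in>{g \<in> GQ. ?c g = z}. [:- ?c g, 1:]) = [:- z, 1:] ^ (p * k)"
      using cfib[OF gz(1)] k gz(2) by simp
  qed
  also have "\<dots> = (\<Prod>z\<in>?c ` GQ. [:- z, 1:] ^ k) ^ p"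
    by (simp add: power_mult[symmetric] mult.commute prod_power_distrib)
  finally have "pderiv (\<Prod>g\<in>GQ. [:- ?c g, 1:]) = 0" using char_p by (simp add: pderiv_power)
  hence "pderiv (A - [:0, val V y ^ (d - 1):]) = 0"
    unfolding gx_in_place(2)[OF V, symmetric] by (simp add: pderiv_smult)
  hence dA: "pderiv A = [:val V y ^ (d - 1):]" by (simp add: pderiv_diff pderiv_pCons)
  obtain V0 where V0: "place V0" "y \<in> V0" "val V0 y = 0" using place_over by blast
  let ?c0 = "\<lambda>g. val V0 (g x)"
  have A: "A = smult a (\<Prod>g\<in>GQ. [:- ?c0 g, 1:])"
    using gx_in_place(2)[OF V0(1,2)] V0(3) d_ge by (simp add: power_0_left)
  have inj0: "inj_on ?c0 GQ"
  proof (rule inj_onI, rule ccontr)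
    fix g h assume gh: "g \<in> GQ" "h \<in> GQ" "?c0 g = ?c0 h" "g \<noteq> h"
    have "poly (pderiv A) (?c0 g) = a * poly (pderiv (\<Prod>g\<in>GQ. [:- ?c0 g, 1:])) (?c0 g)"
      by (subst A) (simp add: pderiv_smult)
    also have "poly (pderiv (\<Prod>g\<in>GQ. [:- ?c0 g, 1:])) (?c0 g) = 0"
      by (rule prod_linear_double[where r = ?c0, OF finQ gh(1,2,4,3)])
    finally have "poly (pderiv A) (?c0 g) = 0" by simp
    thus False unfolding dA using c by simp
  qed
  have "1 < card GP" using cardP d_ge by simp
  then obtain s where s: "s \<in> GP" "s \<noteq> id"
    by (metis card_le_Suc0_iff_eq finP idP not_less One_nat_def)
  have "1 < card GQ" using cardQ d_ge by simp
  then obtain u where u: "u \<in> GQ" "u \<noteq> id"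
    by (metis card_le_Suc0_iff_eq finQ idQ not_less One_nat_def)
  note sh = shift_placeP[OF V0(1,2) s(1)]
  obtain h where h: "h \<in> GQ" "\<And>g. g \<in> GQ \<Longrightarrow> val (ainv s ` V0) (g x) = val V0 (h (g x))"
    using conjugateQ[OF V0(1,2) sh(1,2)] sh(3) V0(3) by auto
  have ch: "?c0 (cj s g) = ?c0 (h \<circ> g)" if "g \<in> GQ" for g
    using h(2)[OF that] sh(4)[OF that] cj_x[OF s(1), of g] by simp
  \<comment> \<open>Over y = 0 equal values now mean equal group elements. So h is the identity and
    s commutes with u, although by \<open>chi_exists\<close> conjugation by s multiplies a nonzero
    value by \<open>zeta s\<close>.\<close>
  have "cj s id = h \<circ> id" using ch[OF idQ] inj0 cj_in[OF s(1) idQ] compQ[OF h(1) idQ] unfolding inj_on_def by blast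
  hence "h = id" using cj_id[OF s(1)] by simp
  hence "cj s u = u" using ch[OF u(1)] inj0 cj_in[OF s(1) u(1)] u(1) unfolding inj_on_def by auto
  moreover obtain ch where "inj_on ch GQ" "ch id = 0" "\<forall>s\<in>GP. \<forall>g\<in>GQ. ch (cj s g) = zeta s * ch g"
    using chi_exists by blast
  ultimately have "zeta s * ch u = ch u" "ch u \<noteq> 0" using s(1) u idQ unfolding inj_on_def by metis+
  thus False using zeta_1[OF s(1)] s(2) by simp
qed

lemma A_values:
  assumes V: "place V" "y \<in> V" "val V y = 0"
  shows "A = smult a (\<Prod>g\<in>GQ. [:- val V (g x), 1:])"
  using gx_in_place(2)[OF V(1,2)] V(3) d_ge by (simp add: power_0_left)

lemma order_A:
  assumes V: "place V" "y \<in> V" "val V y = 0"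
  shows "order z A = card {g \<in> GQ. val V (g x) = z}"
  using order_prod_linear[OF finQ, of z "\<lambda>g. val V (g x)"] a_nonzero by (subst A_values[OF V]) (simp add: order_smult)

text \<open>The critical points of \<open>A / x\<close> are the zeros of \<open>W = x A' - A\<close>, which has degree \<open>d\<close>. By the
  previous lemma all of them are zeros of \<open>A\<close>, where \<open>W\<close> has smaller multiplicity than \<open>A\<close>, unless
  the multiplicity of \<open>A\<close> is divisible by \<open>p\<close>.\<close>

lemma exists_order_p: "\<exists>z. order z A \<noteq> 0 \<and> p dvd order z A"
proof (rule ccontr)
  assume neg: "\<not> ?thesis"
  define W where "W = pCons 0 (pderiv A) - A"
  have W': "W = [:0, 1:] * pderiv A - A" by (simp add: W_def)
  have An: "A \<noteq> 0" using A0 by auto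
  have cW: "coeff W i = (of_nat i - 1) * coeff A i" for i
    unfolding W_def by (cases i) (simp_all add: coeff_pderiv algebra_simps)
  \<comment> \<open>This coefficient is (d - 1) a, that is - a, because d vanishes in k. So W keeps
    the degree of A.\<close>
  have Wd: "coeff W d \<noteq> 0" unfolding cW using d_zero a_nonzero lead_1 by simp
  have degW: "degree W = d"
  proof (rule antisym)
    show "degree W \<le> d" by (rule degree_le) (simp add: cW coeff_eq_0 degA)
    show "d \<le> degree W" by (rule le_degree) (rule Wd)
  qed
  have Wn: "W \<noteq> 0" using Wd by auto
  have W0: "poly W 0 \<noteq> 0" using A0 by (simp add: W_def)
  have rootA: "poly A w = 0" if w: "poly W w = 0" for w
  proof (rule ccontr)
    assume Aw: "poly A w \<noteq> 0"
    have wn: "w \<noteq> 0" using W0 w by auto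
    have e: "w * poly (pderiv A) w = poly A w" using w by (simp add: W_def)
    define h where "h = poly A w / w"
    have hn: "h \<noteq> 0" using Aw wn by (simp add: h_def)
    \<comment> \<open>For this c the number w is a root of A - c^(d-1) X, hence the value of a
      conjugate of x at a place over y = c. As a zero of W it would be a double root, but that fibre
      is unramified.\<close>
    obtain c where c: "c ^ (d - 1) = h" using nth_root_exists[of "d - 1" h] d_ge by auto
    have cn: "c \<noteq> 0" using c hn d_ge by (auto simp: power_0_left)
    obtain V where V: "place V" "y \<in> V" "val V y = c" using place_over by blast
    let ?c = "\<lambda>g. val V (g x)"
    have sp: "smult a (\<Prod>g\<in>GQ. [:- ?c g, 1:]) = A - [:0, h:]" using gx_in_place(2)[OF V(1,2)] V(3) c by simp
    have inj: "inj_on ?c GQ" using unramified_outside_zero[OF V(1,2)] V(3) cn by simp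
    have "poly (A - [:0, h:]) w = 0" using wn by (simp add: h_def)
    hence "w \<in> ?c ` GQ" unfolding sp[symmetric] using a_nonzero poly_prod_linear_eq_0[OF finQ, of ?c w] by simp
    then obtain g where g: "g \<in> GQ" "w = ?c g" by blast
    have "poly (pderiv (smult a (\<Prod>g\<in>GQ. [:- ?c g, 1:]))) w \<noteq> 0"
      using prod_linear_simple[OF finQ g(1) inj] a_nonzero g(2) by (simp add: pderiv_smult)
    moreover have "poly (pderiv (A - [:0, h:])) w = 0"
      using e wn by (simp add: pderiv_diff pderiv_pCons h_def field_simps)
    ultimately show False unfolding sp by simp
  qed
  have ord: "order w W < order w A" if w: "poly W w = 0" for w
  proof -
    have wn: "w \<noteq> 0" using W0 w by auto
    define m where "m = order w A"
    have m0: "m \<noteq> 0" using rootA[OF w] An order_root[of A w] by (simp add: m_def)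
    obtain B where B: "A = [:- w, 1:] ^ m * B" "\<not> [:- w, 1:] dvd B"
      using order_decomp[OF An, of w] unfolding m_def by blast
    have Bw: "poly B w \<noteq> 0" using B(2) by (simp add: poly_eq_0_iff_dvd)
    obtain n where n: "m = Suc n" using m0 by (cases m) auto
    define C where "C = [:0, 1:] * (smult (of_nat m) B + [:- w, 1:] * pderiv B) - [:- w, 1:] * B"
    have "pderiv A = [:- w, 1:] ^ n * (smult (of_nat m) B + [:- w, 1:] * pderiv B)"
      unfolding B(1) n pderiv_mult pderiv_power_Suc by (simp add: pderiv_pCons algebra_simps)
    hence WC: "W = [:- w, 1:] ^ n * C"
      unfolding W' C_def by (subst (2) B(1)) (simp only: n power_Suc algebra_simps)
    have "poly C w = w * (of_nat m * poly B w)" by (simp add: C_def)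
    moreover have "\<not> p dvd m" using neg m0 unfolding m_def by blast
    \<comment> \<open>As p does not divide m, the factor m survives in k, and W vanishes at w to
      order exactly m - 1.\<close>
    hence "of_nat m \<noteq> (0 :: 'k)"
    proof -
      have "CHAR('k) dvd p" using char_p by (simp add: of_nat_eq_0_iff_char_dvd)
      moreover have "CHAR('k) \<noteq> 1" using of_nat_CHAR[where ?'a='k] by (metis of_nat_1 one_neq_zero)
      ultimately have "CHAR('k) = p" using prime_p prime_nat_iff by blast
      thus ?thesis using \<open>\<not> p dvd m\<close> by (simp add: of_nat_eq_0_iff_char_dvd)
    qed
    ultimately have "poly C w \<noteq> 0" using wn Bw by simp
    hence "order w W = n"
      using Wn unfolding WC by (subst order_mult) (auto simp: order_power_n_n order_0I)
    thus ?thesis using n unfolding m_def by simp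
  qed
  \<comment> \<open>Smaller multiplicities at all roots of W make its root multiset strictly smaller
    than that of A, although both polynomials have degree d.\<close>
  have "proots W \<subset># proots A"
  proof (rule subset_mset.le_neq_trans)
    show "proots W \<subseteq># proots A"
    proof (rule mset_subset_eqI)
      fix w show "count (proots W) w \<le> count (proots A) w"
        using ord[of w] Wn An order_root[of W w] by (cases "poly W w = 0") auto
    qed
    have "degree W > 0" using degW d_ge by simp
    then obtain w where w: "poly W w = 0" using alg_closed_imp_poly_has_root by blast
    hence "count (proots W) w < count (proots A) w" using ord[of w] Wn An by simp
    thus "proots W \<noteq> proots A" by auto
  qed
  hence "size (proots W) < size (proots A)" by (rule mset_subset_size)
  thus False using size_proots_alg_closed[OF Wn] size_proots_alg_closed[OF An] degW degA by simp
qed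

text \<open>The vectors \<open>psi g\<close> for g in S and \<open>phi s\<close> for s in
  \<open>GP\<close> list the values of the conjugates of x at the same translates of V, namely those
  where x and y keep their values. If the stabiliser were trivial, \<open>psi\<close> would be
  injective, so the size of S would be that of a \<open>GP\<close>-orbit and divide d - 1. But p
  divides this size and also d.\<close>

lemma stab_nontrivial:
  assumes V: "place V" "y \<in> V" "val V y = 0" and pm: "p dvd card {g \<in> GQ. val V (g x) = val V x}"
  shows "stab V \<noteq> {id}"
proof
  assume triv: "stab V = {id}"
  let ?c = "\<lambda>g. val V (g x)"
  define psi where "psi g = (\<lambda>h\<in>GQ. ?c (g \<circ> h))" for g
  define phi where "phi s = (\<lambda>h\<in>GQ. ?c (cj s h))" for s
  define S where "S = {g \<in> GQ. ?c g = val V x}"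
  have psi_inj: "inj_on psi GQ"
  proof (rule inj_onI)
    fix g g' assume g: "g \<in> GQ" "g' \<in> GQ" "psi g = psi g'"
    have eq: "val V (g (h x)) = val V (g' (h x))" if "h \<in> GQ" for h
      using fun_cong[OF g(3), of h] that unfolding psi_def by simp
    have "val V ((g' \<circ> ainv g) (h x)) = val V (h x)" if "h \<in> GQ" for h
      using eq[OF compQ[OF invQ[OF g(1)] that]] aut_inv_apply(1)[OF autQ[OF g(1)]] by simp
    hence "g' \<circ> ainv g \<in> stab V" using compQ invQ g by (auto simp: stab_def)
    hence "g' \<circ> ainv g = id" using triv by blast
    hence "g' \<circ> (ainv g \<circ> g) = g" by (metis comp_assoc comp_id id_comp)
    thus "g = g'" using ainv_comp(1)[OF g(1)] by simp
  qed
  have "psi ` S = phi ` GP"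
  proof
    show "psi ` S \<subseteq> phi ` GP"
    proof
      fix f assume "f \<in> psi ` S"
      then obtain g where g: "g \<in> GQ" "?c g = val V x" "f = psi g" unfolding S_def by blast
      note sh = shift_place[OF V(1,2) g(1)]
      have "val (ainv g ` V) x = val V x" using sh(4)[OF idQ] g(2) by simp
      from conjugateP[OF V(1,2) sh(1,2) this]
      obtain s where s: "s \<in> GP" "\<And>h. h \<in> GQ \<Longrightarrow> val (ainv g ` V) (h x) = val V (s (h x))" by blast
      have "?c (g \<circ> h) = ?c (cj s h)" if "h \<in> GQ" for h
        using s(2)[OF that] sh(4)[OF that] cj_x[OF s(1), of h] by simp
      hence "psi g = phi s" unfolding psi_def phi_def by (intro restrict_ext) simp
      thus "f \<in> phi ` GP" using s(1) g(3) by blast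
    qed
    show "phi ` GP \<subseteq> psi ` S"
    proof
      fix f assume "f \<in> phi ` GP"
      then obtain s where s: "s \<in> GP" "f = phi s" by blast
      note sh = shift_placeP[OF V(1,2) s(1)]
      have "val (ainv s ` V) y = val V y" using sh(3) V(3) by simp
      from conjugateQ[OF V(1,2) sh(1,2) this]
      obtain g where g: "g \<in> GQ" "\<And>h. h \<in> GQ \<Longrightarrow> val (ainv s ` V) (h x) = val V (g (h x))" by blast
      have eq: "?c (g \<circ> h) = ?c (cj s h)" if "h \<in> GQ" for h
        using g(2)[OF that] sh(4)[OF that] cj_x[OF s(1), of h] by simp
      hence "psi g = phi s" unfolding psi_def phi_def by (intro restrict_ext) simp
      moreover have "g \<in> S" using eq[OF idQ] g(1) cj_id[OF s(1)] by (simp add: S_def)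
      ultimately show "f \<in> psi ` S" using s(2) by (metis imageI)
    qed
  qed
  hence cS: "card S = card (phi ` GP)"
    using card_image[OF inj_on_subset[OF psi_inj, of S]] by (simp add: S_def)
  \<comment> \<open>The stabiliser in \<open>GP\<close>. The fibres of \<open>phi\<close> are its
    cosets, so the number of values of \<open>phi\<close> divides \<open>card GP\<close>.\<close>
  define T where "T = {s \<in> GP. \<forall>h\<in>GQ. ?c (cj s h) = ?c h}"
  have "card GP = card (phi ` GP) * card T"
  proof (rule card_image_fibres[OF finP])
    fix s assume s: "s \<in> GP"
    have "{u \<in> GP. phi u = phi s} = (\<lambda>t. t \<circ> s) ` T"
    proof
      show "{u \<in> GP. phi u = phi s} \<subseteq> (\<lambda>t. t \<circ> s) ` T"
      proof
        fix u assume "u \<in> {u \<in> GP. phi u = phi s}"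
        hence u: "u \<in> GP" "phi u = phi s" by auto
        have eq: "?c (cj u h) = ?c (cj s h)" if "h \<in> GQ" for h
          using fun_cong[OF u(2), of h] that unfolding phi_def by simp
        have "?c (cj (u \<circ> ainv s) h) = ?c h" if "h \<in> GQ" for h
          using eq[OF cj_in[OF invP[OF s] that]] cj_cj[OF u(1) invP[OF s]] cj_cj[OF s invP[OF s]]
            ainv_compP(2)[OF s] cj_id_left by simp
        hence "u \<circ> ainv s \<in> T" using compP[OF u(1) invP[OF s]] by (simp add: T_def)
        moreover have "u = (u \<circ> ainv s) \<circ> s" using ainv_compP(1)[OF s] by (simp add: comp_assoc)
        ultimately show "u \<in> (\<lambda>t. t \<circ> s) ` T" by blast
      qed
      show "(\<lambda>t. t \<circ> s) ` T \<subseteq> {u \<in> GP. phi u = phi s}"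
      proof
        fix u assume "u \<in> (\<lambda>t. t \<circ> s) ` T"
        then obtain t where t: "t \<in> GP" "\<And>h. h \<in> GQ \<Longrightarrow> ?c (cj t h) = ?c h" "u = t \<circ> s" unfolding T_def by blast
        have "?c (cj u h) = ?c (cj s h)" if "h \<in> GQ" for h
          using t(2)[OF cj_in[OF s that]] cj_cj[OF t(1) s] t(3) by simp
        hence "phi u = phi s" unfolding phi_def by (intro restrict_ext) simp
        thus "u \<in> {u \<in> GP. phi u = phi s}" using compP[OF t(1) s] t(3) by simp
      qed
    qed
    moreover have "inj_on (\<lambda>t. t \<circ> s) T"
    proof (rule inj_onI)
      fix t u assume "t \<circ> s = u \<circ> s"
      hence "t \<circ> (s \<circ> ainv s) = u \<circ> (s \<circ> ainv s)" by (metis comp_assoc)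
      thus "t = u" using ainv_compP(2)[OF s] by simp
    qed
    ultimately show "card {u \<in> GP. phi u = phi s} = card T" by (simp add: card_image)
  qed
  hence "p dvd d - 1" using pm cS cardP unfolding S_def by (metis dvd_mult2)
  hence "p dvd 1" using p_dvd d_ge by (metis dvd_diff_nat diff_diff_cancel le_trans one_le_numeral)
  thus False using prime_p by simp
qed

text \<open>By conjugation with \<open>GP\<close>, the conjugates of a nontrivial stabiliser cover \<open>GQ\<close>, which is
  impossible for a proper subgroup of a finite group.\<close>

lemma stab_full:
  assumes V: "place V" "y \<in> V" "val V y = 0" and nt: "stab V \<noteq> {id}"
  shows "stab V = GQ"
proof -
  define J where "J = stab V"
  have J: "J \<subseteq> GQ" "id \<in> J" "\<And>t u. t \<in> J \<Longrightarrow> u \<in> J \<Longrightarrow> t \<circ> u \<in> J" "\<And>t. t \<in> J \<Longrightarrow> ainv t \<in> J"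
    unfolding J_def using stab_subset stab_props by auto
  have finJ: "finite J" using J(1) finQ finite_subset by blast
  obtain t where t: "t \<in> J" "t \<noteq> id" using nt J(2) unfolding J_def by blast
  have tQ: "t \<in> GQ" using t J by blast
  have cover: "\<exists>g\<in>GQ. g \<circ> u \<circ> ainv g \<in> J" if u: "u \<in> GQ" "u \<noteq> id" for u
  proof -
    obtain s where s: "s \<in> GP" "u = cj s t" using cj_transitive[OF tQ t(2) u] by blast
    note i = invP[OF s(1)]
    note sh = shift_placeP[OF V(1,2) i]
    have "val (ainv (ainv s) ` V) y = val V y" using sh(3) V(3) by simp
    from conjugateQ[OF V(1,2) sh(1,2) this]
    obtain g where g: "g \<in> GQ" "\<And>h. h \<in> GQ \<Longrightarrow> val (ainv (ainv s) ` V) (h x) = val V (g (h x))" by blast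
    have eq: "val V (ainv s (h x)) = val V (g (h x))" if "h \<in> GQ" for h
      using g(2)[OF that] sh(4)[OF that] by simp
    have inv: "val V (g (u (h x))) = val V (g (h x))" if h: "h \<in> GQ" for h
    proof -
      have "val V (g (u (h x))) = val V (ainv s (u (h x)))" using eq[OF compQ[OF u(1) h]] by simp
      also have "ainv s (u (h x)) = t (cj (ainv s) h x)"
        using cj_x[OF i, of h] aut_inv_apply(2)[OF autP[OF s(1)]] unfolding s(2) by (simp add: cj_def)
      also have "val V (t (cj (ainv s) h x)) = val V (cj (ainv s) h x)"
        using t(1) cj_in[OF i h] unfolding J_def stab_def by blast
      also have "cj (ainv s) h x = ainv s (h x)" using cj_x[OF i, of h] by simp
      also have "val V (ainv s (h x)) = val V (g (h x))" by (rule eq[OF h])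
      finally show ?thesis .
    qed
    have "val V ((g \<circ> u \<circ> ainv g) (h x)) = val V (h x)" if h: "h \<in> GQ" for h
      using inv[OF compQ[OF invQ[OF g(1)] h]] aut_inv_apply(1)[OF autQ[OF g(1)]] by simp
    hence "g \<circ> u \<circ> ainv g \<in> J" unfolding J_def stab_def using compQ invQ g(1) u(1) by auto
    thus ?thesis using g(1) by blast
  qed
  \<comment> \<open>Double count of the ways to write a nontrivial u as a conjugate of some t in J
    by g. Each u has at least |J| of them, since every j in J replaces (g, t) by (j g, j t j^-1).
    Hence (d - 1) |J| \<le> d (|J| - 1), that is |J| \<ge> d.\<close>
  define P where "P = GQ \<times> (J - {id})"
  let ?m = "\<lambda>(g, t). ainv g \<circ> t \<circ> g"
  have finP': "finite P" unfolding P_def using finQ finJ by simp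
  have fibre: "card J \<le> card {q \<in> P. ?m q = u}" if u: "u \<in> GQ - {id}" for u
  proof -
    obtain g where g: "g \<in> GQ" "g \<circ> u \<circ> ainv g \<in> J" using cover u by blast
    define t where "t = g \<circ> u \<circ> ainv g"
    have tJ: "t \<in> J" using g(2) by (simp add: t_def)
    have ainvg: "ainv g (g e) = e" "g (ainv g e) = e" for e using aut_inv_apply[OF autQ[OF g(1)]] by auto
    have tn: "t \<noteq> id"
    proof
      assume "t = id"
      hence "g (u (ainv g (g e))) = g e" for e by (metis comp_apply id_apply t_def)
      hence "u e = e" for e using ainvg by metis
      thus False using u by auto
    qed
    have "(\<lambda>j. (j \<circ> g, j \<circ> t \<circ> ainv j)) ` J \<subseteq> {q \<in> P. ?m q = u}"
    proof
      fix q assume "q \<in> (\<lambda>j. (j \<circ> g, j \<circ> t \<circ> ainv j)) ` J"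
      then obtain j where j: "j \<in> J" "q = (j \<circ> g, j \<circ> t \<circ> ainv j)" by blast
      have jQ: "j \<in> GQ" using j J by blast
      have jj: "ainv j (j e) = e" "j (ainv j e) = e" for e using aut_inv_apply[OF autQ[OF jQ]] by auto
      have "j \<circ> t \<circ> ainv j \<noteq> id"
      proof
        assume "j \<circ> t \<circ> ainv j = id"
        hence "j (t (ainv j (j e))) = j e" for e by (metis comp_apply id_apply)
        hence "t e = e" for e using jj by metis
        thus False using tn by auto
      qed
      hence "q \<in> P" unfolding P_def j(2) using j(1) tJ J g(1) jQ compQ by auto
      moreover have "ainv (j \<circ> g) = ainv g \<circ> ainv j"
        by (rule o_inv_distrib) (use jQ g(1) autQ aut_bij in auto)
      hence "?m q = u" unfolding j(2) t_def by (auto simp: fun_eq_iff jj ainvg)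
      ultimately show "q \<in> {q \<in> P. ?m q = u}" by blast
    qed
    moreover have "inj_on (\<lambda>j. (j \<circ> g, j \<circ> t \<circ> ainv j)) J"
    proof (rule inj_onI)
      fix j k assume "(j \<circ> g, j \<circ> t \<circ> ainv j) = (k \<circ> g, k \<circ> t \<circ> ainv k)"
      hence "j (g (ainv g e)) = k (g (ainv g e))" for e by (metis comp_apply fst_conv)
      thus "j = k" using ainvg by auto
    qed
    moreover have "finite {q \<in> P. ?m q = u}" using finP' by simp
    ultimately show ?thesis by (metis (no_types, lifting) card_image card_mono)
  qed
  have "(d - 1) * card J = (\<Sum>u\<in>GQ - {id}. card J)" using cardQ idQ finQ by simp
  also have "\<dots> \<le> (\<Sum>u\<in>GQ - {id}. card {q \<in> P. ?m q = u})" by (rule sum_mono) (rule fibre)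
  also have "\<dots> = card (\<Union>u\<in>GQ - {id}. {q \<in> P. ?m q = u})"
    by (rule card_UN_disjoint[symmetric]) (use finQ finP' in auto)
  also have "\<dots> \<le> card P" by (rule card_mono[OF finP']) auto
  also have "card P = d * (card J - 1)" unfolding P_def using cardQ J(2) finJ by (simp add: card_cartesian_product)
  finally have le: "(d - 1) * card J \<le> d * (card J - 1)" .
  have "card J \<ge> 1" using J(2) finJ by (simp add: Suc_le_eq card_gt_0_iff) blast
  then obtain j e where je: "card J = Suc j" "d = Suc e" using d_ge by (metis Suc_le_D One_nat_def numeral_3_eq_3)
  have "d \<le> card J" using le unfolding je by (simp add: algebra_simps)
  hence "J = GQ" using J(1) finQ cardQ by (intro card_subset_eq) (auto intro: antisym card_mono)
  thus ?thesis by (simp add: J_def)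
qed

text \<open>V is translated so that x itself has the value z. The stabiliser of the new place is all
  of \<open>GQ\<close>, so every conjugate of x has the value z there, and \<open>A_values\<close>
  leaves A with this single root.\<close>

theorem A_power: "\<exists>e z. d = p ^ e \<and> z \<noteq> 0 \<and> A = smult a ([:- z, 1:] ^ d)"
proof -
  obtain V where V: "place V" "y \<in> V" "val V y = 0" using place_over by blast
  obtain z where z: "order z A \<noteq> 0" "p dvd order z A" using exists_order_p by blast
  hence "card {g \<in> GQ. val V (g x) = z} \<noteq> 0" "p dvd card {g \<in> GQ. val V (g x) = z}"
    unfolding order_A[OF V] by auto
  then obtain g1 where g1: "g1 \<in> GQ" "val V (g1 x) = z" by (metis (mono_tags, lifting) card.empty empty_Collect_eq)
  define V0 where "V0 = ainv g1 ` V"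
  note sh = shift_place[OF V(1,2) g1(1), folded V0_def]
  have V0: "place V0" "y \<in> V0" "val V0 y = 0" using sh V(3) by auto
  have zx: "val V0 x = z" using sh(4)[OF idQ] g1(2) by simp
  have "p dvd card {g \<in> GQ. val V0 (g x) = val V0 x}" using z(2) unfolding order_A[OF V0] zx .
  hence J: "stab V0 = GQ" using stab_full[OF V0 stab_nontrivial[OF V0]] by blast
  have "val V0 (g x) = z" if "g \<in> GQ" for g
    using that J idQ zx unfolding stab_def by force
  hence "(\<Prod>g\<in>GQ. [:- val V0 (g x), 1:]) = (\<Prod>g\<in>GQ. [:- z, 1:])" by (intro prod.cong) auto
  hence A: "A = smult a ([:- z, 1:] ^ d)" using A_values[OF V0] cardQ by simp
  have "z \<noteq> 0"
  proof
    assume "z = 0"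
    hence "poly A 0 = 0" using d_ge by (subst A) (simp add: poly_power power_0_left)
    thus False using A0 by simp
  qed
  thus ?thesis using A degree_prime_power by blast
qed

end

section \<open>From a pair of Galois projections to the normal form of the equation\<close>

lemma card_roots_le_degree:
  fixes P :: "'a::idom poly"
  assumes "P \<noteq> 0" "finite A" "inj_on r A" "\<And>a. a \<in> A \<Longrightarrow> poly P (r a) = 0"
  shows "card A \<le> degree P"
proof -
  have "card A = card (r ` A)" using assms(3) by (simp add: card_image)
  also have "\<dots> \<le> card {z. poly P z = 0}"
    using assms by (intro card_mono poly_roots_finite) auto
  also have "\<dots> \<le> degree P" by (rule card_poly_roots_bound[OF assms(1)])
  finally show ?thesis .
qed

lemma eq_prod_linear:
  fixes P :: "'a::idom poly"
  assumes "finite A" "inj_on r A" "\<And>a. a \<in> A \<Longrightarrow> poly P (r a) = 0" "degree P = card A"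
  shows "P = smult (lead_coeff P) (\<Prod>a\<in>A. [:- r a, 1:])"
proof (rule ccontr)
  let ?R = "smult (lead_coeff P) (\<Prod>a\<in>A. [:- r a, 1:])"
  assume "P \<noteq> ?R"
  hence n: "P - ?R \<noteq> 0" by simp
  have c: "coeff (\<Prod>a\<in>A. [:- r a, 1:]) (card A) = 1"
    using degree_prod_linear[of r A] by simp
  have "degree (P - ?R) \<le> card A"
    using assms(4) degree_prod_linear(1)[of r A] by (intro degree_diff_le) (auto intro: order_trans[OF degree_smult_le])
  moreover have "coeff (P - ?R) (card A) = 0" using c assms(4) by simp
  ultimately have "degree (P - ?R) < card A" using n eq_zero_or_degree_less by blast
  moreover have "card A \<le> degree (P - ?R)"
  proof (rule card_roots_le_degree[OF n assms(1,2)])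
    fix a assume a: "a \<in> A"
    have "poly (\<Prod>a\<in>A. [:- r a, 1:]) (r a) = 0"
      using a assms(1) by (simp add: poly_prod_linear_eq_0)
    thus "poly (P - ?R) (r a) = 0" using assms(3)[OF a] by simp
  qed
  ultimately show False by simp
qed

lemma degree_diff_left:
  fixes P :: "'a::ab_group_add poly"
  shows "degree Q < degree P \<Longrightarrow> degree (P - Q) = degree P"
  using degree_add_eq_left[of "- Q" P] by simp

context func_field begin

lemma agroup_right:
  assumes G: "agroup G" and s: "s \<in> G"
  shows "bij_betw (\<lambda>t. t \<circ> s) G G"
proof -
  have a: "aut s" using G s unfolding agroup_def by blast
  have "inj_on (\<lambda>t. t \<circ> s) G"
    by (rule inj_onI) (metis a aut_inv_apply(1) comp_apply ext)
  moreover have "(\<lambda>t. t \<circ> s) ` G \<subseteq> G" using G s unfolding agroup_def by blast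
  ultimately show ?thesis using G unfolding agroup_def bij_betw_def by (metis endo_inj_surj)
qed

text \<open>In lowest terms a root of the denominator would be a value of y at some place where c is
  not regular. So the denominator has no root and is constant.\<close>

lemma rat_polynomial:
  assumes y: "y \<in> K" "y \<notin> range emb" and c: "c \<in> rat y" and reg: "\<And>V. place V \<Longrightarrow> y \<in> V \<Longrightarrow> c \<in> V"
  shows "\<exists>B. c = pev emb y B"
proof -
  obtain a b where ab: "c = pev emb y a / pev emb y b" "pev emb y b \<noteq> 0" "\<And>r. \<not> (poly a r = 0 \<and> poly b r = 0)"
    using rat_lowest[OF c] by blast
  have nb: "poly b r \<noteq> 0" for r
  proof
    assume r: "poly b r = 0"
    obtain V where V: "place V" "y \<in> V" "val V y = r" using place_at[OF y] by blast
    interpret V: phom V "val V" by (rule val_phom[OF V(1)])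
    have "c * pev emb y b = pev emb y a" using ab by simp
    hence "val V c * poly b r = poly a r"
      using reg[OF V(1,2)] val_pev[OF V(1,2)] V(3) by (metis V.p_mult)
    thus False using r ab(3) by simp
  qed
  have "degree b = 0" using nb alg_closed_imp_poly_has_root[of b] by (metis gr0I)
  then obtain b0 where b0: "b = [:b0:]" by (rule degree_eq_zeroE)
  hence "b0 \<noteq> 0" using ab(2) by auto
  hence "c = pev emb y (smult (inverse b0) a)"
    using ab(1) b0 by (simp add: pev_smult emb_inverse divide_inverse mult.commute)
  thus ?thesis by blast
qed

lemma galois_conjugates:
  assumes y: "y \<in> K" and x: "x \<in> K" and G: "finite G" "\<And>s. s \<in> G \<Longrightarrow> aut s \<and> s x = x"
    and inj: "inj_on (\<lambda>s. s y) G"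
    and f: "pev (pev emb x) y f = 0"
  shows "s \<in> G \<Longrightarrow> poly (map_poly (pev emb x) f) (s y) = 0"
proof -
  assume s: "s \<in> G"
  interpret s: phom K s by (rule aut_phom) (use G s in blast)
  interpret x: rhom "pev emb x" by (rule rhom_pev)
  have b: "s.Bpoly (map_poly (pev emb x) f)" using x by (simp add: s.Bpoly_def coeff_map_poly)
  have "map_poly s (map_poly (pev emb x) f) = map_poly (pev emb x) f"
    by (rule poly_eqI) (use G(2)[OF s] x in \<open>simp add: coeff_map_poly s.p_zero aut_pev\<close>)
  thus ?thesis using s.p_poly[OF b y] f unfolding pev_def s.p_zero by (simp add: s.p_zero)
qed

end

text \<open>Here f is the affine equation as a polynomial in y over k[x]. The degree d - 1 reflects
  that P lies on the curve, \<open>alpha\<close> that PQ is not the tangent at P, and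
  \<open>deg0\<close> and \<open>integral\<close> that Q is off the curve.\<close>

locale galois_pair = func_field emb K for emb :: "'k::alg_closed_field \<Rightarrow> 'e::field" and K +
  fixes x y :: 'e and d p :: nat and GP GQ :: "('e \<Rightarrow> 'e) set" and f :: "'k poly poly" and \<alpha> \<beta> :: 'k
  assumes xK: "x \<in> K" and yK: "y \<in> K" and x_trans: "x \<notin> range emb" and y_trans: "y \<notin> range emb"
    and GP: "GP = Gal x" and GQ: "GQ = Gal y"
    and GPg: "agroup GP" and GQg: "agroup GQ" and cardP: "card GP = d - 1" and cardQ: "card GQ = d"
    and gen: "aut s \<Longrightarrow> s x = x \<Longrightarrow> s y = y \<Longrightarrow> s = id"
    and fixP: "c \<in> K \<Longrightarrow> (\<And>s. s \<in> GP \<Longrightarrow> s c = c) \<Longrightarrow> c \<in> rat x"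
    and fixQ: "c \<in> K \<Longrightarrow> (\<And>s. s \<in> GQ \<Longrightarrow> s c = c) \<Longrightarrow> c \<in> rat y"
    and normal: "s \<in> GP \<Longrightarrow> t \<in> GQ \<Longrightarrow> t (s y) = s y"
    and root: "pev (pev emb x) y f = 0" and degf: "degree f = d - 1"
    and lead: "lead_coeff f = [:\<beta>, \<alpha>:]" and alpha: "\<alpha> \<noteq> 0"
    and deg0: "degree (coeff f 0) = d" and degj: "j > 0 \<Longrightarrow> degree (coeff f j) < d"
    and integral: "place V \<Longrightarrow> y \<in> V \<Longrightarrow> x \<in> V"
    and prime_p: "prime p" and char_p: "of_nat p = (0 :: 'k)" and p_dvd: "p dvd d" and d_ge: "d \<ge> 3"
begin

lemma autP: "s \<in> GP \<Longrightarrow> aut s" and P_x: "s \<in> GP \<Longrightarrow> s x = x"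
  and autQ: "t \<in> GQ \<Longrightarrow> aut t" and Q_y: "t \<in> GQ \<Longrightarrow> t y = y"
  unfolding GP GQ by auto

lemma finP: "finite GP" and finQ: "finite GQ"
  using GPg GQg unfolding agroup_def by auto

lemma eq_of_images: "aut s \<Longrightarrow> aut t \<Longrightarrow> s x = t x \<Longrightarrow> s y = t y \<Longrightarrow> s = t"
proof -
  assume st: "aut s" "aut t" "s x = t x" "s y = t y"
  have "ainv t \<circ> s = id"
    by (rule gen) (use st in \<open>simp_all add: aut_comp aut_inv aut_inv_apply\<close>)
  hence "ainv t (s a) = a" for a by (metis comp_apply id_apply)
  thus ?thesis using aut_inv_apply(1)[OF st(2)] by (metis ext)
qed

lemma injP: "inj_on (\<lambda>s. s y) GP" and injQ: "inj_on (\<lambda>t. t x) GQ"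
  by (rule inj_onI, rule eq_of_images; simp add: autP autQ P_x Q_y)+

abbreviation "L \<equiv> emb \<alpha> * x + emb \<beta>"

lemma L_pev: "L = pev emb x [:\<beta>, \<alpha>:]" by (simp add: mult.commute add.commute)

lemma L_nonzero: "L \<noteq> 0"
  unfolding L_pev by (rule transcendental[OF x_trans]) (use alpha in simp)

lemma f_product: "map_poly (pev emb x) f = smult L (\<Prod>s\<in>GP. [:- s y, 1:])"
proof -
  interpret x: rhom "pev emb x" by (rule rhom_pev)
  have l: "pev emb x (lead_coeff f) = L" unfolding lead L_pev ..
  hence deg: "degree (map_poly (pev emb x) f) = degree f"
    by (intro degree_map_poly) (use transcendental[OF x_trans] in auto)
  hence "lead_coeff (map_poly (pev emb x) f) = L" using l by (simp add: coeff_map_poly)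
  moreover have "map_poly (pev emb x) f = smult (lead_coeff (map_poly (pev emb x) f)) (\<Prod>s\<in>GP. [:- s y, 1:])"
  proof (rule eq_prod_linear[OF finP injP])
    show "poly (map_poly (pev emb x) f) (s y) = 0" if "s \<in> GP" for s
      using galois_conjugates[OF yK xK finP _ injP root that] autP P_x by blast
  qed (use deg degf cardP in simp)
  ultimately show ?thesis by simp
qed

lemma f_value: "pev emb x (poly f [:c:]) = L * (\<Prod>s\<in>GP. emb c - s y)"
proof -
  interpret x: rhom "pev emb x" by (rule rhom_pev)
  have "pev emb x (poly f [:c:]) = poly (map_poly (pev emb x) f) (pev emb x [:c:])"
    by (rule x.poly_map_poly[symmetric])
  thus ?thesis unfolding f_product by (simp add: poly_prod)
qed

abbreviation "A0 \<equiv> coeff f 0"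

lemma s_rat: "s \<in> GP \<Longrightarrow> s y \<in> rat y"
  by (rule fixQ) (use yK autP normal in \<open>auto simp: aut_in_K\<close>)

lemma A0_prod: "pev emb x A0 = L * (\<Prod>s\<in>GP. - s y)"
  using f_value[of 0] by (simp add: poly_0_coeff_0)

text \<open>Let c be the norm of y up to sign, so that A0(x) = L c. All \<open>s y\<close> lie in
  k(y), hence so does c, and A0 - c L, with L as a linear polynomial, has the d conjugates of x
  under \<open>GQ\<close> as its roots. These are integral over k[y], and therefore c is regular
  wherever y is: it is a polynomial in y.\<close>

lemma A0_polynomial: "\<exists>B. degree B > 0 \<and> pev emb x A0 = L * pev emb y B"
proof -
  let ?c = "\<Prod>s\<in>GP. - s y"
  interpret ry: phom "rat y" "\<lambda>x. x" by (rule rat_phom)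
  have c: "?c \<in> rat y" by (rule ry.B_prod) (simp add: s_rat)
  have cK: "?c \<in> K" using rat_subset[OF yK] c by blast
  let ?R = "map_poly emb A0 - smult ?c [:emb \<beta>, emb \<alpha>:]"
  have dA: "degree (map_poly emb A0) = d"
    using deg0 by (subst degree_map_poly) auto
  have dR: "degree ?R = d"
    using dA d_ge by (subst degree_diff_left) (auto intro: le_less_trans[OF degree_smult_le])
  have lR: "lead_coeff ?R = emb (lead_coeff A0)"
    unfolding dR using deg0 d_ge by (simp add: coeff_map_poly coeff_eq_0)
  have rt: "poly ?R (t x) = 0" if t: "t \<in> GQ" for t
  proof -
    interpret t: phom K t by (rule aut_phom[OF autQ[OF t]])
    have tc: "t ?c = ?c" by (rule aut_rat[OF autQ[OF t] yK Q_y[OF t] c])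
    have "t (pev emb x A0) = t (L * ?c)" using A0_prod by simp
    also have "\<dots> = (emb \<alpha> * t x + emb \<beta>) * ?c" using t xK cK tc
      by (simp add: t.p_mult t.p_add aut_emb[OF autQ])
    finally show ?thesis
      using aut_pev[OF autQ[OF t] xK] by (simp add: pev_def algebra_simps)
  qed
  have R: "?R = smult (lead_coeff ?R) (\<Prod>t\<in>GQ. [:- t x, 1:])"
    by (rule eq_prod_linear[OF finQ injQ], erule rt, simp only: dR cardQ)
  have reg: "?c \<in> V" if V: "place V" "y \<in> V" for V
  proof -
    interpret V: phom V "\<lambda>x. x" using V unfolding place_def by (intro subr_phom) auto
    have tx: "t x \<in> V" if t: "t \<in> GQ" for t
    proof -
      have a: "aut (ainv t)" by (rule aut_inv[OF autQ[OF t]])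
      have "y = ainv t y" using aut_inv_apply(2)[OF autQ[OF t], of y] Q_y[OF t] by simp
      hence "x \<in> ainv t ` V" using V by (intro integral place_aut(1)[OF a V(1)]) auto
      thus ?thesis using aut_inv_apply(1)[OF autQ[OF t]] by auto
    qed
    have "V.Bpoly (\<Prod>t\<in>GQ. [:- t x, 1:])" by (rule V.map_p_prod_linear(1)[OF tx])
    hence "V.Bpoly ?R" using lR place_emb[OF V(1)] by (subst R) (simp only: V.Bpoly_smult)
    \<comment> \<open>The coefficient of degree 1 contains c with the nonzero factor \<alpha>, so
      regularity of c can be read off from it.\<close>
    hence "coeff ?R 1 \<in> V" unfolding V.Bpoly_def by blast
    hence *: "emb (coeff A0 1) - ?c * emb \<alpha> \<in> V" by (simp add: coeff_map_poly)
    have "(emb (coeff A0 1) - (emb (coeff A0 1) - ?c * emb \<alpha>)) * emb (inverse \<alpha>) \<in> V"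
      by (rule V.B_mult[OF V.B_diff[OF place_emb[OF V(1)] *] place_emb[OF V(1)]])
    moreover have "(emb (coeff A0 1) - (emb (coeff A0 1) - ?c * emb \<alpha>)) * emb (inverse \<alpha>) = ?c"
      using alpha by (simp only: diff_diff_eq2 add_diff_cancel_left' emb_inverse) simp
    ultimately show ?thesis by (simp only:)
  qed
  obtain B where B: "?c = pev emb y B" using rat_polynomial[OF yK y_trans c reg] by blast
  have "degree B > 0"
  proof (rule ccontr)
    assume "\<not> degree B > 0"
    then obtain b where b: "B = [:b:]" using degree_eq_zeroE by blast
    have "pev emb x A0 = pev emb x (smult b [:\<beta>, \<alpha>:])"
      using A0_prod B b unfolding pev_smult L_pev by simp
    hence "A0 = smult b [:\<beta>, \<alpha>:]" by (rule transcendental_inj[OF x_trans])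
    hence "degree A0 \<le> 1" using degree_smult_le[of b "[:\<beta>, \<alpha>:]"] by simp
    thus False using deg0 d_ge by simp
  qed
  thus ?thesis using A0_prod B by metis
qed

text \<open>As s fixes both A0(x) and L, the elements y and \<open>s y\<close> have the same image
  under B. So \<open>s y\<close> is integral over k[y], hence a polynomial N(y), and degrees in B(N)
  = B show that N has degree 1.\<close>

lemma s_affine: "s \<in> GP \<Longrightarrow> \<exists>z b. s y = emb z * y + emb b"
proof -
  assume s: "s \<in> GP"
  interpret s: phom K s by (rule aut_phom[OF autP[OF s]])
  obtain B where B: "degree B > 0" "pev emb x A0 = L * pev emb y B" using A0_polynomial by blast
  have "s (pev emb x A0) = pev emb x A0" "s L = L"
    using s by (simp_all add: aut_pev autP xK P_x s.p_add s.p_mult aut_emb)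
  hence "L * pev emb (s y) B = L * pev emb y B"
    using B(2) xK yK s by (metis (no_types, lifting) K_add K_emb K_mult aut_pev autP pev_in_K s.p_mult)
  hence BB: "pev emb (s y) B = pev emb y B" using L_nonzero by simp
  have sK: "s y \<in> K" using s yK autP aut_in_K by blast
  have "s y \<in> V" if V: "place V" "y \<in> V" for V
  proof (rule place_integral[OF V(1)])
    let ?q = "map_poly emb B - [:pev emb y B:]"
    have dB: "degree (map_poly emb B) = degree B" using B(1) by (subst degree_map_poly) auto
    have dq: "degree ?q = degree B" using dB B(1) by (subst degree_diff_left) auto
    interpret V: phom V "\<lambda>x. x" using V unfolding place_def by (intro subr_phom) auto
    show "coeff ?q i \<in> V" for i
      using val_pev[OF V, of B] place_emb[OF V(1)] by (auto simp: coeff_map_poly coeff_pCons split: nat.split)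
    show "?q \<noteq> 0" using dq B(1) by auto
    have "lead_coeff ?q = emb (lead_coeff B)"
      unfolding dq using B(1) by (simp add: coeff_map_poly coeff_eq_0)
    thus "inverse (lead_coeff ?q) \<in> V" using place_emb[OF V(1)] by (simp flip: emb_inverse)
    show "s y \<in> K" by (rule sK)
    show "poly ?q (s y) = 0" using BB by (simp add: pev_def)
  qed
  then obtain N where N: "s y = pev emb y N" using rat_polynomial[OF yK y_trans s_rat[OF s]] by blast
  hence "pev emb y (pcompose B N) = pev emb y B" using BB by (simp add: pev_pcompose)
  hence "pcompose B N = B" by (rule transcendental_inj[OF y_trans])
  hence "degree B * degree N = degree B" by (metis degree_pcompose)
  hence "degree N = 1" using B(1) by simp
  then obtain a b where "N = [:b, a:]" by (metis One_nat_def degree1_coeffs)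
  hence "s y = emb a * y + emb b" using N by (simp add: mult.commute add.commute)
  thus ?thesis by blast
qed

lemma d_minus_1: "of_nat (d - 1) = (- 1 :: 'k)"
proof -
  obtain m where m: "d = p * m" using p_dvd by blast
  have "of_nat (d - 1) + 1 = (of_nat d :: 'k)" using d_ge by (metis Suc_pred' add.commute gr0I not_numeral_le_zero of_nat_Suc)
  also have "\<dots> = 0" unfolding m by (simp add: char_p)
  finally show ?thesis by (simp add: eq_neg_iff_add_eq_0)
qed

text \<open>The trace of y is affine in y and lies in k(x). Its coefficient at y must vanish, or y
  would lie in k(x); so the trace is a constant e. Reindexing it by s gives e = z e + (d - 1) b,
  where d - 1 = -1 in k, and therefore - e is fixed by every map y \<mapsto> z y + b.\<close>

lemma centre_exists: "\<exists>\<gamma>. \<forall>s\<in>GP. \<exists>z. s (y - emb \<gamma>) = emb z * (y - emb \<gamma>)"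
proof -
  obtain z b where zb: "\<And>s. s \<in> GP \<Longrightarrow> s y = emb (z s) * y + emb (b s)" using s_affine by metis
  define S where "S = (\<Sum>s\<in>GP. s y)"
  have sK: "s y \<in> K" if "s \<in> GP" for s using that yK autP aut_in_K by blast
  have SK: "S \<in> K" unfolding S_def by (rule K.B_sum) (rule sK)
  have fixS: "s S = S" if s: "s \<in> GP" for s
  proof -
    interpret s: phom K s by (rule aut_phom[OF autP[OF s]])
    have "s S = (\<Sum>t\<in>GP. (s \<circ> t) y)" unfolding S_def by (subst s.p_sum) (simp_all add: sK)
    also have "\<dots> = S" unfolding S_def by (rule sum.reindex_bij_betw[OF agroup_left[OF GPg s]])
    finally show ?thesis .
  qed
  have Sx: "S \<in> rat x" by (rule fixP[OF SK]) (rule fixS)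
  have S1: "S = emb (\<Sum>s\<in>GP. z s) * y + emb (\<Sum>s\<in>GP. b s)"
    unfolding S_def h_sum by (simp add: zb sum.distrib sum_distrib_right)
  have z0: "(\<Sum>s\<in>GP. z s) = 0"
  proof (rule ccontr)
    assume n: "(\<Sum>s\<in>GP. z s) \<noteq> 0"
    have "y = (S - emb (\<Sum>s\<in>GP. b s)) / emb (\<Sum>s\<in>GP. z s)" using n unfolding S1 by simp
    also have "\<dots> = (S + - emb (\<Sum>s\<in>GP. b s)) / emb (\<Sum>s\<in>GP. z s)" by simp
    also have "\<dots> \<in> rat x" using Sx by (intro rat_divide rat_add rat_uminus rat_emb)
    finally have "y \<in> rat x" .
    hence "s = id" if "s \<in> GP" for s
      using that aut_rat[OF autP[OF that] xK P_x[OF that]] by (intro gen) (auto simp: autP P_x)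
    hence "GP \<subseteq> {id}" by blast
    hence "card GP \<le> card {id :: 'e \<Rightarrow> 'e}" by (intro card_mono) auto
    thus False using cardP d_ge by simp
  qed
  define e where "e = (\<Sum>s\<in>GP. b s)"
  have S: "S = emb e" using S1 z0 by (simp add: e_def)
  show ?thesis
  proof (rule exI[of _ "- e"], rule ballI)
    fix s assume s: "s \<in> GP"
    interpret s: phom K s by (rule aut_phom[OF autP[OF s]])
    have "emb e = (\<Sum>t\<in>GP. (t \<circ> s) y)"
      unfolding S[symmetric] S_def by (rule sum.reindex_bij_betw[OF agroup_right[OF GPg s], symmetric])
    also have "\<dots> = (\<Sum>t\<in>GP. emb (z s) * t y + emb (b s))"
    proof (rule sum.cong[OF refl])
      fix t assume t: "t \<in> GP"
      interpret t: phom K t by (rule aut_phom[OF autP[OF t]])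
      show "(t \<circ> s) y = emb (z s) * t y + emb (b s)"
        using zb[OF s] yK by (simp add: t.p_add t.p_mult aut_emb[OF autP[OF t]])
    qed
    also have "\<dots> = emb (z s) * S + of_nat (d - 1) * emb (b s)"
      by (simp add: sum.distrib S_def sum_distrib_left cardP)
    also have "of_nat (d - 1) = emb (- 1)" unfolding d_minus_1[symmetric] by simp
    finally have "emb e = emb (z s * e - b s)" unfolding S by simp
    hence "e = z s * e - b s" by (simp only: emb_inj)
    hence b: "b s = z s * e - e" by (simp add: algebra_simps)
    have "s (y - emb (- e)) = s y + emb e" using yK by (simp add: s.p_add aut_emb[OF autP[OF s]])
    also have "\<dots> = emb (z s) * (y - emb (- e))" unfolding zb[OF s] b by (simp add: algebra_simps)
    finally show "\<exists>z. s (y - emb (- e)) = emb z * (y - emb (- e))" by blast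
  qed
qed

text \<open>In the coordinates L and Y = y - \<gamma>, the equation f evaluated at the common fixed
  point \<gamma> becomes A(L) = L Y^(d-1). This is the situation of \<open>norm_pair\<close>, where
  \<open>A_power\<close> determines A.\<close>

theorem normal_form:
  "\<exists>e a z \<gamma>. d = p ^ e \<and> a \<noteq> 0 \<and> z \<noteq> 0 \<and> emb a * (L - emb z) ^ d = L * (y - emb \<gamma>) ^ (d - 1)"
proof -
  obtain \<gamma> where g: "\<forall>s\<in>GP. \<exists>z. s (y - emb \<gamma>) = emb z * (y - emb \<gamma>)" using centre_exists by blast
  define Y where "Y = y - emb \<gamma>"
  then obtain z where z: "\<And>s. s \<in> GP \<Longrightarrow> s Y = emb (z s) * Y" using g by metis
  have YK: "Y \<in> K" unfolding Y_def using yK by simp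
  have LK: "L \<in> K" using xK by simp
  have yY: "y = pev emb Y [:\<gamma>, 1:]" by (simp add: Y_def)
  have xL: "x = pev emb L [:- \<beta> / \<alpha>, 1 / \<alpha>:]"
    using alpha by (simp add: emb_divide field_simps)
  have Yn: "Y \<notin> range emb"
  proof
    assume "Y \<in> range emb"
    then obtain c where "y = emb (c + \<gamma>)" unfolding Y_def by (auto simp: algebra_simps)
    thus False using y_trans by blast
  qed
  have Y0: "Y \<noteq> 0" using Yn by (metis h_zero rangeI)
  have sY: "s y = s Y + emb \<gamma>" if "aut s" for s
  proof -
    interpret s: phom K s by (rule aut_phom[OF that])
    show ?thesis using yK that unfolding Y_def by (simp add: s.p_diff aut_emb)
  qed
  have sL: "s L = emb \<alpha> * s x + emb \<beta>" if "aut s" for s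
  proof -
    interpret s: phom K s by (rule aut_phom[OF that])
    show ?thesis using xK that by (simp add: s.p_add s.p_mult aut_emb)
  qed
  have z0: "z s \<noteq> 0" if "s \<in> GP" for s
  proof
    assume "z s = 0"
    hence "s Y = 0" using z[OF that] by simp
    thus False using Y0 aut_zero[OF autP[OF that]] by simp
  qed
  \<comment> \<open>Each factor \<gamma> - s y equals - z s Y. The constants are collected here and
    Y^(d-1) remains.\<close>
  define \<kappa> where "\<kappa> = (\<Prod>s\<in>GP. - z s)"
  have k0: "\<kappa> \<noteq> 0" unfolding \<kappa>_def using finP z0 by simp
  define A3 where "A3 = poly f [:\<gamma>:]"
  have "pev emb x A3 = L * (\<Prod>s\<in>GP. emb \<gamma> - s y)" unfolding A3_def by (rule f_value)
  also have "(\<Prod>s\<in>GP. emb \<gamma> - s y) = (\<Prod>s\<in>GP. emb (- z s) * Y)"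
    by (intro prod.cong refl) (simp add: sY autP z)
  also have "\<dots> = (\<Prod>s\<in>GP. emb (- z s)) * (\<Prod>s\<in>GP. Y)" by (rule prod.distrib)
  also have "\<dots> = emb \<kappa> * Y ^ (d - 1)" unfolding \<kappa>_def h_prod by (simp add: cardP)
  finally have A3: "pev emb x A3 = L * (emb \<kappa> * Y ^ (d - 1))" .
  have dA3: "degree A3 = d"
  proof -
    have A3': "A3 = (\<Sum>j\<le>d - 1. smult (\<gamma> ^ j) (coeff f j))"
      unfolding A3_def poly_altdef degf by (simp add: poly_const_pow)
    have dj: "degree (coeff f j) \<le> d" for j
      using deg0 degj[of j] by (cases j) auto
    have "coeff A3 d = (\<Sum>j\<le>d - 1. if j = 0 then coeff A0 d else 0)"
      unfolding A3' coeff_sum by (intro sum.cong refl) (use degj in \<open>auto simp: coeff_eq_0\<close>)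
    also have "\<dots> = lead_coeff A0" using deg0 by simp
    also have "\<dots> \<noteq> 0" using deg0 d_ge by auto
    finally have "coeff A3 d \<noteq> 0" .
    moreover have "degree A3 \<le> d"
      unfolding A3' by (intro degree_sum_le order_trans[OF degree_smult_le dj]) simp
    ultimately show ?thesis using le_degree by fastforce
  qed
  \<comment> \<open>The polynomial A3 rewritten in the variable L instead of x and divided by
    \<kappa>.\<close>
  define A where "A = smult (inverse \<kappa>) (pcompose A3 [:- \<beta> / \<alpha>, 1 / \<alpha>:])"
  have dA: "degree A = d" using k0 alpha dA3 by (simp add: A_def degree_pcompose)
  have AL: "pev emb L A = L * Y ^ (d - 1)"
    unfolding A_def pev_smult pev_pcompose xL[symmetric] A3 using k0 by (simp add: emb_inverse)
  have root: "poly (map_poly emb A) (t L) = t L * Y ^ (d - 1)" if t: "t \<in> GQ" for t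
  proof -
    interpret t: phom K t by (rule aut_phom[OF autQ[OF t]])
    have "t Y = Y" using sY[OF autQ[OF t]] Q_y[OF t] unfolding Y_def by (simp add: algebra_simps)
    hence "t (L * Y ^ (d - 1)) = t L * Y ^ (d - 1)"
      using LK YK by (simp add: t.p_mult t.p_power del: K_add K_mult)
    thus ?thesis using aut_pev[OF autQ[OF t] LK, of A] AL unfolding pev_def by simp
  qed
  have injL: "inj_on (\<lambda>t. t L) GQ"
    by (rule inj_onI) (use injQ alpha in \<open>auto simp: sL autQ inj_on_def\<close>)
  have dm: "degree (map_poly emb A) = d" using dA d_ge by (subst degree_map_poly) auto
  have split: "map_poly emb A - [:0, Y ^ (d - 1):] = smult (emb (lead_coeff A)) (\<Prod>g\<in>GQ. [:- g L, 1:])"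
  proof -
    let ?R = "map_poly emb A - [:0, Y ^ (d - 1):]"
    have dR: "degree ?R = d" using dm d_ge by (subst degree_diff_left) auto
    have "lead_coeff ?R = emb (lead_coeff A)"
      unfolding dR using dA d_ge by (simp add: coeff_map_poly coeff_eq_0)
    moreover have "?R = smult (lead_coeff ?R) (\<Prod>g\<in>GQ. [:- g L, 1:])"
      by (rule eq_prod_linear[OF finQ injL]) (use root dR cardQ in \<open>auto simp: algebra_simps\<close>)
    ultimately show ?thesis by simp
  qed
  \<comment> \<open>If A vanished at 0, cancelling L would leave an equation of degree d - 1 with
    the d distinct roots \<open>t L\<close>.\<close>
  have A00: "poly A 0 \<noteq> 0"
  proof
    assume "poly A 0 = 0"
    then obtain A' where A': "A = [:0, 1:] * A'" using poly_eq_0_iff_dvd[of A 0] by auto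
    have A'n: "A' \<noteq> 0" using A' dA d_ge by auto
    hence "degree A = Suc (degree A')" unfolding A' by (subst degree_mult_eq) auto
    hence dA': "degree A' = d - 1" using dA by simp
    let ?R = "map_poly emb A' - [:Y ^ (d - 1):]"
    have "degree (map_poly emb A') = d - 1" using dA' by (subst degree_map_poly) (use A'n in auto)
    hence dR: "degree ?R = d - 1" using d_ge by (subst degree_diff_left) auto
    have "card GQ \<le> degree ?R"
    proof (rule card_roots_le_degree[OF _ finQ injL])
      show "?R \<noteq> 0" using dR d_ge by auto
      fix t assume t: "t \<in> GQ"
      have "t L \<noteq> 0" using aut_zero[OF autQ[OF t]] L_nonzero by simp
      moreover have "t L * poly (map_poly emb A') (t L) = t L * Y ^ (d - 1)"
        using root[OF t] unfolding A' by (simp add: map_poly_pCons)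
      ultimately show "poly ?R (t L) = 0" by simp
    qed
    thus False using dR cardQ d_ge by simp
  qed
  interpret n: norm_pair emb K L Y A d p GP GQ
  proof
    have "s x = x \<longleftrightarrow> s L = L" if "aut s" for s using sL[OF that] alpha by simp
    thus "GP = {s. aut s \<and> s L = L}" unfolding GP by blast
    have "s y = y \<longleftrightarrow> s Y = Y" if "aut s" for s
      using sY[OF that] unfolding Y_def by (auto simp: algebra_simps)
    thus "GQ = {s. aut s \<and> s Y = Y}" unfolding GQ by blast
    show "s = id" if s: "aut s" "s L = L" "s Y = Y" for s
      
    proof (rule gen[OF s(1)])
      show "s x = x" using sL[OF s(1)] s(2) alpha by simp
      show "s y = y" using sY[OF s(1)] s(3) unfolding Y_def by simp
    qed
    show "c \<in> rat L" if "c \<in> K" "\<And>s. s \<in> GP \<Longrightarrow> s c = c" for c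
    proof -
      have "c \<in> rat x" by (rule fixP[OF that(1)]) (rule that(2))
      thus ?thesis using rat_mono[of x L] rat_pev[of L] xL by (metis subsetD)
    qed
    show "c \<in> rat Y" if "c \<in> K" "\<And>s. s \<in> GQ \<Longrightarrow> s c = c" for c
    proof -
      have "c \<in> rat y" by (rule fixQ[OF that(1)]) (rule that(2))
      thus ?thesis using rat_mono[of y Y] rat_pev[of Y] yY by (metis subsetD)
    qed
    show "s (t (ainv s Y)) = Y" if st: "s \<in> GP" "t \<in> GQ" for s t
    proof -
      have i: "ainv s \<in> GP" using st(1) aut_inv aut_inv_apply(2)[of s x] unfolding GP by auto
      have "t (ainv s Y) = ainv s Y"
      proof -
        interpret t: phom K t by (rule aut_phom[OF autQ[OF st(2)]])
        have "ainv s Y = ainv s y - emb \<gamma>" using sY[OF autP[OF i]] by simp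
        moreover have "ainv s y \<in> K" using aut_in_K[OF autP[OF i]] yK by simp
        ultimately show ?thesis using normal[OF i st(2)] by (simp add: t.p_diff aut_emb[OF autQ[OF st(2)]])
      qed
      thus ?thesis using aut_inv_apply(1)[OF autP[OF st(1)]] by simp
    qed
  qed (rule LK YK Yn GPg GQg cardP cardQ A00 split prime_p char_p p_dvd d_ge dA | (rule exI, erule z))+
  obtain e w where e: "d = p ^ e" "w \<noteq> 0" "A = smult (lead_coeff A) ([:- w, 1:] ^ d)"
    using n.A_power unfolding n.a_def by (elim exE conjE) (rule that)
  have "lead_coeff A \<noteq> 0" using dA d_ge by auto
  moreover have "emb (lead_coeff A) * (L - emb w) ^ d = L * Y ^ (d - 1)"
  proof -
    have "pev emb L (smult (lead_coeff A) ([:- w, 1:] ^ d)) = emb (lead_coeff A) * (L - emb w) ^ d"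
      by (simp add: pev_smult pev_power)
    thus ?thesis using AL e(3) by metis
  qed
  ultimately show ?thesis using e(1,2) unfolding Y_def by blast
qed

end

section \<open>Linear changes of coordinates\<close>

lemma projectively_equivalentI:
  fixes M :: "'k::field ^ 3 ^ 3"
  assumes M: "invertible M" and F: "homogeneous n F" and G: "homogeneous m G"
    and eq: "\<And>u. eval3 G (M *v u) = 0 \<longleftrightarrow> eval3 F u = 0"
  shows "projectively_equivalent (plane_curve F) (plane_curve G)"
proof -
  obtain M' where M': "M ** M' = mat 1" "M' ** M = mat 1" using M unfolding invertible_def by blast
  have inv: "M *v (M' *v w) = w" "M' *v (M *v w) = w" for w
    using M' by (simp_all add: matrix_vector_mul_assoc)
  have nz: "M *v u \<noteq> 0 \<longleftrightarrow> u \<noteq> 0" for u using inv by (metis matrix_vector_mult_0_right)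
  have im: "((*v) M) ` vec.span {u} = vec.span {M *v u}" for u
    by (simp add: vec.span_singleton image_image vector_scalar_commute)
  have mem: "vec.span {u} \<in> plane_curve H \<longleftrightarrow> u \<noteq> 0 \<and> eval3 H u = 0" if "homogeneous k H" for H :: "'k poly3" and u k
  proof -
    have "vec.span {u} \<in> proj_plane \<longleftrightarrow> u \<noteq> 0"
    proof
      assume "vec.span {u} \<in> proj_plane"
      then obtain w where "vec.span {u} = vec.span {w}" "w \<noteq> 0" unfolding proj_plane_def by blast
      thus "u \<noteq> 0" using vec.span_base[of w "{w}"] by auto
    qed (auto simp: proj_plane_def)
    thus ?thesis unfolding plane_curve_def
      using vanishes_at_span[OF that] by auto
  qed
  have el: "\<exists>u. A = vec.span {u}" if "A \<in> plane_curve H" for A :: "('k ^ 3) set" and H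
    using that unfolding plane_curve_def proj_plane_def by blast
  have "(\<lambda>A. ((*v) M) ` A) ` plane_curve F = plane_curve G"
  proof
    show "(\<lambda>A. ((*v) M) ` A) ` plane_curve F \<subseteq> plane_curve G"
    proof
      fix B assume "B \<in> (\<lambda>A. ((*v) M) ` A) ` plane_curve F"
      then obtain A where A: "A \<in> plane_curve F" "B = ((*v) M) ` A" by blast
      then obtain u where u: "A = vec.span {u}" using el by blast
      show "B \<in> plane_curve G" using A mem[OF F] mem[OF G] eq nz unfolding u im by simp
    qed
    show "plane_curve G \<subseteq> (\<lambda>A. ((*v) M) ` A) ` plane_curve F"
    proof
      fix B assume B: "B \<in> plane_curve G"
      then obtain u where u: "B = vec.span {u}" using el by blast
      have "B = ((*v) M) ` vec.span {M' *v u}" unfolding im inv u ..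
      moreover have "vec.span {M' *v u} \<in> plane_curve F"
        using B mem[OF F] mem[OF G] eq[of "M' *v u"] nz[of "M' *v u"] unfolding u inv by simp
      ultimately show "B \<in> (\<lambda>A. ((*v) M) ` A) ` plane_curve F" by blast
    qed
  qed
  thus ?thesis unfolding projectively_equivalent_def using M by blast
qed

text \<open>The forms a and b are dual to q and r. The cross products of q, r and of a, b complete
  the two matrices: they are orthogonal to the given vectors, and by the Binet-Cauchy identity
  \<open>c2\<close> their product is 1.\<close>

lemma frame_exists:
  fixes q r :: "'k::field ^ 3"
  assumes "q \<notin> vec.span {r}" "r \<notin> vec.span {q}"
  shows "\<exists>(M :: 'k ^ 3 ^ 3) M'. M ** M' = mat 1 \<and> M' ** M = mat 1 \<and> column 1 M = q \<and> column 2 M = r"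
proof -
  obtain a0 where a0: "dot a0 r = 0" "dot a0 q \<noteq> 0" using independent_form[OF assms(1)] by blast
  obtain b0 where b0: "dot b0 q = 0" "dot b0 r \<noteq> 0" using independent_form[OF assms(2)] by blast
  define a b where "a = inverse (dot a0 q) *s a0" and "b = inverse (dot b0 r) *s b0"
  have ds: "dot (t *s f) w = t * dot f w" for t and f w :: "'k ^ 3"
    by (simp add: dot_def algebra_simps)
  have ab: "dot a q = 1" "dot a r = 0" "dot b q = 0" "dot b r = 1"
    using a0 b0 unfolding a_def b_def ds by simp_all
  define cr where "cr = (\<lambda>(u :: 'k ^ 3) (w :: 'k ^ 3). vector [u$2 * w$3 - u$3 * w$2, u$3 * w$1 - u$1 * w$3, u$1 * w$2 - u$2 * w$1] :: 'k ^ 3)"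
  have c1: "dot u (cr u w) = 0" "dot w (cr u w) = 0" "dot (cr u w) u = 0" "dot (cr u w) w = 0" for u w
    unfolding dot_def cr_def by (simp_all add: algebra_simps)
  have c2: "dot (cr u w) (cr u' w') = dot u u' * dot w w' - dot u w' * dot w u'" for u w u' w'
    unfolding dot_def cr_def by (simp add: algebra_simps)
  define M M' where "M = (\<chi> i j. (vector [q, r, cr a b] :: 'k^3^3) $ j $ i)" and "M' = (vector [a, b, cr q r] :: 'k^3^3)"
  have dm: "(\<Sum>j\<in>UNIV. f $ j * w $ j) = dot f w" for f w :: "'k ^ 3" by (simp add: dot_def sum_3)
  have "M' ** M = mat 1"
    using ab c1 c2[of q r a b] unfolding vec_eq_iff forall_3
    by (simp add: M_def M'_def matrix_matrix_mult_def dm mat_def dot_def[symmetric] mult.commute)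
       (simp add: dot_def mult.commute)
  moreover hence "M ** M' = mat 1" using matrix_left_right_inverse by blast
  moreover have "column 1 M = q" "column 2 M = r"
    by (simp_all add: column_def M_def vec_eq_iff)
  ultimately show ?thesis by blast
qed

text \<open>Homogenization, built up from constants and variables; for a sum, powers of Z bring both
  summands to a common degree.\<close>

lemma poly3_dehomogenize:
  fixes h :: "'k::field poly poly"
  shows "\<exists>N H. homogeneous N H \<and> poly H 1 = h"
proof -
  define S where "S = {h :: 'k poly poly. \<exists>N H. homogeneous N H \<and> poly H 1 = h}"
  have mult: "g * h \<in> S" if gh: "g \<in> S" "h \<in> S" for g h
  proof -
    obtain N G N' H where "homogeneous N G" "poly G 1 = g" "homogeneous N' H" "poly H 1 = h"
      using gh unfolding S_def by blast
    hence "homogeneous (N + N') (G * H)" "poly (G * H) 1 = g * h" by (simp_all add: homogeneous_mult)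
    thus ?thesis unfolding S_def by blast
  qed
  have add: "g + h \<in> S" if gh: "g \<in> S" "h \<in> S" for g h
  proof -
    obtain N G N' H where *: "homogeneous N G" "poly G 1 = g" "homogeneous N' H" "poly H 1 = h"
      using gh unfolding S_def by blast
    have z: "homogeneous (N + N') (varZ ^ N' * G)" "homogeneous (N + N') (varZ ^ N * H)"
      using homogeneous_mult[OF homogeneous_power[OF homogeneous_var(3), of N'] *(1)]
        homogeneous_mult[OF homogeneous_power[OF homogeneous_var(3), of N] *(3)] by (simp_all add: add.commute)
    have "poly (varZ ^ N' * G + varZ ^ N * H) 1 = g + h"
      using * by (simp add: varZ_def poly_power)
    thus ?thesis unfolding S_def using homogeneous_add[OF z] by blast
  qed
  have "[:[:c:]:] \<in> S" for c
    unfolding S_def mem_Collect_eq by (rule exI[of _ 0], rule exI[of _ "const3 c"], rule conjI, rule homogeneous_const3) (simp add: const3_def)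
  moreover have "[:[:0, 1:]:] \<in> S"
    unfolding S_def mem_Collect_eq by (rule exI[of _ 1], rule exI[of _ varX]) (rule conjI, rule homogeneous_var, simp add: varX_def)
  moreover have y: "[:0, 1:] \<in> S"
    unfolding S_def mem_Collect_eq by (rule exI[of _ 1], rule exI[of _ varY]) (rule conjI, rule homogeneous_var, simp add: varY_def)
  ultimately have const: "[:q:] \<in> S" for q
  proof (induction q)
    case 0
    show ?case using 0(1)[of 0] by simp
  next
    case (pCons a q)
    have "[:pCons a q:] = [:[:a:]:] + [:[:0, 1:]:] * [:q:]" by simp
    thus ?case using pCons add mult by metis
  qed
  have "h \<in> S"
  proof (induction h)
    case 0
    show ?case using const[of 0] by simp
  next
    case (pCons a h)
    have "pCons a h = [:a:] + [:0, 1:] * h" by simp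
    thus ?case using pCons add mult const y by metis
  qed
  thus ?thesis unfolding S_def by blast
qed

section \<open>The affine equation and the order of the Galois group\<close>

abbreviation cf :: "'k::zero poly3 \<Rightarrow> nat \<Rightarrow> nat \<Rightarrow> nat \<Rightarrow> 'k" where
  "cf G i j l \<equiv> coeff (coeff (coeff G l) j) i"

lemma coeff_dehomogenize:
  assumes G: "homogeneous n G"
  shows "coeff (coeff (poly G 1) j) i = (if i + j \<le> n then cf G i j (n - i - j) else 0)"
proof -
  have "coeff (coeff (poly G 1) j) i = (\<Sum>l\<le>degree G. cf G i j l)"
    by (simp add: poly_altdef coeff_sum)
  also have "\<dots> = (\<Sum>l\<le>degree G + n. cf G i j l)"
    by (rule sum.mono_neutral_left) (auto simp: coeff_eq_0)
  also have "\<dots> = (\<Sum>l\<le>degree G + n. if l = n - i - j then (if i + j \<le> n then cf G i j (n - i - j) else 0) else 0)"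
    by (intro sum.cong refl) (use homogeneousD[OF G] in auto)
  also have "\<dots> = (if i + j \<le> n then cf G i j (n - i - j) else 0)"
  proof -
    have "n - i - j \<le> degree G + n" by simp
    thus ?thesis by (simp only: sum.delta finite_atMost atMost_iff simp_thms if_True)
  qed
  finally show ?thesis .
qed

lemma eval3_100: "homogeneous n G \<Longrightarrow> eval3 G (vector [1, 0, 0]) = cf G n 0 0"
proof -
  assume G: "homogeneous n G"
  have "eval3 G (vector [1, 0, 0]) = poly (coeff (coeff G 0) 0) 1"
    by (simp add: eval3_def poly_0_coeff_0)
  also have "\<dots> = (\<Sum>i\<le>degree (coeff (coeff G 0) 0) + n. cf G i 0 0)"
    unfolding poly_altdef by (simp, rule sum.mono_neutral_left) (auto simp: coeff_eq_0)
  also have "\<dots> = (\<Sum>i\<le>degree (coeff (coeff G 0) 0) + n. if i = n then cf G n 0 0 else 0)"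
    by (intro sum.cong refl) (use homogeneousD[OF G] in auto)
  finally show ?thesis by simp
qed

lemma eval3_010: "homogeneous n G \<Longrightarrow> eval3 G (vector [0, 1, 0]) = cf G 0 n 0"
proof -
  assume G: "homogeneous n G"
  have "eval3 G (vector [0, 1, 0]) = coeff (poly (coeff G 0) 1) 0"
    by (simp add: eval3_def poly_0_coeff_0 flip: one_pCons)
  also have "\<dots> = (\<Sum>i\<le>degree (coeff G 0) + n. cf G 0 i 0)"
    unfolding poly_altdef by (simp add: coeff_sum, rule sum.mono_neutral_left) (auto simp: coeff_eq_0)
  also have "\<dots> = (\<Sum>i\<le>degree (coeff G 0) + n. if i = n then cf G 0 n 0 else 0)"
    by (intro sum.cong refl) (use homogeneousD[OF G] in auto)
  finally show ?thesis by simp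
qed

context generic_point begin

lemma v_coord_nonzero: "v $ i \<noteq> 0"
proof -
  have "ev (lin3 (axis i 1)) \<noteq> 0" by (rule ev_lin3_nonzero) (simp add: axis_eq_0_iff)
  moreover have "ev (lin3 (axis i 1)) = v $ i"
    using exhaust_3[of i] by (auto simp: ev3_lin3 rhom_axioms axis_def)
  ultimately show ?thesis by simp
qed

abbreviation "x1 \<equiv> v $ 1 / v $ 3"
abbreviation "x2 \<equiv> v $ 2 / v $ 3"

lemma x12_K: "x1 \<in> K" "x2 \<in> K"
  using coord_ratio_in_K v_coord_nonzero by blast+

lemma x12_trans: "x1 \<notin> range emb" "x2 \<notin> range emb"
proof -
  have *: "v $ i / v $ 3 \<notin> range emb" if i: "i = 1 \<or> i = 2" for i
  proof
    assume "v $ i / v $ 3 \<in> range emb"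
    then obtain c where "v $ i = emb c * v $ 3" using v_coord_nonzero[of 3] by (auto simp: field_simps)
    hence "ev (lin3 (axis i 1 - axis 3 c)) = 0"
      using i by (auto simp: ev3_lin3 rhom_axioms axis_def)
    moreover have "axis i 1 - axis 3 c \<noteq> (0 :: 'k ^ 3)"
      using i by (auto simp: vec_eq_iff forall_3 axis_def)
    ultimately show False using ev_lin3_nonzero by blast
  qed
  show "x1 \<notin> range emb" "x2 \<notin> range emb" using * by blast+
qed

lemma ev_dehomogenize:
  assumes "homogeneous n G"
  shows "ev G = v $ 3 ^ n * pev (pev emb x1) x2 (poly G 1)"
proof -
  interpret p: rhom "pev (pev emb x1) x2" by (rule rhom.rhom_pev[OF rhom_pev])
  have "v = (\<chi> i. v $ 3 * (vector [x1, x2, 1] :: 'e ^ 3) $ i)"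
    using v_coord_nonzero[of 3] by (simp add: vec_eq_iff forall_3)
  hence "ev G = v $ 3 ^ n * ev3 emb (vector [x1, x2, 1]) G"
    using ev3_scale[OF rhom_axioms assms, of "v $ 3" "vector [x1, x2, 1]"] by metis
  moreover have "ev3 emb (vector [x1, x2, 1]) G = pev (pev emb x1) x2 (poly G 1)"
    using p.poly_map_poly[of G 1] by (simp add: ev3_def pev_def)
  ultimately show ?thesis by simp
qed

lemma affine_root: "pev (pev emb x1) x2 (poly F 1) = 0"
  using ev_dehomogenize[OF F_hom] kernel[of F] v_coord_nonzero[of 3] by simp

lemma affine_minimal:
  assumes "pev (pev emb x1) x2 h = 0"
  shows "poly F 1 dvd h"
proof -
  obtain n H where H: "homogeneous n H" "poly H 1 = h" using poly3_dehomogenize by blast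
  have "ev H = 0" using ev_dehomogenize[OF H(1)] assms H(2) by simp
  hence "F dvd H" using kernel by blast
  thus ?thesis unfolding H(2)[symmetric] dvd_def by (auto simp: poly_mult)
qed

lemma K_affine:
  assumes "c \<in> K"
  shows "\<exists>G H. c = ev3 emb (vector [x1, x2, 1]) G / ev3 emb (vector [x1, x2, 1]) H"
proof -
  obtain n G H where c: "c = ev G / ev H" "homogeneous n G" "homogeneous n H"
    using assms unfolding frac_field_def by blast
  have "v = (\<chi> i. v $ 3 * (vector [x1, x2, 1] :: 'e ^ 3) $ i)"
    using v_coord_nonzero[of 3] by (simp add: vec_eq_iff forall_3)
  hence "ev G = v $ 3 ^ n * ev3 emb (vector [x1, x2, 1]) G" "ev H = v $ 3 ^ n * ev3 emb (vector [x1, x2, 1]) H"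
    using ev3_scale[OF rhom_axioms c(2), of "v $ 3" "vector [x1, x2, 1]"]
      ev3_scale[OF rhom_axioms c(3), of "v $ 3" "vector [x1, x2, 1]"] by metis+
  thus ?thesis using c(1) v_coord_nonzero[of 3] by auto
qed

end

context func_field begin

lemma aut_ev3:
  assumes s: "aut s" and w: "\<And>i. w $ i \<in> K"
  shows "ev3 emb w G \<in> K \<and> s (ev3 emb w G) = ev3 emb (\<chi> i. s (w $ i)) G"
proof -
  interpret s: phom K s by (rule aut_phom[OF s])
  interpret e: rhom "ev3 emb w" by (rule rhom_ev3[OF rhom_axioms])
  interpret e': rhom "ev3 emb (\<chi> i. s (w $ i))" by (rule rhom_ev3[OF rhom_axioms])
  show ?thesis
    by (induction G rule: poly3_induct) (simp_all add: rhom_axioms w aut_emb[OF s] s.p_add s.p_mult)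
qed

lemma rat_poly_clear:
  assumes x: "x \<notin> range emb" and q: "\<And>i. coeff q i \<in> rat x"
  shows "\<exists>h D. D \<noteq> 0 \<and> degree h = degree q \<and> map_poly (pev emb x) h = smult (pev emb x D) q"
proof -
  interpret x: rhom "pev emb x" by (rule rhom_pev)
  have "\<exists>h D. D \<noteq> 0 \<and> map_poly (pev emb x) h = smult (pev emb x D) q" using q
  proof (induction q)
    case 0
    show ?case by (rule exI[of _ 0], rule exI[of _ 1]) simp
  next
    case (pCons a q)
    have "coeff q i \<in> rat x" for i using pCons.prems[of "Suc i"] by simp
    then obtain h D where h: "D \<noteq> 0" "map_poly (pev emb x) h = smult (pev emb x D) q" using pCons.IH by blast
    have "a \<in> rat x" using pCons.prems[of 0] by simp
    then obtain N E where a: "a = pev emb x N / pev emb x E" "pev emb x E \<noteq> 0" unfolding rat_def by blast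
    have "map_poly (pev emb x) (pCons (N * D) (smult E h)) = smult (pev emb x (E * D)) (pCons a q)"
      using h(2) a by (simp add: map_poly_pCons map_poly_smult x.h_mult pev_mult)
    moreover have "E * D \<noteq> 0" using a h by auto
    ultimately show ?case by blast
  qed
  then obtain h D where h: "D \<noteq> 0" "map_poly (pev emb x) h = smult (pev emb x D) q" by blast
  have "degree (map_poly (pev emb x) h) = degree h"
    by (intro degree_map_poly) (use transcendental[OF x] in auto)
  moreover have "degree (smult (pev emb x D) q) = degree q" using transcendental[OF x h(1)] by simp
  ultimately show ?thesis using h by metis
qed

text \<open>An automorphism in G is determined by the image of y, which is a root of f, so there are
  at most \<open>degree f\<close> of them. Conversely, the product over the orbit of y has
  coefficients in k(x); after clearing denominators it is a multiple of f, so the orbit is large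
  enough.\<close>

theorem card_galois_group:
  assumes xy: "x \<in> K" "y \<in> K" "x \<notin> range emb" and f: "f \<noteq> 0" "pev (pev emb x) y f = 0"
    and min: "\<And>h. pev (pev emb x) y h = 0 \<Longrightarrow> f dvd h"
    and G: "G = Gal x"
    and gen: "\<And>s. aut s \<Longrightarrow> s x = x \<Longrightarrow> s y = y \<Longrightarrow> s = id"
    and fixed: "\<And>c. c \<in> K \<Longrightarrow> (\<And>s. s \<in> G \<Longrightarrow> s c = c) \<Longrightarrow> c \<in> rat x"
  shows "agroup G" "card G = degree f"
proof -
  interpret x: rhom "pev emb x" by (rule rhom_pev)
  have inj: "inj_on (\<lambda>s. s y) G"
  proof (rule inj_onI)
    fix s t assume st: "s \<in> G" "t \<in> G" "s y = t y"
    have a: "aut s" "aut t" "s x = x" "t x = x" using st G by auto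
    have "ainv t (t x) = x" by (rule aut_inv_apply(2)[OF a(2)])
    hence tx: "ainv t x = x" using a(4) by simp
    have "ainv t \<circ> s = id"
      by (rule gen) (use a st tx in \<open>simp_all add: aut_comp aut_inv aut_inv_apply\<close>)
    hence "ainv t (s c) = c" for c by (metis comp_apply id_apply)
    thus "s = t" using aut_inv_apply(1)[OF a(2)] by (metis ext)
  qed
  have dm: "degree (map_poly (pev emb x) f) = degree f" "map_poly (pev emb x) f \<noteq> 0"
  proof -
    show "degree (map_poly (pev emb x) f) = degree f"
      by (intro degree_map_poly) (use transcendental[OF xy(3)] in auto)
    have "coeff (map_poly (pev emb x) f) (degree f) \<noteq> 0"
      using f(1) transcendental[OF xy(3)] by (simp add: coeff_map_poly)
    thus "map_poly (pev emb x) f \<noteq> 0" by auto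
  qed
  have bound: "card B \<le> degree f" if B: "finite B" "B \<subseteq> G" for B
  proof -
    have "card B \<le> degree (map_poly (pev emb x) f)"
    proof (rule card_roots_le_degree[OF dm(2) B(1) inj_on_subset[OF inj B(2)]])
      fix s assume s: "s \<in> B"
      show "poly (map_poly (pev emb x) f) (s y) = 0"
        by (rule galois_conjugates[OF xy(2,1) B(1) _ inj_on_subset[OF inj B(2)] f(2) s]) (use B G in auto)
    qed
    thus ?thesis unfolding dm(1) .
  qed
  have fin: "finite G"
  proof (rule ccontr)
    assume "infinite G"
    then obtain B where "B \<subseteq> G" "finite B" "card B = Suc (degree f)"
      using infinite_arbitrarily_large by blast
    thus False using bound by fastforce
  qed
  show g: "agroup G" unfolding agroup_def using fin by (auto simp: G aut_id aut_comp)
  let ?q = "\<Prod>s\<in>G. [:- s y, 1:]"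
  have sK: "s y \<in> K" if "s \<in> G" for s using that xy(2) aut_in_K unfolding G by blast
  have "coeff ?q i \<in> rat x" for i
  proof (rule fixed)
    have "K.Bpoly ?q" by (rule K.map_p_prod_linear) (rule sK)
    thus "coeff ?q i \<in> K" unfolding K.Bpoly_def by blast
    show "s (coeff ?q i) = coeff ?q i" if "s \<in> G" for s
      by (rule agroup_prod_invariant[OF g xy(2) that])
  qed
  then obtain h D where h: "D \<noteq> 0" "degree h = degree ?q" "map_poly (pev emb x) h = smult (pev emb x D) ?q"
    using rat_poly_clear[OF xy(3)] by blast
  have "id \<in> G" using g unfolding agroup_def by blast
  hence "id y \<in> (\<lambda>s. s y) ` G" by (rule imageI)
  hence "y \<in> (\<lambda>s. s y) ` G" by simp
  hence "poly ?q y = 0" using poly_prod_linear_eq_0[OF fin, of "\<lambda>s. s y" y] by blast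
  hence "pev (pev emb x) y h = 0" unfolding pev_def[of "pev emb x"] h(3) by simp
  hence "f dvd h" by (rule min)
  moreover have "h \<noteq> 0"
  proof
    assume "h = 0"
    hence "smult (pev emb x D) ?q = 0" using h(3) by simp
    hence "?q = 0" using transcendental[OF xy(3) h(1)] by simp
    thus False using degree_prod_linear(2)[of "\<lambda>s. s y" G] by simp
  qed
  ultimately have "degree f \<le> card G" using h(2) degree_prod_linear(1)[of "\<lambda>s. s y" G] dvd_imp_degree_le by metis
  thus "card G = degree f" using bound[OF fin] by simp
qed

end

section \<open>From Galois points to the model\<close>

lemma eval3_model_form:
  "eval3 (model_form d) w = (w $ 2) ^ (d - 1) * w $ 1 + (w $ 1 + w $ 3) ^ d"
proof -
  interpret e: rhom "\<lambda>G. eval3 G w" by (rule rhom_eval3)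
  show ?thesis unfolding model_form_def by simp
qed

lemma homogeneous_model_form: "d > 0 \<Longrightarrow> homogeneous d (model_form d)"
proof -
  assume d: "d > 0"
  have "homogeneous (1 * (d - 1) + 1) (varY ^ (d - 1) * varX)"
    by (intro homogeneous_mult homogeneous_power homogeneous_var)
  moreover have "homogeneous (1 * d) ((varX + varZ) ^ d)"
    by (intro homogeneous_power homogeneous_add homogeneous_var)
  ultimately show ?thesis using d unfolding model_form_def by (intro homogeneous_add) simp_all
qed

context generic_point begin

lemma aut_generated:
  assumes s: "aut s" "s x1 = x1" "s x2 = x2"
  shows "s = id"
proof
  fix c
  show "s c = id c"
  proof (cases "c \<in> K")
    case False
    thus ?thesis using s(1) unfolding aut_def by simp
  next
    case True
    let ?w = "vector [x1, x2, 1] :: 'e ^ 3"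
    obtain G H where c: "c = ev3 emb ?w G / ev3 emb ?w H" using K_affine[OF True] by blast
    have w: "?w $ i \<in> K" for i using exhaust_3[of i] x12_K K_emb[of 1] by (auto simp del: K_emb)
    have sw: "(\<chi> i. s (?w $ i)) = ?w" using s aut_emb[OF s(1), of 1] by (simp add: vec_eq_iff forall_3)
    have "s (ev3 emb ?w G) = ev3 emb ?w G" for G using aut_ev3[OF s(1) w, of G] unfolding sw by blast
    thus ?thesis unfolding c using aut_divide[OF s(1)] aut_ev3[OF s(1) w] by simp
  qed
qed

lemma dehomogenize_nonzero: "poly F 1 \<noteq> 0"
proof
  assume z: "poly F 1 = 0"
  obtain l where l: "coeff F l \<noteq> 0" using F_nonzero by (metis leading_coeff_0_iff)
  then obtain j where j: "coeff (coeff F l) j \<noteq> 0" by (metis leading_coeff_0_iff)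
  then obtain i where i: "cf F i j l \<noteq> 0" by (metis leading_coeff_0_iff)
  hence "i + j + l = d" using F_hom unfolding homogeneous_def by blast
  hence "coeff (coeff (poly F 1) j) i = cf F i j l" using coeff_dehomogenize[OF F_hom] by auto
  thus False using i z by simp
qed

lemma card_galois_x1:
  assumes "\<And>c. c \<in> K \<Longrightarrow> (\<And>s. s \<in> Gal x1 \<Longrightarrow> s c = c) \<Longrightarrow> c \<in> rat x1"
  shows "agroup (Gal x1)" "card (Gal x1) = degree (poly F 1)"
proof -
  note * = card_galois_group[where G = "Gal x1" and f = "poly F 1" and x = x1 and y = x2]
  show "agroup (Gal x1)"
    by (rule *(1)[OF x12_K x12_trans(1) dehomogenize_nonzero affine_root])
       (rule affine_minimal refl aut_generated assms; assumption)+
  show "card (Gal x1) = degree (poly F 1)"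
    by (rule *(2)[OF x12_K x12_trans(1) dehomogenize_nonzero affine_root])
       (rule affine_minimal refl aut_generated assms; assumption)+
qed

lemma degree_dehomogenize: "eval3 F (vector [0, 1, 0]) \<noteq> 0 \<Longrightarrow> degree (poly F 1) = d"
proof -
  assume *: "eval3 F (vector [0, 1, 0]) \<noteq> 0"
  have "coeff (coeff (poly F 1) d) 0 \<noteq> 0"
    using * coeff_dehomogenize[OF F_hom, of d 0] eval3_010[OF F_hom] by simp
  hence "coeff (poly F 1) d \<noteq> 0" by auto
  moreover have "coeff (poly F 1) j = 0" if "j > d" for j
    by (rule poly_eqI) (use that coeff_dehomogenize[OF F_hom] in auto)
  hence "degree (poly F 1) \<le> d" by (intro degree_le) auto
  ultimately show ?thesis using le_degree by fastforce
qed

text \<open>M exchanges the first two coordinates and reduces the claim to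
  \<open>card_galois_x1\<close>. The degree of the equation in x1 is d because (1 : 0 : 0) is off
  the curve.\<close>

lemma card_galois_x2:
  assumes e: "eval3 F (vector [1, 0, 0]) \<noteq> 0"
    and fixed: "\<And>c. c \<in> K \<Longrightarrow> (\<And>s. s \<in> Gal x2 \<Longrightarrow> s c = c) \<Longrightarrow> c \<in> rat x2"
  shows "agroup (Gal x2)" "card (Gal x2) = d"
proof -
  define M :: "'k ^ 3 ^ 3" where "M = vector [vector [0, 1, 0], vector [1, 0, 0], vector [0, 0, 1]]"
  have MM: "M ** M = mat 1"
    by (simp add: vec_eq_iff forall_3 M_def matrix_matrix_mult_def sum_3 mat_def)
  define w where "w = (\<chi> i. ev (lin3 (M $ i)))"
  have w: "w $ 1 = v $ 2" "w $ 2 = v $ 1" "w $ 3 = v $ 3"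
    by (simp_all add: w_def M_def ev3_lin3 rhom_axioms)
  have g: "generic_point emb (subst3 M F) d w" and fr: "frac_field emb w = K"
    using change_coordinates[OF MM MM] unfolding w_def by auto
  interpret g: generic_point emb "subst3 M F" d w by (rule g)
  have "eval3 (subst3 M F) (vector [0, 1, 0]) = eval3 F (vector [1, 0, 0])"
    unfolding eval3_subst3 by (rule arg_cong[of _ _ "eval3 F"])
      (simp add: vec_eq_iff forall_3 M_def matrix_vector_mult_def sum_3)
  hence deg: "degree (poly (subst3 M F) 1) = d" using e by (intro g.degree_dehomogenize) simp
  show "agroup (Gal x2)"
    by (rule g.card_galois_x1(1)[unfolded fr w]) (rule fixed)
  show "card (Gal x2) = d"
    by (rule g.card_galois_x1(2)[unfolded fr w deg]) (rule fixed)
qed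

text \<open>If x1 had a pole where x2 is regular, the centre would be (1 : 0 : 0), which is off the
  curve.\<close>

lemma integral_x1:
  assumes e: "eval3 F (vector [1, 0, 0]) \<noteq> 0" and V: "place V" "x2 \<in> V"
  shows "x1 \<in> V"
proof (rule ccontr)
  assume "x1 \<notin> V"
  hence m: "inverse x1 \<in> mid V" by (rule place_notin[OF V(1) x12_K(1)])
  have m2: "inverse x1 * x2 \<in> mid V" by (rule mid_mult[OF V(1) m V(2)])
  let ?l = "inverse (v $ 1)"
  have l: "?l * v $ 1 = emb 1" "?l * v $ 2 = inverse x1 * x2" "?l * v $ 3 = inverse x1"
    using v_coord_nonzero[of 1] v_coord_nonzero[of 3] by (simp_all add: field_simps)
  have z: "f \<in> V \<and> val V f = 0" if "f \<in> mid V" for f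
    using that mid_subset[OF V(1)] val_mid[OF V(1)] by blast
  have "?l * v $ i \<in> V \<and> val V (?l * v $ i) = vector [1, 0, 0] $ i" for i
    using exhaust_3[of i] z[OF m] z[OF m2] place_emb[OF V(1), of 1] val_emb[OF V(1), of 1]
    by (elim disjE) (simp_all only: l vector_3 simp_thms)
  hence "centred V ?l (vector [1, 0, 0])"
    unfolding centred_def using V(1) by (simp add: vec_eq_iff forall_3)
  thus False using centred_on_curve(2) e by blast
qed

text \<open>Coordinates are chosen with Q = (1 : 0 : 0) and P = (0 : 1 : 0), so that x1 is the
  projection from P and x2 the one from Q. The hypothesis \<open>cf1\<close> concerns the
  coefficient of X Y^(d-1), which measures whether PQ is tangent at P.\<close>

theorem forward_algebra:
  assumes e1: "eval3 F (vector [1, 0, 0]) \<noteq> 0" and e2: "eval3 F (vector [0, 1, 0]) = 0"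
    and cf1: "cf F 1 (d - 1) 0 \<noteq> 0"
    and fixP: "\<And>c. c \<in> K \<Longrightarrow> (\<And>s. s \<in> Gal x1 \<Longrightarrow> s c = c) \<Longrightarrow> c \<in> rat x1"
    and fixQ: "\<And>c. c \<in> K \<Longrightarrow> (\<And>s. s \<in> Gal x2 \<Longrightarrow> s c = c) \<Longrightarrow> c \<in> rat x2"
    and normal: "\<And>s t. aut s \<Longrightarrow> s x1 = x1 \<Longrightarrow> aut t \<Longrightarrow> t x2 = x2 \<Longrightarrow> t (s x2) = s x2"
    and p: "prime p" "of_nat p = (0 :: 'k)" "p dvd d" "d \<ge> 3"
  shows "\<exists>e (T :: 'k ^ 3 ^ 3). d = p ^ e \<and> invertible T \<and>
    (\<forall>u. eval3 (model_form d) (T *v u) = 0 \<longleftrightarrow> eval3 F u = 0)"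
proof -
  define \<alpha> where "\<alpha> = cf F 1 (d - 1) 0"
  define \<beta> where "\<beta> = cf F 0 (d - 1) 1"
  let ?f = "poly F 1"
  note cd = coeff_dehomogenize[OF F_hom]
  have top: "coeff ?f (d - 1) = [:\<beta>, \<alpha>:]"
  proof (rule poly_eqI)
    fix i :: nat
    have "i = 0 \<or> i = 1 \<or> i > 1" by auto
    thus "coeff (coeff ?f (d - 1)) i = coeff [:\<beta>, \<alpha>:] i"
      using d_gt_1 by (auto simp: cd \<alpha>_def \<beta>_def coeff_pCons split: nat.split)
  qed
  have big: "coeff ?f j = 0" if "j \<ge> d" for j
  proof (rule poly_eqI)
    fix i
    show "coeff (coeff ?f j) i = coeff 0 i"
      using that e2 unfolding cd eval3_010[OF F_hom] by (cases "i = 0"; cases "j = d") auto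
  qed
  have degf: "degree ?f = d - 1"
  proof (rule antisym)
    show "degree ?f \<le> d - 1" by (rule degree_le) (use big in auto)
    show "d - 1 \<le> degree ?f" by (rule le_degree) (use top cf1 \<alpha>_def in auto)
  qed
  have deg0: "degree (coeff ?f 0) = d"
  proof (rule antisym)
    show "degree (coeff ?f 0) \<le> d" by (rule degree_le) (simp add: cd)
    show "d \<le> degree (coeff ?f 0)" by (rule le_degree) (use e1 in \<open>simp add: cd eval3_100[OF F_hom]\<close>)
  qed
  have degj: "degree (coeff ?f j) < d" if "j > 0" for j
  proof -
    have "degree (coeff ?f j) \<le> d - j" by (rule degree_le) (use that in \<open>auto simp: cd\<close>)
    thus ?thesis using that d_gt_1 by simp
  qed
  interpret gp: galois_pair emb K x1 x2 d p "Gal x1" "Gal x2" ?f \<alpha> \<beta>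
  proof
    show "card (Gal x1) = d - 1" unfolding degf[symmetric] by (rule card_galois_x1(2)) (rule fixP)
    show "agroup (Gal x1)" by (rule card_galois_x1(1)) (rule fixP)
    show "card (Gal x2) = d" by (rule card_galois_x2(2)[OF e1]) (rule fixQ)
    show "agroup (Gal x2)" by (rule card_galois_x2(1)[OF e1]) (rule fixQ)
    show "t (s x2) = s x2" if "s \<in> Gal x1" "t \<in> Gal x2" for s t
      by (rule normal) (use that in auto)
    show "lead_coeff ?f = [:\<beta>, \<alpha>:]" unfolding degf by (rule top)
    show "\<alpha> \<noteq> 0" using cf1 by (simp add: \<alpha>_def)
  qed (rule x12_K x12_trans refl aut_generated fixP fixQ affine_root degf deg0 degj integral_x1[OF e1] p; assumption?)+
  obtain e a z \<gamma> where nf: "d = p ^ e" "a \<noteq> 0" "z \<noteq> 0"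
      "emb a * ((emb \<alpha> * x1 + emb \<beta>) - emb z) ^ d = (emb \<alpha> * x1 + emb \<beta>) * (x2 - emb \<gamma>) ^ (d - 1)"
    using gp.normal_form by (elim exE conjE) (rule that)
  have al: "\<alpha> \<noteq> 0" using cf1 by (simp add: \<alpha>_def)
  \<comment> \<open>The homogenized normal form. It vanishes at the generic point and has the degree
    of F, so its values are a constant multiple of those of F.\<close>
  define G where "G = const3 a * lin3 (vector [\<alpha>, 0, \<beta> - z]) ^ d
    - lin3 (vector [\<alpha>, 0, \<beta>]) * lin3 (vector [0, 1, - \<gamma>]) ^ (d - 1)"
  have Gh: "homogeneous d G"
  proof -
    have "homogeneous (0 + 1 * d) (const3 a * lin3 (vector [\<alpha>, 0, \<beta> - z]) ^ d)"
      by (rule homogeneous_mult[OF homogeneous_const3 homogeneous_power[OF homogeneous_lin3]])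
    moreover have "homogeneous (1 + 1 * (d - 1)) (lin3 (vector [\<alpha>, 0, \<beta>]) * lin3 (vector [0, 1, - \<gamma>]) ^ (d - 1))"
      by (rule homogeneous_mult[OF homogeneous_lin3 homogeneous_power[OF homogeneous_lin3]])
    moreover have "0 + 1 * d = d" "1 + 1 * (d - 1) = d" using d_gt_1 by simp_all
    ultimately show ?thesis unfolding G_def by (intro homogeneous_diff) (simp_all only:)
  qed
  have "ev G = 0"
  proof -
    have l: "ev (lin3 (vector [\<alpha>, 0, \<beta> - z])) = v $ 3 * ((emb \<alpha> * x1 + emb \<beta>) - emb z)"
      "ev (lin3 (vector [\<alpha>, 0, \<beta>])) = v $ 3 * (emb \<alpha> * x1 + emb \<beta>)"
      "ev (lin3 (vector [0, 1, - \<gamma>])) = v $ 3 * (x2 - emb \<gamma>)"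
      using v_coord_nonzero[of 3] by (simp_all add: ev3_lin3 rhom_axioms field_simps)
    have "ev G = emb a * (v $ 3 * ((emb \<alpha> * x1 + emb \<beta>) - emb z)) ^ d
      - v $ 3 * (emb \<alpha> * x1 + emb \<beta>) * (v $ 3 * (x2 - emb \<gamma>)) ^ (d - 1)"
      unfolding G_def ev.h_diff ev.h_mult ev.h_power l ev3_const3[OF rhom_axioms] ..
    also have "\<dots> = v $ 3 ^ d * (emb a * ((emb \<alpha> * x1 + emb \<beta>) - emb z) ^ d)
      - (v $ 3 * v $ 3 ^ (d - 1)) * ((emb \<alpha> * x1 + emb \<beta>) * (x2 - emb \<gamma>) ^ (d - 1))"
      unfolding power_mult_distrib by (simp only: mult_ac)
    also have "v $ 3 * v $ 3 ^ (d - 1) = v $ 3 ^ d" using d_gt_1 by (cases d) auto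
    finally show ?thesis unfolding nf(4) by simp
  qed
  hence "F dvd G" using kernel by blast
  then obtain c where c: "\<And>u. eval3 G u = c * eval3 F u" using form_dvd_same[OF F_hom Gh] by blast
  have Gu: "eval3 G u = a * (\<alpha> * u $ 1 + (\<beta> - z) * u $ 3) ^ d
      - (\<alpha> * u $ 1 + \<beta> * u $ 3) * (u $ 2 - \<gamma> * u $ 3) ^ (d - 1)" for u
  proof -
    interpret r: rhom "\<lambda>G. eval3 G u" by (rule rhom_eval3)
    show ?thesis unfolding G_def by (simp add: eval3_lin3 dot_def)
  qed
  have "eval3 G (vector [1, 0, 0]) \<noteq> 0" unfolding Gu using nf(2) al d_gt_1 by (simp add: power_0_left)
  hence "c \<noteq> 0" using c by auto
  hence GF: "eval3 G u = 0 \<longleftrightarrow> eval3 F u = 0" for u using c by simp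
  obtain \<omega> where om: "\<omega> ^ d = - a" using nth_root_exists[of d "- a"] d_gt_1 by auto
  have om0: "\<omega> \<noteq> 0" using om nf(2) d_gt_1 by (auto simp: power_0_left)
  \<comment> \<open>The new X is L and the new Y is x2 - \<gamma>, homogenized. The third row is
    chosen so that X + Z becomes \<omega> times L - z, and \<omega>^d = - a absorbs the constant of
    the normal form.\<close>
  define T :: "'k ^ 3 ^ 3" where
    "T = vector [vector [\<alpha>, 0, \<beta>], vector [0, 1, - \<gamma>], vector [\<omega> * \<alpha> - \<alpha>, 0, \<omega> * (\<beta> - z) - \<beta>]]"
  have Tu: "(T *v u) $ 1 = \<alpha> * u $ 1 + \<beta> * u $ 3" "(T *v u) $ 2 = u $ 2 - \<gamma> * u $ 3"
    "(T *v u) $ 3 = \<omega> * (\<alpha> * u $ 1 + (\<beta> - z) * u $ 3) - (\<alpha> * u $ 1 + \<beta> * u $ 3)" for u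
    by (simp_all add: T_def matrix_vector_mult_def sum_3 algebra_simps)
  have "invertible T"
    unfolding invertible_left_inverse matrix_left_invertible_ker
  proof (intro allI impI)
    fix u assume "T *v u = 0"
    hence *: "\<alpha> * u $ 1 + \<beta> * u $ 3 = 0" "u $ 2 - \<gamma> * u $ 3 = 0"
      "\<omega> * (\<alpha> * u $ 1 + (\<beta> - z) * u $ 3) - (\<alpha> * u $ 1 + \<beta> * u $ 3) = 0"
      using Tu[of u] by simp_all
    have "\<alpha> * u $ 1 + (\<beta> - z) * u $ 3 = 0" using *(1,3) om0 by simp
    hence "z * u $ 3 = 0" using *(1) by (simp add: algebra_simps)
    hence "u $ 3 = 0" using nf(3) by simp
    thus "u = 0" using * al by (simp add: vec_eq_iff forall_3)
  qed
  moreover have "eval3 (model_form d) (T *v u) = - eval3 G u" for u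
    unfolding eval3_model_form Tu Gu by (simp add: power_mult_distrib om mult.commute)
  ultimately show ?thesis using nf(1) GF by (intro exI[of _ e] exI[of _ T]) simp
qed

end

section \<open>Tangent lines\<close>

definition gradient :: "'k::field poly3 \<Rightarrow> 'k ^ 3 \<Rightarrow> 'k ^ 3" where
  "gradient F u = vector [eval3 (partialX F) u, eval3 (partialY F) u, eval3 (partialZ F) u]"

lemma homogeneous_partial:
  assumes "homogeneous d F"
  shows "homogeneous (d - 1) (partialX F)" "homogeneous (d - 1) (partialY F)" "homogeneous (d - 1) (partialZ F)"
proof -
  have x: "cf (partialX F) i j l = of_nat (Suc i) * cf F (Suc i) j l" for i j l
    by (simp add: partialX_def coeff_map_poly coeff_pderiv)
  have y: "cf (partialY F) i j l = of_nat (Suc j) * cf F i (Suc j) l" for i j l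
    by (simp add: partialY_def coeff_map_poly coeff_pderiv flip: of_nat_Suc) (simp add: of_nat_poly)
  have z: "cf (partialZ F) i j l = of_nat (Suc l) * cf F i j (Suc l)" for i j l
    by (simp add: partialZ_def coeff_pderiv flip: of_nat_Suc) (simp add: of_nat_poly)
  have F: "i + j + l = d" if "of_nat n * cf F i j l \<noteq> 0" for n i j l
    using assms that unfolding homogeneous_def by auto
  show "homogeneous (d - 1) (partialX F)" "homogeneous (d - 1) (partialY F)" "homogeneous (d - 1) (partialZ F)"
    unfolding homogeneous_def x y z by (fastforce dest: F)+
qed

lemma tangent_line_gradient:
  assumes "homogeneous d F"
  shows "tangent_line F (vec.span {r}) = {w. dot (gradient F r) w = 0}"
proof -
  note h = eval3_scale[OF homogeneous_partial(1)[OF assms]] eval3_scale[OF homogeneous_partial(2)[OF assms]]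
    eval3_scale[OF homogeneous_partial(3)[OF assms]]
  have *: "eval3 (partialX F) (t *s r) * w $ 1 + eval3 (partialY F) (t *s r) * w $ 2
      + eval3 (partialZ F) (t *s r) * w $ 3 = t ^ (d - 1) * dot (gradient F r) w" for t w
    unfolding h by (simp add: dot_def gradient_def algebra_simps)
  show ?thesis unfolding tangent_line_def vec.span_singleton
    using * *[of 1] by (auto simp del: vector_smult_lid)
qed

lemma gradient_nonzero:
  assumes F: "homogeneous d F" and P: "vec.span {r} \<in> plane_curve F - singular_points F"
  shows "gradient F r \<noteq> 0"
proof
  assume "gradient F r = 0"
  hence "eval3 (partialX F) r = 0" "eval3 (partialY F) r = 0" "eval3 (partialZ F) r = 0"
    by (simp_all add: gradient_def vec_eq_iff forall_3)
  hence "vec.span {r} \<in> singular_points F"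
    using P vanishes_at_span homogeneous_partial[OF F] unfolding singular_points_def by blast
  thus False using P by blast
qed

lemma gradient_line:
  fixes F :: "'k::field poly3"
  shows "coeff (ev3 (\<lambda>c. [:c:]) (\<chi> i. [:u $ i, w $ i:]) F) 1 = dot (gradient F u) w"
proof -
  let ?w = "\<chi> i. [:u $ i, w $ i:]"
  have e: "poly (ev3 (\<lambda>c. [:c:]) ?w G) 0 = eval3 G u" for G
    unfolding ev3_hom[OF rhom_const_poly rhom_poly] eval3_conv_ev3 by simp
  have "coeff (ev3 (\<lambda>c. [:c:]) ?w F) 1 = poly (pderiv (ev3 (\<lambda>c. [:c:]) ?w F)) 0"
    by (simp add: poly_0_coeff_0 coeff_pderiv)
  also have "\<dots> = dot (gradient F u) w"
    unfolding ev3_pderiv[OF refl] by (simp add: e pderiv_pCons dot_def gradient_def)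
  finally show ?thesis .
qed

text \<open>Along (1 + t) u the form F is (1 + t)^d times its value at u, hence zero, and so is its
  linear coefficient in t. The argument does not divide by d.\<close>

lemma euler_zero:
  fixes F :: "'k::field poly3"
  assumes F: "homogeneous d F" and u: "eval3 F u = 0"
  shows "dot (gradient F u) u = 0"
proof -
  have "ev3 (\<lambda>c. [:c:]) (\<chi> i. [:1, 1:] * (\<chi> i. [:u $ i:]) $ i) F = [:1, 1:] ^ d * ev3 (\<lambda>c. [:c:]) (\<chi> i. [:u $ i:]) F"
    by (rule ev3_scale[OF rhom_const_poly F])
  moreover have "ev3 (\<lambda>c. [:c:]) (\<chi> i. [:u $ i:]) F = [:eval3 F u:]"
    unfolding eval3_conv_ev3 using ev3_hom[OF rhom_id rhom_const_poly, of u F] by simp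
  ultimately have "ev3 (\<lambda>c. [:c:]) (\<chi> i. [:u $ i, u $ i:]) F = 0" using u by simp
  thus ?thesis using gradient_line[of u u F] by simp
qed

text \<open>On the points (t : 1 : 0) the pulled back form is F along the line from column 2 towards
  column 1, and its linear coefficient is a directional derivative. With P and Q as these columns it
  is nonzero exactly when Q is off the tangent line at P.\<close>

lemma gradient_subst3:
  fixes F :: "'k::field poly3"
  assumes F: "homogeneous d F" and d: "d > 0"
  shows "cf (subst3 M F) 1 (d - 1) 0 = dot (gradient F (column 2 M)) (column 1 M)"
proof -
  let ?w = "vector [[:0, 1:], 1, 0] :: 'k poly ^ 3"
  let ?G = "subst3 M F"
  have G: "homogeneous d ?G" by (rule homogeneous_subst3[OF F])
  have "(\<chi> i. ev3 (\<lambda>c. [:c:]) ?w (lin3 (M $ i))) = (\<chi> i. [:column 2 M $ i, column 1 M $ i:])"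
    by (simp add: vec_eq_iff ev3_lin3 rhom_const_poly column_def one_pCons)
  hence "ev3 (\<lambda>c. [:c:]) (\<chi> i. [:column 2 M $ i, column 1 M $ i:]) F = ev3 (\<lambda>c. [:c:]) ?w ?G"
    by (simp add: ev3_subst3[OF rhom_const_poly])
  also have "\<dots> = poly (coeff ?G 0) 1"
  proof (rule poly3_hom_unique[where g = "\<lambda>G. poly (coeff G 0) 1"])
    show "rhom (\<lambda>G :: 'k poly3. poly (coeff G 0) 1)"
      by unfold_locales (simp_all add: coeff_mult_0)
  qed (simp_all add: rhom_ev3 rhom_const_poly, simp_all add: const3_def varX_def varY_def varZ_def)
  finally have "dot (gradient F (column 2 M)) (column 1 M) = coeff (poly (coeff ?G 0) 1) 1"
    using gradient_line[of "column 2 M" "column 1 M" F] by simp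
  also have "\<dots> = (\<Sum>j\<le>degree (coeff ?G 0) + d. cf ?G 1 j 0)"
    unfolding poly_altdef by (simp add: coeff_sum, rule sum.mono_neutral_left) (auto simp: coeff_eq_0)
  also have "\<dots> = (\<Sum>j\<le>degree (coeff ?G 0) + d. if j = d - 1 then cf ?G 1 (d - 1) 0 else 0)"
    by (intro sum.cong refl) (use homogeneousD[OF G] d in auto)
  also have "\<dots> = cf ?G 1 (d - 1) 0" by simp
  finally show ?thesis by simp
qed

lemma frame_expansion:
  fixes M M' :: "'k::field ^ 3 ^ 3"
  assumes "M ** M' = mat 1"
  shows "w = dot (M' $ 1) w *s column 1 M + dot (M' $ 2) w *s column 2 M + dot (M' $ 3) w *s column 3 M"
proof -
  have "M *v (M' *v w) = w" using assms by (simp add: matrix_vector_mul_assoc)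
  thus ?thesis
    by (simp add: vec_eq_iff matrix_vector_mult_def sum_3 column_def dot_def mult.commute)
qed

lemma dot_frame:
  fixes M M' :: "'k::field ^ 3 ^ 3"
  assumes "M' ** M = mat 1"
  shows "dot (M' $ i) (column j M) = (if i = j then 1 else 0)"
  using assms by (simp add: vec_eq_iff matrix_matrix_mult_def mat_def dot_def column_def sum_3)

lemma pencil_frame:
  fixes M M' :: "'k::field ^ 3 ^ 3"
  assumes M: "M ** M' = mat 1" "M' ** M = mat 1"
  shows "pencil (column 2 M) (M' $ 1) (M' $ 3)" "pencil (column 1 M) (M' $ 2) (M' $ 3)"
proof -
  note d = dot_frame[OF M(2)] and e = frame_expansion[OF M(1)]
  have nz: "column j M \<noteq> 0" for j using d[of j j] by (auto simp: dot_def)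
  have n: "(1::3) \<noteq> 2" "(1::3) \<noteq> 3" "(2::3) \<noteq> 3" "(2::3) \<noteq> 1" "(3::3) \<noteq> 1" "(3::3) \<noteq> 2" by simp_all
  show "pencil (column 2 M) (M' $ 1) (M' $ 3)" unfolding pencil_def
  proof (intro conjI, goal_cases)
    case 4
    show ?case
    proof (rule exI[of _ "column 1 M"], rule exI[of _ "column 3 M"], intro conjI allI)
      fix w show "\<exists>t. w = dot (M' $ 1) w *s column 1 M + dot (M' $ 3) w *s column 3 M + t *s column 2 M"
      using e[of w]
        by (intro exI[of _ "dot (M' $ 2) w"]) (simp only: add_ac)
    qed (simp_all add: d n)
  qed (simp_all add: d nz n)
  show "pencil (column 1 M) (M' $ 2) (M' $ 3)" unfolding pencil_def
  proof (intro conjI, goal_cases)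
    case 4
    show ?case
    proof (rule exI[of _ "column 2 M"], rule exI[of _ "column 3 M"], intro conjI allI)
      fix w show "\<exists>t. w = dot (M' $ 2) w *s column 2 M + dot (M' $ 3) w *s column 3 M + t *s column 1 M"
      using e[of w]
        by (intro exI[of _ "dot (M' $ 1) w"]) (simp only: add_ac)
    qed (simp_all add: d n)
  qed (simp_all add: d nz n)
qed

section \<open>The forward implication\<close>

lemma Aut_group_simps:
  "carrier (Aut_group F) = Aut_curve F"
  "\<one>\<^bsub>Aut_group F\<^esub> = (\<lambda>W\<in>normalization F. W)"
  "f \<in> Aut_curve F \<Longrightarrow> g \<in> Aut_curve F \<Longrightarrow> f \<otimes>\<^bsub>Aut_group F\<^esub> g = compose (normalization F) f g"
  unfolding Aut_group_def BijGroup_def Aut_curve_def by auto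

context generic_point begin

abbreviation "AG \<equiv> Aut_group F"

text \<open>Normality as equality of cosets gives n in B with n after \<open>sig s\<close> equal to
  \<open>sig s\<close> after \<open>sig t\<close>. Cancelling \<open>sig s\<close> on the right
  identifies n as the image of the conjugate.\<close>

lemma semidirect_conj:
  assumes sd: "internal_semidirect AG A B"
    and s: "aut s" "sig s \<in> A" and t: "aut t" "sig t \<in> B"
  shows "sig (s \<circ> t \<circ> ainv s) \<in> B"
proof -
  let ?G = "AG"
  have sub: "subgroup A ?G" "subgroup B ?G" and nrm: "B \<lhd> ?G\<lparr>carrier := A <#>\<^bsub>?G\<^esub> B\<rparr>"
    using sd unfolding internal_semidirect_def by auto
  have sA: "sig s \<in> Aut_curve F" "sig t \<in> Aut_curve F" using s t sig_Aut_curve by blast+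
  have Bij: "f \<in> Bij N" if "f \<in> Aut_curve F" for f using that unfolding Aut_curve_def by blast
  have oneB: "(\<lambda>W\<in>N. W) \<in> B" using subgroup.one_closed[OF sub(2)] unfolding Aut_group_simps .
  have oneA: "(\<lambda>W\<in>N. W) \<in> Aut_curve F"
    using subgroup.mem_carrier[OF sub(2) oneB] unfolding Aut_group_simps .
  have "sig s \<otimes>\<^bsub>?G\<^esub> (\<lambda>W\<in>N. W) = sig s"
    unfolding Aut_group_simps(3)[OF sA(1) oneA]
    by (rule compose_Id) (use Bij[OF sA(1)] in \<open>auto simp: Bij_def bij_betw_def\<close>)
  hence mem: "sig s \<in> A <#>\<^bsub>?G\<^esub> B" unfolding set_mult_def using s(2) oneB by fastforce
  have "B #>\<^bsub>?G\<lparr>carrier := A <#>\<^bsub>?G\<^esub> B\<rparr>\<^esub> sig s = sig s <#\<^bsub>?G\<lparr>carrier := A <#>\<^bsub>?G\<^esub> B\<rparr>\<^esub> B"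
    using normal.coset_eq[OF nrm] mem by simp
  moreover have "sig s \<otimes>\<^bsub>?G\<^esub> sig t \<in> sig s <#\<^bsub>?G\<lparr>carrier := A <#>\<^bsub>?G\<^esub> B\<rparr>\<^esub> B"
    unfolding l_coset_def using t(2) by auto
  ultimately have "sig s \<otimes>\<^bsub>?G\<^esub> sig t \<in> B #>\<^bsub>?G\<lparr>carrier := A <#>\<^bsub>?G\<^esub> B\<rparr>\<^esub> sig s" by simp
  then obtain n where n: "n \<in> B" "sig s \<otimes>\<^bsub>?G\<^esub> sig t = n \<otimes>\<^bsub>?G\<^esub> sig s"
    unfolding r_coset_def by auto
  have nA: "n \<in> Aut_curve F" using subgroup.mem_carrier[OF sub(2) n(1)] unfolding Aut_group_simps .
  have eq: "sig s (sig t W) = n (sig s W)" if "W \<in> N" for W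
    using fun_cong[OF n(2), of W] that unfolding Aut_group_simps(3)[OF sA] Aut_group_simps(3)[OF nA sA(1)]
    by (simp add: compose_def)
  have i: "aut (ainv s)" by (rule aut_inv[OF s(1)])
  have "n = sig (s \<circ> t \<circ> ainv s)"
  proof (rule extensionalityI)
    show "n \<in> extensional N" using Bij[OF nA] unfolding Bij_def by blast
    show "sig (s \<circ> t \<circ> ainv s) \<in> extensional N" unfolding sig_def by simp
    fix W assume W: "W \<in> N"
    have W': "sig (ainv s) W \<in> N" by (rule sig_in_N[OF i W])
    have "n W = n (sig s (sig (ainv s) W))" using sig_ainv(2)[OF s(1) W] by simp
    also have "\<dots> = sig s (sig t (sig (ainv s) W))" by (rule eq[OF W', symmetric])
    also have "\<dots> = sig (s \<circ> t \<circ> ainv s) W"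
      using sig_comp[OF t(1) i W] sig_comp[OF s(1) aut_comp[OF t(1) i] W] by (simp add: comp_assoc)
    finally show "n W = sig (s \<circ> t \<circ> ainv s) W" .
  qed
  thus ?thesis using n(1) by simp
qed

theorem forward:
  assumes P: "inner_galois_point F P" and Q: "outer_galois_point F Q"
    and sd: "internal_semidirect AG (galois_group F P) (galois_group F Q)"
    and tl: "line_through P Q \<noteq> tangent_line F P"
    and p: "prime p" "of_nat p = (0 :: 'k)" "p dvd d" "d \<ge> 3"
  shows "(\<exists>e. d = p ^ e) \<and> projectively_equivalent (plane_curve F) (plane_curve (model_form d))"
proof -
  obtain r where r: "P = vec.span {r}" "r \<noteq> 0"
    using P unfolding inner_galois_point_def galois_point_def proj_plane_def by blast
  obtain q where q: "Q = vec.span {q}" "q \<noteq> 0"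
    using Q unfolding outer_galois_point_def galois_point_def proj_plane_def by blast
  have Fr: "eval3 F r = 0"
    using P vanishes_at_span[OF F_hom] unfolding inner_galois_point_def plane_curve_def r by blast
  have Fq: "eval3 F q \<noteq> 0"
    using Q vanishes_at_span[OF F_hom] unfolding outer_galois_point_def plane_curve_def q by blast
  have "Q \<noteq> P" using Fr Fq vanishes_at_span[OF F_hom] unfolding r q by metis
  hence qr: "q \<notin> vec.span {r}" "r \<notin> vec.span {q}"
    using span_singleton_eq[OF q(2), of r] span_singleton_eq[OF r(2), of q] unfolding r q by blast+
  obtain M M' :: "'k ^ 3 ^ 3" where M: "M ** M' = mat 1" "M' ** M = mat 1" "column 1 M = q" "column 2 M = r"
    using frame_exists[OF qr] by blast
  define w where "w = (\<chi> i. ev (lin3 (M' $ i)))"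
  have g: "generic_point emb (subst3 M F) d w" and fr: "frac_field emb w = K"
    using change_coordinates[OF M(1,2)] unfolding w_def by auto
  interpret g: generic_point emb "subst3 M F" d w by (rule g)
  have pP: "pencil r (M' $ 1) (M' $ 3)" and pQ: "pencil q (M' $ 2) (M' $ 3)"
    using pencil_frame[OF M(1,2)] unfolding M(3,4) by auto
  have wi: "ev (lin3 (M' $ i)) = w $ i" for i by (simp add: w_def)
  have gP: "sig s \<in> galois_group F P \<longleftrightarrow> s g.x1 = g.x1" if "aut s" for s
    using galois_group_iff[OF that pP] unfolding r wi .
  have gQ: "sig s \<in> galois_group F Q \<longleftrightarrow> s g.x2 = g.x2" if "aut s" for s
    using galois_group_iff[OF that pQ] unfolding q wi .
  have xK: "g.x1 \<in> K" "g.x2 \<in> K" using g.x12_K unfolding fr .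
  have ext: "galois_extension FF (cls ` rat g.x1)" "galois_extension FF (cls ` rat g.x2)"
    using P Q proj_subfield_eq[OF pP] proj_subfield_eq[OF pQ]
    unfolding inner_galois_point_def outer_galois_point_def galois_point_def r q wi by auto
  have cm: "M *v vector [1, 0, 0] = q" "M *v vector [0, 1, 0] = r"
    unfolding M(3,4)[symmetric] by (simp_all add: vec_eq_iff matrix_vector_mult_def sum_3 column_def)
  have "dot (gradient F r) q \<noteq> 0"
  proof
    assume gq: "dot (gradient F r) q = 0"
    \<comment> \<open>The gradient annihilates r by \<open>euler_zero\<close> and q by assumption,
      so it is a multiple of the third coordinate form, whose zero set is the line PQ. That line
      would be the tangent.\<close>
    have e: "dot (gradient F r) u = dot (M' $ 3) u * dot (gradient F r) (column 3 M)" for u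
    proof -
      have "dot (gradient F r) u = dot (gradient F r)
          (dot (M' $ 1) u *s column 1 M + dot (M' $ 2) u *s column 2 M + dot (M' $ 3) u *s column 3 M)"
        by (rule arg_cong[OF frame_expansion[OF M(1)]])
      thus ?thesis by (simp only: dot_add dot_scale gq euler_zero[OF F_hom Fr] M(3,4)) simp
    qed
    have gr: "gradient F r \<noteq> 0"
      by (rule gradient_nonzero[OF F_hom]) (use P in \<open>simp add: inner_galois_point_def r\<close>)
    have "dot (gradient F r) (column 3 M) \<noteq> 0"
    proof
      assume "dot (gradient F r) (column 3 M) = 0"
      hence z: "dot (gradient F r) u = 0" for u using e[of u] by simp
      show False using gr z[of "vector [1, 0, 0]"] z[of "vector [0, 1, 0]"] z[of "vector [0, 0, 1]"]
        by (simp add: dot_def vec_eq_iff forall_3)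
    qed
    hence "dot (gradient F r) u = 0 \<longleftrightarrow> dot (M' $ 3) u = 0" for u using e[of u] by simp
    hence "tangent_line F P = {u. dot (M' $ 3) u = 0}"
      unfolding r tangent_line_gradient[OF F_hom] by simp
    also have "\<dots> = line_through P Q"
      unfolding r q line_through_pencil[OF pP qr(1)]
      using dot_frame[OF M(2), of 1 1] dot_frame[OF M(2), of 3 1] unfolding M(3) by simp
    finally show False using tl by simp
  qed
  have "\<exists>e (T :: 'k ^ 3 ^ 3). d = p ^ e \<and> invertible T \<and>
    (\<forall>u. eval3 (model_form d) (T *v u) = 0 \<longleftrightarrow> eval3 (subst3 M F) u = 0)"
  proof (rule g.forward_algebra[unfolded fr])
    show "eval3 (subst3 M F) (vector [1, 0, 0]) \<noteq> 0" "eval3 (subst3 M F) (vector [0, 1, 0]) = 0"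
      unfolding eval3_subst3 cm by fact+
    show "cf (subst3 M F) 1 (d - 1) 0 \<noteq> 0"
      using gradient_subst3[OF F_hom, of M] d_gt_1 \<open>dot (gradient F r) q \<noteq> 0\<close> unfolding M(3,4) by simp
    show "c \<in> rat g.x1" if "c \<in> K" "\<And>s. s \<in> Gal g.x1 \<Longrightarrow> s c = c" for c
      by (rule galois_extension_rat_fixed[OF ext(1) xK(1) that(1)]) (rule that(2))
    show "c \<in> rat g.x2" if "c \<in> K" "\<And>s. s \<in> Gal g.x2 \<Longrightarrow> s c = c" for c
      by (rule galois_extension_rat_fixed[OF ext(2) xK(2) that(1)]) (rule that(2))
    show "t (s g.x2) = s g.x2" if st: "aut s" "s g.x1 = g.x1" "aut t" "t g.x2 = g.x2" for s t
    proof -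
      have i: "aut (ainv s)" by (rule aut_inv[OF st(1)])
      have ix: "ainv s g.x1 = g.x1" using aut_inv_apply(2)[OF st(1), of g.x1] st(2) by simp
      \<comment> \<open>The conjugate is taken by the inverse of s, because t (s x2) = s x2 says
        that this conjugate fixes x2.\<close>
      have "sig (ainv s \<circ> t \<circ> ainv (ainv s)) \<in> galois_group F Q"
        by (rule semidirect_conj[OF sd i _ st(3)]) (use gP[OF i] gQ[OF st(3)] ix st(4) in auto)
      moreover have "ainv (ainv s) = s" by (rule inv_inv_eq[OF aut_bij[OF st(1)]])
      ultimately have "ainv s (t (s g.x2)) = g.x2"
        using gQ[of "ainv s \<circ> t \<circ> s"] aut_comp[OF aut_comp[OF i st(3)] st(1)] by simp
      thus ?thesis using aut_inv_apply(1)[OF st(1)] by metis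
    qed
  qed (rule p)+
  then obtain e T where T: "d = p ^ e" "invertible T"
    "\<And>u. eval3 (model_form d) (T *v u) = 0 \<longleftrightarrow> eval3 (subst3 M F) u = 0" by blast
  have "projectively_equivalent (plane_curve F) (plane_curve (model_form d))"
  proof (rule projectively_equivalentI)
    show "invertible (T ** M')" using T(2) M(1,2) by (intro invertible_mult) (auto simp: invertible_def)
    show "homogeneous d F" by (rule F_hom)
    show "homogeneous d (model_form d :: 'k poly3)" by (rule homogeneous_model_form) (use d_gt_1 in simp)
    fix u
    have "eval3 (model_form d) ((T ** M') *v u) = 0 \<longleftrightarrow> eval3 (subst3 M F) (M' *v u) = 0"
      using T(3)[of "M' *v u"] by (simp add: matrix_vector_mul_assoc)
    thus "eval3 (model_form d) ((T ** M') *v u) = 0 \<longleftrightarrow> eval3 F u = 0"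
      using M(1) by (simp add: eval3_subst3 matrix_vector_mul_assoc)
  qed
  thus ?thesis using T(1) by blast
qed

end

section \<open>Automorphisms of the rational function field\<close>

lemma card_simple_roots:
  fixes f :: "'k::alg_closed_field poly"
  assumes f: "f \<noteq> 0" and simple: "\<And>a. poly f a = 0 \<Longrightarrow> poly (pderiv f) a \<noteq> 0"
  shows "card {a. poly f a = 0} = degree f"
proof -
  have "order a f = 1" if a: "poly f a = 0" for a
  proof -
    have "order a f \<noteq> 0" using a f order_root by blast
    moreover have "\<not> 2 \<le> order a f"
    proof
      assume "2 \<le> order a f"
      hence "[:- a, 1:] ^ 2 dvd f" using f by (simp add: order_divides)
      then obtain g where "f = [:- a, 1:] ^ 2 * g" unfolding dvd_def by blast
      hence g: "f = [:- a, 1:] * ([:- a, 1:] * g)" by (simp only: power2_eq_square mult.assoc)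
      have "poly (pderiv f) a = 0" unfolding g pderiv_mult by simp
      thus False using simple[OF a] by simp
    qed
    ultimately show ?thesis by simp
  qed
  hence "(\<Sum>a\<in>{a. poly f a = 0}. order a f) = card {a. poly f a = 0}" by simp
  moreover have "size (proots f) = (\<Sum>a\<in>{a. poly f a = 0}. order a f)"
    using f by (simp add: size_multiset_overloaded_eq)
  ultimately show ?thesis using size_proots_alg_closed[OF f] by simp
qed

context func_field begin

lemma algebraic_over_constants:
  assumes "c \<in> K" "f \<noteq> 0" "pev emb c f = 0"
  shows "\<exists>b. c = emb b \<and> poly f b = 0"
proof -
  have "c \<in> range emb" using transcendental[of c f] assms by blast
  then obtain b where b: "c = emb b" by blast
  hence "emb (poly f b) = 0" using assms(3) by (simp add: pev_def poly_map_poly)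
  thus ?thesis using b by simp
qed

text \<open>Since w and w' are both transcendental, equality of two fractions means the same
  polynomial identity for either of them. So replacing w by w' is well defined and
  injective.\<close>

lemma hom_exists:
  assumes w: "w \<notin> range emb" "w' \<notin> range emb"
  shows "\<exists>s. (\<forall>a\<in>rat w. \<forall>b\<in>rat w. s (a + b) = s a + s b \<and> s (a * b) = s a * s b) \<and>
    (\<forall>c. s (emb c) = emb c) \<and> s w = w' \<and> s ` rat w = rat w' \<and> inj_on s (rat w)"
proof -
  define R where "R c c' \<longleftrightarrow> (\<exists>p q. q \<noteq> 0 \<and> c = pev emb w p / pev emb w q \<and> c' = pev emb w' p / pev emb w' q)" for c c'
  have nz: "pev emb w q \<noteq> 0" "pev emb w' q \<noteq> 0" if "q \<noteq> 0" for q
    using transcendental w that by blast+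
  have cross: "pev emb u p / pev emb u q = pev emb u p2 / pev emb u q2 \<longleftrightarrow> p * q2 = p2 * q"
    if "q \<noteq> 0" "q2 \<noteq> 0" "u = w \<or> u = w'" for p q p2 q2 u
  proof -
    have u: "u \<notin> range emb" using that w by blast
    have "pev emb u q \<noteq> 0" "pev emb u q2 \<noteq> 0" using transcendental[OF u] that by blast+
    hence "pev emb u p / pev emb u q = pev emb u p2 / pev emb u q2 \<longleftrightarrow> pev emb u (p * q2) = pev emb u (p2 * q)"
      by (simp add: pev_mult field_simps)
    thus ?thesis using transcendental_inj[OF u] by metis
  qed
  have det: "c' = c'' \<longleftrightarrow> c = d" if R: "R c c'" "R d c''" for c d c' c''
  proof -
    obtain p q where 1: "q \<noteq> 0" "c = pev emb w p / pev emb w q" "c' = pev emb w' p / pev emb w' q"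
      using R(1) unfolding R_def by blast
    obtain p2 q2 where 2: "q2 \<noteq> 0" "d = pev emb w p2 / pev emb w q2" "c'' = pev emb w' p2 / pev emb w' q2"
      using R(2) unfolding R_def by blast
    show ?thesis unfolding 1(2,3) 2(2,3)
      using cross[OF 1(1) 2(1), of w p p2] cross[OF 1(1) 2(1), of w' p p2] by simp
  qed
  define s where "s c = (SOME c'. R c c')" for c
  have ex: "\<exists>c'. R c c'" if c: "c \<in> rat w" for c
  proof -
    obtain p q where "c = pev emb w p / pev emb w q" "pev emb w q \<noteq> 0" using c unfolding rat_def by blast
    moreover from this have "q \<noteq> 0" by auto
    ultimately have "R c (pev emb w' p / pev emb w' q)" unfolding R_def by blast
    thus ?thesis by blast
  qed
  have sR: "R c (s c)" if "c \<in> rat w" for c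
    unfolding s_def using someI_ex[OF ex[OF that]] .
  have sI: "s c = c'" if "R c c'" for c c'
  proof -
    have "c \<in> rat w" using that nz(1) unfolding R_def rat_def by blast
    thus ?thesis using det[OF sR that] by simp
  qed
  have R1: "R c c'" if "c = pev emb w p" "c' = pev emb w' p" for c c' p
    unfolding R_def by (rule exI[of _ p], rule exI[of _ 1]) (simp add: that)
  show ?thesis
  proof (intro exI[of _ s] conjI ballI allI)
    show "s (emb c) = emb c" for c by (rule sI, rule R1[of _ "[:c:]"]) simp_all
    show "s w = w'" by (rule sI, rule R1[of _ "[:0, 1:]"]) simp_all
    show "inj_on s (rat w)"
    proof (rule inj_onI)
      fix a b assume ab: "a \<in> rat w" "b \<in> rat w" "s a = s b"
      show "a = b" using det[OF sR[OF ab(1)] sR[OF ab(2)]] ab(3) by simp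
    qed
    show "s ` rat w = rat w'"
    proof
      show "s ` rat w \<subseteq> rat w'"
      proof
        fix c assume "c \<in> s ` rat w"
        then obtain b where "c = s b" "b \<in> rat w" by blast
        thus "c \<in> rat w'" using sR[of b] nz(2) unfolding R_def rat_def by blast
      qed
      show "rat w' \<subseteq> s ` rat w"
      proof
        fix c assume "c \<in> rat w'"
        then obtain p q where pq: "c = pev emb w' p / pev emb w' q" "pev emb w' q \<noteq> 0" unfolding rat_def by blast
        hence q: "q \<noteq> 0" by auto
        have "s (pev emb w p / pev emb w q) = c" by (rule sI) (use q pq in \<open>auto simp: R_def\<close>)
        moreover have "pev emb w p / pev emb w q \<in> rat w" by (rule ratI[OF nz(1)[OF q]])
        ultimately show "c \<in> s ` rat w" by blast
      qed
    qed
    fix a b assume ab: "a \<in> rat w" "b \<in> rat w"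
    obtain p q where 1: "q \<noteq> 0" "a = pev emb w p / pev emb w q" "s a = pev emb w' p / pev emb w' q"
      using sR[OF ab(1)] unfolding R_def by blast
    obtain p2 q2 where 2: "q2 \<noteq> 0" "b = pev emb w p2 / pev emb w q2" "s b = pev emb w' p2 / pev emb w' q2"
      using sR[OF ab(2)] unfolding R_def by blast
    have n: "q * q2 \<noteq> 0" using 1 2 by simp
    show "s (a + b) = s a + s b"
    proof (rule sI)
      have "a + b = pev emb w (p * q2 + p2 * q) / pev emb w (q * q2)"
        unfolding 1(2) 2(2) pev_add pev_mult using nz 1(1) 2(1) by (simp add: field_simps)
      moreover have "s a + s b = pev emb w' (p * q2 + p2 * q) / pev emb w' (q * q2)"
        unfolding 1(3) 2(3) pev_add pev_mult using nz 1(1) 2(1) by (simp add: field_simps)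
      ultimately show "R (a + b) (s a + s b)" unfolding R_def using n by blast
    qed
    show "s (a * b) = s a * s b"
    proof (rule sI)
      have "a * b = pev emb w (p * p2) / pev emb w (q * q2)"
        unfolding 1(2) 2(2) pev_mult by simp
      moreover have "s a * s b = pev emb w' (p * p2) / pev emb w' (q * q2)"
        unfolding 1(3) 2(3) pev_mult by simp
      ultimately show "R (a * b) (s a * s b)" unfolding R_def using n by blast
    qed
  qed
qed

end

section \<open>The rational function field k(w) and its affine automorphisms\<close>

locale rational_field = func_field emb K for emb :: "'k::alg_closed_field \<Rightarrow> 'e::field" and K +
  fixes w :: 'e
  assumes K_rat: "K = rat w" and w_trans: "w \<notin> range emb"
begin

lemma wK: "w \<in> K" unfolding K_rat by (rule rat_self)

lemma aut_eqI: "aut s \<Longrightarrow> aut t \<Longrightarrow> s w = t w \<Longrightarrow> s = t"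
proof
  fix c assume st: "aut s" "aut t" "s w = t w"
  show "s c = t c"
  proof (cases "c \<in> K")
    case True
    then obtain p q where "c = pev emb w p / pev emb w q" unfolding K_rat rat_def by blast
    thus ?thesis using st wK by (simp add: aut_divide aut_pev)
  next
    case False
    thus ?thesis using st unfolding aut_def by simp
  qed
qed

lemma affine_trans: "z \<noteq> 0 \<Longrightarrow> emb z * w + emb a \<notin> range emb"
proof
  assume z: "z \<noteq> 0" and "emb z * w + emb a \<in> range emb"
  then obtain c where "emb z * w + emb a = emb c" by blast
  hence "pev emb w [:a - c, z:] = 0" by (simp add: algebra_simps)
  thus False using transcendental[OF w_trans, of "[:a - c, z:]"] z by simp
qed

lemma aut_affine_exists:
  assumes z: "z \<noteq> 0"
  shows "\<exists>s. aut s \<and> s w = emb z * w + emb a"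
proof -
  let ?w = "emb z * w + emb a"
  have t: "?w \<notin> range emb" by (rule affine_trans[OF z])
  have "w = pev emb ?w [:- a / z, 1 / z:]" using z by (simp add: emb_divide field_simps)
  hence "rat w \<subseteq> rat ?w" by (metis rat_mono rat_pev)
  moreover have "rat ?w \<subseteq> rat w"
    by (intro rat_mono rat_add rat_mult rat_emb rat_self)
  ultimately have r: "rat ?w = K" unfolding K_rat by blast
  obtain s where s: "\<forall>a\<in>rat w. \<forall>b\<in>rat w. s (a + b) = s a + s b \<and> s (a * b) = s a * s b"
    "\<forall>c. s (emb c) = emb c" "s w = ?w" "s ` rat w = rat ?w" "inj_on s (rat w)"
    using hom_exists[OF w_trans t] by blast
  define s' where "s' c = (if c \<in> K then s c else c)" for c
  have im: "s' ` K = K" using s(4) r unfolding s'_def K_rat[symmetric] by simp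
  have "inj s'"
  proof (rule injI)
    fix a b assume ab: "s' a = s' b"
    have m: "s c \<in> K" if "c \<in> K" for c using s(4) r that unfolding K_rat[symmetric] by blast
    show "a = b" using ab m s(5) unfolding s'_def K_rat[symmetric] inj_on_def by (metis (full_types))
  qed
  moreover have "surj s'"
    unfolding surj_def
  proof
    fix c show "\<exists>b. c = s' b"
    proof (cases "c \<in> K")
      case True
      thus ?thesis using im by (metis imageE)
    qed (auto simp: s'_def)
  qed
  ultimately have "bij s'" by (rule bijI)
  hence "aut s'" unfolding aut_def using im s(1,2) by (auto simp: s'_def K_rat[symmetric])
  moreover have "s' w = ?w" using s(3) wK by (simp add: s'_def)
  ultimately show ?thesis by blast
qed

lemma aut_affine: "aut u \<Longrightarrow> u (emb b * w + emb c) = emb b * u w + emb c"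
proof -
  assume u: "aut u"
  interpret u: phom K u by (rule aut_phom[OF u])
  show ?thesis using wK by (simp add: u.p_add u.p_mult aut_emb[OF u])
qed

lemma card_auts:
  assumes P: "\<And>s. aut s \<Longrightarrow> P s \<longleftrightarrow> (\<exists>c\<in>R. s w = \<phi> c)" and ex: "\<And>c. c \<in> R \<Longrightarrow> \<exists>s. aut s \<and> s w = \<phi> c"
    and inj: "inj_on \<phi> R"
  shows "card {s. aut s \<and> P s} = card R"
proof -
  have "inj_on (\<lambda>s. s w) {s. aut s \<and> P s}" by (rule inj_onI) (simp add: aut_eqI)
  moreover have "(\<lambda>s. s w) ` {s. aut s \<and> P s} = \<phi> ` R"
  proof
    show "(\<lambda>s. s w) ` {s. aut s \<and> P s} \<subseteq> \<phi> ` R" using P by auto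
    show "\<phi> ` R \<subseteq> (\<lambda>s. s w) ` {s. aut s \<and> P s}"
    proof
      fix b assume "b \<in> \<phi> ` R"
      then obtain c where c: "b = \<phi> c" "c \<in> R" by blast
      obtain s where s: "aut s" "s w = \<phi> c" using ex[OF c(2)] by blast
      hence "s \<in> {s. aut s \<and> P s}" "b = s w" using P[OF s(1)] c by auto
      thus "b \<in> (\<lambda>s. s w) ` {s. aut s \<and> P s}" by blast
    qed
  qed
  ultimately show ?thesis using card_image inj by metis
qed

text \<open>A monic equation of degree \<open>card G\<close> for \<open>w\<close> over \<open>k(x)\<close> expresses every polynomial in \<open>w\<close>
  with lower degree; for a \<open>G\<close>-invariant value this expression has too many roots.\<close>

lemma fixed_field:
  assumes G: "finite G" "\<And>s. s \<in> G \<Longrightarrow> aut s" "\<And>s. s \<in> G \<Longrightarrow> s x = x" "id \<in> G"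
    and comp: "\<And>s t. s \<in> G \<Longrightarrow> t \<in> G \<Longrightarrow> s \<circ> t \<in> G"
    and pol: "\<And>s. s \<in> G \<Longrightarrow> \<exists>p. s w = pev emb w p"
    and x: "x \<in> K" and m: "\<And>i. coeff m i \<in> rat x" "poly m w = 0" "degree m = card G" "lead_coeff m = 1"
    and c: "c \<in> K" "\<And>s. s \<in> G \<Longrightarrow> s c = c"
  shows "c \<in> rat x"
proof -
  define n where "n = card G"
  have n: "n > 0" using G(1,4) unfolding n_def by (auto simp: card_gt_0_iff)
  interpret r: phom "rat x" "\<lambda>x. x" by (rule rat_phom)
  have ag: "agroup G" unfolding agroup_def using G comp by blast
  have inj: "inj_on (\<lambda>s. s w) G" by (rule inj_onI) (rule aut_eqI[OF G(2) G(2)])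
  have red: "\<exists>C. (\<forall>i. coeff C i \<in> rat x) \<and> degree C < n \<and> pev emb w p = poly C w" for p
  proof (induction p)
    case 0
    show ?case using n by (intro exI[of _ 0]) simp
  next
    case (pCons a p)
    then obtain C where C: "\<forall>i. coeff C i \<in> rat x" "degree C < n" "pev emb w p = poly C w" by blast
    let ?D = "pCons (emb a) C"
    \<comment> \<open>Multiplication by w may reach degree n. Subtracting a multiple of the monic
      equation m removes that term without changing the value at w.\<close>
    let ?C = "?D - smult (coeff ?D n) m"
    have D: "coeff ?D i \<in> rat x" for i using C(1) rat_emb by (simp add: coeff_pCons split: nat.split)
    have "degree ?C < n"
    proof -
      have "degree ?D \<le> n" using C(2) by (simp add: degree_pCons_eq_if)
      hence "degree ?C \<le> n" using m(3) n_def by (intro degree_diff_le order_trans[OF degree_smult_le]) auto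
      moreover have "coeff ?C n = 0" using m(3,4) n_def by simp
      ultimately show ?thesis using eq_zero_or_degree_less[of ?C n] n by (metis degree_0)
    qed
    moreover have "coeff ?C i \<in> rat x" for i
      unfolding coeff_diff coeff_smult by (intro r.B_diff r.B_mult D m(1))
    moreover have "pev emb w (pCons a p) = poly ?C w" using C(3) m(2) by simp
    ultimately show ?case by blast
  qed
  have inv: "pev emb w p \<in> rat x" if p: "\<And>s. s \<in> G \<Longrightarrow> s (pev emb w p) = pev emb w p" for p
  proof -
    obtain C where C: "\<forall>i. coeff C i \<in> rat x" "degree C < n" "pev emb w p = poly C w" using red by blast
    let ?D = "C - [:pev emb w p:]"
    have "?D = 0"
    proof (rule ccontr)
      assume D: "?D \<noteq> 0"
      have "card G \<le> degree ?D"
      proof (rule card_roots_le_degree[OF D G(1) inj])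
        fix s assume s: "s \<in> G"
        interpret s: phom K s by (rule aut_phom[OF G(2)[OF s]])
        have CK: "coeff C i \<in> K" for i using C(1) rat_subset[OF x] by blast
        hence "s (poly C w) = poly (map_poly s C) (s w)"
          using wK by (intro s.p_poly) (auto simp: s.Bpoly_def)
        also have "map_poly s C = C"
        proof (rule poly_eqI)
          fix i
          have "s (coeff C i) = coeff C i" by (rule aut_rat[OF G(2)[OF s] x G(3)[OF s]]) (use C(1) in blast)
          thus "coeff (map_poly s C) i = coeff C i" by (simp add: coeff_map_poly s.p_zero)
        qed
        finally show "poly ?D (s w) = 0" using C(3) p[OF s] by simp
      qed
      moreover have "degree ?D \<le> degree C" by (rule degree_diff_le) simp_all
      ultimately show False using C(2) n_def by simp
    qed
    hence "pev emb w p = coeff C 0" by (metis coeff_pCons_0 eq_iff_diff_eq_0)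
    thus ?thesis using C(1) by simp
  qed
  obtain A B where AB: "c = pev emb w A / pev emb w B" "pev emb w B \<noteq> 0" using c(1) unfolding K_rat rat_def by blast
  obtain P where P: "\<And>s. s \<in> G \<Longrightarrow> s w = pev emb w (P s)" using pol by metis
  have sB: "s (pev emb w B) = pev emb w (pcompose B (P s))" if "s \<in> G" for s
    using aut_pev[OF G(2)[OF that] wK, of B] P[OF that] by (simp add: pev_pcompose)
  \<comment> \<open>The denominator is enlarged to the product of its conjugates, which are
    polynomials in w by \<open>pol\<close>. This product is invariant, so \<open>inv\<close> applies
    to numerator and denominator separately.\<close>
  define N where "N = (\<Prod>s\<in>G. pcompose B (P s))"
  define N' where "N' = (\<Prod>s\<in>G - {id}. pcompose B (P s))"
  have N: "pev emb w N = (\<Prod>s\<in>G. s (pev emb w B))" unfolding N_def pev_prod using sB by simp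
  have BN: "pev emb w N = pev emb w B * pev emb w N'"
    unfolding N pev_prod N'_def using sB G(1,4) by (simp add: prod.remove[of G id])
  have N0: "pev emb w N \<noteq> 0" unfolding N using AB(2) aut_zero[OF G(2)] G(1) by simp
  have BK: "pev emb w B \<in> K" using wK by simp
  have fixN: "s (pev emb w N) = pev emb w N" if s: "s \<in> G" for s
  proof -
    interpret s: phom K s by (rule aut_phom[OF G(2)[OF s]])
    have "s (pev emb w N) = (\<Prod>t\<in>G. (s \<circ> t) (pev emb w B))" unfolding N
      by (subst s.p_prod) (use aut_in_K G(2) BK in auto)
    also have "\<dots> = pev emb w N" unfolding N by (rule prod.reindex_bij_betw[OF agroup_left[OF ag s]])
    finally show ?thesis .
  qed
  have cN: "c * pev emb w N = pev emb w (A * N')" unfolding BN AB(1) pev_mult using AB(2) by simp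
  have "pev emb w (A * N') \<in> rat x"
  proof (rule inv)
    fix s assume s: "s \<in> G"
    interpret s: phom K s by (rule aut_phom[OF G(2)[OF s]])
    show "s (pev emb w (A * N')) = pev emb w (A * N')"
      unfolding cN[symmetric] using c wK fixN[OF s] s by (simp add: s.p_mult)
  qed
  moreover have "pev emb w N \<in> rat x" by (rule inv) (rule fixN)
  ultimately have "pev emb w (A * N') / pev emb w N \<in> rat x" by (rule rat_divide)
  thus ?thesis using cN N0 by (metis nonzero_mult_div_cancel_right)
qed

lemma place_w_eq:
  assumes "place V" "place V'" "w \<in> V" "w \<in> V'" "val V w = val V' w"
  shows "V = V'"
  using rat_val[OF assms(1,2,3,4,5)] rat_val[OF assms(2,1,4,3) assms(5)[symmetric]]
    place_subset[OF assms(1)] place_subset[OF assms(2)] unfolding K_rat by blast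

lemma place_infinity_eq:
  assumes V: "place V" "place V'" "w \<notin> V" "w \<notin> V'"
  shows "V = V'"
proof -
  let ?u = "inverse w"
  have w0: "w \<noteq> 0" using w_trans by (metis h_zero rangeI)
  have "?u \<in> mid V" "?u \<in> mid V'" using place_notin wK V by blast+
  hence u: "?u \<in> V" "?u \<in> V'" "val V ?u = val V' ?u"
    using mid_subset V(1,2) val_mid by metis+
  have "K \<subseteq> rat ?u" unfolding K_rat using rat_mono[OF rat_inverse[OF rat_self[of ?u]]] by simp
  thus ?thesis
    using rat_val[OF V(1,2) u] rat_val[OF V(2,1) u(2,1) u(3)[symmetric]]
      place_subset[OF V(1)] place_subset[OF V(2)] by blast
qed

text \<open>A nonzero quotient of polynomials in w has a nonzero value wherever numerator and
  denominator do not vanish, and such a value of w exists outside the finite set S.\<close>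

lemma val_identity:
  assumes f: "f \<in> K" and S: "finite S"
    and z: "\<And>V. place V \<Longrightarrow> w \<in> V \<Longrightarrow> val V w \<notin> S \<Longrightarrow> f \<in> V \<Longrightarrow> val V f = 0"
  shows "f = 0"
proof (rule ccontr)
  assume f0: "f \<noteq> 0"
  obtain A B where AB: "f = pev emb w A / pev emb w B" "pev emb w B \<noteq> 0" using f unfolding K_rat rat_def by blast
  hence "A \<noteq> 0" "B \<noteq> 0" using f0 by auto
  then obtain c where c: "c \<notin> S" "poly (A * B) c \<noteq> 0" using exists_nonroot[of "A * B" S] S by auto
  obtain V where V: "place V" "w \<in> V" "val V w = c" using place_at[OF wK w_trans] by blast
  interpret V: phom V "val V" by (rule val_phom[OF V(1)])
  note p = val_pev[OF V(1,2), unfolded V(3)]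
  have i: "inverse (pev emb w B) \<in> V \<and> val V (inverse (pev emb w B)) = inverse (poly B c)"
    using val_nonzeroD[OF V(1), of "pev emb w B"] p[of B] c by auto
  have "f \<in> V" "val V f = poly A c * inverse (poly B c)"
    unfolding AB(1) divide_inverse using i p[of A] by (auto simp: V.p_mult)
  thus False using z[OF V(1,2)] c V(3) by auto
qed

end

locale model_field = rational_field emb K w for emb :: "'k::alg_closed_field \<Rightarrow> 'e::field" and K w +
  fixes p e q :: nat
  assumes prime_p: "prime p" and char_p: "of_nat p = (0 :: 'k)" and q: "q = p ^ e" and q_ge: "q \<ge> 3"
begin

lemma frob: "(a + b :: 'e) ^ q = a ^ q + b ^ q" "(c + b' :: 'k) ^ q = c ^ q + b' ^ q"
  and of_nat_q: "of_nat q = (0 :: 'k)" and char_e: "of_nat q = (0 :: 'e)"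
proof -
  have ce: "of_nat p = (0 :: 'e)" using h_of_nat[of p] char_p by simp
  have "CHAR('e) dvd p" "CHAR('k) dvd p" using ce char_p by (simp_all add: of_nat_eq_0_iff_char_dvd)
  moreover have "CHAR('e) \<noteq> 1" using of_nat_CHAR[where ?'a='e] by (metis of_nat_1 one_neq_zero)
  moreover have "CHAR('k) \<noteq> 1" using of_nat_CHAR[where ?'a='k] by (metis of_nat_1 one_neq_zero)
  ultimately have "CHAR('e) = p" "CHAR('k) = p" using prime_p prime_nat_iff by blast+
  thus "(a + b :: 'e) ^ q = a ^ q + b ^ q" "(c + b' :: 'k) ^ q = c ^ q + b' ^ q"
    using freshmans_dream'[where ?'a='e, of q e a b] freshmans_dream'[where ?'a='k, of q e c b'] prime_p q by simp_all
  have "e \<noteq> 0" using q q_ge by (cases e) auto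
  thus "of_nat q = (0 :: 'k)" "of_nat q = (0 :: 'e)" using char_p ce q by (simp_all add: of_nat_power power_0_left)
qed

lemma frob_diff: "(a - b :: 'e) ^ q = a ^ q - b ^ q"
  using frob(1)[of "a - b" b] by simp

text \<open>The affine coordinates X / Z and Y / Z of the model. With w = (X + Z) / Y its equation
  gives w^q = - X / Y, and hence w + w^q = Z / Y.\<close>

definition "xP = - (w ^ (q - 1)) / (1 + w ^ (q - 1))"
definition "xQ = 1 / (w + w ^ q)"

lemma pev_nonzero: "f \<noteq> 0 \<Longrightarrow> pev emb w f \<noteq> 0"
  by (rule transcendental[OF w_trans])

lemma denominators: "1 + w ^ (q - 1) \<noteq> 0" "w + w ^ q \<noteq> 0" "w \<noteq> 0"
proof -
  have "monom 1 (q - 1) + 1 \<noteq> (0 :: 'k poly)"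
  proof
    assume "monom 1 (q - 1) + 1 = (0 :: 'k poly)"
    hence "coeff (monom 1 (q - 1) + 1 :: 'k poly) (q - 1) = 0" by simp
    thus False using q_ge by (simp add: coeff_eq_0)
  qed
  from pev_nonzero[OF this] show "1 + w ^ (q - 1) \<noteq> 0" by (simp add: pev_add pev_monom add.commute)
  moreover show w: "w \<noteq> 0" using w_trans by (metis h_zero rangeI)
  moreover have "w + w ^ q = w * (1 + w ^ (q - 1))" using q_ge by (cases q) (simp_all add: algebra_simps)
  ultimately show "w + w ^ q \<noteq> 0" by simp
qed

lemma xK: "xP \<in> K" "xQ \<in> K"
  unfolding xP_def xQ_def using wK K_emb[of 1] by (auto simp del: K_emb)

lemma w_power: "w ^ (q - 1) = - xP / (1 + xP)" "1 + xP \<noteq> 0" "w + w ^ q = 1 / xQ"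
proof -
  have "1 + xP = 1 / (1 + w ^ (q - 1))"
    unfolding xP_def using denominators(1) by (simp add: field_simps)
  thus "1 + xP \<noteq> 0" "w ^ (q - 1) = - xP / (1 + xP)"
    using denominators(1) by (auto simp: xP_def)
  show "w + w ^ q = 1 / xQ" by (simp add: xQ_def)
qed

lemma root_ratio:
  assumes u: "u \<in> K" "u ^ (q - 1) = w ^ (q - 1)"
  shows "\<exists>z. z ^ (q - 1) = 1 \<and> u = emb z * w"
proof -
  let ?f = "monom 1 (q - 1) - 1 :: 'k poly"
  have "coeff ?f (q - 1) = 1" using q_ge by (simp add: coeff_eq_0)
  hence f: "?f \<noteq> 0" by (metis coeff_0 zero_neq_one)
  have "pev emb (u / w) ?f = 0"
    using u(2) denominators(3) by (simp add: pev_diff pev_monom power_divide)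
  then obtain z where "u / w = emb z" "poly ?f z = 0"
    using algebraic_over_constants[OF _ f, of "u / w"] u(1) wK by auto
  thus ?thesis using denominators(3) by (intro exI[of _ z]) (simp add: poly_monom field_simps)
qed

text \<open>Raising to the power q is additive, so u - w is a root of T^q + T and therefore a
  constant.\<close>

lemma root_difference:
  assumes u: "u \<in> K" "u + u ^ q = w + w ^ q"
  shows "\<exists>a. a ^ q + a = 0 \<and> u = w + emb a"
proof -
  let ?f = "monom 1 q + [:0, 1:] :: 'k poly"
  have "coeff ?f q = 1" using q_ge by (simp add: coeff_eq_0)
  hence f: "?f \<noteq> 0" by (metis coeff_0 zero_neq_one)
  have "pev emb (u - w) ?f = 0"
    using u(2) by (simp add: pev_add pev_monom frob_diff algebra_simps)
  then obtain a where "u - w = emb a" "poly ?f a = 0"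
    using algebraic_over_constants[OF _ f, of "u - w"] u(1) wK by auto
  thus ?thesis by (intro exI[of _ a]) (simp add: poly_monom algebra_simps)
qed

text \<open>The function xP and the power w^(q-1) are fractional linear in each other, so fixing one
  is fixing the other, and \<open>root_ratio\<close> applies.\<close>

lemma fixP_iff: "aut s \<Longrightarrow> s xP = xP \<longleftrightarrow> (\<exists>z. z ^ (q - 1) = 1 \<and> s w = emb z * w)"
proof -
  assume s: "aut s"
  interpret s: phom K s by (rule aut_phom[OF s])
  have wq: "w ^ (q - 1) \<in> K" "1 \<in> K" using wK K_emb[of 1] by (auto simp del: K_emb)
  have s1: "s 1 = 1" using aut_emb[OF s, of 1] by simp
  have e: "s xP = - (s w ^ (q - 1)) / (1 + s w ^ (q - 1))"
    unfolding xP_def using wq wK by (simp add: aut_divide[OF s] s.p_uminus s.p_add s.p_power s1)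
  show ?thesis
  proof
    assume x: "s xP = xP"
    have "s (w ^ (q - 1)) = w ^ (q - 1)"
      unfolding w_power(1) using xK(1) wq(2) x by (simp add: aut_divide[OF s] s.p_uminus s.p_add s1)
    hence "s w ^ (q - 1) = w ^ (q - 1)" using wK by (simp add: s.p_power)
    moreover have "s w \<in> K" using wK aut_in_K[OF s] by simp
    ultimately show "\<exists>z. z ^ (q - 1) = 1 \<and> s w = emb z * w" using root_ratio by blast
  next
    assume "\<exists>z. z ^ (q - 1) = 1 \<and> s w = emb z * w"
    then obtain z where z: "z ^ (q - 1) = 1" "s w = emb z * w" by blast
    have "s w ^ (q - 1) = emb (z ^ (q - 1)) * w ^ (q - 1)" unfolding z(2) by (simp add: power_mult_distrib)
    thus "s xP = xP" unfolding e z(1) by (simp add: xP_def)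
  qed
qed

lemma fixQ_iff: "aut s \<Longrightarrow> s xQ = xQ \<longleftrightarrow> (\<exists>a. a ^ q + a = 0 \<and> s w = w + emb a)"
proof -
  assume s: "aut s"
  interpret s: phom K s by (rule aut_phom[OF s])
  have wq: "w + w ^ q \<in> K" "w ^ q \<in> K" "1 \<in> K" using wK K_emb[of 1] by (auto simp del: K_emb)
  have s1: "s 1 = 1" using aut_emb[OF s, of 1] by simp
  have e: "s xQ = 1 / (s w + s w ^ q)"
    unfolding xQ_def using wq wK by (simp add: aut_divide[OF s] s.p_add s.p_power s1)
  show ?thesis
  proof
    assume x: "s xQ = xQ"
    have "s (w + w ^ q) = w + w ^ q"
      unfolding w_power(3) using xK(2) wq x by (simp add: aut_divide[OF s] s1)
    hence "s w + s w ^ q = w + w ^ q" using wK wq by (simp add: s.p_power s.p_add)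
    moreover have "s w \<in> K" using wK aut_in_K[OF s] by simp
    ultimately show "\<exists>a. a ^ q + a = 0 \<and> s w = w + emb a" using root_difference by blast
  next
    assume "\<exists>a. a ^ q + a = 0 \<and> s w = w + emb a"
    then obtain a where a: "a ^ q + a = 0" "s w = w + emb a" by blast
    have "s w + s w ^ q = w + w ^ q + emb (a ^ q + a)" unfolding a(2) frob by simp
    thus "s xQ = xQ" unfolding e a(1) by (simp add: xQ_def)
  qed
qed

lemma root_nonzero: "z ^ (q - 1) = 1 \<Longrightarrow> z \<noteq> (0 :: 'k)"
  using q_ge by (auto simp: power_0_left)

text \<open>Since q - 1 = -1 in k, the derivative of T^(q-1) - 1 is - T^(q-2), which vanishes at no
  root.\<close>

lemma card_roots_of_unity: "card {z :: 'k. z ^ (q - 1) = 1} = q - 1"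
proof -
  let ?f = "monom 1 (q - 1) - 1 :: 'k poly"
  have d: "degree (monom 1 (q - 1) :: 'k poly) = q - 1" by (simp add: degree_monom_eq)
  have df: "degree ?f = q - 1" using d q_ge by (subst degree_diff_left) simp_all
  have f: "?f \<noteq> 0" using df q_ge by auto
  have r: "poly ?f z = 0 \<longleftrightarrow> z ^ (q - 1) = 1" for z by (simp add: poly_monom)
  have on: "of_nat (q - 1) = (- 1 :: 'k)"
  proof -
    have "of_nat (q - 1) + 1 = (of_nat q :: 'k)"
      using q_ge by (metis Suc_pred' add.commute gr0I not_numeral_le_zero of_nat_Suc)
    thus ?thesis using of_nat_q by (simp add: eq_neg_iff_add_eq_0)
  qed
  have "card {z. poly ?f z = 0} = degree ?f"
  proof (rule card_simple_roots[OF f])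
    fix z assume "poly ?f z = 0"
    hence "z \<noteq> 0" using r root_nonzero by blast
    thus "poly (pderiv ?f) z \<noteq> 0"
      by (simp only: pderiv_diff pderiv_monom poly_monom on pderiv_1 poly_diff poly_0) simp
  qed
  thus ?thesis unfolding r df .
qed

lemma card_additive_roots: "card {a :: 'k. a ^ q + a = 0} = q"
proof -
  let ?f = "monom 1 q + [:0, 1:] :: 'k poly"
  have d: "degree (monom 1 q :: 'k poly) = q" by (simp add: degree_monom_eq)
  have df: "degree ?f = q" using d q_ge by (subst degree_add_eq_left) simp_all
  have f: "?f \<noteq> 0" using df q_ge by auto
  have r: "poly ?f a = 0 \<longleftrightarrow> a ^ q + a = 0" for a by (simp add: poly_monom)
  have "card {a. poly ?f a = 0} = degree ?f"
    by (rule card_simple_roots[OF f]) (simp add: pderiv_add pderiv_monom of_nat_q pderiv_pCons)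
  thus ?thesis unfolding r df .
qed

lemma card_fixP: "card (Gal xP) = q - 1"
proof -
  have "card (Gal xP) = card {z :: 'k. z ^ (q - 1) = 1}"
  proof (rule card_auts[where \<phi> = "\<lambda>z. emb z * w"])
    show "s xP = xP \<longleftrightarrow> (\<exists>z\<in>{z. z ^ (q - 1) = 1}. s w = emb z * w)" if "aut s" for s
      using fixP_iff[OF that] by auto
    show "\<exists>s. aut s \<and> s w = emb z * w" if "z \<in> {z. z ^ (q - 1) = 1}" for z
      using aut_affine_exists[of z 0] root_nonzero that by auto
  qed (use denominators(3) in \<open>auto simp: inj_on_def\<close>)
  thus ?thesis using card_roots_of_unity by simp
qed

lemma card_fixQ: "card (Gal xQ) = q"
proof -
  have "card (Gal xQ) = card {a :: 'k. a ^ q + a = 0}"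
  proof (rule card_auts[where \<phi> = "\<lambda>a. w + emb a"])
    show "s xQ = xQ \<longleftrightarrow> (\<exists>a\<in>{a. a ^ q + a = 0}. s w = w + emb a)" if "aut s" for s
      using fixQ_iff[OF that] by auto
    show "\<exists>s. aut s \<and> s w = w + emb a" for a
      using aut_affine_exists[of 1 a] by auto
  qed (auto simp: inj_on_def)
  thus ?thesis using card_additive_roots by simp
qed

text \<open>The power w^(q-1) lies in k(xP), which gives a monic equation for w whose degree is the
  order of the group, as \<open>fixed_field\<close> requires.\<close>

lemma fixed_xP:
  assumes c: "c \<in> K" "\<And>s. aut s \<Longrightarrow> s xP = xP \<Longrightarrow> s c = c"
  shows "c \<in> rat xP"
proof (rule fixed_field[where G = "Gal xP" and m = "monom 1 (q - 1) - [:w ^ (q - 1):]"])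
  let ?m = "monom 1 (q - 1) - [:w ^ (q - 1):]"
  show "finite (Gal xP)" using card_fixP q_ge by (intro card_ge_0_finite) simp
  show "\<exists>p. s w = pev emb w p" if s: "s \<in> Gal xP" for s
  proof -
    obtain z where "s w = emb z * w" using s fixP_iff by blast
    thus ?thesis by (intro exI[of _ "[:0, z:]"]) simp
  qed
  have "w ^ (q - 1) \<in> rat xP"
    unfolding w_power(1) using rat_emb[of 1 xP] by (intro rat_divide rat_uminus rat_add rat_self) simp
  thus "coeff ?m i \<in> rat xP" for i
    using rat_emb[of 1 xP] rat_emb[of 0 xP] rat_uminus by (auto simp: coeff_pCons split: nat.split)
  show "poly ?m w = 0" by (simp add: poly_monom)
  have d: "degree ?m = q - 1" using q_ge by (subst degree_diff_left) (simp_all add: degree_monom_eq)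
  thus "degree ?m = card (Gal xP)" using card_fixP by simp
  show "lead_coeff ?m = 1" unfolding d using q_ge by (simp add: coeff_eq_0)
qed (use xK c aut_id aut_comp in auto)

lemma fixed_xQ:
  assumes c: "c \<in> K" "\<And>s. aut s \<Longrightarrow> s xQ = xQ \<Longrightarrow> s c = c"
  shows "c \<in> rat xQ"
proof (rule fixed_field[where G = "Gal xQ" and m = "monom 1 q + [:- 1 / xQ, 1:]"])
  let ?m = "monom 1 q + [:- 1 / xQ, 1:]"
  show "finite (Gal xQ)" using card_fixQ q_ge by (intro card_ge_0_finite) simp
  show "\<exists>p. s w = pev emb w p" if s: "s \<in> Gal xQ" for s
  proof -
    obtain a where "s w = w + emb a" using s fixQ_iff by blast
    thus ?thesis by (intro exI[of _ "[:a, 1:]"]) (simp add: add.commute)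
  qed
  have "- 1 / xQ \<in> rat xQ" using rat_emb[of "- 1" xQ] by (intro rat_divide rat_self) simp
  thus "coeff ?m i \<in> rat xQ" for i
    using rat_emb[of 1 xQ] rat_emb[of 0 xQ] q_ge by (auto simp: coeff_pCons split: nat.split)
  show "poly ?m w = 0" using w_power(3) by (simp add: poly_monom algebra_simps)
  have d: "degree ?m = q" using q_ge by (subst degree_add_eq_left) (simp_all add: degree_monom_eq)
  thus "degree ?m = card (Gal xQ)" using card_fixQ by simp
  show "lead_coeff ?m = 1" unfolding d using q_ge by (simp add: coeff_eq_0)
qed (use xK c aut_id aut_comp in auto)


lemma place_xPQ:
  assumes V: "place V" "w \<in> V" and c: "val V w ^ q + val V w \<noteq> 0"
  shows "xP \<in> V" "xQ \<in> V" "val V xQ = inverse (val V w ^ q + val V w)"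
    "val V xP = - (val V w ^ q * inverse (val V w ^ q + val V w))"
proof -
  interpret V: phom V "val V" by (rule val_phom[OF V(1)])
  have s: "w + w ^ q \<in> V" "val V (w + w ^ q) = val V w ^ q + val V w"
    using V(2) by (simp_all add: V.p_add V.p_power add.commute)
  have i: "inverse (w + w ^ q) \<in> V" "val V (inverse (w + w ^ q)) = inverse (val V w ^ q + val V w)"
    using val_nonzeroD[OF V(1) s(1)] c unfolding s(2) by auto
  have xQ: "xQ = inverse (w + w ^ q)" by (simp add: xQ_def inverse_eq_divide)
  have "w + w ^ q = w * (1 + w ^ (q - 1))" "w ^ q = w * w ^ (q - 1)"
    using q_ge by (cases q; simp add: algebra_simps)+
  hence xP: "xP = - (w ^ q * inverse (w + w ^ q))"
    using denominators by (simp add: xP_def divide_inverse)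
  show "xQ \<in> V" "val V xQ = inverse (val V w ^ q + val V w)" unfolding xQ by fact+
  show "xP \<in> V" "val V xP = - (val V w ^ q * inverse (val V w ^ q + val V w))"
    unfolding xP using V(2) i by (simp_all add: V.p_uminus V.p_mult V.p_power)
qed

text \<open>The translation by a, conjugated with the scaling by z, is the translation by
  \<open>inverse z * a\<close>. As z^q = z, this is again a root of T^q + T.\<close>

lemma conj_normal:
  assumes s: "aut s" "s xP = xP" and t: "aut t" "t xQ = xQ"
  shows "(s \<circ> t \<circ> ainv s) xQ = xQ"
proof -
  obtain z where z: "z ^ (q - 1) = 1" "s w = emb z * w" using fixP_iff s by blast
  obtain a where a: "a ^ q + a = 0" "t w = w + emb a" using fixQ_iff t by blast
  note z0 = root_nonzero[OF z(1)]
  have i: "aut (ainv s)" by (rule aut_inv[OF s(1)])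
  have au: "aut (s \<circ> t \<circ> ainv s)" by (intro aut_comp s(1) t(1) i)
  have "s (emb (inverse z) * w + emb 0) = w" unfolding aut_affine[OF s(1)] z(2) using z0 by (simp add: emb_inverse)
  hence "ainv s w = emb (inverse z) * w + emb 0" using aut_inv_apply(2)[OF s(1)] by metis
  hence "(s \<circ> t \<circ> ainv s) w = s (t (emb (inverse z) * w + emb 0))" by simp
  also have "t (emb (inverse z) * w + emb 0) = emb (inverse z) * w + emb (inverse z * a)"
    unfolding aut_affine[OF t(1)] a(2) by (simp add: algebra_simps)
  also have "s \<dots> = w + emb (inverse z * a)" unfolding aut_affine[OF s(1)] z(2) using z0 by (simp add: emb_inverse)
  finally have sw: "(s \<circ> t \<circ> ainv s) w = w + emb (inverse z * a)" .
  have "z ^ q = z" using z(1) q_ge by (cases q) auto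
  hence "(inverse z * a) ^ q + inverse z * a = inverse z * (a ^ q + a)"
    by (simp add: power_mult_distrib power_inverse algebra_simps)
  thus ?thesis unfolding fixQ_iff[OF au] sw using a(1) by auto
qed

lemma fix_both:
  assumes s: "aut s" "s xP = xP" "s xQ = xQ"
  shows "s = id"
proof -
  obtain z where z: "z ^ (q - 1) = 1" "s w = emb z * w" using fixP_iff s by blast
  obtain a where a: "s w = w + emb a" using fixQ_iff s by blast
  have "pev emb w [:- a, z - 1:] = 0" using z(2) a by (simp add: algebra_simps)
  hence "[:- a, z - 1:] = 0" using pev_nonzero by blast
  hence "s w = w" using a by simp
  thus ?thesis using aut_eqI[OF s(1) aut_id] by simp
qed

text \<open>Conjugating the scaling by z with the translation by a gives w \<mapsto> z w + (z - 1)
  a, which is not a scaling when z differs from 1 and a from 0.\<close>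

lemma not_commuting:
  "\<exists>s t. aut s \<and> s xP = xP \<and> aut t \<and> t xQ = xQ \<and> (t \<circ> s \<circ> ainv t) xP \<noteq> xP"
proof -
  have "\<not> {z :: 'k. z ^ (q - 1) = 1} \<subseteq> {1}"
  proof
    assume "{z :: 'k. z ^ (q - 1) = 1} \<subseteq> {1}"
    hence "card {z :: 'k. z ^ (q - 1) = 1} \<le> card {1 :: 'k}" by (intro card_mono) auto
    thus False using card_roots_of_unity q_ge by simp
  qed
  then obtain z :: 'k where z: "z ^ (q - 1) = 1" "z \<noteq> 1" by blast
  have "\<not> {a :: 'k. a ^ q + a = 0} \<subseteq> {0}"
  proof
    assume "{a :: 'k. a ^ q + a = 0} \<subseteq> {0}"
    hence "card {a :: 'k. a ^ q + a = 0} \<le> card {0 :: 'k}" by (intro card_mono) auto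
    thus False using card_additive_roots q_ge by simp
  qed
  then obtain a :: 'k where a: "a ^ q + a = 0" "a \<noteq> 0" by blast
  obtain s where s: "aut s" "s w = emb z * w + emb 0" using aut_affine_exists[OF root_nonzero[OF z(1)]] by blast
  obtain t where t: "aut t" "t w = emb 1 * w + emb a" using aut_affine_exists[of 1 a] by auto
  have i: "aut (ainv t)" by (rule aut_inv[OF t(1)])
  have au: "aut (t \<circ> s \<circ> ainv t)" by (intro aut_comp s(1) t(1) i)
  have "t (emb 1 * w + emb (- a)) = w" unfolding aut_affine[OF t(1)] t(2) by simp
  hence "ainv t w = emb 1 * w + emb (- a)" using aut_inv_apply(2)[OF t(1)] by metis
  hence "(t \<circ> s \<circ> ainv t) w = t (s (emb 1 * w + emb (- a)))" by simp
  also have "s (emb 1 * w + emb (- a)) = emb z * w + emb (- a)" unfolding aut_affine[OF s(1)] s(2) by simp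
  also have "t \<dots> = emb z * w + emb (z * a - a)" unfolding aut_affine[OF t(1)] t(2) by (simp add: algebra_simps)
  finally have tw: "(t \<circ> s \<circ> ainv t) w = emb z * w + emb (z * a - a)" .
  have "(t \<circ> s \<circ> ainv t) xP \<noteq> xP"
  proof
    assume "(t \<circ> s \<circ> ainv t) xP = xP"
    then obtain z' where "emb z * w + emb (z * a - a) = emb z' * w" using fixP_iff[OF au] unfolding tw by blast
    hence "pev emb w [:z * a - a, z - z':] = 0" by (simp add: algebra_simps)
    hence "[:z * a - a, z - z':] = 0" using pev_nonzero by blast
    hence "z * a - a = 0" unfolding pCons_eq_0_iff by blast
    hence "(z - 1) * a = 0" by (simp only: left_diff_distrib mult_1)
    thus False using z a by simp
  qed
  moreover have "s xP = xP" using fixP_iff[OF s(1)] s(2) z(1) by auto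
  moreover have "t xQ = xQ" using fixQ_iff[OF t(1)] t(2) a(1) by auto
  ultimately show ?thesis using s(1) t(1) by blast
qed

end

section \<open>Automorphisms of the curve as automorphisms of the function field\<close>

context generic_point begin

text \<open>At most one place is a pole of w, so the places where w is regular form an open set.
  That \<sigma> is a morphism then provides a function w' whose values are those of w at the image
  places.\<close>

lemma automorphism_pullback:
  assumes rf: "rational_field emb K w" and \<sigma>: "\<sigma> \<in> Aut_curve F"
  shows "\<exists>w'\<in>K. \<forall>V V'. place V \<longrightarrow> place V' \<longrightarrow> \<sigma> (cls ` V) = cls ` V' \<longrightarrow> w \<in> V' \<longrightarrow> w' \<in> V \<and> val V w' = val V' w"
proof -
  interpret rf: rational_field emb K w by (rule rf)
  define U where "U = {W \<in> N. cls w \<in> W}"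
  have wU: "cls ` V \<in> U \<longleftrightarrow> w \<in> V" if V: "place V" for V
    unfolding U_def using place_normalization[OF V] cls_image_iff[OF rf.wK, of V] place_subset[OF V] by auto
  have "\<exists>W0. N - U \<subseteq> {W0}"
  proof (cases "N - U = {}")
    case False
    then obtain W0 where "W0 \<in> N - U" by blast
    hence "W = W0" if "W \<in> N - U" for W
      using that wU rf.place_infinity_eq normalization_place by (metis Diff_iff)
    thus ?thesis by blast
  qed blast
  hence "finite (N - U)" using finite_subset by auto
  hence U: "open_subset F U" unfolding open_subset_def U_def by auto
  let ?g = "\<lambda>W. value_at F W (cls w)"
  have "regular_on F U ?g" unfolding regular_on_def
    by (rule bexI[of _ "cls w"]) (auto simp: U_def rf.wK)
  hence "regular_on F (\<sigma> -` U \<inter> N) (?g \<circ> \<sigma>)"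
    using \<sigma> U unfolding Aut_curve_def self_morphism_def by blast
  then obtain w' where w': "w' \<in> K" "\<forall>W\<in>\<sigma> -` U \<inter> N. cls w' \<in> W \<and> (?g \<circ> \<sigma>) W = value_at F W (cls w')"
    unfolding regular_on_def carrier_FF by blast
  show ?thesis
  proof (rule bexI[OF _ w'(1)], intro allI impI)
    fix V V' assume V: "place V" "place V'" "\<sigma> (cls ` V) = cls ` V'" "w \<in> V'"
    hence "cls ` V \<in> \<sigma> -` U \<inter> N" using wU[OF V(2)] place_normalization[OF V(1)] by simp
    hence "cls w' \<in> cls ` V" "value_at F (cls ` V') (cls w) = value_at F (cls ` V) (cls w')"
      using bspec[OF w'(2), of "cls ` V"] V(3) by simp_all
    thus "w' \<in> V \<and> val V w' = val V' w"
      using cls_image_iff[OF w'(1), of V] place_subset[OF V(1)]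
      unfolding value_at_cls[OF V(1) w'(1)] value_at_cls[OF V(2) rf.wK] by auto
  qed
qed

lemma pl_place: "W \<in> N \<Longrightarrow> place (pl W) \<and> cls ` pl W = W"
proof -
  assume "W \<in> N"
  then obtain V where V: "place V" "W = cls ` V" using normalization_place by blast
  have "V \<subseteq> K" using place_subset[OF V(1)] by blast
  thus ?thesis using pl_cls[of V] V by simp
qed

text \<open>At all but finitely many places, both the place and its image have admissible values of
  w, and there t(w') and t(w) have equal values because w' is the pullback of w. By
  \<open>val_identity\<close> they coincide.\<close>

lemma automorphism_relation:
  assumes rf: "rational_field emb K w" and \<sigma>: "\<sigma> \<in> Aut_curve F" and S: "finite S"
    and t: "\<And>V V'. place V \<Longrightarrow> place V' \<Longrightarrow> \<sigma> (cls ` V) = cls ` V' \<Longrightarrow> w \<in> V \<Longrightarrow> w \<in> V' \<Longrightarrow>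
      val V w \<notin> S \<Longrightarrow> val V' w \<notin> S \<Longrightarrow> poly t (val V' w) = poly t (val V w)"
    and w': "w' \<in> K" "\<And>V V'. place V \<Longrightarrow> place V' \<Longrightarrow> \<sigma> (cls ` V) = cls ` V' \<Longrightarrow> w \<in> V' \<Longrightarrow> w' \<in> V \<and> val V w' = val V' w"
  shows "pev emb w' t = pev emb w t"
proof -
  interpret rf: rational_field emb K w by (rule rf)
  have bij: "bij_betw \<sigma> N N" using \<sigma> unfolding Aut_curve_def Bij_def by blast
  define T where "T = {W \<in> N. w \<notin> pl W} \<union> (\<Union>c\<in>S. {W \<in> N. w \<in> pl W \<and> val (pl W) w = c})"
  have one: "finite B" if "\<And>x y. x \<in> B \<Longrightarrow> y \<in> B \<Longrightarrow> x = y" for B :: "'k place set"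
  proof (cases "B = {}")
    case False
    then obtain x where "x \<in> B" by blast
    hence "B \<subseteq> {x}" using that by blast
    thus ?thesis using finite_subset by auto
  qed auto
  have "finite {W \<in> N. w \<notin> pl W}"
  proof (rule one)
    fix x y assume xy: "x \<in> {W \<in> N. w \<notin> pl W}" "y \<in> {W \<in> N. w \<notin> pl W}"
    have "pl x = pl y" by (rule rf.place_infinity_eq) (use xy pl_place in auto)
    moreover have "cls ` pl x = x" "cls ` pl y = y" using xy pl_place by simp_all
    ultimately show "x = y" by metis
  qed
  moreover have "finite {W \<in> N. w \<in> pl W \<and> val (pl W) w = c}" for c
  proof (rule one)
    fix x y assume xy: "x \<in> {W \<in> N. w \<in> pl W \<and> val (pl W) w = c}" "y \<in> {W \<in> N. w \<in> pl W \<and> val (pl W) w = c}"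
    have "pl x = pl y" by (rule rf.place_w_eq) (use xy pl_place in auto)
    moreover have "cls ` pl x = x" "cls ` pl y = y" using xy pl_place by simp_all
    ultimately show "x = y" by metis
  qed
  ultimately have "finite T" unfolding T_def using S by blast
  hence "finite (\<sigma> -` T \<inter> N)" using bij finite_vimage_IntI[of T \<sigma> N] unfolding bij_betw_def by blast
  define S' where "S' = S \<union> (\<lambda>W. val (pl W) w) ` (\<sigma> -` T \<inter> N)"
  have S': "finite S'" unfolding S'_def using S \<open>finite (\<sigma> -` T \<inter> N)\<close> by blast
  have "pev emb w' t - pev emb w t = 0"
  proof (rule rf.val_identity[OF _ S'])
    show "pev emb w' t - pev emb w t \<in> K" using w'(1) rf.wK by simp
    fix V assume V: "place V" "w \<in> V" "val V w \<notin> S'"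
    interpret V: phom V "val V" by (rule val_phom[OF V(1)])
    let ?W = "cls ` V"
    have W: "?W \<in> N" "pl ?W = V" using place_normalization[OF V(1)] pl_cls[of V] place_subset[OF V(1)] by auto
    have sN: "\<sigma> ?W \<in> N" using bij W(1) by (auto simp: bij_betw_def)
    define V' where "V' = pl (\<sigma> ?W)"
    have V': "place V'" "\<sigma> ?W = cls ` V'" using pl_place[OF sN] unfolding V'_def by auto
    have "\<sigma> ?W \<notin> T"
    proof
      assume "\<sigma> ?W \<in> T"
      hence "?W \<in> \<sigma> -` T \<inter> N" using W(1) by blast
      hence "val (pl ?W) w \<in> S'" unfolding S'_def by blast
      thus False using V(3) W(2) by simp
    qed
    hence c: "w \<in> V'" "val V' w \<notin> S" using sN unfolding T_def V'_def by auto
    have "val V w \<notin> S" using V(3) unfolding S'_def by blast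
    hence e: "poly t (val V' w) = poly t (val V w)" using t V(1,2) V' c by blast
    have "w' \<in> V" "val V w' = val V' w" using w'(2)[OF V(1) V'(1) V'(2) c(1)] by auto
    thus "val V (pev emb w' t - pev emb w t) = 0"
      using val_pev[OF V(1) V(2), of t] val_pev[OF V(1) \<open>w' \<in> V\<close>, of t] e by (simp add: V.p_diff)
  qed
  thus ?thesis by simp
qed

text \<open>The automorphism s inverts the substitution of z w + a for w. The maps \<sigma> and
  \<open>sig s\<close> agree at every place whose image under \<sigma> is not the pole of w; the
  remaining place is matched because both maps are bijective.\<close>

lemma automorphism_affine:
  assumes rf: "rational_field emb K w" and \<sigma>: "\<sigma> \<in> Aut_curve F" and z: "z \<noteq> 0"
    and w': "\<And>V V'. place V \<Longrightarrow> place V' \<Longrightarrow> \<sigma> (cls ` V) = cls ` V' \<Longrightarrow> w \<in> V' \<Longrightarrow>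
      emb z * w + emb a \<in> V \<and> val V (emb z * w + emb a) = val V' w"
  shows "\<exists>s. aut s \<and> \<sigma> = sig s"
proof -
  interpret rf: rational_field emb K w by (rule rf)
  have bij: "bij_betw \<sigma> N N" and ext: "\<sigma> \<in> extensional N" using \<sigma> unfolding Aut_curve_def Bij_def by blast+
  let ?w = "emb z * w + emb a"
  obtain s where s: "aut s" "s w = emb (inverse z) * w + emb (- a * inverse z)"
    using rf.aut_affine_exists[of "inverse z" "- a * inverse z"] z by (metis nonzero_imp_inverse_nonzero)
  interpret s: phom K s by (rule aut_phom[OF s(1)])
  have zz: "emb z * emb (inverse z) = 1" unfolding emb_inverse using z by simp
  have "s ?w = emb z * (emb (inverse z) * w + emb (- a * inverse z)) + emb a"
    using rf.wK by (simp add: s.p_add s.p_mult aut_emb[OF s(1)] s(2))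
  also have "\<dots> = (emb z * emb (inverse z)) * w + (1 - emb z * emb (inverse z)) * emb a"
    by (simp add: algebra_simps)
  finally have sw: "s ?w = w" unfolding zz by simp
  have main: "\<sigma> W = sig s W" if W: "W \<in> N" "w \<in> pl (\<sigma> W)" for W
  proof -
    obtain V where V: "place V" "W = cls ` V" using normalization_place W(1) by blast
    have sN: "\<sigma> W \<in> N" using bij W(1) by (auto simp: bij_betw_def)
    note p = pl_place[OF sN]
    have "\<sigma> (cls ` V) = cls ` pl (\<sigma> W)" using p V(2) by simp
    hence wV: "?w \<in> V \<and> val V ?w = val (pl (\<sigma> W)) w"
      by (intro w'[OF V(1)]) (use p W(2) in simp_all)
    have "s ?w \<in> s ` V" using wV by (intro imageI) simp
    moreover have "val (s ` V) (s ?w) = val (pl (\<sigma> W)) w" using place_aut(3)[OF s(1) V(1)] wV by simp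
    ultimately have "w \<in> s ` V" "val (s ` V) w = val (pl (\<sigma> W)) w" unfolding sw by blast+
    hence "pl (\<sigma> W) = s ` V"
      using rf.place_w_eq[OF _ place_aut(1)[OF s(1) V(1)], of "pl (\<sigma> W)"] p W(2) by simp
    hence "cls ` pl (\<sigma> W) = sig s W" using sig_cls[OF V(1)] V(2) by simp
    thus ?thesis using p by simp
  qed
  have "\<sigma> W = sig s W" if W: "W \<in> N" for W
  proof (cases "w \<in> pl (\<sigma> W)")
    case True
    thus ?thesis using main W by blast
  next
    case False
    have sN: "\<sigma> W \<in> N" using bij W by (auto simp: bij_betw_def)
    have "sig s W \<in> \<sigma> ` N" using sig_in_N[OF s(1) W] bij unfolding bij_betw_def by blast
    then obtain W1 where W1: "W1 \<in> N" "sig s W = \<sigma> W1" by blast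
    show ?thesis
    proof (cases "w \<in> pl (\<sigma> W1)")
      case True
      hence "sig s W = sig s W1" using main[OF W1(1)] W1(2) by simp
      hence "W = W1" using sig_bij[OF s(1)] W W1(1) by (auto simp: bij_betw_def inj_on_def)
      thus ?thesis using W1(2) by simp
    next
      case F: False
      have sN1: "\<sigma> W1 \<in> N" using bij W1(1) by (auto simp: bij_betw_def)
      have "pl (\<sigma> W) = pl (\<sigma> W1)"
        by (rule rf.place_infinity_eq) (use pl_place[OF sN] pl_place[OF sN1] False F in auto)
      thus ?thesis using pl_place[OF sN] pl_place[OF sN1] W1(2) by metis
    qed
  qed
  moreover have "sig s \<in> extensional N" unfolding sig_def by simp
  ultimately have "\<sigma> = sig s" using ext by (intro extensionalityI) auto
  thus ?thesis using s(1) by blast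
qed

text \<open>The polynomial t has a value determined by that of x. So
  \<open>automorphism_relation\<close> gives t(w') = t(w) for the pullback w' of w, and
  \<open>sol\<close> makes w' affine. For the model, t is T^(d-1) at P and T^d + T at Q.\<close>

lemma galois_group_eq:
  assumes rf: "rational_field emb K w" and p: "pencil r a b" and S: "finite S"
    and x: "x = ev (lin3 a) / ev (lin3 b)"
    and reg: "\<And>V i. place V \<Longrightarrow> w \<in> V \<Longrightarrow> val V w \<notin> S \<Longrightarrow> v $ i / ev (lin3 b) \<in> V"
    and t: "\<And>V V'. place V \<Longrightarrow> place V' \<Longrightarrow> w \<in> V \<Longrightarrow> w \<in> V' \<Longrightarrow> val V w \<notin> S \<Longrightarrow> val V' w \<notin> S \<Longrightarrow>
      val V' x = val V x \<Longrightarrow> poly t (val V' w) = poly t (val V w)"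
    and sol: "\<And>w'. w' \<in> K \<Longrightarrow> pev emb w' t = pev emb w t \<Longrightarrow> \<exists>z a. z \<noteq> 0 \<and> w' = emb z * w + emb a"
  shows "galois_group F (vec.span {r}) = sig ` Gal x"
proof
  show "sig ` Gal x \<subseteq> galois_group F (vec.span {r})"
    using galois_group_iff[OF _ p] unfolding x by auto
  show "galois_group F (vec.span {r}) \<subseteq> sig ` Gal x"
  proof
    fix \<sigma> assume \<sigma>: "\<sigma> \<in> galois_group F (vec.span {r})"
    hence \<sigma>A: "\<sigma> \<in> Aut_curve F" unfolding galois_group_def by blast
    obtain w' where w': "w' \<in> K" "\<And>V V'. place V \<Longrightarrow> place V' \<Longrightarrow> \<sigma> (cls ` V) = cls ` V' \<Longrightarrow> w \<in> V' \<Longrightarrow> w' \<in> V \<and> val V w' = val V' w"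
      using automorphism_pullback[OF rf \<sigma>A] by metis
    have "pev emb w' t = pev emb w t"
    proof (rule automorphism_relation[OF rf \<sigma>A S _ w'])
      fix V V' assume V: "place V" "place V'" "\<sigma> (cls ` V) = cls ` V'" "w \<in> V" "w \<in> V'" "val V w \<notin> S" "val V' w \<notin> S"
      have "val V' x = val V x"
        unfolding x by (rule galois_group_values[OF \<sigma> p V(1,2,3)]; (rule reg, (rule V)+))
      thus "poly t (val V' w) = poly t (val V w)" by (rule t[OF V(1,2,4-7)])
    qed
    then obtain z c where z: "z \<noteq> 0" "w' = emb z * w + emb c" using sol[OF w'(1)] by blast
    obtain s where s: "aut s" "\<sigma> = sig s"
      using automorphism_affine[OF rf \<sigma>A z(1) w'(2)[unfolded z(2)]] by blast
    thus "\<sigma> \<in> sig ` Gal x" using galois_group_iff[OF s(1) p] \<sigma> unfolding x by blast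
  qed
qed

lemma sig_mult: "aut s \<Longrightarrow> aut t \<Longrightarrow> sig s \<otimes>\<^bsub>AG\<^esub> sig t = sig (s \<circ> t)"
proof -
  assume st: "aut s" "aut t"
  have "compose N (sig s) (sig t) W = sig (s \<circ> t) W" for W
  proof (cases "W \<in> N")
    case True
    thus ?thesis using sig_comp[OF st] by (simp add: compose_def)
  qed (simp add: compose_def sig_def)
  thus ?thesis unfolding Aut_group_simps(3)[OF sig_Aut_curve[OF st(1)] sig_Aut_curve[OF st(2)]] by blast
qed

lemma sig_one: "\<one>\<^bsub>AG\<^esub> = sig id"
  unfolding Aut_group_simps using sig_id by (auto simp: fun_eq_iff restrict_def sig_def)

section \<open>Subgroups and semidirect products of curve automorphisms\<close>

definition closed_auts :: "('e \<Rightarrow> 'e) set \<Rightarrow> bool" where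
  "closed_auts A \<longleftrightarrow> id \<in> A \<and> (\<forall>s\<in>A. aut s \<and> ainv s \<in> A) \<and> (\<forall>s\<in>A. \<forall>t\<in>A. s \<circ> t \<in> A)"

lemma closed_auts_fix: "closed_auts (Gal x)"
proof -
  have "ainv s x = x" if "aut s" "s x = x" for s using aut_inv_apply(2)[OF that(1), of x] that(2) by simp
  thus ?thesis unfolding closed_auts_def by (auto simp: aut_id aut_inv aut_comp)
qed

lemma ainv_comp_id: "aut s \<Longrightarrow> ainv s \<circ> s = id" "aut s \<Longrightarrow> s \<circ> ainv s = id"
  using aut_inv_apply by auto

lemma subgroup_sig:
  assumes A: "closed_auts A"
  shows "subgroup (sig ` A) AG"
proof -
  have a: "aut s" "ainv s \<in> A" if "s \<in> A" for s using A that unfolding closed_auts_def by blast+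
  have inv: "inv\<^bsub>AG\<^esub> (sig s) = sig (ainv s)" if s: "s \<in> A" for s
    unfolding m_inv_def
  proof (rule the_equality)
    note i = aut_inv[OF a(1)[OF s]]
    show "sig (ainv s) \<in> carrier AG \<and> sig s \<otimes>\<^bsub>AG\<^esub> sig (ainv s) = \<one>\<^bsub>AG\<^esub> \<and>
        sig (ainv s) \<otimes>\<^bsub>AG\<^esub> sig s = \<one>\<^bsub>AG\<^esub>"
      using sig_Aut_curve[OF i] sig_mult[OF i a(1)[OF s]] sig_mult[OF a(1)[OF s] i]
      by (simp add: Aut_group_simps(1) ainv_comp_id[OF a(1)[OF s]] sig_one)
    fix y assume y: "y \<in> carrier AG \<and> sig s \<otimes>\<^bsub>AG\<^esub> y = \<one>\<^bsub>AG\<^esub> \<and>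
        y \<otimes>\<^bsub>AG\<^esub> sig s = \<one>\<^bsub>AG\<^esub>"
    hence yA: "y \<in> Aut_curve F" unfolding Aut_group_simps by blast
    hence yB: "y \<in> extensional N" "\<And>W. W \<in> N \<Longrightarrow> y W \<in> N"
      unfolding Aut_curve_def Bij_def by (auto simp: bij_betw_def)
    have c: "compose N (sig s) y = (\<lambda>W\<in>N. W)"
      using y unfolding Aut_group_simps(3)[OF sig_Aut_curve[OF a(1)[OF s]] yA] Aut_group_simps(2) by blast
    show "y = sig (ainv s)"
    proof (rule extensionalityI[OF yB(1)])
      show "sig (ainv s) \<in> extensional N" unfolding sig_def by simp
      fix W assume W: "W \<in> N"
      have "sig s (y W) = W" using fun_cong[OF c, of W] W by (simp add: compose_def)
      thus "y W = sig (ainv s) W" using sig_ainv(1)[OF a(1)[OF s] yB(2)[OF W]] by simp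
    qed
  qed
  show ?thesis
  proof
    show "sig ` A \<subseteq> carrier AG" unfolding Aut_group_simps using a sig_Aut_curve by blast
    show "x \<otimes>\<^bsub>AG\<^esub> y \<in> sig ` A" if "x \<in> sig ` A" "y \<in> sig ` A" for x y
      using that sig_mult a A unfolding closed_auts_def by auto
    show "\<one>\<^bsub>AG\<^esub> \<in> sig ` A" unfolding sig_one using A unfolding closed_auts_def by blast
    show "inv\<^bsub>AG\<^esub> x \<in> sig ` A" if "x \<in> sig ` A" for x
      using that inv a by auto
  qed
qed

lemma group_sig:
  assumes A: "closed_auts A"
  shows "group (AG\<lparr>carrier := sig ` A\<rparr>)"
    and "s \<in> A \<Longrightarrow> inv\<^bsub>AG\<lparr>carrier := sig ` A\<rparr>\<^esub> (sig s) = sig (ainv s)"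
proof -
  let ?G = "AG\<lparr>carrier := sig ` A\<rparr>"
  have a: "aut s" "ainv s \<in> A" if "s \<in> A" for s using A that unfolding closed_auts_def by blast+
  have c: "s \<circ> t \<in> A" "id \<in> A" if "s \<in> A" "t \<in> A" for s t using A that unfolding closed_auts_def by blast+
  have m: "sig s \<otimes>\<^bsub>?G\<^esub> sig t = sig (s \<circ> t)" if "s \<in> A" "t \<in> A" for s t
    using sig_mult a that by simp
  have one: "\<one>\<^bsub>?G\<^esub> = sig id" using sig_one by simp
  have idA: "id \<in> A" using A unfolding closed_auts_def by blast
  show g: "group ?G"
  proof (rule groupI)
    show "x \<otimes>\<^bsub>?G\<^esub> y \<in> carrier ?G" if "x \<in> carrier ?G" "y \<in> carrier ?G" for x y
      using that m c by auto
    show "\<one>\<^bsub>?G\<^esub> \<in> carrier ?G" unfolding one using idA by simp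
    show "x \<otimes>\<^bsub>?G\<^esub> y \<otimes>\<^bsub>?G\<^esub> z = x \<otimes>\<^bsub>?G\<^esub> (y \<otimes>\<^bsub>?G\<^esub> z)"
      if xyz: "x \<in> carrier ?G" "y \<in> carrier ?G" "z \<in> carrier ?G" for x y z
    proof -
      obtain s t u where "x = sig s" "y = sig t" "z = sig u" "s \<in> A" "t \<in> A" "u \<in> A" using xyz by auto
      thus ?thesis by (simp only: m c comp_assoc)
    qed
    show "\<one>\<^bsub>?G\<^esub> \<otimes>\<^bsub>?G\<^esub> x = x" if x: "x \<in> carrier ?G" for x
    proof -
      obtain s where "x = sig s" "s \<in> A" using x by auto
      thus ?thesis unfolding one by (simp only: m idA id_comp)
    qed
    show "\<exists>y\<in>carrier ?G. y \<otimes>\<^bsub>?G\<^esub> x = \<one>\<^bsub>?G\<^esub>" if x: "x \<in> carrier ?G" for x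
    proof -
      obtain s where s: "x = sig s" "s \<in> A" using x by auto
      have "sig (ainv s) \<otimes>\<^bsub>?G\<^esub> x = \<one>\<^bsub>?G\<^esub>"
        unfolding s(1) one by (simp only: m[OF a(2)[OF s(2)] s(2)] ainv_comp_id[OF a(1)[OF s(2)]])
      moreover have "sig (ainv s) \<in> carrier ?G" using a(2)[OF s(2)] by simp
      ultimately show ?thesis by blast
    qed
  qed
  show "inv\<^bsub>?G\<^esub> (sig s) = sig (ainv s)" if s: "s \<in> A"
  proof (rule group.inv_equality[OF g])
    show "sig (ainv s) \<otimes>\<^bsub>?G\<^esub> sig s = \<one>\<^bsub>?G\<^esub>"
      unfolding one by (simp only: m[OF a(2)[OF s] s] ainv_comp_id[OF a(1)[OF s]])
  qed (use s a in auto)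
qed

text \<open>A product t s is rewritten as s (s^-1 t s), whose second factor is in B, so compositions
  and inverses return to the required order.\<close>

lemma closed_auts_product:
  assumes A: "closed_auts A" and B: "closed_auts B"
    and nrm: "\<And>s t. s \<in> A \<Longrightarrow> t \<in> B \<Longrightarrow> s \<circ> t \<circ> ainv s \<in> B"
  shows "closed_auts {s \<circ> t | s t. s \<in> A \<and> t \<in> B}"
proof -
  have a: "aut s" "ainv s \<in> A" if "s \<in> A" for s using A that unfolding closed_auts_def by blast+
  have b: "aut s" "ainv s \<in> B" if "s \<in> B" for s using B that unfolding closed_auts_def by blast+
  have aa: "ainv (ainv s) = s" if "s \<in> A" for s by (rule inv_inv_eq[OF aut_bij[OF a(1)[OF that]]])
  have com: "t \<circ> s = s \<circ> (ainv s \<circ> t \<circ> s)" "ainv s \<circ> t \<circ> s \<in> B" if st: "s \<in> A" "t \<in> B" for s t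
  proof -
    have "s \<circ> (ainv s \<circ> t \<circ> s) = (s \<circ> ainv s) \<circ> t \<circ> s" by (simp only: comp_assoc)
    thus "t \<circ> s = s \<circ> (ainv s \<circ> t \<circ> s)" using ainv_comp_id[OF a(1)[OF st(1)]] by simp
    show "ainv s \<circ> t \<circ> s \<in> B" using nrm[OF a(2)[OF st(1)] st(2)] unfolding aa[OF st(1)] .
  qed
  let ?C = "{s \<circ> t | s t. s \<in> A \<and> t \<in> B}"
  show ?thesis unfolding closed_auts_def
  proof (intro conjI ballI)
    have "id \<circ> id \<in> ?C" using A B unfolding closed_auts_def by blast
    thus "id \<in> ?C" by simp
    fix u assume "u \<in> ?C"
    then obtain s t where u: "u = s \<circ> t" "s \<in> A" "t \<in> B" by blast
    show "aut u" unfolding u by (rule aut_comp[OF a(1)[OF u(2)] b(1)[OF u(3)]])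
    have "ainv u = ainv t \<circ> ainv s"
      unfolding u by (rule o_inv_distrib[OF aut_bij[OF a(1)[OF u(2)]] aut_bij[OF b(1)[OF u(3)]]])
    also have "\<dots> = ainv s \<circ> (ainv (ainv s) \<circ> ainv t \<circ> ainv s)" by (rule com(1)[OF a(2)[OF u(2)] b(2)[OF u(3)]])
    finally show "ainv u \<in> ?C" using com(2)[OF a(2)[OF u(2)] b(2)[OF u(3)]] a(2)[OF u(2)] by blast
    fix u' assume "u' \<in> ?C"
    then obtain s' t' where u': "u' = s' \<circ> t'" "s' \<in> A" "t' \<in> B" by blast
    have "u \<circ> u' = s \<circ> (t \<circ> s') \<circ> t'" unfolding u(1) u'(1) by (simp only: comp_assoc)
    also have "\<dots> = (s \<circ> s') \<circ> ((ainv s' \<circ> t \<circ> s') \<circ> t')"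
      by (subst com(1)[OF u'(2) u(3)]) (simp only: comp_assoc)
    finally have e: "u \<circ> u' = (s \<circ> s') \<circ> ((ainv s' \<circ> t \<circ> s') \<circ> t')" .
    have "s \<circ> s' \<in> A" using A u(2) u'(2) unfolding closed_auts_def by blast
    moreover have "(ainv s' \<circ> t \<circ> s') \<circ> t' \<in> B" using B com(2)[OF u'(2) u(3)] u'(3) unfolding closed_auts_def by blast
    ultimately show "u \<circ> u' \<in> ?C" unfolding e by blast
  qed
qed

text \<open>The group laws are transported from composition of field automorphisms by
  \<open>sig\<close>. The second claim extracts from a direct product the stability under
  conjugation that \<open>not_commuting\<close> refutes for the model.\<close>

lemma semidirect_sig:
  assumes A: "closed_auts A" and B: "closed_auts B"
    and nrm: "\<And>s t. s \<in> A \<Longrightarrow> t \<in> B \<Longrightarrow> s \<circ> t \<circ> ainv s \<in> B"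
    and int: "\<And>s. s \<in> A \<Longrightarrow> sig s \<in> sig ` B \<Longrightarrow> s = id"
  shows "internal_semidirect AG (sig ` A) (sig ` B)"
    and "internal_direct AG (sig ` A) (sig ` B) \<Longrightarrow> s \<in> A \<Longrightarrow> t \<in> B \<Longrightarrow> sig (t \<circ> s \<circ> ainv t) \<in> sig ` A"
proof -
  let ?C = "{s \<circ> t | s t. s \<in> A \<and> t \<in> B}"
  let ?G = "AG\<lparr>carrier := sig ` ?C\<rparr>"
  have C: "closed_auts ?C" by (rule closed_auts_product[OF A B nrm])
  have a: "aut s" "ainv s \<in> A" if "s \<in> A" for s using A that unfolding closed_auts_def by blast+
  have b: "aut s" "ainv s \<in> B" if "s \<in> B" for s using B that unfolding closed_auts_def by blast+
  have c: "aut s" "ainv s \<in> ?C" if "s \<in> ?C" for s using C that unfolding closed_auts_def by blast+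
  have idA: "id \<in> A" "id \<in> B" using A B unfolding closed_auts_def by blast+
  have AC: "s \<in> ?C" if "s \<in> A" for s
  proof -
    have "s = s \<circ> id" by simp
    thus ?thesis using that idA(2) by blast
  qed
  have BC: "s \<in> ?C" if "s \<in> B" for s
  proof -
    have "s = id \<circ> s" by simp
    thus ?thesis using that idA(1) by blast
  qed
  have HN: "sig ` A <#>\<^bsub>AG\<^esub> sig ` B = sig ` ?C"
  proof -
    have "sig ` A <#>\<^bsub>AG\<^esub> sig ` B = (\<Union>s\<in>A. \<Union>t\<in>B. {sig s \<otimes>\<^bsub>AG\<^esub> sig t})"
      unfolding set_mult_def by auto
    also have "\<dots> = (\<Union>s\<in>A. \<Union>t\<in>B. {sig (s \<circ> t)})" using sig_mult a(1) b(1) by simp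
    also have "\<dots> = sig ` ?C" by auto
    finally show ?thesis .
  qed
  interpret G: group ?G by (rule group_sig(1)[OF C])
  have conj: "sig s \<otimes>\<^bsub>?G\<^esub> sig t \<otimes>\<^bsub>?G\<^esub> inv\<^bsub>?G\<^esub> (sig s) = sig (s \<circ> t \<circ> ainv s)" if st: "s \<in> ?C" "t \<in> ?C" for s t
    unfolding group_sig(2)[OF C st(1)]
    using sig_mult[OF c(1)[OF st(1)] c(1)[OF st(2)]]
      sig_mult[OF aut_comp[OF c(1)[OF st(1)] c(1)[OF st(2)]] aut_inv[OF c(1)[OF st(1)]]] by simp
  have subB: "subgroup (sig ` B) ?G"
  proof
    show "sig ` B \<subseteq> carrier ?G" using BC by auto
    show "x \<otimes>\<^bsub>?G\<^esub> y \<in> sig ` B" if "x \<in> sig ` B" "y \<in> sig ` B" for x y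
      using that sig_mult b B unfolding closed_auts_def by auto
    show "\<one>\<^bsub>?G\<^esub> \<in> sig ` B" using sig_one idA(2) by auto
    show "inv\<^bsub>?G\<^esub> x \<in> sig ` B" if x: "x \<in> sig ` B" for x
    proof -
      obtain t where t: "x = sig t" "t \<in> B" using x by blast
      show ?thesis unfolding t(1) group_sig(2)[OF C BC[OF t(2)]] using b(2)[OF t(2)] by blast
    qed
  qed
  have "sig ` B \<lhd> ?G"
    unfolding G.normal_inv_iff
  proof (intro conjI ballI subB)
    fix x h assume x: "x \<in> carrier ?G" and h: "h \<in> sig ` B"
    obtain u where u: "x = sig u" "u \<in> ?C" using x by auto
    obtain s t where st: "u = s \<circ> t" "s \<in> A" "t \<in> B" using u(2) by blast
    obtain t' where t': "h = sig t'" "t' \<in> B" using h by blast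
    have "ainv u = ainv t \<circ> ainv s"
      unfolding st by (rule o_inv_distrib[OF aut_bij[OF a(1)[OF st(2)]] aut_bij[OF b(1)[OF st(3)]]])
    hence "u \<circ> t' \<circ> ainv u = s \<circ> (t \<circ> t' \<circ> ainv t) \<circ> ainv s" unfolding st(1) by (simp only: comp_assoc)
    moreover have "t \<circ> t' \<circ> ainv t \<in> B" using B b(2)[OF st(3)] st(3) t'(2) unfolding closed_auts_def by blast
    ultimately have "u \<circ> t' \<circ> ainv u \<in> B" using nrm[OF st(2)] by simp
    thus "x \<otimes>\<^bsub>?G\<^esub> h \<otimes>\<^bsub>?G\<^esub> inv\<^bsub>?G\<^esub> x \<in> sig ` B" unfolding u(1) t'(1) conj[OF u(2) BC[OF t'(2)]] by blast
  qed
  moreover have "sig ` A \<inter> sig ` B = {\<one>\<^bsub>AG\<^esub>}"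
    unfolding sig_one using int idA by blast
  ultimately show "internal_semidirect AG (sig ` A) (sig ` B)"
    unfolding internal_semidirect_def HN using subgroup_sig A B C by blast
  assume "internal_direct AG (sig ` A) (sig ` B)" and s: "s \<in> A" and t: "t \<in> B"
  hence "sig ` A \<lhd> ?G" unfolding internal_direct_def HN by blast
  moreover have "sig t \<in> carrier ?G" using BC[OF t] by auto
  moreover have "sig s \<in> sig ` A" using s by blast
  ultimately have "sig t \<otimes>\<^bsub>?G\<^esub> sig s \<otimes>\<^bsub>?G\<^esub> inv\<^bsub>?G\<^esub> (sig t) \<in> sig ` A" by (rule normal.inv_op_closed2)
  thus "sig (t \<circ> s \<circ> ainv t) \<in> sig ` A" unfolding conj[OF BC[OF t] AC[OF s]] .
qed

end

section \<open>From the model to Galois points\<close>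

context func_field begin

lemma rat_ev3:
  assumes w: "\<And>i. u $ i \<in> rat w"
  shows "ev3 emb u G \<in> rat w"
proof -
  interpret e: rhom "ev3 emb u" by (rule rhom_ev3[OF rhom_axioms])
  show ?thesis
    by (induction G rule: poly3_induct) (simp_all add: rhom_axioms w rat_emb rat_add rat_mult)
qed

end

context generic_point begin

lemma galois_extension_rat:
  assumes x: "x \<in> K" "x \<notin> range emb" and fixed: "\<And>c. c \<in> K \<Longrightarrow> (\<And>s. aut s \<Longrightarrow> s x = x \<Longrightarrow> s c = c) \<Longrightarrow> c \<in> rat x"
  shows "galois_extension FF (cls ` rat x)"
proof (rule galois_extensionI[OF rat_subset[OF x(1)] subfield_rat[OF x(1)]])
  show "range emb \<subseteq> rat x" using rat_emb by blast
  show "ring.algebraic FF (cls ` rat x) (cls f)" if f: "f \<in> K" for f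
  proof -
    interpret r: rhom "pev emb x" by (rule rhom_pev)
    obtain P where P: "P \<noteq> 0" "pev (pev emb x) f P = 0" using K_dep[OF x(1) f] by blast
    show ?thesis
    proof (rule algebraicI_poly[OF rat_subset[OF x(1)] f])
      have "coeff (map_poly (pev emb x) P) (degree P) \<noteq> 0"
        using P(1) transcendental[OF x(2)] by (simp add: coeff_map_poly)
      thus "map_poly (pev emb x) P \<noteq> 0" by auto
      show "coeff (map_poly (pev emb x) P) i \<in> rat x" for i by (simp add: coeff_map_poly rat_pev)
      show "poly (map_poly (pev emb x) P) f = 0" using P(2) by (simp add: pev_def[of "pev emb x"])
    qed
  qed
  show "f \<in> rat x" if f: "f \<in> K" "\<And>s. aut s \<Longrightarrow> (\<And>a. a \<in> rat x \<Longrightarrow> s a = a) \<Longrightarrow> s f = f" for f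
  proof (rule fixed[OF f(1)])
    fix s assume s: "aut s" "s x = x"
    show "s f = f" by (rule f(2)[OF s(1)]) (rule aut_rat[OF s(1) x(1) s(2)])
  qed
qed

text \<open>The model is the rational curve parametrized by \<open>w = (X + Z) / Y\<close>.\<close>

lemma model_parameter:
  assumes rel: "ev (model_form d) = 0" and p: "prime p" "of_nat p = (0 :: 'k)" "d = p ^ e" "d \<ge> 3"
  shows "\<exists>w. model_field emb K w p e d \<and> model_field.xP w d = x1 \<and> model_field.xQ w d = x2"
proof -
  define w where "w = (v $ 1 + v $ 3) / v $ 2"
  note vn = v_coord_nonzero[of 1] v_coord_nonzero[of 2] v_coord_nonzero[of 3]
  have d: "v $ 2 ^ d = v $ 2 ^ (d - 1) * v $ 2" using p(4) by (cases d) simp_all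
  have "ev (model_form d) = v $ 2 ^ (d - 1) * v $ 1 + (v $ 1 + v $ 3) ^ d"
    unfolding model_form_def by (simp add: rhom_axioms)
  hence vd: "(v $ 1 + v $ 3) ^ d = - (v $ 2 ^ (d - 1) * v $ 1)" using rel by (simp add: eq_neg_iff_add_eq_0 add.commute)
  \<comment> \<open>The equation of the model divided by Y^d reads w^d = - X / Y. Then w + w^d = Z /
    Y, and both affine coordinates are rational in w.\<close>
  have "w ^ d = (v $ 1 + v $ 3) ^ d / v $ 2 ^ d" unfolding w_def by (rule power_divide)
  also have "\<dots> = - (v $ 2 ^ (d - 1) * v $ 1) / (v $ 2 ^ (d - 1) * v $ 2)" by (simp only: vd d)
  also have "\<dots> = - (v $ 1 / v $ 2)" using vn by simp
  finally have wd: "w ^ d = - (v $ 1 / v $ 2)" .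
  have wd1: "w + w ^ d = v $ 3 / v $ 2" unfolding wd by (simp add: w_def add_divide_distrib)
  have wK: "w = (x1 + 1) / x2" unfolding w_def using vn by (simp add: field_simps)
  have "1 \<in> K" using K_emb[of 1] by simp
  hence wK': "w \<in> K" unfolding wK by (rule K_divide[OF K_add[OF x12_K(1)] x12_K(2)])
  have x2: "x2 = 1 / (w + w ^ d)" unfolding wd1 by simp
  have x1: "x1 = - (w ^ d) / (w + w ^ d)" by (simp only: wd1) (use vn in \<open>simp add: wd\<close>)
  have wt: "w \<notin> range emb"
  proof
    assume "w \<in> range emb"
    then obtain c where "w = emb c" by blast
    hence "x2 = emb (1 / (c + c ^ d))" unfolding x2 by (simp add: emb_divide)
    thus False using x12_trans(2) by blast
  qed
  interpret rw: phom "rat w" "\<lambda>x. x" by (rule rat_phom)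
  have xr: "x1 \<in> rat w" "x2 \<in> rat w"
    unfolding x1 x2 by (intro rat_divide rw.B_add rw.B_uminus rw.B_power rw.B_one rat_self)+
  have "K \<subseteq> rat w"
  proof
    fix c assume "c \<in> K"
    then obtain G H where c: "c = ev3 emb (vector [x1, x2, 1]) G / ev3 emb (vector [x1, x2, 1]) H" using K_affine by blast
    have "(vector [x1, x2, 1] :: 'e ^ 3) $ i \<in> rat w" for i using exhaust_3[of i] xr by auto
    thus "c \<in> rat w" unfolding c by (intro rat_divide rat_ev3)
  qed
  hence Kr: "K = rat w" using rat_subset[OF wK'] by blast
  interpret mf: model_field emb K w p e d
    by unfold_locales (rule Kr wt p)+
  have ws: "w + w ^ d = w * (1 + w ^ (d - 1))" "w ^ d = w * w ^ (d - 1)"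
    using p(4) by (cases d; simp add: algebra_simps)+
  have "mf.xP = x1" unfolding x1 ws(1) mf.xP_def using mf.denominators ws(2) by (simp add: field_simps)
  moreover have "mf.xQ = x2" unfolding x2 mf.xQ_def ..
  ultimately show ?thesis using mf.model_field_axioms by blast
qed

text \<open>Projective equivalence compares point sets only. To recover the equation,
  \<open>vanishing_form\<close> shows that the pulled back model G, which vanishes on the curve, is
  a multiple of F, and equal degrees make it a constant multiple. P and Q are the preimages of (0 :
  1 : 0) and (1 : 0 : 0).\<close>

theorem reverse:
  assumes p: "prime p" "of_nat p = (0 :: 'k)" "d = p ^ e" "d \<ge> 3"
    and pe: "projectively_equivalent (plane_curve F) (plane_curve (model_form d))"
  shows "\<exists>P Q. inner_galois_point F P \<and> outer_galois_point F Q \<and>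
    internal_semidirect AG (galois_group F P) (galois_group F Q) \<and>
    \<not> internal_direct AG (galois_group F P) (galois_group F Q) \<and>
    line_through P Q \<noteq> tangent_line F P"
proof -
  obtain M' :: "'k ^ 3 ^ 3" where M': "invertible M'" "(\<lambda>A. ((*v) M') ` A) ` plane_curve F = plane_curve (model_form d)"
    using pe unfolding projectively_equivalent_def by blast
  obtain M where M: "M ** M' = mat 1" "M' ** M = mat 1" using M'(1) unfolding invertible_def by blast
  have mh: "homogeneous d (model_form d :: 'k poly3)" by (rule homogeneous_model_form) (use d_gt_1 in simp)
  define G where "G = subst3 M' (model_form d)"
  have Gh: "homogeneous d G" unfolding G_def by (rule homogeneous_subst3[OF mh])
  have Gz: "eval3 G u = 0" if u: "u \<noteq> 0" "eval3 F u = 0" for u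
  proof -
    have "vec.span {u} \<in> plane_curve F"
      using u vanishes_at_span[OF F_hom] unfolding plane_curve_def proj_plane_def by blast
    hence "((*v) M') ` vec.span {u} \<in> plane_curve (model_form d)" using M'(2) by blast
    moreover have "M' *v u \<in> ((*v) M') ` vec.span {u}" by (rule imageI) (simp add: vec.span_base)
    ultimately show ?thesis unfolding plane_curve_def vanishes_at_def G_def eval3_subst3 by blast
  qed
  have evG: "ev G = 0" by (rule vanishing_form[OF Gh Gz])
  hence "F dvd G" using kernel by blast
  then obtain c where c: "\<And>u. eval3 G u = c * eval3 F u" using form_dvd_same[OF F_hom Gh] by blast
  have cF: "const3 c * F = G"
  proof (rule ccontr)
    assume "const3 c * F \<noteq> G"
    then obtain u where u: "eval3 (const3 c * F - G) u \<noteq> 0" using eval3_nonzero[of "const3 c * F - G"] by auto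
    interpret r: rhom "\<lambda>G. eval3 G u" by (rule rhom_eval3)
    show False using c[of u] u by simp
  qed
  define r where "r = column 2 M"
  define s where "s = column 1 M"
  note df = dot_frame[OF M(2)]
  have Mr: "M' *v r = vector [0, 1, 0]" "M' *v s = vector [1, 0, 0]"
    using df[of _ 2] df[of _ 1] unfolding r_def s_def
    by (simp_all add: vec_eq_iff forall_3 matrix_vector_mult_def sum_3 dot_def)
  have Gs: "eval3 G s = 1" "eval3 G r = 0"
    using d_gt_1 unfolding G_def eval3_subst3 Mr eval3_model_form by (simp_all add: power_0_left)
  have c0: "c \<noteq> 0" using Gs(1) c[of s] by auto
  have Fs: "eval3 F s \<noteq> 0" "eval3 F r = 0" using Gs c[of s] c[of r] c0 by auto
  have grad: "dot (gradient F r) s \<noteq> 0"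
  proof
    assume z: "dot (gradient F r) s = 0"
    \<comment> \<open>On the line r + t s the pulled back model is t + t^d, with linear coefficient
      1. So the derivative of F at r in the direction s cannot be zero.\<close>
    let ?w = "\<chi> i. [:r $ i, s $ i:]"
    interpret e: rhom "ev3 (\<lambda>c. [:c:]) ?w" by (rule rhom_ev3[OF rhom_const_poly])
    have "ev3 (\<lambda>c. [:c:]) ?w (lin3 (M' $ i)) = [:dot (M' $ i) r, dot (M' $ i) s:]" for i
      by (simp add: ev3_lin3 rhom_const_poly dot_def)
    hence "(\<chi> i. ev3 (\<lambda>c. [:c:]) ?w (lin3 (M' $ i))) = vector [[:0, 1:], 1, 0]"
      using df[of _ 2] df[of _ 1] unfolding r_def s_def by (simp add: vec_eq_iff forall_3 one_pCons)
    hence "ev3 (\<lambda>c. [:c:]) ?w G = ev3 (\<lambda>c. [:c:]) (vector [[:0, 1:], 1, 0]) (model_form d)"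
      unfolding G_def ev3_subst3[OF rhom_const_poly] by simp
    also have "\<dots> = [:0, 1:] + [:0, 1:] ^ d"
    proof -
      interpret f: rhom "ev3 (\<lambda>c. [:c :: 'k:]) (vector [[:0, 1:], 1, 0])" by (rule rhom_ev3[OF rhom_const_poly])
      show ?thesis unfolding model_form_def by (simp add: rhom_const_poly)
    qed
    finally have "coeff ([:c:] * ev3 (\<lambda>c. [:c:]) ?w F) 1 = coeff ([:0, 1:] + [:0, 1:] ^ d) 1"
      unfolding cF[symmetric] by (simp add: rhom_const_poly)
    moreover have "[:0, 1:] ^ d = monom (1 :: 'k) d" by (simp add: monom_altdef)
    ultimately have "c * dot (gradient F r) s = 1" using gradient_line[of r s F] d_gt_1 by simp
    thus False using z by simp
  qed
  define \<xi> where "\<xi> = (\<chi> i. ev (lin3 (M' $ i)))"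
  have g: "generic_point emb (subst3 M F) d \<xi>" and fr: "frac_field emb \<xi> = K"
    using change_coordinates[OF M] unfolding \<xi>_def by auto
  interpret g: generic_point emb "subst3 M F" d \<xi> by (rule g)
  have "ev3 emb \<xi> (model_form d) = 0"
    using evG unfolding G_def ev3_subst3[OF rhom_axioms] \<xi>_def .
  then obtain w where w: "model_field emb K w p e d" "model_field.xP w d = g.x1" "model_field.xQ w d = g.x2"
    using g.model_parameter[OF _ p] unfolding fr by blast
  interpret mf: model_field emb K w p e d by (rule w(1))
  have pP: "pencil r (M' $ 1) (M' $ 3)" and pQ: "pencil s (M' $ 2) (M' $ 3)"
    using pencil_frame[OF M] unfolding r_def s_def by auto
  have wi: "ev (lin3 (M' $ i)) = \<xi> $ i" for i by (simp add: \<xi>_def)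
  note xx = w(2,3)
  have xt: "mf.xP \<notin> range emb" "mf.xQ \<notin> range emb" unfolding xx by (rule g.x12_trans)+
  let ?P = "vec.span {r}" and ?Q = "vec.span {s}"
  have pP': "r \<noteq> 0" "s \<noteq> 0" using pP pQ unfolding pencil_def by auto
  have galP: "galois_extension FF (proj_subfield F ?P)"
    unfolding proj_subfield_eq[OF pP] wi xx[symmetric]
    by (rule galois_extension_rat[OF mf.xK(1) xt(1)]) (rule mf.fixed_xP)
  have galQ: "galois_extension FF (proj_subfield F ?Q)"
    unfolding proj_subfield_eq[OF pQ] wi xx[symmetric]
    by (rule galois_extension_rat[OF mf.xK(2) xt(2)]) (rule mf.fixed_xQ)
  have pc: "vec.span {u} \<in> plane_curve F \<longleftrightarrow> eval3 F u = 0" if "u \<noteq> 0" for u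
    using that vanishes_at_span[OF F_hom, of u] unfolding plane_curve_def proj_plane_def by blast
  have "?P \<notin> singular_points F"
  proof
    assume "?P \<in> singular_points F"
    hence "eval3 (partialX F) r = 0" "eval3 (partialY F) r = 0" "eval3 (partialZ F) r = 0"
      using vanishes_at_span homogeneous_partial[OF F_hom] unfolding singular_points_def by blast+
    hence "gradient F r = 0" by (simp add: gradient_def vec_eq_iff forall_3)
    thus False using grad by (simp add: dot_def)
  qed
  hence inner: "inner_galois_point F ?P"
    unfolding inner_galois_point_def galois_point_def using galP pc[OF pP'(1)] Fs(2) pP'(1)
    unfolding proj_plane_def by blast
  have outer: "outer_galois_point F ?Q"
    unfolding outer_galois_point_def galois_point_def using galQ pc[OF pP'(2)] Fs(1) pP'(2)
    unfolding proj_plane_def by blast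
  have line: "line_through ?P ?Q \<noteq> tangent_line F ?P"
  proof
    assume "line_through ?P ?Q = tangent_line F ?P"
    moreover have "s \<in> line_through ?P ?Q"
      unfolding line_through_def by (intro vec.span_base UnI2) simp
    ultimately show False using grad unfolding tangent_line_gradient[OF F_hom] by simp
  qed
  have iffP: "sig t \<in> galois_group F ?P \<longleftrightarrow> t mf.xP = mf.xP" if "aut t" for t
    using galois_group_iff[OF that pP] unfolding wi xx[symmetric] .
  have iffQ: "sig t \<in> galois_group F ?Q \<longleftrightarrow> t mf.xQ = mf.xQ" if "aut t" for t
    using galois_group_iff[OF that pQ] unfolding wi xx[symmetric] .
  \<comment> \<open>At these values of w the common denominator w + w^d of the coordinates vanishes.
    Off S all affine coordinates are regular.\<close>
  define S where "S = {c :: 'k. c ^ d + c = 0}"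
  have finS: "finite S" unfolding S_def using mf.card_additive_roots p(4) by (intro card_ge_0_finite) simp
  have vi: "v $ i / \<xi> $ 3 \<in> V" if V: "place V" "w \<in> V" "val V w \<notin> S" for V i
  proof -
    interpret V: phom V "val V" by (rule val_phom[OF V(1)])
    have x: "g.x1 \<in> V" "g.x2 \<in> V" using mf.place_xPQ[OF V(1,2)] V(3) unfolding S_def xx by auto
    have "(\<chi> j. \<xi> $ j) = (\<chi> j. \<Sum>k\<in>UNIV. emb (M' $ j $ k) * v $ k)"
      unfolding \<xi>_def by (simp add: vec_eq_iff ev3_lin3 rhom_axioms sum_3)
    hence "(\<Sum>j\<in>UNIV. emb (M $ i $ j) * \<xi> $ j) = (\<Sum>j\<in>UNIV. emb (M $ i $ j) * (\<Sum>k\<in>UNIV. emb (M' $ j $ k) * v $ k))"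
      by (simp add: vec_eq_iff)
    also have "\<dots> = (\<Sum>k\<in>UNIV. emb (\<Sum>j\<in>UNIV. M $ i $ j * M' $ j $ k) * v $ k)"
      by (simp add: sum_3 algebra_simps)
    also have "\<dots> = (\<Sum>k\<in>UNIV. emb (if i = k then 1 else 0) * v $ k)"
      using M(1) by (simp add: vec_eq_iff matrix_matrix_mult_def mat_def)
    also have "\<dots> = v $ i" using exhaust_3[of i] by (auto simp: sum_3)
    finally have e: "v $ i / \<xi> $ 3 = emb (M $ i $ 1) * g.x1 + emb (M $ i $ 2) * g.x2 + emb (M $ i $ 3)"
      using g.v_coord_nonzero[of 3] by (simp add: sum_3 field_simps)
    show ?thesis unfolding e by (intro V.B_add V.B_mult place_emb V(1) x)
  qed
  have n: "c ^ d + c \<noteq> 0" if "c \<notin> S" for c using that unfolding S_def by simp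
  have eqP: "galois_group F ?P = sig ` Gal mf.xP"
  proof (rule galois_group_eq[OF mf.rational_field_axioms pP finS, where t = "monom 1 (d - 1)"])
    show "mf.xP = ev (lin3 (M' $ 1)) / ev (lin3 (M' $ 3))" unfolding wi xx ..
    fix V V' assume V: "place V" "place V'" "w \<in> V" "w \<in> V'" "val V w \<notin> S" "val V' w \<notin> S"
      and x: "val V' mf.xP = val V mf.xP"
    let ?c = "val V w" and ?c' = "val V' w"
    have "?c' ^ d * inverse (?c' ^ d + ?c') = ?c ^ d * inverse (?c ^ d + ?c)"
      using x mf.place_xPQ(4)[OF V(1,3) n[OF V(5)]] mf.place_xPQ(4)[OF V(2,4) n[OF V(6)]] by simp
    hence "?c' ^ d * (?c ^ d + ?c) = ?c ^ d * (?c' ^ d + ?c')" using n[OF V(5)] n[OF V(6)] by (simp add: field_simps)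
    hence e: "?c' ^ d * ?c = ?c ^ d * ?c'" by (simp add: algebra_simps)
    have c0: "?c \<noteq> 0" "?c' \<noteq> 0" using n[OF V(5)] n[OF V(6)] p(4) by (auto simp: power_0_left)
    have dd: "a ^ d = a ^ (d - 1) * a" for a :: 'k using p(4) by (cases d) simp_all
    have "?c' ^ (d - 1) = ?c ^ (d - 1)" using e c0 unfolding dd[of ?c] dd[of ?c'] by (simp add: mult_ac)
    thus "poly (monom 1 (d - 1)) ?c' = poly (monom 1 (d - 1)) ?c" by (simp add: poly_monom)
  next
    fix w' assume w': "w' \<in> K" "pev emb w' (monom 1 (d - 1)) = pev emb w (monom 1 (d - 1))"
    hence "w' ^ (d - 1) = w ^ (d - 1)" by (simp add: pev_monom)
    then obtain z where z: "z ^ (d - 1) = 1" "w' = emb z * w" using mf.root_ratio[OF w'(1)] by blast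
    have "w' = emb z * w + emb 0" using z(2) by simp
    thus "\<exists>z a. z \<noteq> 0 \<and> w' = emb z * w + emb a" using mf.root_nonzero[OF z(1)] by blast
  qed (unfold wi, rule vi)
  have eqQ: "galois_group F ?Q = sig ` Gal mf.xQ"
  proof (rule galois_group_eq[OF mf.rational_field_axioms pQ finS, where t = "monom 1 d + [:0, 1:]"])
    show "mf.xQ = ev (lin3 (M' $ 2)) / ev (lin3 (M' $ 3))" unfolding wi xx ..
    fix V V' assume V: "place V" "place V'" "w \<in> V" "w \<in> V'" "val V w \<notin> S" "val V' w \<notin> S"
      and "val V' mf.xQ = val V mf.xQ"
    hence "val V' w ^ d + val V' w = val V w ^ d + val V w"
      using mf.place_xPQ(3)[OF V(1,3) n[OF V(5)]] mf.place_xPQ(3)[OF V(2,4) n[OF V(6)]] by simp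
    thus "poly (monom 1 d + [:0, 1:]) (val V' w) = poly (monom 1 d + [:0, 1:]) (val V w)" by (simp add: poly_monom)
  next
    fix w' assume w': "w' \<in> K" "pev emb w' (monom 1 d + [:0, 1:]) = pev emb w (monom 1 d + [:0, 1:])"
    hence "w' + w' ^ d = w + w ^ d" by (simp add: pev_monom pev_add add.commute)
    then obtain a where "w' = w + emb a" using mf.root_difference[OF w'(1)] by blast
    hence "w' = emb 1 * w + emb a" by simp
    thus "\<exists>z a. z \<noteq> 0 \<and> w' = emb z * w + emb a" using one_neq_zero by blast
  qed (unfold wi, rule vi)
  have nrm: "s \<circ> t \<circ> ainv s \<in> Gal mf.xQ"
    if "s \<in> Gal mf.xP" "t \<in> Gal mf.xQ" for s t
    using that mf.conj_normal[of s t] by (simp add: aut_comp aut_inv)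
  have int: "u = id" if "u \<in> Gal mf.xP" "sig u \<in> sig ` Gal mf.xQ" for u
    using that mf.fix_both[of u] iffQ[of u] unfolding eqQ[symmetric] by simp
  note sd = semidirect_sig[where A = "Gal mf.xP" and B = "Gal mf.xQ",
      OF closed_auts_fix closed_auts_fix]
  have semi: "internal_semidirect AG (galois_group F ?P) (galois_group F ?Q)"
    unfolding eqP eqQ by (rule sd(1), erule (1) nrm, erule (1) int)
  have "\<not> internal_direct AG (galois_group F ?P) (galois_group F ?Q)"
  proof
    assume dir: "internal_direct AG (galois_group F ?P) (galois_group F ?Q)"
    obtain u t where ut: "aut u" "u mf.xP = mf.xP" "aut t" "t mf.xQ = mf.xQ" "(t \<circ> u \<circ> ainv t) mf.xP \<noteq> mf.xP"
      using mf.not_commuting by blast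
    have "sig (t \<circ> u \<circ> ainv t) \<in> galois_group F ?P"
      unfolding eqP by (rule sd(2), erule (1) nrm, erule (1) int, rule dir[unfolded eqP eqQ]) (use ut in auto)
    hence "(t \<circ> u \<circ> ainv t) mf.xP = mf.xP"
      using iffP[OF aut_comp[OF aut_comp[OF ut(3,1)] aut_inv[OF ut(3)]]] by blast
    thus False using ut(5) by blast
  qed
  thus ?thesis using inner outer semi line by blast
qed

end

theorem proposition1:
  fixes F :: "'k::alg_closed_field poly3" and p d :: nat
  assumes "CHAR('k) = p" and "p > 0"
    and "homogeneous d F" and "Factorial_Ring.irreducible F"
    and "d \<ge> 3" and "p dvd d"
  shows "(\<exists>P Q. inner_galois_point F P \<and> outer_galois_point F Q \<and>
             internal_semidirect (Aut_group F) (galois_group F P) (galois_group F Q) \<and>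
             \<not> internal_direct (Aut_group F) (galois_group F P) (galois_group F Q) \<and>
             line_through P Q \<noteq> tangent_line F P)
         \<longleftrightarrow>
         (\<exists>e. d = p ^ e) \<and>
         projectively_equivalent (plane_curve F) (plane_curve (model_form d))"
proof -
  have p: "prime p" using assms(1,2) prime_CHAR_semidom[where ?'a='k] by simp
  have p0: "of_nat p = (0 :: 'k)" using assms(1) of_nat_CHAR[where ?'a='k] by simp
  have "d > 1" using assms(5) by simp
  then obtain emb :: "'k \<Rightarrow> 'k poly poly fract alg_closure" and v where g: "generic_point emb F d v"
    using generic_point_exists[OF assms(3) _ assms(4)] by blast
  show ?thesis
    using generic_point.forward[OF g _ _ _ _ p p0 assms(6,5)] generic_point.reverse[OF g p p0 _ assms(5)] by blast
qed

end
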